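(* Let $\Sigma_d$ be a smooth curve of degree $d$ in $\mathbb{C}P^2$. Then $$2d^2-4d+4\leq\mathcal{T}(\Sigma_d)\leq 2d^2.$$
   Context: $\mathbb{C}P^N$ carries its canonical (Fubini–Study) metric, normalized to have holomorphic sectional curvature $4$. A smooth curve in $\mathbb{C}P^2$ is a smooth complex projective algebraic curve, i.e. a compact complex submanifold of complex dimension $1$. For a normal vector $\vec v$ to a complex manifold $M$ immersed in $\mathbb{C}P^N$, at $p$, $A_{\vec v}:T_pM\to T_pM$ denotes the second fundamental form (shape operator), $A_{\vec v}(x)=-(\nabla_x V)^{\top}$ for any normal field $V$ extending $\vec v$. The total absolute curvature of a complex manifold $M$ of complex dimension $m$ holomorphically immersed in $\mathbb{C}P^N$ is $$\mathcal{T}(M)=\frac{2}{\mathrm{Vol}(\mathbb{C}P^N)}\int_{\nu^{<\pi/2}M}\left|\det\left(\cos(r)\,\mathrm{Id}_{T_pM}-\left(\tfrac{\sin r}{r}\right)A_{\vec v}\right)\right|\cos(r)\left(\tfrac{\sin r}{r}\right)^{2N-2m-1}dVol_{\nu^{<\pi/2}M}(\vec v),$$ where $\nu^{<\pi/2}M$ is the bundle of normal vectors of length less than $\pi/2$ (with its natural volume form, $dVol_M$ times Lebesgue measure on the fibres), $p$ is the base point of $\vec v$, $r=\|\vec v\|$, and $\frac{\sin r}{r}=1$ at $r=0$. Here $m=1$, $N=2$. *)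

theory Defs
  imports "HOL-Analysis.Analysis" "HOL-Probability.Sinc_Integral"
begin

section \<open>Complex projective space\<close>

text \<open>Projective space of \<open>complex ^ 'n\<close>: the set of complex lines through the origin, with the
  quotient topology from the nonzero vectors. \<open>CP\<^sup>N\<close> is the case \<open>CARD('n) = N + 1\<close>.\<close>

typedef ('n::finite) cproj =
  "{range (\<lambda>c. c *s z) | z :: complex ^ 'n. z \<noteq> 0}"
proof -
  have "(1 :: complex ^ 'n) \<noteq> 0" by (simp add: vec_eq_iff)
  then show ?thesis by blast
qed

definition proj :: "complex ^ 'n \<Rightarrow> 'n::finite cproj"
  where "proj z = Abs_cproj (range (\<lambda>c. c *s z))"

instantiation cproj :: (finite) topological_space
begin

definition open_cproj :: "'a cproj set \<Rightarrow> bool"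
  where "open_cproj U \<longleftrightarrow> open {z. z \<noteq> 0 \<and> proj z \<in> U}"

instance
proof
  have "{z :: complex ^ 'a. z \<noteq> 0 \<and> proj z \<in> UNIV} = - {0}" by auto
  moreover have "open (- {0 :: complex ^ 'a})" by (intro open_Compl closed_singleton)
  ultimately show "open (UNIV :: 'a cproj set)" by (simp only: open_cproj_def)
next
  fix S T :: "'a cproj set"
  assume "open S" "open T"
  moreover have "{z. z \<noteq> 0 \<and> proj z \<in> S \<inter> T} =
      {z. z \<noteq> 0 \<and> proj z \<in> S} \<inter> {z. z \<noteq> 0 \<and> proj z \<in> T}" by auto
  ultimately show "open (S \<inter> T)" by (simp add: open_cproj_def open_Int)
next
  fix K :: "'a cproj set set"
  assume "\<forall>S\<in>K. open S"
  moreover have "{z. z \<noteq> 0 \<and> proj z \<in> \<Union>K} = (\<Union>S\<in>K. {z. z \<noteq> 0 \<and> proj z \<in> S})" by auto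
  ultimately show "open (\<Union>K)" by (simp add: open_cproj_def open_UN)
qed

end


section \<open>Fubini--Study metric and Riemannian volume\<close>

definition hinner :: "complex ^ 'n::finite \<Rightarrow> complex ^ 'n \<Rightarrow> complex"
  where "hinner u v = (\<Sum>i\<in>UNIV. u $ i * cnj (v $ i))"

text \<open>The Fubini--Study metric in homogeneous coordinates, as a form on the nonzero vectors \<open>z\<close>:
  \<open>(|z|\<^sup>2 |dz|\<^sup>2 - |\<langle>dz,z\<rangle>|\<^sup>2) / |z|\<^sup>4\<close>. It is the pullback under \<open>z \<mapsto> [z]\<close> of the metric that makes the
  Hopf map from the unit sphere a Riemannian submersion (so its kernel is the complex line of
  \<open>z\<close>); this is the normalization with holomorphic sectional curvature 4. The metric in
  coordinates is obtained by pulling it back along a lift of the coordinate map.\<close>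

definition fs_form :: "complex ^ 'n::finite \<Rightarrow> complex ^ 'n \<Rightarrow> complex ^ 'n \<Rightarrow> real"
  where "fs_form z u v =
    Re ((complex_of_real (norm z))\<^sup>2 * hinner u v - hinner u z * hinner z v) / norm z ^ 4"

definition fs_pullback ::
    "('a::real_normed_vector \<Rightarrow> complex ^ 'n::finite) \<Rightarrow> 'a \<Rightarrow> 'a \<Rightarrow> 'a \<Rightarrow> real"
  where "fs_pullback \<phi> t u v =
    fs_form (\<phi> t) (frechet_derivative \<phi> (at t) u) (frechet_derivative \<phi> (at t) v)"

definition C1_on :: "'a::real_normed_vector set \<Rightarrow> ('a \<Rightarrow> 'b::real_normed_vector) \<Rightarrow> bool"
  where "C1_on U f \<longleftrightarrow> (\<forall>t\<in>U. f differentiable (at t)) \<and>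
    (\<forall>u. continuous_on U (\<lambda>t. frechet_derivative f (at t) u))"

definition gram :: "(real ^ 'k \<Rightarrow> complex ^ 'n::finite) \<Rightarrow> real ^ 'k \<Rightarrow> real ^ 'k ^ 'k::finite"
  where "gram \<phi> t = (\<chi> i j. fs_pullback \<phi> t (axis i 1) (axis j 1))"

text \<open>Local parametrizations \<open>t \<mapsto> [\<phi> t]\<close> of \<open>M\<close> by an open subset \<open>U\<close> of a Euclidean space,
  given by a lift \<open>\<phi>\<close> to homogeneous coordinates. Nonvanishing of the Gram determinant says that
  \<open>t \<mapsto> [\<phi> t]\<close> is an immersion.\<close>

definition local_param ::
    "(real ^ 'k::finite) set \<Rightarrow> (real ^ 'k \<Rightarrow> complex ^ 'n::finite) \<Rightarrow> 'n cproj set \<Rightarrow> bool"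
  where "local_param U \<phi> M \<longleftrightarrow> open U \<and> C1_on U \<phi> \<and> (\<forall>t\<in>U. \<phi> t \<noteq> 0 \<and> proj (\<phi> t) \<in> M) \<and>
    inj_on (\<lambda>t. proj (\<phi> t)) U \<and> (\<forall>t\<in>U. det (gram \<phi> t) \<noteq> 0)"

text \<open>The Riemannian volume measure on a submanifold \<open>M\<close> of real dimension \<open>CARD('k)\<close>: the Borel
  measure on \<open>M\<close> with density \<open>sqrt (det g)\<close> in every local parametrization.\<close>

definition fs_volume :: "'k::finite itself \<Rightarrow> 'n::finite cproj set \<Rightarrow> 'n cproj measure"
  where "fs_volume _ M = (THE \<mu>. sets \<mu> = sets (restrict_space borel M) \<and>
    (\<forall>U (\<phi> :: real ^ 'k \<Rightarrow> complex ^ 'n). local_param U \<phi> M \<longrightarrow>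
      (\<forall>B\<in>sets \<mu>. B \<subseteq> (\<lambda>t. proj (\<phi> t)) ` U \<longrightarrow>
        emeasure \<mu> B = (\<integral>\<^sup>+t\<in>{t\<in>U. proj (\<phi> t) \<in> B}. ennreal (sqrt (det (gram \<phi> t))) \<partial>lborel))))"


section \<open>Submanifolds of a coordinate domain with a Riemannian metric\<close>

text \<open>Here \<open>g p u v\<close> is a Riemannian metric in coordinates and \<open>S\<close> is a submanifold in these
  coordinates. The Christoffel operator is determined by the Koszul formula
  \<open>2 g(\<Gamma>(u,v),x) = \<partial>\<^sub>u g(v,x) + \<partial>\<^sub>v g(u,x) - \<partial>\<^sub>x g(u,v)\<close>, and \<open>cov_deriv\<close> is
  the Levi-Civita connection.\<close>

definition christoffel ::
    "('a::euclidean_space \<Rightarrow> 'a \<Rightarrow> 'a \<Rightarrow> real) \<Rightarrow> 'a \<Rightarrow> 'a \<Rightarrow> 'a \<Rightarrow> 'a"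
  where "christoffel g p u v = (THE y. \<forall>x. 2 * g p y x =
    frechet_derivative (\<lambda>q. g q v x) (at p) u + frechet_derivative (\<lambda>q. g q u x) (at p) v
      - frechet_derivative (\<lambda>q. g q u v) (at p) x)"

definition cov_deriv ::
    "('a::euclidean_space \<Rightarrow> 'a \<Rightarrow> 'a \<Rightarrow> real) \<Rightarrow> 'a \<Rightarrow> 'a \<Rightarrow> ('a \<Rightarrow> 'a) \<Rightarrow> 'a"
  where "cov_deriv g p x V = frechet_derivative V (at p) x + christoffel g p x (V p)"

definition tangent_space :: "'a::euclidean_space set \<Rightarrow> 'a \<Rightarrow> 'a set"
  where "tangent_space S p = {u. \<exists>c :: real \<Rightarrow> 'a. c 0 = p \<and>
    (\<forall>\<^sub>F t in nhds 0. c t \<in> S) \<and> (c has_vector_derivative u) (at 0)}"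

definition normal_space ::
    "('a::euclidean_space \<Rightarrow> 'a \<Rightarrow> 'a \<Rightarrow> real) \<Rightarrow> 'a set \<Rightarrow> 'a \<Rightarrow> 'a set"
  where "normal_space g S p = {v. \<forall>x\<in>tangent_space S p. g p v x = 0}"

definition tangential ::
    "('a::euclidean_space \<Rightarrow> 'a \<Rightarrow> 'a \<Rightarrow> real) \<Rightarrow> 'a set \<Rightarrow> 'a \<Rightarrow> 'a \<Rightarrow> 'a"
  where "tangential g S p y = (THE x. x \<in> tangent_space S p \<and> y - x \<in> normal_space g S p)"

definition normal_field ::
    "('a::euclidean_space \<Rightarrow> 'a \<Rightarrow> 'a \<Rightarrow> real) \<Rightarrow> 'a set \<Rightarrow> 'a \<Rightarrow> ('a \<Rightarrow> 'a) \<Rightarrow> bool"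
  where "normal_field g S p V \<longleftrightarrow>
    (\<exists>W. open W \<and> p \<in> W \<and> C1_on W V \<and> (\<forall>q\<in>W \<inter> S. V q \<in> normal_space g S q))"

text \<open>\<open>A\<^sub>v x = - (\<nabla>\<^sub>x V)\<^sup>T\<close>, which does not depend on the normal field \<open>V\<close> extending \<open>v\<close>.\<close>

definition shape_operator ::
    "('a::euclidean_space \<Rightarrow> 'a \<Rightarrow> 'a \<Rightarrow> real) \<Rightarrow> 'a set \<Rightarrow> 'a \<Rightarrow> 'a \<Rightarrow> 'a \<Rightarrow> 'a"
  where "shape_operator g S p v x = (THE y. \<exists>V. normal_field g S p V \<and> V p = v \<and>
    y = - tangential g S p (cov_deriv g p x V))"

text \<open>Determinant of an endomorphism \<open>L\<close> of a real plane \<open>T\<close>, as the determinant of its matrix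
  with respect to any basis \<open>e\<close> of \<open>T\<close>.\<close>

definition endo_det :: "'a::real_vector set \<Rightarrow> ('a \<Rightarrow> 'a) \<Rightarrow> real"
  where "endo_det T L = (THE c. \<exists>(e :: 2 \<Rightarrow> 'a) (A :: real ^ 2 ^ 2).
    inj e \<and> independent (range e) \<and> span (range e) = T \<and>
    (\<forall>j. L (e j) = (\<Sum>i\<in>UNIV. A $ i $ j *\<^sub>R e i)) \<and> c = det A)"

text \<open>Lebesgue measure of a normal plane with the inner product \<open>g p\<close>, transported from the
  coordinates of an orthonormal basis (the result does not depend on the basis). It is a measure
  on the ambient space that is concentrated on the normal plane.\<close>

definition orthonormal_normal_basis ::
    "('a::euclidean_space \<Rightarrow> 'a \<Rightarrow> 'a \<Rightarrow> real) \<Rightarrow> 'a set \<Rightarrow> 'a \<Rightarrow> (2 \<Rightarrow> 'a) \<Rightarrow> bool"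
  where "orthonormal_normal_basis g S p e \<longleftrightarrow>
    (\<forall>i j. g p (e i) (e j) = (if i = j then 1 else 0)) \<and> span (range e) = normal_space g S p"

definition normal_lebesgue ::
    "('a::euclidean_space \<Rightarrow> 'a \<Rightarrow> 'a \<Rightarrow> real) \<Rightarrow> 'a set \<Rightarrow> 'a \<Rightarrow> 'a measure"
  where "normal_lebesgue g S p =
    (let e = SOME e. orthonormal_normal_basis g S p e
     in distr (lborel :: (real ^ 2) measure) borel (\<lambda>s. \<Sum>i\<in>UNIV. s $ i *\<^sub>R e i))"

text \<open>The integrand of the total absolute curvature for \<open>m = 1\<close>, \<open>N = 2\<close>. The exponent is
  \<open>2N - 2m - 1\<close>, and \<open>sinc r\<close> is \<open>sin r / r\<close> with value 1 at 0.\<close>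

definition curvature_integrand ::
    "('a::euclidean_space \<Rightarrow> 'a \<Rightarrow> 'a \<Rightarrow> real) \<Rightarrow> 'a set \<Rightarrow> 'a \<Rightarrow> 'a \<Rightarrow> real"
  where "curvature_integrand g S p v = (let r = sqrt (g p v v) in
    \<bar>endo_det (tangent_space S p) (\<lambda>x. cos r *\<^sub>R x - sinc r *\<^sub>R shape_operator g S p v x)\<bar>
      * cos r * sinc r ^ (2 * 2 - 2 * 1 - 1))"

definition fibre_integral ::
    "('a::euclidean_space \<Rightarrow> 'a \<Rightarrow> 'a \<Rightarrow> real) \<Rightarrow> 'a set \<Rightarrow> 'a \<Rightarrow> ennreal"
  where "fibre_integral g S p =
    (\<integral>\<^sup>+v\<in>{v. sqrt (g p v v) < pi / 2}. ennreal (curvature_integrand g S p v)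
       \<partial>normal_lebesgue g S p)"


section \<open>Total absolute curvature of curves in the projective plane\<close>

text \<open>The three standard affine charts of the projective plane, given by their lifts to
  homogeneous coordinates.\<close>

definition affine_lift :: "3 \<Rightarrow> complex ^ 2 \<Rightarrow> complex ^ 3"
  where "affine_lift k w =
    (if k = 1 then vector [1, w $ 1, w $ 2]
     else if k = 2 then vector [w $ 1, 1, w $ 2]
     else vector [w $ 1, w $ 2, 1])"

definition affine_part :: "3 \<Rightarrow> 3 cproj set \<Rightarrow> (complex ^ 2) set"
  where "affine_part k M = {w. proj (affine_lift k w) \<in> M}"

text \<open>The integral over the normal disc at a point of \<open>M\<close>, computed in an affine chart around the
  point; it does not depend on the chart, because chart changes are isometries.\<close>

definition curvature_density :: "3 cproj set \<Rightarrow> 3 cproj \<Rightarrow> ennreal"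
  where "curvature_density M P =
    (let (k, w) = SOME (k, w). proj (affine_lift k w) = P
     in fibre_integral (fs_pullback (affine_lift k)) (affine_part k M) w)"

text \<open>The integral over the bundle of normal vectors of length less than \<open>pi / 2\<close> is written as an
  iterated integral over \<open>M\<close> and the normal discs. The value is in \<open>ennreal\<close> because the
  integrand is nonnegative.\<close>

definition total_absolute_curvature :: "3 cproj set \<Rightarrow> ennreal"
  where "total_absolute_curvature M =
    2 / emeasure (fs_volume TYPE(4) (UNIV :: 3 cproj set)) UNIV *
      (\<integral>\<^sup>+P. curvature_density M P \<partial>fs_volume TYPE(2) M)"


section \<open>Smooth plane curves\<close>

text \<open>Ternary forms: the homogeneous polynomials of degree \<open>d\<close> in three variables.\<close>

definition ternary_form :: "nat \<Rightarrow> (nat \<Rightarrow> nat \<Rightarrow> complex) \<Rightarrow> complex ^ 3 \<Rightarrow> complex"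
  where "ternary_form d a z =
    (\<Sum>i\<le>d. \<Sum>j\<le>d - i. a i j * (z $ 1) ^ i * (z $ 2) ^ j * (z $ 3) ^ (d - i - j))"

definition partial_deriv :: "3 \<Rightarrow> (complex ^ 3 \<Rightarrow> complex) \<Rightarrow> complex ^ 3 \<Rightarrow> complex"
  where "partial_deriv k F z = deriv (\<lambda>t. F (z + axis k t)) 0"

text \<open>The zero locus of a form of degree \<open>d \<ge> 1\<close> whose gradient vanishes nowhere on the locus.
  The gradient condition also forces the form to be square-free, so that \<open>d\<close> is the degree of
  the curve.\<close>

definition smooth_plane_curve :: "nat \<Rightarrow> 3 cproj set \<Rightarrow> bool"
  where "smooth_plane_curve d M \<longleftrightarrow> d \<ge> 1 \<and> (\<exists>a.
    (\<forall>z. z \<noteq> 0 \<longrightarrow> ternary_form d a z = 0 \<longrightarrow> (\<exists>k. partial_deriv k (ternary_form d a) z \<noteq> 0)) \<and>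
    M = {proj z | z. z \<noteq> 0 \<and> ternary_form d a z = 0})"

end

theory Submission
  imports Defs "HOL-Complex_Analysis.Complex_Analysis" "HOL-Computational_Algebra.Fundamental_Theorem_Algebra"
begin

text \<open>Let \<open>Z\<close> be a local lift of the curve \<open>F = 0\<close> of degree \<open>d\<close>, \<open>G\<close> the gradient of \<open>F\<close> along \<open>Z\<close>, and let \<open>a\<close> and
  \<open>b\<close> be the area densities of \<open>[Z]\<close> and of the Gauss image \<open>[G]\<close>. The shape operator in a unit normal
  direction is conjugate linear with singular value \<open>sqrt (b / a)\<close>, so the integral over the normal disc is
  elementary; with \<open>s = a + b\<close> it equals \<open>pi / 2 * (s - 2 a + 2 a\<^sup>2 / s) / a\<close>. The area of the image of the
  curve under a map given by forms of degree \<open>m\<close> without common zeros on the curve is \<open>pi d m\<close>: summed over the \<open>d\<close>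
  points in the fibres of a projection to a line, \<open>ln |\<Phi>|\<^sup>2\<close> is continuous on the plane, has Laplacian 4 times
  the density off the branch points, and grows like \<open>2 d m ln |x|\<close>. Hence \<open>a\<close> and \<open>s\<close> integrate to \<open>pi d\<close> and
  \<open>pi d\<^sup>2\<close>, and the bounds follow from \<open>2 a / d - s / d\<^sup>2 \<le> a\<^sup>2 / s \<le> a\<close>.\<close>

text \<open>The area form pulled back by a homogeneous map has \<open>ln |\<Phi>|^2\<close> as a
  local potential, but this potential depends on the lift and so is no function on the curve. A
  fixed affine frame normalises the lift away from infinity, and summing over the fibre yields one
  function on the plane, whose growth carries all the global information: homogeneity of degree
  \<open>m\<close> over \<open>d\<close> sheets. Ramification needs no local analysis. The sum runs
  over polynomial roots with multiplicity, hence stays continuous at the branch points, and a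
  continuous function cannot have Laplacian mass at an isolated point. Both areas come from the same
  theorem, for the identity with \<open>m = 1\<close> and for the gradient with
  \<open>m = d - 1\<close>; together they give \<open>s\<close>.

  A second constraint is that volume, shape operator and determinant are specified by definite
  descriptions, so each needs existence and uniqueness: the volume through countably many charts
  with differentiable inverse coordinates, the shape operator through an identity that involves a
  normal field only through its value at the point.\<close>

no_notation fps_nth (infixl "$" 75)

section \<open>Laplacians of functions on the complex plane\<close>

lemma integrable_compact_support:
  fixes f :: "'a::euclidean_space \<Rightarrow> real"
  assumes "continuous_on UNIV f" "compact K" "\<And>x. x \<notin> K \<Longrightarrow> f x = 0"
  shows "integrable lborel f"
proof -
  have "set_integrable lborel K f"
    unfolding set_integrable_def using borel_integrable_compact[OF assms(2), of f] assms(1)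
    by (auto intro: continuous_on_subset)
  moreover have "(\<lambda>x. indicator K x *\<^sub>R f x) = f"
    using assms(3) by (auto simp: indicator_def fun_eq_iff)
  ultimately show ?thesis by (simp add: set_integrable_def)
qed

lemma bounded_compact_support:
  fixes f :: "'a::euclidean_space \<Rightarrow> real"
  assumes "continuous_on UNIV f" "compact K" "\<And>x. x \<notin> K \<Longrightarrow> f x = 0"
  obtains B where "B > 0" "\<And>x. \<bar>f x\<bar> \<le> B"
proof -
  have "compact (f ` K)" using assms by (intro compact_continuous_image) (auto intro: continuous_on_subset)
  then have "bounded (f ` K)" by (rule compact_imp_bounded)
  then obtain B where B: "B > 0" "\<And>y. y \<in> f ` K \<Longrightarrow> norm y \<le> B"
    by (auto simp: bounded_pos)
  show ?thesis
  proof (rule that[of B])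
    fix x show "\<bar>f x\<bar> \<le> B" using B assms(3)[of x] by (cases "x \<in> K") auto
  qed (use B in auto)
qed

lemma integral_shift_lborel:
  fixes f :: "'a::euclidean_space \<Rightarrow> real"
  assumes [measurable]: "f \<in> borel_measurable borel"
  shows "integral\<^sup>L lborel (\<lambda>x. f (x + a)) = integral\<^sup>L lborel f"
proof -
  have "integral\<^sup>L lborel f = integral\<^sup>L (distr lborel borel ((+) a)) f"
    by (simp add: lborel_distr_plus)
  also have "\<dots> = integral\<^sup>L lborel (\<lambda>x. f (a + x))" by (rule integral_distr) auto
  finally show ?thesis by (simp add: add.commute)
qed

text \<open>Translation invariance makes the integral of every difference quotient vanish.\<close>

lemma integral_directional_derivative_eq_0:
  fixes f f' :: "complex \<Rightarrow> real"
  assumes cf: "continuous_on UNIV f" and cf': "continuous_on UNIV f'"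
    and K: "compact K" "\<And>x. x \<notin> K \<Longrightarrow> f x = 0" "\<And>x. x \<notin> K \<Longrightarrow> f' x = 0"
    and d: "\<And>x. ((\<lambda>s. f (x + of_real s * v)) has_real_derivative f' x) (at 0)"
  shows "integral\<^sup>L lborel f' = 0"
proof -
  have mf [measurable]: "f \<in> borel_measurable borel" by (rule borel_measurable_continuous_onI[OF cf])
  have mf' [measurable]: "f' \<in> borel_measurable borel" by (rule borel_measurable_continuous_onI[OF cf'])
  have if1: "integrable lborel f" by (rule integrable_compact_support[OF cf K(1,2)])
  obtain B where B: "B > 0" "\<And>x. \<bar>f' x\<bar> \<le> B"
    using bounded_compact_support[OF cf' K(1,3)] by blast
  define h where "h n = inverse (real (Suc n))" for n
  define q where "q n x = (f (x + of_real (h n) * v) - f x) / h n" for n x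
  have h: "h n > 0" "h n \<le> 1" for n by (auto simp: h_def inverse_eq_divide)
  have h0: "h \<longlonglongrightarrow> 0" unfolding h_def by (rule LIMSEQ_inverse_real_of_nat)
  have ifs: "integrable lborel (\<lambda>x. f (x + a))" for a
  proof (rule integrable_compact_support)
    show "compact ((\<lambda>x. x - a) ` K)" using K(1) by (intro compact_continuous_image continuous_intros)
    show "continuous_on UNIV (\<lambda>x. f (x + a))"
      by (rule continuous_on_compose2[OF cf]) (auto intro!: continuous_intros)
    fix x assume "x \<notin> (\<lambda>x. x - a) ` K"
    then have "x + a \<notin> K" by (metis add_diff_cancel_right' image_eqI)
    then show "f (x + a) = 0" by (rule K(2))
  qed
  have int0: "integral\<^sup>L lborel (q n) = 0" for n
  proof -
    have "integral\<^sup>L lborel (\<lambda>x. f (x + of_real (h n) * v) - f x) = 0"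
      using ifs if1 by (simp add: integral_shift_lborel)
    then show ?thesis unfolding q_def by simp
  qed
  have dx: "((\<lambda>s. f (x + of_real s * v)) has_real_derivative f' (x + of_real s * v)) (at s)" for x s
  proof -
    have "((\<lambda>t. f ((x + of_real s * v) + of_real (t - s) * v)) has_real_derivative f' (x + of_real s * v)) (at s)"
      using DERIV_shift[of "\<lambda>t. f ((x + of_real s * v) + of_real t * v)" "f' (x + of_real s * v)" s "-s"]
        d[of "x + of_real s * v"] by simp
    then show ?thesis by (simp add: algebra_simps)
  qed
  have qb: "\<bar>q n x\<bar> \<le> B" for n x
  proof -
    have "\<exists>z. 0 < z \<and> z < h n \<and> f (x + of_real (h n) * v) - f (x + of_real 0 * v) = (h n - 0) * f' (x + of_real z * v)"
      by (rule MVT2) (use h dx in auto)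
    then obtain z where "f (x + of_real (h n) * v) - f x = h n * f' (x + of_real z * v)" by auto
    then show ?thesis using h(1)[of n] B(2)[of "x + of_real z * v"] by (simp add: q_def)
  qed
  obtain \<rho> where \<rho>: "\<And>x. x \<in> K \<Longrightarrow> norm x \<le> \<rho>"
    using compact_imp_bounded[OF K(1)] by (auto simp: bounded_iff)
  \<comment> \<open>As \<open>h n \<le> 1\<close>, all difference quotients vanish outside this one
    ball. With the mean value bound \<open>B\<close> this gives an integrable dominating
    function.\<close>
  define S where "S = cball (0::complex) (\<rho> + norm v)"
  have qS: "q n x = 0" if "x \<notin> S" for n x
  proof -
    have "norm x > \<rho> + norm v" using that by (simp add: S_def)
    moreover have "norm (x + of_real (h n) * v) \<ge> norm x - norm v"
    proof -
      have "norm (of_real (h n) * v) \<le> norm v"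
        using h[of n] by (simp add: norm_mult mult_left_le_one_le)
      then show ?thesis using norm_diff_ineq[of x "of_real (h n) * v"] by linarith
    qed
    ultimately have "x \<notin> K" "x + of_real (h n) * v \<notin> K"
      using \<rho>[of x] \<rho>[of "x + of_real (h n) * v"] norm_ge_zero[of v] by auto
    then show ?thesis by (simp add: q_def K)
  qed
  have "(\<lambda>n. integral\<^sup>L lborel (q n)) \<longlonglongrightarrow> integral\<^sup>L lborel f'"
  proof (rule integral_dominated_convergence)
    show "integrable lborel (\<lambda>x. B * indicator S x :: real)"
      unfolding S_def by (intro integrable_mult_right integrable_real_indicator)
        (use emeasure_lborel_cball_finite[of "0::complex" "\<rho> + norm v"] in auto)
    show "AE x in lborel. (\<lambda>n. q n x) \<longlonglongrightarrow> f' x"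
    proof (rule AE_I2)
      fix x
      have "((\<lambda>s. (f (x + of_real s * v) - f x) / s) \<longlongrightarrow> f' x) (at 0)"
        using d[of x] by (simp add: DERIV_def)
      moreover have "filterlim h (at 0) sequentially"
        using h0 h(1) by (simp add: filterlim_at less_imp_neq[symmetric] eventually_sequentially)
      ultimately show "(\<lambda>n. q n x) \<longlonglongrightarrow> f' x"
        unfolding q_def by (rule filterlim_compose)
    qed
    show "AE x in lborel. norm (q n x) \<le> B * indicator S x" for n
      using qb qS by (auto simp: indicator_def)
  next
    show "q n \<in> borel_measurable lborel" for n unfolding q_def[abs_def] by measurable
  qed simp
  then show ?thesis by (simp add: int0 LIMSEQ_const_iff)
qed

text \<open>\<open>g1 v\<close> and \<open>g2 v\<close> are the first and second derivatives of \<open>g\<close> in the direction \<open>v\<close>; the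
  mixed derivatives play no role for the Laplacian.\<close>

definition C2_with :: "complex set \<Rightarrow> (complex \<Rightarrow> real) \<Rightarrow> (complex \<Rightarrow> complex \<Rightarrow> real) \<Rightarrow>
    (complex \<Rightarrow> complex \<Rightarrow> real) \<Rightarrow> bool"
  where "C2_with S g g1 g2 \<longleftrightarrow> continuous_on S g \<and>
    (\<forall>v\<in>{1, \<i>}. continuous_on S (g1 v) \<and> continuous_on S (g2 v) \<and>
      (\<forall>x\<in>S. ((\<lambda>s. g (x + of_real s * v)) has_real_derivative g1 v x) (at 0) \<and>
        ((\<lambda>s. g1 v (x + of_real s * v)) has_real_derivative g2 v x) (at 0)))"

definition lap :: "(complex \<Rightarrow> complex \<Rightarrow> real) \<Rightarrow> complex \<Rightarrow> real"
  where "lap g2 x = g2 1 x + g2 \<i> x"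

lemma C2_withD:
  assumes "C2_with S g g1 g2"
  shows "continuous_on S g" "v \<in> {1, \<i>} \<Longrightarrow> continuous_on S (g1 v)"
    "v \<in> {1, \<i>} \<Longrightarrow> continuous_on S (g2 v)"
    "v \<in> {1, \<i>} \<Longrightarrow> x \<in> S \<Longrightarrow> ((\<lambda>s. g (x + of_real s * v)) has_real_derivative g1 v x) (at 0)"
    "v \<in> {1, \<i>} \<Longrightarrow> x \<in> S \<Longrightarrow> ((\<lambda>s. g1 v (x + of_real s * v)) has_real_derivative g2 v x) (at 0)"
  using assms unfolding C2_with_def by blast+

lemma C2_with_continuous_lap: "C2_with S g g1 g2 \<Longrightarrow> continuous_on S (lap g2)"
  unfolding lap_def[abs_def] by (auto dest: C2_withD(3) intro!: continuous_on_add)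

lemma C2_with_subset: "C2_with S g g1 g2 \<Longrightarrow> T \<subseteq> S \<Longrightarrow> C2_with T g g1 g2"
  unfolding C2_with_def by (auto intro: continuous_on_subset)

lemma C2_with_mult:
  assumes "C2_with S g g1 g2" "C2_with S h h1 h2"
  shows "C2_with S (\<lambda>x. g x * h x) (\<lambda>v x. g1 v x * h x + g x * h1 v x)
    (\<lambda>v x. g2 v x * h x + 2 * g1 v x * h1 v x + g x * h2 v x)"
  unfolding C2_with_def
proof (intro conjI ballI)
  fix v :: complex and x :: complex assume v: "v \<in> {1, \<i>}" and x: "x \<in> S"
  note d = C2_withD(4,5)[OF assms(1) v x] C2_withD(4,5)[OF assms(2) v x]
  show "((\<lambda>s. g (x + of_real s * v) * h (x + of_real s * v)) has_real_derivative g1 v x * h x + g x * h1 v x) (at 0)"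
    by (rule derivative_eq_intros d)+ (simp add: algebra_simps)
  show "((\<lambda>s. g1 v (x + of_real s * v) * h (x + of_real s * v) + g (x + of_real s * v) * h1 v (x + of_real s * v))
      has_real_derivative g2 v x * h x + 2 * g1 v x * h1 v x + g x * h2 v x) (at 0)"
    using DERIV_add[OF DERIV_mult[OF d(2,3)] DERIV_mult[OF d(1,4)]] by (simp add: algebra_simps)
qed (auto intro!: continuous_intros intro: C2_withD(1-3)[OF assms(1)] C2_withD(1-3)[OF assms(2)])

lemma C2_with_diff:
  assumes "C2_with S g g1 g2" "C2_with S h h1 h2"
  shows "C2_with S (\<lambda>x. g x - h x) (\<lambda>v x. g1 v x - h1 v x) (\<lambda>v x. g2 v x - h2 v x)"
  using assms unfolding C2_with_def by (auto intro!: continuous_intros derivative_intros)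

lemma C2_with_compose:
  assumes g: "C2_with S g g1 g2"
    and r: "\<And>x. x \<in> S \<Longrightarrow> (r has_real_derivative r' (g x)) (at (g x))" "\<And>x. x \<in> S \<Longrightarrow> (r' has_real_derivative r'' (g x)) (at (g x))"
    and c: "continuous_on (g ` S) r''"
  shows "C2_with S (\<lambda>x. r (g x)) (\<lambda>v x. r' (g x) * g1 v x) (\<lambda>v x. r'' (g x) * (g1 v x)\<^sup>2 + r' (g x) * g2 v x)"
  unfolding C2_with_def
proof (intro conjI ballI)
  have c1: "continuous_on S (\<lambda>x. r (g x))"
    by (rule continuous_on_compose2[OF _ C2_withD(1)[OF g], of "g ` S"])
      (auto intro!: continuous_at_imp_continuous_on DERIV_isCont r)
  have c2: "continuous_on S (\<lambda>x. r' (g x))"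
    by (rule continuous_on_compose2[OF _ C2_withD(1)[OF g], of "g ` S"])
      (auto intro!: continuous_at_imp_continuous_on DERIV_isCont r)
  have c3: "continuous_on S (\<lambda>x. r'' (g x))"
    by (rule continuous_on_compose2[OF c C2_withD(1)[OF g]]) auto
  show "continuous_on S (\<lambda>x. r (g x))" by (rule c1)
  fix v :: complex assume v: "v \<in> {1, \<i>}"
  note cg = C2_withD(2,3)[OF g v]
  show "continuous_on S (\<lambda>x. r' (g x) * g1 v x)" by (intro continuous_intros c2 cg)
  show "continuous_on S (\<lambda>x. r'' (g x) * (g1 v x)\<^sup>2 + r' (g x) * g2 v x)" by (intro continuous_intros c2 c3 cg)
  fix x :: complex assume x: "x \<in> S"
  note d = C2_withD(4,5)[OF g v x]
  have r0: "(r has_real_derivative r' (g x)) (at (g (x + of_real 0 * v)))"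
     "(r' has_real_derivative r'' (g x)) (at (g (x + of_real 0 * v)))" using r x by auto
  show "((\<lambda>s. r (g (x + of_real s * v))) has_real_derivative r' (g x) * g1 v x) (at 0)"
    using DERIV_chain2[OF r0(1) d(1)] .
  have "((\<lambda>s. r' (g (x + of_real s * v))) has_real_derivative r'' (g x) * g1 v x) (at 0)"
    using DERIV_chain2[OF r0(2) d(1)] .
  from DERIV_mult[OF this d(2)]
  show "((\<lambda>s. r' (g (x + of_real s * v)) * g1 v (x + of_real s * v)) has_real_derivative
      r'' (g x) * (g1 v x)\<^sup>2 + r' (g x) * g2 v x) (at 0)"
    by (simp add: power2_eq_square algebra_simps)
qed

lemma C2_with_cmod_square:
  "C2_with S (\<lambda>x. k * (cmod (x - e))\<^sup>2) (\<lambda>v x. k * (2 * Re ((x - e) * cnj v))) (\<lambda>v x. 2 * k)"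
  unfolding C2_with_def
proof (intro conjI ballI)
  fix v x :: complex assume v: "v \<in> {1, \<i>}"
  have n: "(cmod (x + of_real s * v - e))\<^sup>2 = (cmod (x - e))\<^sup>2 + 2 * s * Re ((x - e) * cnj v) + s\<^sup>2" for s
    using v by (auto simp: cmod_power2) (auto simp: power2_eq_square algebra_simps)
  show "((\<lambda>s. k * (cmod (x + of_real s * v - e))\<^sup>2) has_real_derivative k * (2 * Re ((x - e) * cnj v))) (at 0)"
    unfolding n by (auto intro!: derivative_eq_intros)
  have m: "Re ((x + of_real s * v - e) * cnj v) = Re ((x - e) * cnj v) + s" for s
    using v by (auto simp: algebra_simps)
  show "((\<lambda>s. k * (2 * Re ((x + of_real s * v - e) * cnj v))) has_real_derivative 2 * k) (at 0)"
    unfolding m by (auto intro!: derivative_eq_intros)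
qed (auto intro!: continuous_intros)

text \<open>\<open>C2_with\<close> pins \<open>g1\<close> and \<open>g2\<close> down pointwise by
  uniqueness of derivatives, so the vanishing of \<open>g\<close> on the open complement of
  \<open>K\<close> passes to both.\<close>

lemma C2_with_support:
  assumes g: "C2_with UNIV g g1 g2" and K: "closed K" "\<And>x. x \<notin> K \<Longrightarrow> g x = 0" and x: "x \<notin> K" and v: "v \<in> {1, \<i>}"
  shows "g1 v x = 0" "g2 v x = 0"
proof -
  have ev: "\<forall>\<^sub>F s in nhds 0. y + of_real s * v \<in> - K" if "y \<notin> K" for y
  proof -
    have "((\<lambda>s::real. y + of_real s * v) \<longlongrightarrow> y + of_real 0 * v) (nhds 0)"
      by (intro tendsto_intros filterlim_ident)
    then show ?thesis using K(1) that by (auto simp: tendsto_def open_Compl)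
  qed
  have g1: "g1 v y = 0" if "y \<notin> K" for y
  proof -
    have "((\<lambda>s. g (y + of_real s * v)) has_real_derivative 0) (at 0)"
      by (rule DERIV_cong_ev[THEN iffD2, OF refl _ refl DERIV_const[of 0]])
        (use ev[OF that] K(2) in \<open>auto elim: eventually_mono\<close>)
    then show ?thesis using C2_withD(4)[OF g v] DERIV_unique by blast
  qed
  then show "g1 v x = 0" using x by blast
  have "((\<lambda>s. g1 v (x + of_real s * v)) has_real_derivative 0) (at 0)"
    by (rule DERIV_cong_ev[THEN iffD2, OF refl _ refl DERIV_const[of 0]])
        (use ev[OF x] g1 in \<open>auto elim: eventually_mono\<close>)
  then show "g2 v x = 0" using C2_withD(5)[OF g v] DERIV_unique by blast
qed

lemma continuous_on_UNIV_of_compact_support: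
  fixes f :: "complex \<Rightarrow> real"
  assumes "open S" "continuous_on S f" "closed K" "K \<subseteq> S" "\<And>x. x \<notin> K \<Longrightarrow> f x = 0"
  shows "continuous_on UNIV f"
proof -
  have "continuous_on (- K) f" using assms(5) by (subst continuous_on_cong[OF refl, of _ f "\<lambda>_. 0"]) auto
  then have "continuous_on (S \<union> - K) f" using assms by (intro continuous_on_open_Un) auto
  moreover have "S \<union> - K = UNIV" using assms(4) by auto
  ultimately show ?thesis by simp
qed

section \<open>Green's identity for compactly supported test functions\<close>

text \<open>In each coordinate direction \<open>g * u1 - u * g1\<close> has derivative
  \<open>g * u2 - u * g2\<close>, since the first order terms cancel, and the integral of a
  derivative with compact support is 0. The support belongs to \<open>g\<close>, so \<open>u\<close>
  has to be smooth only on a neighbourhood \<open>S\<close> of it.\<close>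

lemma green_C2_with:
  assumes S: "open S" and u: "C2_with S u u1 u2" and g: "C2_with UNIV g g1 g2"
    and K: "compact K" "K \<subseteq> S" "\<And>x. x \<notin> K \<Longrightarrow> g x = 0"
  shows "integrable lborel (\<lambda>x. g x * lap u2 x)" "integrable lborel (\<lambda>x. u x * lap g2 x)"
    "integral\<^sup>L lborel (\<lambda>x. g x * lap u2 x) = integral\<^sup>L lborel (\<lambda>x. u x * lap g2 x)"
proof -
  note Kc = compact_imp_closed[OF K(1)]
  note sup = C2_with_support[OF g Kc K(3)]
  have gS: "C2_with S g g1 g2" using C2_with_subset[OF g] by simp
  have z: "lap g2 x = 0" if "x \<notin> K" for x using sup[OF _ that] that by (simp add: lap_def)
  have i: "integrable lborel (\<lambda>x. g x * u2 v x)" "integrable lborel (\<lambda>x. u x * g2 v x)"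
     "integral\<^sup>L lborel (\<lambda>x. g x * u2 v x) = integral\<^sup>L lborel (\<lambda>x. u x * g2 v x)"
    if v: "v \<in> {1, \<i>}" for v
  proof -
    have z1: "g1 v x = 0" "g2 v x = 0" if "x \<notin> K" for x using sup[OF _ that v] that by auto
    have c: "continuous_on UNIV (\<lambda>x. g x * u2 v x)" "continuous_on UNIV (\<lambda>x. u x * g2 v x)"
      by (rule continuous_on_UNIV_of_compact_support[OF S _ Kc K(2)];
         use K(3) z1 in \<open>auto intro!: continuous_intros C2_withD[OF u] C2_withD[OF gS] v\<close>)+
    show 1: "integrable lborel (\<lambda>x. g x * u2 v x)"
      by (rule integrable_compact_support[OF c(1) K(1)]) (use K(3) in auto)
    show 2: "integrable lborel (\<lambda>x. u x * g2 v x)"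
      by (rule integrable_compact_support[OF c(2) K(1)]) (use z1 in auto)
    have "integral\<^sup>L lborel (\<lambda>x. g x * u2 v x - u x * g2 v x) = 0"
    proof (rule integral_directional_derivative_eq_0[where f = "\<lambda>x. g x * u1 v x - u x * g1 v x" and K = K and v = v])
      show "continuous_on UNIV (\<lambda>x. g x * u1 v x - u x * g1 v x)"
        by (rule continuous_on_UNIV_of_compact_support[OF S _ Kc K(2)];
         use K(3) z1 in \<open>auto intro!: continuous_intros C2_withD[OF u] C2_withD[OF gS] v\<close>)
      show "continuous_on UNIV (\<lambda>x. g x * u2 v x - u x * g2 v x)" by (intro continuous_intros c)
      fix x
      show "((\<lambda>s. g (x + of_real s * v) * u1 v (x + of_real s * v) - u (x + of_real s * v) * g1 v (x + of_real s * v))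
          has_real_derivative g x * u2 v x - u x * g2 v x) (at 0)"
      proof (cases "x \<in> K")
        case True
        then have x: "x \<in> S" using K by auto
        note d = C2_withD(4,5)[OF u v x] C2_withD(4,5)[OF gS v x]
        show ?thesis using DERIV_diff[OF DERIV_mult[OF d(3,2)] DERIV_mult[OF d(1,4)]] by (simp add: algebra_simps)
      next
        case False
        have "((\<lambda>s::real. x + of_real s * v) \<longlongrightarrow> x + of_real 0 * v) (nhds 0)"
          by (intro tendsto_intros filterlim_ident)
        then have ev: "\<forall>\<^sub>F s in nhds 0. x + of_real s * v \<in> - K" using Kc False
          by (auto simp: tendsto_def open_Compl)
        have "((\<lambda>s. g (x + of_real s * v) * u1 v (x + of_real s * v) - u (x + of_real s * v) * g1 v (x + of_real s * v)) has_real_derivative 0) (at 0)"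
          by (rule DERIV_cong_ev[THEN iffD2, OF refl _ refl DERIV_const[of 0]])
            (use ev K(3) z1 in \<open>auto elim!: eventually_mono\<close>)
        then show ?thesis using False K(3) z1 by simp
      qed
    qed (use K z1 in auto)
    then show "integral\<^sup>L lborel (\<lambda>x. g x * u2 v x) = integral\<^sup>L lborel (\<lambda>x. u x * g2 v x)"
      using 1 2 by simp
  qed
  have e: "(\<lambda>x. g x * lap u2 x) = (\<lambda>x. g x * u2 1 x + g x * u2 \<i> x)"
    "(\<lambda>x. u x * lap g2 x) = (\<lambda>x. u x * g2 1 x + u x * g2 \<i> x)"
    by (auto simp: lap_def algebra_simps)
  show "integrable lborel (\<lambda>x. g x * lap u2 x)" "integrable lborel (\<lambda>x. u x * lap g2 x)"
    "integral\<^sup>L lborel (\<lambda>x. g x * lap u2 x) = integral\<^sup>L lborel (\<lambda>x. u x * lap g2 x)"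
    unfolding e using i by auto
qed

section \<open>Twice differentiable cutoffs and radial integrals\<close>

text \<open>The cube is the smallest power of the positive part whose second derivative is
  continuous at 0, as \<open>C2_with\<close> demands.\<close>

definition cutoff :: "real \<Rightarrow> real" where "cutoff t = (max t 0) ^ 3"

lemma cutoff_deriv: "(cutoff has_real_derivative 3 * (max t 0)\<^sup>2) (at t)"
proof -
  consider "t > 0" | "t < 0" | "t = 0" by linarith
  then show ?thesis
  proof cases
    case 1
    have "((\<lambda>t. t ^ 3) has_real_derivative 3 * (max t 0)\<^sup>2) (at t)"
      using 1 by (auto intro!: derivative_eq_intros)
    moreover have "\<forall>\<^sub>F s in nhds t. s ^ 3 = cutoff s"
      using eventually_nhds_in_open[of "{0<..}" t] 1 by (auto elim!: eventually_mono simp: cutoff_def)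
    ultimately show ?thesis by (subst (asm) DERIV_cong_ev[OF refl _ refl])
  next
    case 2
    have "((\<lambda>t. 0) has_real_derivative 3 * (max t 0)\<^sup>2) (at t)"
      using 2 by (auto intro!: derivative_eq_intros)
    moreover have "\<forall>\<^sub>F s in nhds t. 0 = cutoff s"
      using eventually_nhds_in_open[of "{..<0}" t] 2 by (auto elim!: eventually_mono simp: cutoff_def)
    ultimately show ?thesis by (subst (asm) DERIV_cong_ev[OF refl _ refl])
  next
    case 3
    have "((\<lambda>h. (cutoff (0 + h) - cutoff 0) / h) \<longlongrightarrow> 0) (at 0)"
    proof (rule Lim_null_comparison)
      show "\<forall>\<^sub>F h in at 0. norm ((cutoff (0 + h) - cutoff 0) / h) \<le> h\<^sup>2"
        by (auto simp: cutoff_def max_def power2_eq_square power3_eq_cube intro!: always_eventually)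
      show "((\<lambda>h. h\<^sup>2) \<longlongrightarrow> (0::real)) (at 0)" by (auto intro!: tendsto_eq_intros)
    qed
    then show ?thesis using 3 by (simp add: DERIV_def)
  qed
qed

lemma cutoff_deriv2: "((\<lambda>t. 3 * (max t 0)\<^sup>2) has_real_derivative 6 * max t 0) (at t)"
proof -
  consider "t > 0" | "t < 0" | "t = 0" by linarith
  then show ?thesis
  proof cases
    case 1
    have "((\<lambda>t. 3 * t\<^sup>2) has_real_derivative 6 * max t 0) (at t)"
      using 1 by (auto intro!: derivative_eq_intros)
    moreover have "\<forall>\<^sub>F s in nhds t. 3 * s\<^sup>2 = 3 * (max s 0)\<^sup>2"
      using eventually_nhds_in_open[of "{0<..}" t] 1 by (auto elim!: eventually_mono)
    ultimately show ?thesis by (subst (asm) DERIV_cong_ev[OF refl _ refl])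
  next
    case 2
    have "((\<lambda>t. 0) has_real_derivative 6 * max t 0) (at t)"
      using 2 by (auto intro!: derivative_eq_intros)
    moreover have "\<forall>\<^sub>F s in nhds t. 0 = 3 * (max s 0)\<^sup>2"
      using eventually_nhds_in_open[of "{..<0}" t] 2 by (auto elim!: eventually_mono)
    ultimately show ?thesis by (subst (asm) DERIV_cong_ev[OF refl _ refl])
  next
    case 3
    have "((\<lambda>h. (3 * (max (0 + h) 0)\<^sup>2 - 3 * (max 0 0)\<^sup>2) / h) \<longlongrightarrow> (0::real)) (at 0)"
    proof (rule Lim_null_comparison)
      show "\<forall>\<^sub>F h in at (0::real). norm ((3 * (max (0 + h) 0)\<^sup>2 - 3 * (max 0 0)\<^sup>2) / h) \<le> 3 * \<bar>h\<bar>"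
        by (auto simp: max_def power2_eq_square intro!: always_eventually)
      show "((\<lambda>h. 3 * \<bar>h\<bar>) \<longlongrightarrow> (0::real)) (at 0)" by (auto intro!: tendsto_eq_intros)
    qed
    then show ?thesis using 3 by (simp add: DERIV_def)
  qed
qed

lemma C2_with_cutoff:
  assumes "C2_with S g g1 g2"
  shows "C2_with S (\<lambda>x. cutoff (g x)) (\<lambda>v x. 3 * (max (g x) 0)\<^sup>2 * g1 v x)
    (\<lambda>v x. 6 * max (g x) 0 * (g1 v x)\<^sup>2 + 3 * (max (g x) 0)\<^sup>2 * g2 v x)"
  by (rule C2_with_compose[OF assms cutoff_deriv cutoff_deriv2]) (auto intro!: continuous_intros)

text \<open>Polar coordinates without a parametrization of the sphere: the image of Lebesgue measure
  under the norm and the measure with the stated density agree on all rays \<open>{..t}\<close>, by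
  the volume of balls, and the rays generate the Borel sets.\<close>

lemma nn_integral_norm:
  fixes h :: "real \<Rightarrow> ennreal"
  assumes [measurable]: "h \<in> borel_measurable borel"
  shows "(\<integral>\<^sup>+x. h (norm (x :: 'a::euclidean_space)) \<partial>lborel)
    = (\<integral>\<^sup>+r\<in>{0..}. ennreal (unit_ball_vol (real DIM('a)) * (real DIM('a) * r ^ (DIM('a) - 1))) * h r \<partial>lborel)"
proof -
  let ?V = "unit_ball_vol (real DIM('a))"
  let ?\<rho> = "\<lambda>r::real. ?V * (real DIM('a) * r ^ (DIM('a) - 1))"
  let ?M = "distr lborel borel (\<lambda>x::'a. norm x)"
  let ?N = "density lborel (\<lambda>t. ennreal (?\<rho> t) * indicator {0..} t)"
  have M: "emeasure ?M {..t} = (if t \<ge> 0 then ennreal (?V * t ^ DIM('a)) else 0)" for t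
  proof (cases "t \<ge> 0")
    case True
    have "(\<lambda>x::'a. norm x) -` {..t} \<inter> space lborel = cball 0 t" by auto
    then show ?thesis using True by (simp add: emeasure_distr emeasure_cball)
  next
    case False
    then have "(\<lambda>x::'a. norm x) -` {..t} \<inter> space lborel = {}"
      by (auto simp: not_le) (meson norm_ge_zero not_less order_trans)
    then show ?thesis using False by (simp add: emeasure_distr)
  qed
  have N: "emeasure ?N {..t} = (if t \<ge> 0 then ennreal (?V * t ^ DIM('a)) else 0)" for t
  proof -
    have e: "emeasure ?N {..t} = (\<integral>\<^sup>+s\<in>{0..t}. ennreal (?\<rho> s) \<partial>lborel)"
      by (auto simp: emeasure_density indicator_def intro!: nn_integral_cong)
    show ?thesis
    proof (cases "t \<ge> 0")
      case True
      have "(\<integral>\<^sup>+s\<in>{0..t}. ennreal (?\<rho> s) \<partial>lborel) = ennreal (?V * t ^ DIM('a) - ?V * 0 ^ DIM('a))"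
        by (rule nn_integral_FTC_Icc[where F = "\<lambda>t. ?V * t ^ DIM('a)"])
          (use True in \<open>auto intro!: derivative_eq_intros\<close>)
      then show ?thesis using True e by (simp add: zero_power)
    next
      case False
      then show ?thesis using e by simp
    qed
  qed
  have "?M = ?N"
  proof (rule measure_eqI_generator_eq[where E = "range (\<lambda>a. {..a})" and \<Omega> = UNIV and A = "\<lambda>i. {..real i}"])
    show "Int_stable (range (\<lambda>a::real. {..a}))" by (auto simp: Int_stable_def)
    show "sets ?M = sigma_sets UNIV (range (\<lambda>a. {..a}))" "sets ?N = sigma_sets UNIV (range (\<lambda>a. {..a}))"
      by (simp_all add: borel_eq_atMost sets_measure_of)
    show "(\<Union>i. {..real i}) = UNIV" by (auto simp: real_arch_simple)
  qed (use M N in auto)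
  then have "integral\<^sup>N ?M h = integral\<^sup>N ?N h" by simp
  then show ?thesis
    by (simp add: nn_integral_distr nn_integral_density mult_ac)
qed

text \<open>The area of the unit sphere in stereographic coordinates. The integrand is the Laplacian
  of \<open>ln (1 + |x|^2)\<close>, so this number calibrates the growth theorem below.\<close>

lemma nn_integral_spherical_density:
  "(\<integral>\<^sup>+x. ennreal (4 / (1 + (cmod x)\<^sup>2)\<^sup>2) \<partial>lborel) = ennreal (4 * pi)"
proof -
  have p: "1 + t\<^sup>2 \<noteq> 0" for t :: real by (smt (verit) zero_le_power2)
  have "(\<integral>\<^sup>+x. ennreal (4 / (1 + (cmod x)\<^sup>2)\<^sup>2) \<partial>lborel)
      = (\<integral>\<^sup>+t\<in>{0..}. ennreal (pi * (2 * t)) * ennreal (4 / (1 + t\<^sup>2)\<^sup>2) \<partial>lborel)"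
    using nn_integral_norm[where 'a = complex, of "\<lambda>t. ennreal (4 / (1 + t\<^sup>2)\<^sup>2)"] by (simp add: unit_ball_vol_2)
  also have "\<dots> = (\<integral>\<^sup>+t\<in>{0..}. ennreal (8 * pi * t / (1 + t\<^sup>2)\<^sup>2) \<partial>lborel)"
    by (intro nn_integral_cong) (auto simp: ennreal_mult[symmetric] indicator_def mult_ac)
  also have "\<dots> = ennreal (0 - (- 4 * pi / (1 + 0\<^sup>2)))"
  proof (rule nn_integral_FTC_atLeast[where F = "\<lambda>t. - 4 * pi / (1 + t\<^sup>2)"])
    fix t :: real
    show "((\<lambda>t. - 4 * pi / (1 + t\<^sup>2)) has_real_derivative 8 * pi * t / (1 + t\<^sup>2)\<^sup>2) (at t)"
      using p by (auto intro!: derivative_eq_intros simp: power2_eq_square)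
  next
    have "filterlim (\<lambda>t::real. 1 + t\<^sup>2) at_top at_top"
      by (intro filterlim_tendsto_add_at_top[OF tendsto_const] filterlim_pow_at_top filterlim_ident) auto
    then have "((\<lambda>t::real. - 4 * pi * inverse (1 + t\<^sup>2)) \<longlongrightarrow> - 4 * pi * 0) at_top"
      by (intro tendsto_mult tendsto_const tendsto_inverse_0_at_top)
    then show "((\<lambda>t::real. - 4 * pi / (1 + t\<^sup>2)) \<longlongrightarrow> 0) at_top" by (simp add: divide_inverse)
  qed auto
  finally show ?thesis by simp
qed

lemma cutoff_bounds: "0 \<le> cutoff t" "t \<le> 1 \<Longrightarrow> cutoff t \<le> 1" "t \<le> 0 \<Longrightarrow> cutoff t = 0" "cutoff 1 = 1"
  "s \<le> t \<Longrightarrow> cutoff s \<le> cutoff t"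
  by (auto simp: cutoff_def power_le_one max_def power_mono)

text \<open>The inner cutoff turns the squared distance into a ramp that starts at radius
  \<open>1 / n\<close>; subtracting it from 1 makes the plateau. The outer cutoff removes the
  negative values without losing a derivative.\<close>

definition bump :: "complex \<Rightarrow> real \<Rightarrow> complex \<Rightarrow> real"
  where "bump e n x = cutoff (1 - cutoff (n\<^sup>2 * (cmod (x - e))\<^sup>2 - 1))"

lemma bump_bounds:
  assumes "n > 0"
  shows "0 \<le> bump e n x" "bump e n x \<le> 1" "cmod (x - e) \<ge> 2 / n \<Longrightarrow> bump e n x = 0"
    "cmod (x - e) \<le> 1 / n \<Longrightarrow> bump e n x = 1"
    "n \<le> m \<Longrightarrow> bump e m x \<le> bump e n x"
proof -
  show "0 \<le> bump e n x" "bump e n x \<le> 1" by (auto simp: bump_def cutoff_bounds)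
  show "bump e n x = 0" if "cmod (x - e) \<ge> 2 / n"
  proof -
    have "2 \<le> n * cmod (x - e)" using that assms by (simp add: field_simps)
    then have "2\<^sup>2 \<le> (n * cmod (x - e))\<^sup>2" by (intro power_mono) auto
    then have "n\<^sup>2 * (cmod (x - e))\<^sup>2 - 1 \<ge> 1" by (simp add: power_mult_distrib)
    from cutoff_bounds(5)[OF this] show ?thesis by (auto simp: bump_def cutoff_bounds)
  qed
  show "bump e n x = 1" if "cmod (x - e) \<le> 1 / n"
  proof -
    have "n * cmod (x - e) \<le> 1" using that assms by (simp add: field_simps)
    then have "(n * cmod (x - e))\<^sup>2 \<le> 1" using assms by (intro power_le_one) auto
    then show ?thesis by (simp add: bump_def cutoff_bounds power_mult_distrib)
  qed
  show "bump e m x \<le> bump e n x" if "n \<le> m"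
    unfolding bump_def using that assms
    by (intro cutoff_bounds(5)) (auto intro!: cutoff_bounds(5) mult_right_mono power_mono diff_mono)
qed

text \<open>Only the powers of \<open>n\<close> matter: every derivative costs one factor
  \<open>n\<close>. The chain rule yields \<open>36 n\<close> and \<open>1170 n^2\<close>, so the
  constants are generous.\<close>

lemma C2_with_bump:
  assumes n: "n \<ge> 1"
  shows "\<exists>b1 b2. C2_with UNIV (bump e n) b1 b2 \<and>
    (\<forall>v\<in>{1, \<i>}. \<forall>x. \<bar>b1 v x\<bar> \<le> 1200 * n \<and> \<bar>b2 v x\<bar> \<le> 200000 * n\<^sup>2)"
proof -
  define q where "q = (\<lambda>x. n\<^sup>2 * (cmod (x - e))\<^sup>2 - 1)"
  define q1 where "q1 = (\<lambda>v x. n\<^sup>2 * (2 * Re ((x - e) * cnj v)))"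
  define q2 where "q2 = (\<lambda>(v::complex) (x::complex). 2 * n\<^sup>2)"
  define k where "k = (\<lambda>x. 1 - cutoff (q x))"
  define k1 where "k1 = (\<lambda>v x. 0 - 3 * (max (q x) 0)\<^sup>2 * q1 v x)"
  define k2 where "k2 = (\<lambda>v x. 0 - (6 * max (q x) 0 * (q1 v x)\<^sup>2 + 3 * (max (q x) 0)\<^sup>2 * q2 v x))"
  define b1 where "b1 = (\<lambda>v x. 3 * (max (k x) 0)\<^sup>2 * k1 v x)"
  define b2 where "b2 = (\<lambda>v x. 6 * max (k x) 0 * (k1 v x)\<^sup>2 + 3 * (max (k x) 0)\<^sup>2 * k2 v x)"
  have c: "C2_with UNIV (\<lambda>_. c) (\<lambda>_ _. 0) (\<lambda>_ _. 0)" for c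
    by (auto simp: C2_with_def)
  have "C2_with UNIV q (\<lambda>v x. q1 v x - 0) (\<lambda>v x. q2 v x - 0)" unfolding q_def q1_def q2_def
    by (rule C2_with_diff[OF C2_with_cmod_square c])
  then have "C2_with UNIV q q1 q2" by simp
  from C2_with_diff[OF c C2_with_cutoff[OF this], of 1]
  have "C2_with UNIV k k1 k2" unfolding k_def k1_def k2_def .
  from C2_with_cutoff[OF this] have C2: "C2_with UNIV (bump e n) b1 b2"
    unfolding b1_def b2_def bump_def[abs_def] k_def q_def .
  have main: "\<bar>b1 v x\<bar> \<le> 1200 * n \<and> \<bar>b2 v x\<bar> \<le> 200000 * n\<^sup>2" if v: "v \<in> {1, \<i>}" for v x
  proof (cases "k x \<le> 0")
    case True then show ?thesis using n by (simp add: b1_def b2_def)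
  next
    case False
    have k1x: "max (k x) 0 \<le> 1" "max (k x) 0 \<ge> 0" by (auto simp: k_def cutoff_bounds)
    \<comment> \<open>Where the outer cutoff has a positive argument, the point lies in the small
      disc. This confines all later estimates to \<open>n * cmod (x - e) \<le> 2\<close>.\<close>
    have ql: "q x \<le> 1"
    proof (rule ccontr)
      assume "\<not> q x \<le> 1"
      then have "cutoff 1 \<le> cutoff (q x)" by (intro cutoff_bounds(5)) auto
      then show False using False by (simp add: k_def cutoff_bounds)
    qed
    then have "(n * cmod (x - e))\<^sup>2 \<le> 2\<^sup>2" by (simp add: q_def power_mult_distrib)
    then have nx: "n * cmod (x - e) \<le> 2" by (rule power2_le_imp_le) auto
    have "\<bar>Re ((x - e) * cnj v)\<bar> \<le> cmod (x - e)"
      using abs_Re_le_cmod[of "(x - e) * cnj v"] v by (auto simp: norm_mult)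
    then have "n\<^sup>2 * (2 * \<bar>Re ((x - e) * cnj v)\<bar>) \<le> n * (2 * (n * cmod (x - e)))"
      using n by (simp add: power2_eq_square mult.assoc)
    also have "\<dots> \<le> n * 4" using nx n by (intro mult_left_mono) auto
    finally have q1: "\<bar>q1 v x\<bar> \<le> 4 * n" unfolding q1_def abs_mult by simp
    have mq: "0 \<le> max (q x) 0" "max (q x) 0 \<le> 1" using ql by auto
    have mq2: "(max (q x) 0)\<^sup>2 \<le> 1" using mq by (intro power_le_one)
    have q12: "(q1 v x)\<^sup>2 \<le> 16 * n\<^sup>2" using power_mono[OF q1, of 2] by (simp add: power_mult_distrib)
    have "\<bar>k1 v x\<bar> = 3 * ((max (q x) 0)\<^sup>2 * \<bar>q1 v x\<bar>)" by (simp add: k1_def abs_mult)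
    also have "\<dots> \<le> 3 * (1 * (4 * n))" using mq2 q1 by (intro mult_left_mono mult_mono) auto
    finally have k1: "\<bar>k1 v x\<bar> \<le> 12 * n" by simp
    have k12: "(k1 v x)\<^sup>2 \<le> 144 * n\<^sup>2" using power_mono[OF k1, of 2] by (simp add: power_mult_distrib)
    have "\<bar>k2 v x\<bar> = 6 * (max (q x) 0 * (q1 v x)\<^sup>2) + 3 * ((max (q x) 0)\<^sup>2 * (2 * n\<^sup>2))"
    proof -
      have "k2 v x = - (6 * (max (q x) 0 * (q1 v x)\<^sup>2) + 3 * ((max (q x) 0)\<^sup>2 * (2 * n\<^sup>2)))"
        by (simp add: k2_def q2_def)
      moreover have "0 \<le> 6 * (max (q x) 0 * (q1 v x)\<^sup>2) + 3 * ((max (q x) 0)\<^sup>2 * (2 * n\<^sup>2))"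
        using mq by (intro add_nonneg_nonneg mult_nonneg_nonneg) auto
      ultimately show ?thesis by (simp only: abs_minus_cancel abs_of_nonneg)
    qed
    also have "\<dots> \<le> 6 * (1 * (16 * n\<^sup>2)) + 3 * (1 * (2 * n\<^sup>2))"
      using mq mq2 q12 by (intro add_mono mult_left_mono mult_mono) auto
    finally have k2: "\<bar>k2 v x\<bar> \<le> 102 * n\<^sup>2" by simp
    have mk2: "(max (k x) 0)\<^sup>2 \<le> 1" using k1x by (intro power_le_one)
    have "\<bar>b1 v x\<bar> = 3 * ((max (k x) 0)\<^sup>2 * \<bar>k1 v x\<bar>)" by (simp add: b1_def abs_mult)
    also have "\<dots> \<le> 3 * (1 * (12 * n))" using mk2 k1 by (intro mult_left_mono mult_mono) auto
    finally have b1: "\<bar>b1 v x\<bar> \<le> 1200 * n" using n by simp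
    have "\<bar>b2 v x\<bar> \<le> 6 * (max (k x) 0 * (k1 v x)\<^sup>2) + 3 * ((max (k x) 0)\<^sup>2 * \<bar>k2 v x\<bar>)"
      unfolding b2_def by (rule order_trans[OF abs_triangle_ineq]) (use k1x in \<open>simp add: abs_mult\<close>)
    also have "\<dots> \<le> 6 * (1 * (144 * n\<^sup>2)) + 3 * (1 * (102 * n\<^sup>2))"
      using k1x mk2 k12 k2 by (intro add_mono mult_left_mono mult_mono) auto
    finally have "\<bar>b2 v x\<bar> \<le> 200000 * n\<^sup>2" using zero_le_power2[of n] by linarith
    then show ?thesis using b1 by simp
  qed
  show ?thesis using C2 main by blast
qed

lemma measurable_indicator_continuous:
  fixes f :: "'a::topological_space \<Rightarrow> real"
  assumes "open S" "continuous_on S f"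
  shows "(\<lambda>x. indicator S x * f x) \<in> borel_measurable borel"
  using borel_measurable_continuous_on_indicator[OF _ assms(2)] assms(1) by simp

section \<open>Isolated singularities and logarithmic growth\<close>

text \<open>Green's identity against the constant 1. It allows a constant to be subtracted from
  \<open>u\<close> under an integral against \<open>lap g2\<close>.\<close>

lemma integral_lap_eq_0:
  assumes "C2_with UNIV g g1 g2" "compact K" "\<And>x. x \<notin> K \<Longrightarrow> g x = 0"
  shows "integrable lborel (lap g2)" "integral\<^sup>L lborel (lap g2) = 0"
proof -
  have c: "C2_with UNIV (\<lambda>_. 1) (\<lambda>_ _. 0) (\<lambda>_ _. 0)" by (auto simp: C2_with_def)
  from green_C2_with[OF open_UNIV c assms(1,2) _ assms(3)]
  show "integrable lborel (lap g2)" "integral\<^sup>L lborel (lap g2) = 0" by (simp_all add: lap_def[abs_def])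
qed

lemma abs_integral_le_disc:
  fixes f :: "complex \<Rightarrow> real"
  assumes "integrable lborel f" "\<And>x. \<bar>f x\<bar> \<le> B * indicator (cball e r) x" "r \<ge> 0"
  shows "\<bar>integral\<^sup>L lborel f\<bar> \<le> B * pi * r\<^sup>2"
proof -
  have m: "emeasure lborel (cball e r) = ennreal (pi * r\<^sup>2)"
    using assms(3) by (simp add: emeasure_cball unit_ball_vol_2)
  then have m': "measure lborel (cball e r) = pi * r\<^sup>2" by (simp add: measure_def)
  have "\<bar>integral\<^sup>L lborel f\<bar> \<le> integral\<^sup>L lborel (\<lambda>x. \<bar>f x\<bar>)" by (rule integral_abs_bound)
  also have "\<dots> \<le> integral\<^sup>L lborel (\<lambda>x. B * indicator (cball e r) x)"
    by (rule integral_mono[OF integrable_abs[OF assms(1)] integrable_mult_right[OF integrable_real_indicator]])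
      (use m assms(2) in auto)
  also have "\<dots> = B * pi * r\<^sup>2" using m' by simp
  finally show ?thesis .
qed

text \<open>An isolated point where \<open>u\<close> is merely continuous carries no part of the distributional
  Laplacian: multiplying the test function by a bump of radius \<open>1 / n\<close> costs a factor \<open>n\<^sup>2\<close> in the
  second derivatives, which the area of the disc compensates, and the oscillation of \<open>u\<close> tends to 0.\<close>

lemma bump_integral_tendsto_0:
  fixes u :: "complex \<Rightarrow> real"
  assumes u: "continuous_on UNIV u" and g: "C2_with UNIV g g1 g2"
    and K: "compact K" "\<And>x. x \<notin> K \<Longrightarrow> g x = 0"
  shows "\<exists>h2. (\<forall>n. \<exists>h1. C2_with UNIV (\<lambda>x. g x * bump e (Suc n) x) h1 (h2 n)) \<and>
    (\<forall>n. integrable lborel (\<lambda>x. u x * lap (h2 n) x)) \<and>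
    (\<lambda>n. integral\<^sup>L lborel (\<lambda>x. u x * lap (h2 n) x)) \<longlonglongrightarrow> 0"
proof -
  have "\<exists>b1 b2. C2_with UNIV (bump e (Suc n)) b1 b2 \<and> (\<forall>v\<in>{1,\<i>}. \<forall>x. \<bar>b1 v x\<bar> \<le> 1200 * real (Suc n) \<and> \<bar>b2 v x\<bar> \<le> 200000 * (real (Suc n))\<^sup>2)" for n
    by (rule C2_with_bump) simp
  then obtain b1 b2 where b: "\<And>n. C2_with UNIV (bump e (Suc n)) (b1 n) (b2 n)"
    "\<And>n v x. v \<in> {1,\<i>} \<Longrightarrow> \<bar>b1 n v x\<bar> \<le> 1200 * real (Suc n)" "\<And>n v x. v \<in> {1,\<i>} \<Longrightarrow> \<bar>b2 n v x\<bar> \<le> 200000 * (real (Suc n))\<^sup>2"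
    by metis
  define h1 where "h1 n = (\<lambda>v x. g1 v x * bump e (Suc n) x + g x * b1 n v x)" for n
  define h2 where "h2 n = (\<lambda>v x. g2 v x * bump e (Suc n) x + 2 * g1 v x * b1 n v x + g x * b2 n v x)" for n
  have h: "C2_with UNIV (\<lambda>x. g x * bump e (Suc n) x) (h1 n) (h2 n)" for n
    unfolding h1_def h2_def by (rule C2_with_mult[OF g b(1)])
  obtain B where B: "B > 0" "\<And>x. \<bar>g x\<bar> \<le> B" using bounded_compact_support[OF C2_withD(1)[OF g] K] by blast
  have "\<exists>B. \<forall>x. \<bar>g1 v x\<bar> \<le> B \<and> \<bar>g2 v x\<bar> \<le> B" if v: "v \<in> {1, \<i>}" for v
  proof -
    note s = C2_with_support[OF g compact_imp_closed[OF K(1)] K(2) _ v]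
    obtain B1 where B1: "\<And>x. \<bar>g1 v x\<bar> \<le> B1" using bounded_compact_support[OF C2_withD(2)[OF g v] K(1) s(1)] by blast
    obtain B2 where B2: "\<And>x. \<bar>g2 v x\<bar> \<le> B2" using bounded_compact_support[OF C2_withD(3)[OF g v] K(1) s(2)] by blast
    show ?thesis by (rule exI[of _ "max B1 B2"]) (use B1 B2 in \<open>auto simp: le_max_iff_disj\<close>)
  qed
  then obtain C1 C2 where C: "\<And>x. \<bar>g1 1 x\<bar> \<le> C1 \<and> \<bar>g2 1 x\<bar> \<le> C1" "\<And>x. \<bar>g1 \<i> x\<bar> \<le> C2 \<and> \<bar>g2 \<i> x\<bar> \<le> C2"
    by (metis insertI1 insertI2)
  define D where "D = max B (max C1 C2)"
  have D: "\<bar>g x\<bar> \<le> D" "\<And>v. v \<in> {1, \<i>} \<Longrightarrow> \<bar>g1 v x\<bar> \<le> D" "\<And>v. v \<in> {1, \<i>} \<Longrightarrow> \<bar>g2 v x\<bar> \<le> D" for x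
    using B(2)[of x] C[of x] by (auto simp: D_def le_max_iff_disj)
  have D0: "D > 0" using B(1) by (auto simp: D_def)
  \<comment> \<open>With \<open>n = Suc n\<close> the product rule gives at most
    \<open>D + 2400 n D + 200000 n^2 D\<close>, hence \<open>250000 D n^2\<close>, for each
    direction; the Laplacian adds two directions.\<close>
  define E where "E = 500000 * D"
  have h2b: "\<bar>lap (h2 n) x\<bar> \<le> E * (real (Suc n))\<^sup>2 * indicator (cball e (2 / Suc n)) x" for n x
  proof (cases "x \<in> cball e (2 / Suc n)")
    case True
    have "\<bar>h2 n v x\<bar> \<le> 250000 * D * (real (Suc n))\<^sup>2" if v: "v \<in> {1, \<i>}" for v
    proof -
      have m: "1 \<le> real (Suc n)" "real (Suc n) \<le> (real (Suc n))\<^sup>2" by (auto simp: power2_eq_square)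
      have "\<bar>h2 n v x\<bar> \<le> \<bar>g2 v x\<bar> * \<bar>bump e (Suc n) x\<bar> + 2 * (\<bar>g1 v x\<bar> * \<bar>b1 n v x\<bar>) + \<bar>g x\<bar> * \<bar>b2 n v x\<bar>"
        unfolding h2_def by (simp add: abs_mult[symmetric])
      also have "\<dots> \<le> D * 1 + 2 * (D * (1200 * Suc n)) + D * (200000 * (real (Suc n))\<^sup>2)"
        using D(1)[of x] D(2,3)[OF v, of x] b(2,3)[OF v, of n x] bump_bounds(1,2)[of "Suc n" e x] D0
        by (intro add_mono mult_mono mult_left_mono) (simp_all only: abs_of_nonneg, simp_all)
      also have "\<dots> \<le> D * (real (Suc n))\<^sup>2 + 2 * (D * (1200 * (real (Suc n))\<^sup>2)) + D * (200000 * (real (Suc n))\<^sup>2)"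
        using m D0 by (intro add_mono mult_left_mono) auto
      also have "\<dots> \<le> 250000 * D * (real (Suc n))\<^sup>2" using D0 by simp
      finally show ?thesis .
    qed
    from this[of 1] this[of \<i>] have "\<bar>lap (h2 n) x\<bar> \<le> 500000 * D * (real (Suc n))\<^sup>2" by (simp add: lap_def)
    then show ?thesis using True by (simp add: E_def)
  next
    case False
    then have "x \<notin> cball e (2 / Suc n)" .
    moreover have "g y * bump e (Suc n) y = 0" if "y \<notin> cball e (2 / Suc n)" for y
      using that bump_bounds(3)[of "Suc n" y e] by (simp add: dist_norm norm_minus_commute)
    ultimately have "h2 n 1 x = 0" "h2 n \<i> x = 0"
      using C2_with_support(2)[OF h closed_cball, of e "2 / Suc n" n x] by blast+
    then show ?thesis using False by (simp add: lap_def)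
  qed
  have i: "integrable lborel (\<lambda>x. u x * lap (h2 n) x)" "integrable lborel (lap (h2 n))" "integral\<^sup>L lborel (lap (h2 n)) = 0" for n
  proof -
    have c: "continuous_on UNIV (\<lambda>x. u x * lap (h2 n) x)"
      by (intro continuous_intros u C2_with_continuous_lap[OF h])
    show "integrable lborel (\<lambda>x. u x * lap (h2 n) x)"
    proof (rule integrable_compact_support[OF c compact_cball])
      fix x assume "x \<notin> cball e (2 / Suc n)"
      then show "u x * lap (h2 n) x = 0" using h2b[of n x] by simp
    qed
    show "integrable lborel (lap (h2 n))" "integral\<^sup>L lborel (lap (h2 n)) = 0"
      using integral_lap_eq_0[OF h K(1)] K(2) by auto
  qed
  have "(\<lambda>n. integral\<^sup>L lborel (\<lambda>x. u x * lap (h2 n) x)) \<longlonglongrightarrow> 0"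
  proof (rule LIMSEQ_I)
    fix r :: real assume r: "r > 0"
    \<comment> \<open>The area of the disc of radius \<open>2 / Suc n\<close> cancels the square in
      the bound on the Laplacian and leaves \<open>\<epsilon> * E * pi * 4\<close>. The final factor
      2 makes the estimate strict.\<close>
    define \<epsilon> where "\<epsilon> = r / (E * pi * 4) / 2"
    have \<epsilon>: "\<epsilon> > 0" "E > 0" using r D0 by (auto simp: \<epsilon>_def E_def)
    have "isCont u e" using u by (simp add: continuous_on_eq_continuous_at)
    then obtain \<delta> where \<delta>: "\<delta> > 0" "\<And>x. dist x e < \<delta> \<Longrightarrow> dist (u x) (u e) < \<epsilon>"
      using \<epsilon>(1) by (auto simp: continuous_at)  (metis continuous_at continuous_at_eps_delta dist_norm)
    obtain N where N: "2 / \<delta> < real N" using reals_Archimedean2 by blast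
    show "\<exists>N. \<forall>n\<ge>N. norm (integral\<^sup>L lborel (\<lambda>x. u x * lap (h2 n) x) - 0) < r"
    proof (intro exI allI impI)
      fix n assume n: "n \<ge> N"
      have "2 / \<delta> < real (Suc n)" using N n by linarith
      then have sm: "2 / real (Suc n) < \<delta>" using \<delta>(1) by (simp add: field_simps)
      \<comment> \<open>Replacing \<open>u\<close> by \<open>u - u e\<close> is free because
        \<open>lap (h2 n)\<close> has integral 0. Now only the oscillation of \<open>u\<close> near
        \<open>e\<close> enters.\<close>
      have "integral\<^sup>L lborel (\<lambda>x. u x * lap (h2 n) x) = integral\<^sup>L lborel (\<lambda>x. u x * lap (h2 n) x - u e * lap (h2 n) x)"
        using i[of n] by simp
      also have "\<bar>\<dots>\<bar> \<le> (\<epsilon> * (E * (real (Suc n))\<^sup>2)) * pi * (2 / Suc n)\<^sup>2"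
      proof (rule abs_integral_le_disc)
        show "integrable lborel (\<lambda>x. u x * lap (h2 n) x - u e * lap (h2 n) x)" using i[of n] by auto
        fix x
        show "\<bar>u x * lap (h2 n) x - u e * lap (h2 n) x\<bar> \<le> \<epsilon> * (E * (real (Suc n))\<^sup>2) * indicator (cball e (2 / Suc n)) x"
        proof (cases "x \<in> cball e (2 / Suc n)")
          case True
          then have "\<bar>u x - u e\<bar> \<le> \<epsilon>" using \<delta>(2)[of x] sm by (simp add: dist_norm norm_minus_commute)
          moreover have "\<bar>lap (h2 n) x\<bar> \<le> E * (real (Suc n))\<^sup>2" using h2b[of n x] True by simp
          ultimately have "\<bar>u x - u e\<bar> * \<bar>lap (h2 n) x\<bar> \<le> \<epsilon> * (E * (real (Suc n))\<^sup>2)" using \<epsilon> by (intro mult_mono) auto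
          then show ?thesis using True by (simp add: abs_mult[symmetric] left_diff_distrib)
        next
          case False then show ?thesis using h2b[of n x] by simp
        qed
      qed auto
      also have "\<dots> = \<epsilon> * (E * pi * 4)" by (simp add: power_divide)
      also have "\<dots> < r" using r \<epsilon> by (simp add: \<epsilon>_def)
      finally show "norm (integral\<^sup>L lborel (\<lambda>x. u x * lap (h2 n) x) - 0) < r" by simp
    qed
  qed
  then show ?thesis using h i(1) by blast
qed

text \<open>Induction on the singular points in the support of \<open>g\<close>. Removing a
  shrinking bump at \<open>e\<close> gives test functions whose support avoids \<open>e\<close>, and
  the removed part contributes nothing in the limit. Nonnegativity of the Laplacian makes the
  passage to the limit monotone, which also yields integrability.\<close>

lemma integral_lap_isolated_singularities:
  fixes u :: "complex \<Rightarrow> real"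
  assumes u: "continuous_on UNIV u" and E: "closed E" and uE: "C2_with (- E) u u1 u2"
    and pos: "\<And>x. x \<notin> E \<Longrightarrow> lap u2 x \<ge> 0"
    and A: "finite A"
  shows "C2_with UNIV g g1 g2 \<Longrightarrow> (\<And>x. g x \<ge> 0) \<Longrightarrow> compact K \<Longrightarrow> (\<And>x. x \<notin> K \<Longrightarrow> g x = 0) \<Longrightarrow> K \<inter> E \<subseteq> A \<Longrightarrow>
    integrable lborel (\<lambda>x. indicator (- E) x * (g x * lap u2 x)) \<and>
    integral\<^sup>L lborel (\<lambda>x. indicator (- E) x * (g x * lap u2 x)) = integral\<^sup>L lborel (\<lambda>x. u x * lap g2 x)"
  using A
proof (induction A arbitrary: g g1 g2 K rule: finite_induct)
  case empty
  have "(\<lambda>x. indicator (- E) x * (g x * lap u2 x)) = (\<lambda>x. g x * lap u2 x)"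
    using empty.prems(4,5) by (auto simp: fun_eq_iff indicator_def)
  moreover have "K \<subseteq> - E" using empty.prems(5) by auto
  ultimately show ?case
    using green_C2_with[OF open_Compl[OF E] uE empty.prems(1,3) _ empty.prems(4)] by simp
next
  case (insert e A)
  note g = insert.prems(1) and g0 = insert.prems(2) and K = insert.prems(3,4)
  obtain h2 where h: "\<And>n. \<exists>h1. C2_with UNIV (\<lambda>x. g x * bump e (Suc n) x) h1 (h2 n)"
    "\<And>n. integrable lborel (\<lambda>x. u x * lap (h2 n) x)"
    "(\<lambda>n. integral\<^sup>L lborel (\<lambda>x. u x * lap (h2 n) x)) \<longlonglongrightarrow> 0"
    using bump_integral_tendsto_0[OF u g K, of e] by blast
  \<comment> \<open>This function vanishes on a disc around \<open>e\<close>, so its support meets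
    \<open>E\<close> in the smaller set \<open>A\<close> and the induction hypothesis
    applies.\<close>
  define k where "k n = (\<lambda>x. g x - g x * bump e (Suc n) x)" for n
  define k2 where "k2 n = (\<lambda>v x. g2 v x - h2 n v x)" for n
  have kC: "\<exists>k1. C2_with UNIV (k n) k1 (k2 n)" for n
    unfolding k_def k2_def using h(1)[of n] C2_with_diff[OF g] by blast
  have k: "integrable lborel (\<lambda>x. indicator (- E) x * (k n x * lap u2 x)) \<and>
    integral\<^sup>L lborel (\<lambda>x. indicator (- E) x * (k n x * lap u2 x)) = integral\<^sup>L lborel (\<lambda>x. u x * lap (k2 n) x)" for n
  proof -
    obtain k1 where k1: "C2_with UNIV (k n) k1 (k2 n)" using kC by blast
    show ?thesis
    proof (rule insert.IH[OF k1])
      show "k n x \<ge> 0" for x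
        using mult_left_le[of "bump e (Suc n) x" "g x"] g0[of x] bump_bounds(2)[of "Suc n" e x] by (simp add: k_def)
      show "compact (K - ball e (1 / Suc n))" by (intro compact_diff K open_ball)
      show "k n x = 0" if "x \<notin> K - ball e (1 / Suc n)" for x
        using that K(2)[of x] bump_bounds(4)[of "Suc n" x e] by (auto simp: k_def dist_norm norm_minus_commute)
      show "(K - ball e (1 / Suc n)) \<inter> E \<subseteq> A" using insert.prems(5) by auto
    qed
  qed
  have gi: "integrable lborel (\<lambda>x. u x * lap g2 x)"
    using green_C2_with(2)[OF open_UNIV _ g K(1) _ K(2)]
  proof -
    have "continuous_on UNIV (\<lambda>x. u x * lap g2 x)" by (intro continuous_intros u C2_with_continuous_lap[OF g])
    moreover have "u x * lap g2 x = 0" if "x \<notin> K" for x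
      using C2_with_support(2)[OF g compact_imp_closed[OF K(1)] K(2) that] by (simp add: lap_def)
    ultimately show ?thesis by (intro integrable_compact_support[OF _ K(1)])
  qed
  have lk: "integral\<^sup>L lborel (\<lambda>x. u x * lap (k2 n) x) = integral\<^sup>L lborel (\<lambda>x. u x * lap g2 x) - integral\<^sup>L lborel (\<lambda>x. u x * lap (h2 n) x)" for n
  proof -
    have "(\<lambda>x. u x * lap (k2 n) x) = (\<lambda>x. u x * lap g2 x - u x * lap (h2 n) x)"
      by (auto simp: k2_def lap_def algebra_simps)
    then show ?thesis using gi h(2) by simp
  qed
  have lim: "(\<lambda>n. integral\<^sup>L lborel (\<lambda>x. indicator (- E) x * (k n x * lap u2 x))) \<longlonglongrightarrow> integral\<^sup>L lborel (\<lambda>x. u x * lap g2 x)"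
    using tendsto_diff[OF tendsto_const h(3), of "integral\<^sup>L lborel (\<lambda>x. u x * lap g2 x)"] k lk by simp
  have meas: "(\<lambda>x. indicator (- E) x * (g x * lap u2 x)) \<in> borel_measurable lborel"
    using measurable_indicator_continuous[OF open_Compl[OF E], of "\<lambda>x. g x * lap u2 x"]
      continuous_on_mult[OF continuous_on_subset[OF C2_withD(1)[OF g]] C2_with_continuous_lap[OF uE]] by simp
  have mono: "mono (\<lambda>n. indicator (- E) x * (k n x * lap u2 x))" for x
  proof (rule monoI)
    fix m n :: nat assume "m \<le> n"
    then have "bump e (Suc n) x \<le> bump e (Suc m) x" by (intro bump_bounds(5)) auto
    then have "k m x \<le> k n x" using g0[of x] by (auto simp: k_def intro: mult_left_mono)
    then show "indicator (- E) x * (k m x * lap u2 x) \<le> indicator (- E) x * (k n x * lap u2 x)"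
      using pos[of x] by (auto simp: indicator_def intro: mult_right_mono)
  qed
  have k0: "k n x \<ge> 0" for n x
    using mult_left_le[of "bump e (Suc n) x" "g x"] g0[of x] bump_bounds(2)[of "Suc n" e x] by (simp add: k_def)
  have ptw: "(\<lambda>n. indicator (- E) x * (k n x * lap u2 x)) \<longlonglongrightarrow> indicator (- E) x * (g x * lap u2 x)" if "x \<noteq> e" for x
  proof -
    obtain N where N: "2 / cmod (x - e) < real N" using reals_Archimedean2 by blast
    have "\<forall>\<^sub>F n in sequentially. indicator (- E) x * (k n x * lap u2 x) = indicator (- E) x * (g x * lap u2 x)"
      using eventually_ge_at_top[of N]
    proof eventually_elim
      case (elim n)
      have "2 / real (Suc n) \<le> cmod (x - e)"
      proof -
        have "2 / cmod (x - e) < real (Suc n)" using N elim by linarith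
        then show ?thesis using that by (simp add: field_simps)
      qed
      then show ?case using bump_bounds(3)[of "Suc n" x e] by (simp add: k_def)
    qed
    then show ?thesis by (rule tendsto_eventually)
  qed
  have ae: "AE x in lborel. (\<lambda>n. indicator (- E) x * (k n x * lap u2 x)) \<longlonglongrightarrow> indicator (- E) x * (g x * lap u2 x)"
    using AE_lborel_singleton[of e] ptw by (auto elim: eventually_mono)
  show ?case
    using integral_monotone_convergence_nonneg[OF conjunct1[OF k] _ _ ae lim meas] mono k0 pos
    by (auto simp: indicator_def)
qed

lemma C2_with_log_one_plus_square:
  "C2_with UNIV (\<lambda>x. ln (1 + (cmod x)\<^sup>2)) (\<lambda>v x. inverse (1 + (cmod x)\<^sup>2) * (2 * Re (x * cnj v)))
    (\<lambda>v x. - (inverse (1 + (cmod x)\<^sup>2))\<^sup>2 * (2 * Re (x * cnj v))\<^sup>2 + inverse (1 + (cmod x)\<^sup>2) * 2)"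
proof -
  have p: "1 + (cmod x)\<^sup>2 > 0" for x by (smt (verit) zero_le_power2)
  have "C2_with UNIV (\<lambda>x. ln (1 + 1 * (cmod (x - 0))\<^sup>2))
     (\<lambda>v x. inverse (1 + 1 * (cmod (x - 0))\<^sup>2) * (1 * (2 * Re ((x - 0) * cnj v))))
     (\<lambda>v x. - (inverse (1 + 1 * (cmod (x - 0))\<^sup>2))\<^sup>2 * (1 * (2 * Re ((x - 0) * cnj v)))\<^sup>2 + inverse (1 + 1 * (cmod (x - 0))\<^sup>2) * (2 * 1))"
  proof (rule C2_with_compose[OF C2_with_cmod_square, where r = "\<lambda>t. ln (1 + t)" and r' = "\<lambda>t. inverse (1 + t)" and r'' = "\<lambda>t. - (inverse (1 + t))\<^sup>2"])
    fix x :: complex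
    show "((\<lambda>t. ln (1 + t)) has_real_derivative inverse (1 + 1 * (cmod (x - 0))\<^sup>2)) (at (1 * (cmod (x - 0))\<^sup>2))"
      using p[of x] by (auto intro!: derivative_eq_intros simp: divide_inverse)
    show "((\<lambda>t. inverse (1 + t)) has_real_derivative - (inverse (1 + 1 * (cmod (x - 0))\<^sup>2))\<^sup>2) (at (1 * (cmod (x - 0))\<^sup>2))"
      using p[of x] by (auto intro!: derivative_eq_intros simp: power2_eq_square)
    show "continuous_on (range (\<lambda>x. 1 * (cmod (x - 0))\<^sup>2)) (\<lambda>t. - (inverse (1 + t))\<^sup>2)"
      using p by (auto intro!: continuous_intros simp: less_imp_neq[OF p, symmetric])
  qed
  then show ?thesis by simp
qed

lemma lap_log_one_plus_square:
  "- (inverse (1 + (cmod x)\<^sup>2))\<^sup>2 * (2 * Re (x * cnj 1))\<^sup>2 + inverse (1 + (cmod x)\<^sup>2) * 2 +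
   (- (inverse (1 + (cmod x)\<^sup>2))\<^sup>2 * (2 * Re (x * cnj \<i>))\<^sup>2 + inverse (1 + (cmod x)\<^sup>2) * 2) = 4 / (1 + (cmod x)\<^sup>2)\<^sup>2"
proof -
  define s where "s = 1 + (cmod x)\<^sup>2"
  have s: "s \<noteq> 0" "(Re x)\<^sup>2 + (Im x)\<^sup>2 = s - 1" unfolding s_def by (auto simp: cmod_power2) (smt (verit) zero_le_power2)
  have "- (inverse s)\<^sup>2 * (2 * Re x)\<^sup>2 + inverse s * 2 + (- (inverse s)\<^sup>2 * (2 * Im x)\<^sup>2 + inverse s * 2)
     = - 4 * (inverse s)\<^sup>2 * ((Re x)\<^sup>2 + (Im x)\<^sup>2) + 4 * inverse s" by (simp add: power2_eq_square algebra_simps)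
  also have "\<dots> = 4 / s\<^sup>2" unfolding s(2) using s(1) by (simp add: field_simps power2_eq_square)
  finally show ?thesis by (simp add: s_def)
qed

text \<open>Compare \<open>u\<close> with \<open>N * ln (1 + cmod x ^ 2)\<close>, whose Laplacian is known, by integrating both against
  cutoffs of radius \<open>n\<close>.\<close>

theorem nn_integral_lap_logarithmic_growth:
  fixes u :: "complex \<Rightarrow> real"
  assumes u: "continuous_on UNIV u" and E: "closed E" "\<And>R. finite (E \<inter> cball 0 R)" and uE: "C2_with (- E) u u1 u2"
    and pos: "\<And>x. x \<notin> E \<Longrightarrow> lap u2 x \<ge> 0"
    and lim: "((\<lambda>x. u x - N * ln (1 + (cmod x)\<^sup>2)) \<longlongrightarrow> c) at_infinity" and N: "N \<ge> 0"
  shows "(\<integral>\<^sup>+x\<in>- E. ennreal (lap u2 x) \<partial>lborel) = ennreal (4 * pi * N)"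
proof -
  \<comment> \<open>The deviation from the model is continuous and tends to 0 at infinity, hence is
    bounded. Only these facts about it enter.\<close>
  define w where "w x = u x - N * ln (1 + (cmod x)\<^sup>2) - c" for x
  define l1 where "l1 = (\<lambda>v x. inverse (1 + (cmod x)\<^sup>2) * (2 * Re (x * cnj v)))"
  define l2 where "l2 = (\<lambda>v x. - (inverse (1 + (cmod x)\<^sup>2))\<^sup>2 * (2 * Re (x * cnj v))\<^sup>2 + inverse (1 + (cmod x)\<^sup>2) * 2)"
  have l: "C2_with UNIV (\<lambda>x. ln (1 + (cmod x)\<^sup>2)) l1 l2" unfolding l1_def l2_def by (rule C2_with_log_one_plus_square)
  have ll: "lap l2 x = 4 / (1 + (cmod x)\<^sup>2)\<^sup>2" for x using lap_log_one_plus_square[of x] by (simp add: lap_def l2_def)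
  have cw: "continuous_on UNIV w" unfolding w_def by (intro continuous_intros u C2_withD(1)[OF l])
  \<comment> \<open>Cutoffs of radius \<open>Suc n\<close>: their Laplacians are of size
    \<open>60 / (Suc n)^2\<close> on a disc of area \<open>pi * (Suc n)^2\<close>, so they are
    bounded in mean uniformly in \<open>n\<close>.\<close>
  define q where "q n = (\<lambda>x. 1 - (1 / (real (Suc n))\<^sup>2) * (cmod (x - 0))\<^sup>2)" for n
  define q1 where "q1 n = (\<lambda>v x. 0 - (1 / (real (Suc n))\<^sup>2) * (2 * Re ((x - 0) * cnj v)))" for n
  define q2 where "q2 n = (\<lambda>(v::complex) (x::complex). 0 - 2 * (1 / (real (Suc n))\<^sup>2))" for n
  have c: "C2_with UNIV (\<lambda>_. 1) (\<lambda>_ _. 0) (\<lambda>_ _. 0)" by (auto simp: C2_with_def)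
  have q: "C2_with UNIV (q n) (q1 n) (q2 n)" for n unfolding q_def q1_def q2_def
    by (rule C2_with_diff[OF c C2_with_cmod_square])
  define p where "p n = (\<lambda>x. cutoff (q n x))" for n
  define p1 where "p1 n = (\<lambda>v x. 3 * (max (q n x) 0)\<^sup>2 * q1 n v x)" for n
  define p2 where "p2 n = (\<lambda>v x. 6 * max (q n x) 0 * (q1 n v x)\<^sup>2 + 3 * (max (q n x) 0)\<^sup>2 * q2 n v x)" for n
  have p: "C2_with UNIV (p n) (p1 n) (p2 n)" for n unfolding p_def p1_def p2_def by (rule C2_with_cutoff[OF q])
  have psup: "p n x = 0" if "x \<notin> cball 0 (Suc n)" for n x
  proof -
    have "real (Suc n) \<le> cmod x" using that by simp
    then have "(real (Suc n))\<^sup>2 \<le> (cmod x)\<^sup>2" by (intro power_mono) auto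
    then have "q n x \<le> 0" by (simp add: q_def)
    then show ?thesis by (simp add: p_def cutoff_bounds)
  qed
  have p01: "0 \<le> p n x" "p n x \<le> 1" for n x by (auto simp: p_def q_def intro!: cutoff_bounds)
  have p2b: "\<bar>lap (p2 n) x\<bar> \<le> 60 / (real (Suc n))\<^sup>2 * indicator (cball 0 (Suc n)) x" for n x
  proof (cases "x \<in> cball 0 (Suc n)")
    case True
    have m: "max (q n x) 0 \<le> 1" "0 \<le> max (q n x) 0" by (auto simp: q_def)
    then have m2: "(max (q n x) 0)\<^sup>2 \<le> 1" by (intro power_le_one)
    define R where "R = real (Suc n)"
    have R: "R > 0" by (simp add: R_def)
    have "\<bar>p2 n v x\<bar> \<le> 30 / R\<^sup>2" if v: "v \<in> {1, \<i>}" for v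
    proof -
      have "\<bar>Re (x * cnj v)\<bar> \<le> R"
        using abs_Re_le_cmod[of "x * cnj v"] v True by (auto simp: norm_mult R_def)
      then have "\<bar>q1 n v x\<bar> \<le> 2 / R"
      proof -
        assume *: "\<bar>Re (x * cnj v)\<bar> \<le> R"
        have "\<bar>q1 n v x\<bar> = 2 * \<bar>Re (x * cnj v)\<bar> / R\<^sup>2"
          unfolding q1_def R_def by (simp only: abs_minus_cancel diff_0 abs_mult diff_0_right) simp
        also have "\<dots> \<le> 2 * R / R\<^sup>2" using * R by (intro divide_right_mono mult_left_mono) auto
        also have "\<dots> = 2 / R" using R by (simp add: power2_eq_square)
        finally show ?thesis .
      qed
      then have q12: "(q1 n v x)\<^sup>2 \<le> 4 / R\<^sup>2" using power_mono[of "\<bar>q1 n v x\<bar>" "2 / R" 2] by (simp add: power_divide)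
      have "\<bar>p2 n v x\<bar> \<le> 6 * (max (q n x) 0 * (q1 n v x)\<^sup>2) + 3 * ((max (q n x) 0)\<^sup>2 * \<bar>q2 n v x\<bar>)"
        unfolding p2_def by (rule order_trans[OF abs_triangle_ineq]) (use m in \<open>simp add: abs_mult\<close>)
      also have "\<dots> \<le> 6 * (1 * (4 / R\<^sup>2)) + 3 * (1 * (2 / R\<^sup>2))"
        using m m2 q12 by (intro add_mono mult_left_mono mult_mono) (auto simp: q2_def R_def)
      finally show ?thesis by simp
    qed
    from this[of 1] this[of \<i>] have "\<bar>lap (p2 n) x\<bar> \<le> 60 / R\<^sup>2" by (simp add: lap_def)
    then show ?thesis using True by (simp add: R_def)
  next
    case False
    then show ?thesis using C2_with_support(2)[OF p closed_cball psup False] by (simp add: lap_def)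
  qed
  obtain W where W: "W > 0" "\<And>x. \<bar>w x\<bar> \<le> W"
  proof -
    have "\<forall>\<^sub>F x in at_infinity. \<bar>w x\<bar> < 1"
      using tendstoD[OF lim, of 1] by (simp add: w_def dist_real_def)
    then obtain b where b: "\<And>x. cmod x \<ge> b \<Longrightarrow> \<bar>w x\<bar> < 1" by (auto simp: eventually_at_infinity)
    have "compact (w ` cball 0 b)" by (intro compact_continuous_image compact_cball continuous_on_subset[OF cw]) auto
    then obtain B where B: "B > 0" "\<And>x. x \<in> cball 0 b \<Longrightarrow> \<bar>w x\<bar> \<le> B"
      using compact_imp_bounded bounded_pos by (metis imageI real_norm_def)
    show ?thesis
    proof (rule that[of "max B 1"])
      fix x show "\<bar>w x\<bar> \<le> max B 1" using b[of x] B(2)[of x] by (cases "cmod x \<le> b") auto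
    qed auto
  qed
  have iw: "integrable lborel (\<lambda>x. f x * lap (p2 n) x)" if "continuous_on UNIV f" for f n
  proof (rule integrable_compact_support[of _ "cball 0 (real (Suc n))"])
    show "continuous_on UNIV (\<lambda>x. f x * lap (p2 n) x)" by (intro continuous_intros that C2_with_continuous_lap[OF p])
    show "f x * lap (p2 n) x = 0" if "x \<notin> cball 0 (real (Suc n))" for x using p2b[of n x] that by simp
  qed auto
  have w0: "(\<lambda>n. integral\<^sup>L lborel (\<lambda>x. w x * lap (p2 n) x)) \<longlonglongrightarrow> 0"
  proof (rule LIMSEQ_I)
    fix r :: real assume r: "r > 0"
    define \<epsilon> where "\<epsilon> = r / (60 * pi) / 4"
    have \<epsilon>: "\<epsilon> > 0" using r by (simp add: \<epsilon>_def)
    have "\<forall>\<^sub>F x in at_infinity. \<bar>w x\<bar> < \<epsilon>"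
      using tendstoD[OF lim \<epsilon>] by (simp add: w_def dist_real_def)
    then obtain b where b: "\<And>x. cmod x \<ge> b \<Longrightarrow> \<bar>w x\<bar> < \<epsilon>" by (auto simp: eventually_at_infinity)
    define \<beta> where "\<beta> = max b 1"
    have \<beta>: "\<beta> > 0" "\<And>x. cmod x \<ge> \<beta> \<Longrightarrow> \<bar>w x\<bar> < \<epsilon>" using b by (auto simp: \<beta>_def)
    have "(\<lambda>n. W * 60 * pi * \<beta>\<^sup>2 * (inverse (real (Suc n)))\<^sup>2) \<longlonglongrightarrow> W * 60 * pi * \<beta>\<^sup>2 * 0\<^sup>2"
      by (intro tendsto_intros LIMSEQ_inverse_real_of_nat)
    then have "\<forall>\<^sub>F n in sequentially. W * 60 * pi * \<beta>\<^sup>2 * (inverse (real (Suc n)))\<^sup>2 < r / 2"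
      by (rule order_tendstoD(2)) (use r in simp)
    then obtain n0 where n0: "\<And>n. n \<ge> n0 \<Longrightarrow> W * 60 * pi * \<beta>\<^sup>2 * (inverse (real (Suc n)))\<^sup>2 < r / 2"
      by (auto simp: eventually_sequentially)
    show "\<exists>n0. \<forall>n\<ge>n0. norm (integral\<^sup>L lborel (\<lambda>x. w x * lap (p2 n) x) - 0) < r"
    proof (intro exI allI impI)
      fix n assume n: "n \<ge> n0"
      define R where "R = real (Suc n)"
      have R: "R > 0" by (simp add: R_def)
      \<comment> \<open>Inside the fixed disc of radius \<open>\<beta>\<close> the bounded
        \<open>w\<close> meets a Laplacian of size \<open>1 / R^2\<close>. Outside it
        \<open>w\<close> is below \<open>\<epsilon>\<close>, against a Laplacian bounded in
        mean.\<close>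
      define f1 where "f1 = (\<lambda>x. indicator (cball 0 \<beta>) x * (w x * lap (p2 n) x))"
      define f2 where "f2 = (\<lambda>x. indicator (- cball 0 \<beta>) x * (w x * lap (p2 n) x))"
      have if1: "integrable lborel f1" "integrable lborel f2" unfolding f1_def f2_def
        using integrable_real_mult_indicator[OF _ iw[OF cw, of n]] by (simp_all add: mult.commute)
      have "integral\<^sup>L lborel (\<lambda>x. w x * lap (p2 n) x) = integral\<^sup>L lborel (\<lambda>x. f1 x + f2 x)"
        by (intro Bochner_Integration.integral_cong) (auto simp: f1_def f2_def indicator_def)
      also have "\<dots> = integral\<^sup>L lborel f1 + integral\<^sup>L lborel f2" using if1 by simp
      finally have e: "integral\<^sup>L lborel (\<lambda>x. w x * lap (p2 n) x) = integral\<^sup>L lborel f1 + integral\<^sup>L lborel f2" .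
      have lb: "\<bar>lap (p2 n) x\<bar> \<le> 60 / R\<^sup>2" for x
        using p2b[of n x] by (cases "x \<in> cball 0 (real (Suc n))") (auto simp: R_def)
      have "\<bar>integral\<^sup>L lborel f1\<bar> \<le> (W * (60 / R\<^sup>2)) * pi * \<beta>\<^sup>2"
      proof (rule abs_integral_le_disc[OF if1(1), of _ 0])
        fix x show "\<bar>f1 x\<bar> \<le> W * (60 / R\<^sup>2) * indicator (cball 0 \<beta>) x"
          using mult_mono[OF W(2)[of x] lb[of x]] W(1) by (auto simp: f1_def abs_mult indicator_def)
      qed (use \<beta> in auto)
      also have "\<dots> = W * 60 * pi * \<beta>\<^sup>2 * (inverse R)\<^sup>2" by (simp add: field_simps)
      also have "\<dots> < r / 2" using n0[OF n] by (simp add: R_def)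
      finally have 1: "\<bar>integral\<^sup>L lborel f1\<bar> < r / 2" .
      have "\<bar>integral\<^sup>L lborel f2\<bar> \<le> (\<epsilon> * (60 / R\<^sup>2)) * pi * R\<^sup>2"
      proof (rule abs_integral_le_disc[OF if1(2), of _ 0])
        fix x show "\<bar>f2 x\<bar> \<le> \<epsilon> * (60 / R\<^sup>2) * indicator (cball 0 R) x"
        proof (cases "x \<in> cball 0 R \<and> x \<notin> cball 0 \<beta>")
          case True
          then show ?thesis using mult_mono[OF less_imp_le[OF \<beta>(2)[of x]] lb[of x]] \<epsilon> by (auto simp: f2_def abs_mult)
        next
          case False
          then show ?thesis using p2b[of n x] \<epsilon> by (auto simp: f2_def R_def indicator_def)
        qed
      qed (use R in auto)
      also have "\<dots> = r / 4" using R by (simp add: \<epsilon>_def)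
      also have "\<dots> < r / 2" using r by simp
      finally have 2: "\<bar>integral\<^sup>L lborel f2\<bar> < r / 2" .
      show "norm (integral\<^sup>L lborel (\<lambda>x. w x * lap (p2 n) x) - 0) < r" using 1 2 e by simp
    qed
  qed
  have pmono: "mono (\<lambda>n. p n x)" for x
  proof (rule monoI)
    fix m n :: nat assume "m \<le> n"
    then have "1 / (real (Suc n))\<^sup>2 \<le> 1 / (real (Suc m))\<^sup>2" by (intro divide_left_mono power_mono) auto
    then show "p m x \<le> p n x" unfolding p_def q_def by (intro cutoff_bounds diff_mono mult_right_mono) auto
  qed
  have plim: "(\<lambda>n. p n x) \<longlonglongrightarrow> 1" for x
  proof -
    have "(\<lambda>n. q n x) \<longlonglongrightarrow> 1 - 0\<^sup>2 * (cmod (x - 0))\<^sup>2" unfolding q_def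
      using LIMSEQ_inverse_real_of_nat by (intro tendsto_intros) (simp add: inverse_eq_divide power_one_over[symmetric])
    moreover have "isCont cutoff (1 - 0\<^sup>2 * (cmod (x - 0))\<^sup>2)" using cutoff_deriv DERIV_isCont by blast
    ultimately have "(\<lambda>n. cutoff (q n x)) \<longlonglongrightarrow> cutoff (1 - 0\<^sup>2 * (cmod (x - 0))\<^sup>2)" by (rule isCont_tendsto_compose[rotated])
    then show ?thesis by (simp add: p_def cutoff_bounds)
  qed
  \<comment> \<open>The cutoffs increase to 1, so monotone convergence recovers a full integral from
    the limit of the truncated ones.\<close>
  have sup: "(\<integral>\<^sup>+x. ennreal (f x) \<partial>lborel) = ennreal L"
    if f: "f \<in> borel_measurable lborel" "\<And>x. f x \<ge> 0" "\<And>n. integrable lborel (\<lambda>x. f x * p n x)"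
      "(\<lambda>n. integral\<^sup>L lborel (\<lambda>x. f x * p n x)) \<longlonglongrightarrow> L" for f L
  proof -
    note m = integral_monotone_convergence_nonneg[OF f(3) _ _ _ f(4,1)]
    have 1: "AE x in lborel. mono (\<lambda>n. f x * p n x)"
      using f(2) pmono by (intro AE_I2 monoI mult_left_mono) (auto dest: monoD)
    have 2: "AE x in lborel. 0 \<le> f x * p i x" for i using f(2) p01 by auto
    have 3: "AE x in lborel. (\<lambda>i. f x * p i x) \<longlonglongrightarrow> f x"
      using tendsto_mult[OF tendsto_const plim] by (intro AE_I2) (metis mult.right_neutral)
    have "integrable lborel f" "integral\<^sup>L lborel f = L" using m[OF 1 2 3] by auto
    then show ?thesis using nn_integral_eq_integral[of lborel f] f(2) by simp
  qed
  have spl: "(\<lambda>n. integral\<^sup>L lborel (\<lambda>x. 4 / (1 + (cmod x)\<^sup>2)\<^sup>2 * p n x)) \<longlonglongrightarrow> 4 * pi"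
  proof -
    have m: "(\<lambda>x. 4 / (1 + (cmod x)\<^sup>2)\<^sup>2) \<in> borel_measurable lborel" by measurable
    have i: "integrable lborel (\<lambda>x. 4 / (1 + (cmod x)\<^sup>2)\<^sup>2)" "integral\<^sup>L lborel (\<lambda>x. 4 / (1 + (cmod x)\<^sup>2)\<^sup>2) = 4 * pi"
      using nn_integral_eq_integrable[of "\<lambda>x. 4 / (1 + (cmod x)\<^sup>2)\<^sup>2" lborel "4 * pi", OF m] nn_integral_spherical_density by auto
    have "(\<lambda>n. integral\<^sup>L lborel (\<lambda>x. 4 / (1 + (cmod x)\<^sup>2)\<^sup>2 * p n x)) \<longlonglongrightarrow> integral\<^sup>L lborel (\<lambda>x. 4 / (1 + (cmod x)\<^sup>2)\<^sup>2)"
    proof (rule integral_dominated_convergence[OF m _ i(1)])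
      show "(\<lambda>x. 4 / (1 + (cmod x)\<^sup>2)\<^sup>2 * p n x) \<in> borel_measurable lborel" for n
        using borel_measurable_continuous_onI[OF C2_withD(1)[OF p[of n]]] by measurable
      show "AE x in lborel. (\<lambda>n. 4 / (1 + (cmod x)\<^sup>2)\<^sup>2 * p n x) \<longlonglongrightarrow> 4 / (1 + (cmod x)\<^sup>2)\<^sup>2"
        using tendsto_mult[OF tendsto_const plim] by (intro AE_I2) (metis mult.right_neutral)
      show "AE x in lborel. norm (4 / (1 + (cmod x)\<^sup>2)\<^sup>2 * p n x) \<le> 4 / (1 + (cmod x)\<^sup>2)\<^sup>2" for n
        using p01 by (intro AE_I2) (simp add: abs_mult mult_left_le divide_right_mono)
    qed
    then show ?thesis using i(2) by simp
  qed
  \<comment> \<open>Decompose \<open>u\<close> into \<open>w\<close>, the model and the constant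
    \<open>c\<close>. The constant drops out, and Green's identity moves the Laplacian from the
    cutoff to the model.\<close>
  have main: "integrable lborel (\<lambda>x. indicator (- E) x * lap u2 x * p n x) \<and>
     integral\<^sup>L lborel (\<lambda>x. indicator (- E) x * lap u2 x * p n x)
      = integral\<^sup>L lborel (\<lambda>x. w x * lap (p2 n) x) + N * integral\<^sup>L lborel (\<lambda>x. 4 / (1 + (cmod x)\<^sup>2)\<^sup>2 * p n x)" for n
  proof -
    have 1: "integrable lborel (\<lambda>x. indicator (- E) x * (p n x * lap u2 x)) \<and>
      integral\<^sup>L lborel (\<lambda>x. indicator (- E) x * (p n x * lap u2 x)) = integral\<^sup>L lborel (\<lambda>x. u x * lap (p2 n) x)"
      by (rule integral_lap_isolated_singularities[OF u E(1) uE pos E(2)[of "Suc n"] p p01(1) compact_cball psup]) auto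
    have 2: "integral\<^sup>L lborel (\<lambda>x. p n x * lap l2 x) = integral\<^sup>L lborel (\<lambda>x. ln (1 + (cmod x)\<^sup>2) * lap (p2 n) x)"
      by (rule green_C2_with[OF open_UNIV l p compact_cball subset_UNIV psup])
    have 3: "integral\<^sup>L lborel (lap (p2 n)) = 0" "integrable lborel (lap (p2 n))"
      by (rule integral_lap_eq_0[OF p compact_cball psup], assumption)+
    have "integral\<^sup>L lborel (\<lambda>x. u x * lap (p2 n) x) =
      integral\<^sup>L lborel (\<lambda>x. w x * lap (p2 n) x + (N * (ln (1 + (cmod x)\<^sup>2) * lap (p2 n) x) + c * lap (p2 n) x))"
      by (intro Bochner_Integration.integral_cong refl) (simp add: w_def algebra_simps)
    also have "\<dots> = integral\<^sup>L lborel (\<lambda>x. w x * lap (p2 n) x) + N * integral\<^sup>L lborel (\<lambda>x. ln (1 + (cmod x)\<^sup>2) * lap (p2 n) x)"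
      using iw[OF cw] iw[OF C2_withD(1)[OF l]] 3 by simp
    finally show ?thesis using 1 2 by (simp add: ll mult_ac)
  qed
  have "(\<integral>\<^sup>+x. ennreal (indicator (- E) x * lap u2 x) \<partial>lborel) = ennreal (0 + N * (4 * pi))"
  proof (rule sup)
    show "(\<lambda>x. indicator (- E) x * lap u2 x) \<in> borel_measurable lborel"
      using measurable_indicator_continuous[OF open_Compl[OF E(1)] C2_with_continuous_lap[OF uE]] by simp
    show "(\<lambda>n. integral\<^sup>L lborel (\<lambda>x. indicator (- E) x * lap u2 x * p n x)) \<longlonglongrightarrow> 0 + N * (4 * pi)"
      using main tendsto_add[OF w0 tendsto_mult[OF tendsto_const spl, of N]] by simp
  qed (use main pos in \<open>auto simp: indicator_def\<close>)
  moreover have "(\<lambda>x. ennreal (indicator (- E) x * lap u2 x)) = (\<lambda>x. ennreal (lap u2 x) * indicator (- E) x)"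
    by (auto simp: indicator_def)
  ultimately show ?thesis by (simp add: mult_ac)
qed

section \<open>Roots of polynomials and ternary forms\<close>

lemma simultaneous_convergent_subsequence:
  fixes r :: "nat \<Rightarrow> nat \<Rightarrow> complex"
  assumes "\<And>n j. j < d \<Longrightarrow> cmod (r n j) \<le> B"
  shows "\<exists>k l. strict_mono (k :: nat \<Rightarrow> nat) \<and> (\<forall>j<d. (\<lambda>n. r (k n) j) \<longlonglongrightarrow> l j)"
  using assms
proof (induction d)
  case 0
  then show ?case by (intro exI[of _ id]) (auto simp: strict_mono_def)
next
  case (Suc d)
  then obtain k l where k: "strict_mono k" "\<And>j. j < d \<Longrightarrow> (\<lambda>n. r (k n) j) \<longlonglongrightarrow> l j" by (metis less_SucI)
  have "bounded (range (\<lambda>n. r (k n) d))" using Suc.prems[of d] by (auto simp: bounded_iff)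
  then obtain l' k' where k': "strict_mono k'" "((\<lambda>n. r (k n) d) \<circ> k') \<longlonglongrightarrow> l'"
    using bounded_imp_convergent_subsequence by blast
  have "(\<lambda>n. r ((k \<circ> k') n) j) \<longlonglongrightarrow> (l(d := l')) j" if "j < Suc d" for j
  proof (cases "j = d")
    case True then show ?thesis using k'(2) by (simp add: o_def)
  next
    case False
    then show ?thesis using LIMSEQ_subseq_LIMSEQ[OF k(2) k'(1), of j] that by (simp add: o_def)
  qed
  then show ?case using strict_mono_o[OF k(1) k'(1)] by blast
qed

lemma proots_smult_prod_linear:
  fixes c :: complex
  assumes "c \<noteq> 0"
  shows "proots (smult c (\<Prod>j<d. [:- r j, 1:])) = image_mset r (mset_set {..<(d::nat)})"
proof -
  have "proots (\<Prod>j<d. [:- r j, 1:]) = image_mset r (mset_set {..<d})"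
  proof (induction d)
    case (Suc d)
    have "proots ((\<Prod>j<d. [:- r j, 1:]) * [:- r d, 1:]) = proots (\<Prod>j<d. [:- r j, 1:]) + proots [:- r d, 1:]"
      by (intro proots_mult) (auto simp: prod_zero_iff)
    moreover have "proots [:- r d, 1:] = {#r d#}" by (simp add: proots_linear_factor)
    ultimately show ?case using Suc by (simp add: lessThan_Suc add_ac)
  qed auto
  then show ?thesis using assms by simp
qed

text \<open>By compactness it suffices to see that a limit of root tuples is a root tuple of the limit.\<close>

lemma sum_over_roots_tendsto:
  fixes P :: "nat \<Rightarrow> complex poly" and f :: "nat \<Rightarrow> complex \<Rightarrow> real"
  assumes deg: "\<And>n. degree (P n) = d" "degree Q = d" and lc: "\<And>n. lead_coeff (P n) = c" "lead_coeff Q = c" "c \<noteq> 0"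
    and lim: "\<And>y. (\<lambda>n. poly (P n) y) \<longlonglongrightarrow> poly Q y"
    and bd: "\<And>n y. poly (P n) y = 0 \<Longrightarrow> cmod y \<le> B"
    and f: "\<And>y y' k. strict_mono k \<Longrightarrow> y' \<longlonglongrightarrow> y \<Longrightarrow> poly Q y = 0 \<Longrightarrow> (\<And>n. poly (P (k n)) (y' n) = 0) \<Longrightarrow>
      (\<lambda>n. f (k n) (y' n)) \<longlonglongrightarrow> g y"
  shows "(\<lambda>n. \<Sum>y\<in>#proots (P n). f n y) \<longlonglongrightarrow> (\<Sum>y\<in>#proots Q. g y)"
proof -
  have "\<exists>r. P n = smult c (\<Prod>j<d. [:- r j, 1:])" for n
    using complex_poly_decompose'[of "P n"] deg(1)[of n] lc(1)[of n] by metis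
  then obtain r where r: "\<And>n. P n = smult c (\<Prod>j<d. [:- r n j, 1:])" by metis
  have s: "(\<Sum>y\<in>#proots (P n). f n y) = (\<Sum>j<d. f n (r n j))" for n
    unfolding r proots_smult_prod_linear[OF lc(3)] by (simp add: sum_unfold_sum_mset multiset.map_comp o_def)
  have pr: "poly (P n) y = c * (\<Prod>j<d. y - r n j)" for n y unfolding r by (simp add: poly_prod)
  have root: "poly (P n) (r n j) = 0" if "j < d" for n j using that by (auto simp: pr)
  have rb: "cmod (r n j) \<le> B" if "j < d" for n j using bd[OF root[OF that]] .
  \<comment> \<open>Every subsequence has a further subsequence with the right limit, which
    suffices. Roots can be followed only after such a passage, so the hypothesis on \<open>f\<close>
    speaks about an arbitrary subsequence \<open>k\<close>.\<close>
  have conv: "\<exists>k'. strict_mono k' \<and> (\<lambda>n. \<Sum>y\<in>#proots (P (k (k' n))). f (k (k' n)) y) \<longlonglongrightarrow> (\<Sum>y\<in>#proots Q. g y)"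
    if k: "strict_mono k" for k :: "nat \<Rightarrow> nat"
  proof -
    obtain k' l where k': "strict_mono k'" "\<And>j. j < d \<Longrightarrow> (\<lambda>n. r (k (k' n)) j) \<longlonglongrightarrow> l j"
      using simultaneous_convergent_subsequence[of d "\<lambda>n. r (k n)" B] rb by blast
    have kk: "strict_mono (\<lambda>n. k (k' n))" using strict_mono_o[OF k k'(1)] by (simp add: o_def)
    have "(\<lambda>n. poly (P (k (k' n))) y) \<longlonglongrightarrow> c * (\<Prod>j<d. y - l j)" for y
      unfolding pr by (intro tendsto_intros k'(2)) auto
    moreover have "(\<lambda>n. poly (P (k (k' n))) y) \<longlonglongrightarrow> poly Q y" for y
      using LIMSEQ_subseq_LIMSEQ[OF lim kk] by (simp add: o_def)
    ultimately have "poly Q y = c * (\<Prod>j<d. y - l j)" for y using LIMSEQ_unique by blast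
    then have "poly Q y = poly (smult c (\<Prod>j<d. [:- l j, 1:])) y" for y by (simp add: poly_prod)
    then have Q: "Q = smult c (\<Prod>j<d. [:- l j, 1:])" by (simp add: poly_eq_poly_eq_iff[symmetric] fun_eq_iff)
    have sQ: "(\<Sum>y\<in>#proots Q. g y) = (\<Sum>j<d. g (l j))"
      unfolding Q proots_smult_prod_linear[OF lc(3)] by (simp add: sum_unfold_sum_mset multiset.map_comp o_def)
    have "(\<lambda>n. \<Sum>j<d. f (k (k' n)) (r (k (k' n)) j)) \<longlonglongrightarrow> (\<Sum>j<d. g (l j))"
    proof (intro tendsto_sum f[OF kk])
      fix j assume "j \<in> {..<d}"
      then show "(\<lambda>n. r (k (k' n)) j) \<longlonglongrightarrow> l j" "\<And>n. poly (P (k (k' n))) (r (k (k' n)) j) = 0" using k' root by auto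
      show "poly Q (l j) = 0" unfolding Q using \<open>j \<in> {..<d}\<close> by (auto simp: poly_prod)
    qed
    then show ?thesis using k'(1) unfolding s sQ by blast
  qed
  show ?thesis
  proof (rule ccontr)
    let ?X = "\<lambda>n. \<Sum>y\<in>#proots (P n). f n y" and ?L = "\<Sum>y\<in>#proots Q. g y"
    assume "\<not> ?X \<longlonglongrightarrow> ?L"
    then obtain e where e: "e > 0" "\<And>N. \<exists>n\<ge>N. \<not> dist (?X n) ?L < e"
      by (auto simp: lim_sequentially)
    then have "\<exists>\<^sub>\<infinity>n. \<not> dist (?X n) ?L < e" by (auto simp: INFM_nat_le)
    then have inf: "infinite {n. \<not> dist (?X n) ?L < e}" by (simp add: INFM_iff_infinite)
    define k where "k = enumerate {n. \<not> dist (?X n) ?L < e}"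
    have k: "strict_mono k" "\<And>n. \<not> dist (?X (k n)) ?L < e"
      using strict_mono_enumerate[OF inf] enumerate_in_set[OF inf] by (auto simp: k_def)
    obtain k' where "(\<lambda>n. ?X (k (k' n))) \<longlonglongrightarrow> ?L" using conv[OF k(1)] by blast
    then show False using k(2) e(1) unfolding lim_sequentially by blast
  qed
qed

section \<open>Restriction of a form to a line\<close>

text \<open>Stated for degree bounds rather than degrees, because the linear factors substituted
  into a form may be constant.\<close>

lemma coeff_mult_at_degree_bounds:
  fixes p q :: "'a::comm_semiring_0 poly"
  assumes "degree p \<le> m" "degree q \<le> n"
  shows "coeff (p * q) (m + n) = coeff p m * coeff q n"
proof -
  have "coeff (p * q) (m + n) = (\<Sum>i\<le>m + n. coeff p i * coeff q (m + n - i))" by (rule coeff_mult)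
  also have "\<dots> = (\<Sum>i\<in>{m}. coeff p i * coeff q (m + n - i))"
  proof (rule sum.mono_neutral_right)
    show "\<forall>i\<in>{..m + n} - {m}. coeff p i * coeff q (m + n - i) = 0"
    proof
      fix i assume "i \<in> {..m + n} - {m}"
      then consider "i > m" | "m + n - i > n" by fastforce
      then show "coeff p i * coeff q (m + n - i) = 0"
        using assms by cases (auto simp: coeff_eq_0)
    qed
  qed auto
  finally show ?thesis by simp
qed

lemma linear_power_degree:
  fixes a b :: "'a::comm_semiring_1"
  shows "degree ([:a, b:] ^ n) \<le> n" "coeff ([:a, b:] ^ n) n = b ^ n"
proof -
  show d: "degree ([:a, b:] ^ n) \<le> n" for n
    by (rule order_trans[OF degree_power_le]) (use degree_pCons_le[of a "[:b:]"] in auto)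
  show "coeff ([:a, b:] ^ n) n = b ^ n"
  proof (induction n)
    case (Suc n)
    have "coeff ([:a, b:] * [:a, b:] ^ n) (1 + n) = coeff [:a, b:] 1 * coeff ([:a, b:] ^ n) n"
      by (rule coeff_mult_at_degree_bounds[OF _ d]) (use degree_pCons_le[of a "[:b:]"] in auto)
    then show ?case using Suc by simp
  qed auto
qed

definition form_poly :: "nat \<Rightarrow> (nat \<Rightarrow> nat \<Rightarrow> complex) \<Rightarrow> complex ^ 3 \<Rightarrow> complex ^ 3 \<Rightarrow> complex poly"
  where "form_poly d a u v = (\<Sum>i\<le>d. \<Sum>j\<le>d - i. smult (a i j) ([:u $ 1, v $ 1:] ^ i * [:u $ 2, v $ 2:] ^ j * [:u $ 3, v $ 3:] ^ (d - i - j)))"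

lemma poly_form_poly: "poly (form_poly d a u v) y = ternary_form d a (u + y *s v)"
  by (simp add: form_poly_def ternary_form_def poly_sum mult.assoc)

lemma degree_form_poly_le: "degree (form_poly d a u v) \<le> d"
proof -
  have "degree (smult (a i j) ([:u $ 1, v $ 1:] ^ i * [:u $ 2, v $ 2:] ^ j * [:u $ 3, v $ 3:] ^ (d - i - j))) \<le> d"
    if "i \<le> d" "j \<le> d - i" for i j
  proof -
    have "degree ([:u $ 1, v $ 1:] ^ i * [:u $ 2, v $ 2:] ^ j * [:u $ 3, v $ 3:] ^ (d - i - j)) \<le> i + j + (d - i - j)"
      by (intro order_trans[OF degree_mult_le] add_mono linear_power_degree)
    then show ?thesis using that by (intro order_trans[OF degree_smult_le]) simp
  qed
  then show ?thesis unfolding form_poly_def by (intro degree_sum_le) auto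
qed

text \<open>Each linear factor contributes its slope, which is a coordinate of \<open>v\<close>. If
  the form does not vanish at the direction \<open>v\<close>, the line therefore meets the curve at
  exactly \<open>d\<close> parameters, with multiplicity.\<close>

lemma coeff_form_poly: "coeff (form_poly d a u v) d = ternary_form d a v"
proof -
  have "coeff ([:u $ 1, v $ 1:] ^ i * [:u $ 2, v $ 2:] ^ j * [:u $ 3, v $ 3:] ^ (d - i - j)) d = v $ 1 ^ i * v $ 2 ^ j * v $ 3 ^ (d - i - j)"
    if "i \<le> d" "j \<le> d - i" for i j
  proof -
    have 1: "degree ([:u $ 1, v $ 1:] ^ i * [:u $ 2, v $ 2:] ^ j) \<le> i + j"
      by (intro order_trans[OF degree_mult_le] add_mono linear_power_degree)
    have "coeff ([:u $ 1, v $ 1:] ^ i * [:u $ 2, v $ 2:] ^ j * [:u $ 3, v $ 3:] ^ (d - i - j)) ((i + j) + (d - i - j))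
      = v $ 1 ^ i * v $ 2 ^ j * v $ 3 ^ (d - i - j)"
      by (simp add: coeff_mult_at_degree_bounds[OF 1 linear_power_degree(1)] coeff_mult_at_degree_bounds[OF linear_power_degree(1) linear_power_degree(1)] linear_power_degree(2))
    then show ?thesis using that by simp
  qed
  then show ?thesis by (simp add: form_poly_def ternary_form_def coeff_sum mult.assoc)
qed

lemma form_poly_lead:
  assumes "ternary_form d a v \<noteq> 0"
  shows "degree (form_poly d a u v) = d" "lead_coeff (form_poly d a u v) = ternary_form d a v" "form_poly d a u v \<noteq> 0"
proof -
  show "degree (form_poly d a u v) = d"
    using degree_form_poly_le[of d a u v] le_degree[of "form_poly d a u v" d] assms by (simp add: coeff_form_poly)
  then show "lead_coeff (form_poly d a u v) = ternary_form d a v" by (simp add: coeff_form_poly)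
  then show "form_poly d a u v \<noteq> 0" using assms by auto
qed

lemma ternary_form_scale: "ternary_form d a (c *s z) = c ^ d * ternary_form d a z"
proof -
  have *: "a i j * (c * z $ 1) ^ i * (c * z $ 2) ^ j * (c * z $ 3) ^ (d - i - j) = c ^ d * (a i j * z $ 1 ^ i * z $ 2 ^ j * z $ 3 ^ (d - i - j))"
    if "i \<le> d" "j \<le> d - i" for i j
  proof -
    have "c ^ d = c ^ i * c ^ j * c ^ (d - i - j)" using that by (simp add: power_add[symmetric])
    then show ?thesis by (simp add: power_mult_distrib mult_ac)
  qed
  have "ternary_form d a (c *s z) = (\<Sum>i\<le>d. \<Sum>j\<le>d - i. c ^ d * (a i j * z $ 1 ^ i * z $ 2 ^ j * z $ 3 ^ (d - i - j)))"
    unfolding ternary_form_def vector_smult_component by (intro sum.cong refl *) auto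
  then show ?thesis by (simp only: ternary_form_def sum_distrib_left)
qed

lemma continuous_on_ternary_form [continuous_intros]:
  "continuous_on S f \<Longrightarrow> continuous_on S (\<lambda>x. ternary_form d a (f x))"
  unfolding ternary_form_def by (intro continuous_intros)

text \<open>The derivative of the implicit function is forced to be complex linear by differentiating
  \<open>p x (h x) = 0\<close>, so the real inverse function theorem suffices.\<close>

lemma implicit_function_complex:
  fixes p px py :: "complex \<Rightarrow> complex \<Rightarrow> complex"
  assumes der: "\<And>x y. ((\<lambda>z. p (fst z) (snd z)) has_derivative (\<lambda>v. px x y * fst v + py x y * snd v)) (at (x, y))"
    and cx: "continuous_on UNIV (\<lambda>z. px (fst z) (snd z))" and cy: "continuous_on UNIV (\<lambda>z. py (fst z) (snd z))"
    and 0: "p x0 y0 = 0" "py x0 y0 \<noteq> 0"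
  obtains D D' h where "open D" "open D'" "x0 \<in> D" "y0 \<in> D'" "h x0 = y0" "\<And>x. x \<in> D \<Longrightarrow> h x \<in> D'"
    "\<And>x y. x \<in> D \<Longrightarrow> y \<in> D' \<Longrightarrow> p x y = 0 \<longleftrightarrow> y = h x"
    "\<And>x. x \<in> D \<Longrightarrow> py x (h x) \<noteq> 0"
    "\<And>x. x \<in> D \<Longrightarrow> (h has_field_derivative - px x (h x) / py x (h x)) (at x)"
proof -
  \<comment> \<open>The map to be inverted keeps \<open>x\<close> and replaces \<open>y\<close> by
    the value of \<open>p\<close>. Its derivative is triangular, with \<open>py\<close> as the
    nontrivial diagonal entry.\<close>
  define f where "f = (\<lambda>z. (fst z, p (fst z) (snd z)))"
  define f' where "f' z = Blinfun (\<lambda>v. (fst v, px (fst z) (snd z) * fst v + py (fst z) (snd z) * snd v))" for z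
  have bl: "bounded_linear (\<lambda>v. (fst v, a * fst v + b * snd v))" for a b :: complex
    by (intro bounded_linear_Pair bounded_linear_add bounded_linear_fst
        bounded_linear_const_mult bounded_linear_fst bounded_linear_snd)
  have f'_apply: "blinfun_apply (f' z) v = (fst v, px (fst z) (snd z) * fst v + py (fst z) (snd z) * snd v)" for z v
    unfolding f'_def using bounded_linear_Blinfun_apply[OF bl] by simp
  define inv where "inv = Blinfun (\<lambda>v. (fst v, (- px x0 y0 / py x0 y0) * fst v + (1 / py x0 y0) * snd v))"
  have inv_apply: "blinfun_apply inv v = (fst v, (- px x0 y0 / py x0 y0) * fst v + (1 / py x0 y0) * snd v)" for v
    unfolding inv_def by (subst bounded_linear_Blinfun_apply[OF bl]) (rule refl)
  have d: "(f has_derivative blinfun_apply (f' z)) (at z)" for z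
  proof -
    have "((\<lambda>z. (fst z, p (fst z) (snd z))) has_derivative (\<lambda>v. (fst v, px (fst z) (snd z) * fst v + py (fst z) (snd z) * snd v))) (at z)"
      using der[of "fst z" "snd z"] by (intro has_derivative_Pair) (auto intro!: derivative_intros)
    then show ?thesis by (simp add: f_def f'_apply[abs_def])
  qed
  have c: "continuous_on UNIV f'"
    by (rule continuous_on_blinfun_componentwise) (auto simp: f'_apply intro!: continuous_intros cx cy)
  have i: "inv o\<^sub>L f' (x0, y0) = id_blinfun"
    using 0(2) by (intro blinfun_eqI) (auto simp: f'_apply inv_apply field_simps)
  obtain U' V g g' where U: "open U'" "(x0, y0) \<in> U'" "open V" "f (x0, y0) \<in> V" "homeomorphism U' V f g"
    and g': "\<And>y. y \<in> V \<Longrightarrow> (g has_derivative (g' y)) (at y)"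
    using inverse_function_theorem[OF open_UNIV d c UNIV_I i] by metis
  have "open (U' \<inter> (\<lambda>z. py (fst z) (snd z)) -` (- {0}))"
    by (intro open_Int U open_vimage[OF _ cy]) auto
  moreover have "(x0, y0) \<in> U' \<inter> (\<lambda>z. py (fst z) (snd z)) -` (- {0})" using U 0 by auto
  \<comment> \<open>A product neighbourhood is needed: uniqueness of the root in \<open>D'\<close>
    requires every pair \<open>(x, y)\<close> to lie in the domain of the local inverse.\<close>
  ultimately obtain D1 D' where D1: "open D1" "open D'" "x0 \<in> D1" "y0 \<in> D'" "D1 \<times> D' \<subseteq> U' \<inter> (\<lambda>z. py (fst z) (snd z)) -` (- {0})"
    by (auto elim!: open_prod_elim)
  define h where "h x = snd (g (x, 0))" for x
  define W where "W = V \<inter> g -` (D1 \<times> D')"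
  have "continuous_on V g" using U(5) by (auto simp: homeomorphism_def)
  then have oW: "open W" unfolding W_def using continuous_open_preimage[OF _ U(3) open_Times[OF D1(1,2)]] by blast
  define D where "D = (\<lambda>x. (x, 0)) -` W"
  have oD: "open D" unfolding D_def by (intro open_vimage oW continuous_intros)
  have fg: "f (g v) = v" if "v \<in> V" for v using U(5) that by (auto simp: homeomorphism_def)
  have gf: "g (f v) = v" if "v \<in> U'" for v using U(5) that by (auto simp: homeomorphism_def)
  have D: "(x, 0) \<in> V" "g (x, 0) \<in> D1 \<times> D'" "g (x, 0) = (x, h x)" "h x \<in> D'" "x \<in> D1" "p x (h x) = 0" "py x (h x) \<noteq> 0" if "x \<in> D" for x
  proof -
    show 1: "(x, 0) \<in> V" "g (x, 0) \<in> D1 \<times> D'" using that by (auto simp: D_def W_def)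
    show "g (x, 0) = (x, h x)" using fg[OF 1(1)] by (auto simp: f_def h_def prod_eq_iff)
    then show "h x \<in> D'" "x \<in> D1" "p x (h x) = 0" "py x (h x) \<noteq> 0"
      using 1(2) fg[OF 1(1)] D1(5) by (auto simp: f_def)
  qed
  have f0: "f (x0, y0) = (x0, 0)" using 0 by (simp add: f_def)
  have g0: "g (x0, 0) = (x0, y0)" using gf[OF U(2)] f0 by simp
  have x0D: "x0 \<in> D" using U(4) f0 g0 D1 by (simp add: D_def W_def)
  have uniq: "p x y = 0 \<longleftrightarrow> y = h x" if "x \<in> D" "y \<in> D'" for x y
  proof
    assume "p x y = 0"
    then have "f (x, y) = (x, 0)" by (simp add: f_def)
    moreover have "(x, y) \<in> U'" using D(5)[OF that(1)] that(2) D1(5) by auto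
    ultimately show "y = h x" using gf[of "(x, y)"] by (simp add: h_def)
  qed (use D(6)[OF that(1)] in simp)
  have der_h: "(h has_field_derivative - px x (h x) / py x (h x)) (at x)" if x: "x \<in> D" for x
  proof -
    define k where "k = (\<lambda>v. snd (g' (x, 0) (v, 0)))"
    have hk: "(h has_derivative k) (at x)"
    proof -
      have "((\<lambda>x. (x, 0::complex)) has_derivative (\<lambda>v. (v, 0))) (at x)" by (intro derivative_intros)
      from diff_chain_at[OF this g'[OF D(1)[OF x]]]
      have "((\<lambda>x. g (x, 0)) has_derivative (\<lambda>v. g' (x, 0) (v, 0))) (at x)" by (simp add: o_def)
      then show ?thesis unfolding h_def[abs_def] k_def by (rule has_derivative_snd)
    qed
    have "((\<lambda>x. (x, h x)) has_derivative (\<lambda>v. (v, k v))) (at x)" by (intro derivative_intros hk)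
    from diff_chain_at[OF this der]
    have "((\<lambda>x. p x (h x)) has_derivative (\<lambda>v. px x (h x) * v + py x (h x) * k v)) (at x)" by (simp add: o_def)
    moreover have "((\<lambda>x. p x (h x)) has_derivative (\<lambda>v. 0)) (at x)"
      by (rule has_derivative_transform_within_open[OF has_derivative_const[where c = 0] oD x]) (use D(6) in auto)
    ultimately have "(\<lambda>v. px x (h x) * v + py x (h x) * k v) = (\<lambda>v. 0)" by (rule has_derivative_unique)
    then have "px x (h x) * v + py x (h x) * k v = 0" for v by (rule fun_cong)
    then have "k v = (- px x (h x) / py x (h x)) * v" for v
      using D(7)[OF x] by (simp add: field_simps eq_neg_iff_add_eq_0)
    then have "k = (*) (- px x (h x) / py x (h x))" by blast
    then show ?thesis using hk by (simp only: has_field_derivative_def)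
  qed
  show ?thesis
    by (rule that[OF oD D1(2) x0D D1(4) _ D(4) uniq D(7) der_h]) (use g0 in \<open>auto simp: h_def\<close>)
qed

section \<open>The gradient of a ternary form\<close>

text \<open>The coefficients are read in degree \<open>d - 1\<close>, where the third exponent is
  implicit. So a derivative in the third variable shifts no index but brings the factor
  \<open>d - i - j\<close>.\<close>

definition partial_coeffs :: "nat \<Rightarrow> (nat \<Rightarrow> nat \<Rightarrow> complex) \<Rightarrow> 3 \<Rightarrow> nat \<Rightarrow> nat \<Rightarrow> complex"
  where "partial_coeffs d a k i j = (if k = 1 then of_nat (Suc i) * a (Suc i) j
     else if k = 2 then of_nat (Suc j) * a i (Suc j) else of_nat (d - i - j) * a i j)"

text \<open>For \<open>d = 0\<close> the truncated degree \<open>d - 1\<close> would pick up the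
  coefficient \<open>a 1 0\<close>, which does not occur in the form; hence the explicit
  zero.\<close>

definition form_grad :: "nat \<Rightarrow> (nat \<Rightarrow> nat \<Rightarrow> complex) \<Rightarrow> complex ^ 3 \<Rightarrow> complex ^ 3"
  where "form_grad d a z = (\<chi> k. if d = 0 then 0 else ternary_form (d - 1) (partial_coeffs d a k) z)"

text \<open>The pairing without conjugation. Unlike \<open>hinner\<close> it is holomorphic in both
  arguments, so tangency and incidence are holomorphic conditions.\<close>

definition dotc :: "complex ^ 'n::finite \<Rightarrow> complex ^ 'n \<Rightarrow> complex"
  where "dotc u v = (\<Sum>i\<in>UNIV. u $ i * v $ i)"

lemma has_derivative_ternary_form:
  "(ternary_form d a has_derivative (\<lambda>h. dotc (form_grad d a z) h)) (at z)"
proof (cases d)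
  case 0
  then show ?thesis by (simp add: ternary_form_def[abs_def] form_grad_def dotc_def)
next
  case d: (Suc e)
  define D where "D = (\<lambda>h. \<Sum>i\<le>d. \<Sum>j\<le>d - i.
      a i j * (of_nat i * z $ 1 ^ (i - 1)) * z $ 2 ^ j * z $ 3 ^ (d - i - j) * h $ (1::3)
    + a i j * z $ 1 ^ i * (of_nat j * z $ 2 ^ (j - 1)) * z $ 3 ^ (d - i - j) * h $ 2
    + a i j * z $ 1 ^ i * z $ 2 ^ j * (of_nat (d - i - j) * z $ 3 ^ (d - i - j - 1)) * h $ 3)"
  have nth: "((\<lambda>z. z $ k) has_derivative (\<lambda>h. h $ k)) (at z)" for k :: 3 and z :: "complex ^ 3"
    by (intro bounded_linear_imp_has_derivative bounded_linear_vec_nth)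
  have "(ternary_form d a has_derivative D) (at z)"
    unfolding ternary_form_def[abs_def] D_def
    by (auto intro!: derivative_eq_intros nth ext sum.cong simp: algebra_simps)
  moreover have "D = dotc (form_grad d a z)"
  proof
    fix h
    \<comment> \<open>The three sums lower the three exponents in turn. The boundary terms that have
      no counterpart in degree \<open>e\<close> carry a factor 0.\<close>
    have 1: "(\<Sum>i\<le>Suc e. \<Sum>j\<le>Suc e - i. a i j * (of_nat i * z $ 1 ^ (i - 1)) * z $ 2 ^ j * z $ 3 ^ (Suc e - i - j))
        = ternary_form e (partial_coeffs (Suc e) a 1) z"
      unfolding ternary_form_def by (subst sum.atMost_Suc_shift) (auto simp: partial_coeffs_def mult_ac intro!: sum.cong)
    have 2: "(\<Sum>i\<le>Suc e. \<Sum>j\<le>Suc e - i. a i j * z $ 1 ^ i * (of_nat j * z $ 2 ^ (j - 1)) * z $ 3 ^ (Suc e - i - j))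
        = ternary_form e (partial_coeffs (Suc e) a 2) z"
    proof -
      have "(\<Sum>j\<le>Suc e - i. a i j * z $ 1 ^ i * (of_nat j * z $ 2 ^ (j - 1)) * z $ 3 ^ (Suc e - i - j))
        = (\<Sum>j\<le>e - i. partial_coeffs (Suc e) a 2 i j * z $ 1 ^ i * z $ 2 ^ j * z $ 3 ^ (e - i - j))" if "i \<le> e" for i
        using that by (subst Suc_diff_le[OF that], subst sum.atMost_Suc_shift) (auto simp: Suc_diff_le partial_coeffs_def mult_ac intro!: sum.cong)
      then show ?thesis unfolding ternary_form_def by simp
    qed
    have 3: "(\<Sum>i\<le>Suc e. \<Sum>j\<le>Suc e - i. a i j * z $ 1 ^ i * z $ 2 ^ j * (of_nat (Suc e - i - j) * z $ 3 ^ (Suc e - i - j - 1)))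
        = ternary_form e (partial_coeffs (Suc e) a 3) z"
    proof -
      have "(\<Sum>j\<le>Suc e - i. a i j * z $ 1 ^ i * z $ 2 ^ j * (of_nat (Suc e - i - j) * z $ 3 ^ (Suc e - i - j - 1)))
        = (\<Sum>j\<le>e - i. partial_coeffs (Suc e) a 3 i j * z $ 1 ^ i * z $ 2 ^ j * z $ 3 ^ (e - i - j))" if "i \<le> e" for i
        using that by (subst Suc_diff_le[OF that]) (auto simp: Suc_diff_le partial_coeffs_def mult_ac intro!: sum.cong)
      then show ?thesis unfolding ternary_form_def by simp
    qed
    show "D h = dotc (form_grad d a z) h"
      unfolding D_def d dotc_def form_grad_def sum_3
      by (simp only: sum.distrib sum_distrib_right[symmetric] 1 2 3) simp
  qed
  ultimately show ?thesis by simp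
qed

lemma partial_deriv_ternary_form:
  "partial_deriv k (ternary_form d a) z = form_grad d a z $ k"
proof -
  have ax: "axis k t = t *s axis k (1::complex)" for t by (simp add: vec_eq_iff axis_def)
  have "bounded_linear (\<lambda>t::complex. axis k t :: complex ^ 3)"
    by (intro linear_conv_bounded_linear[THEN iffD1] linearI) (auto simp: vec_eq_iff axis_def)
  then have "((\<lambda>t. z + axis k t) has_derivative (\<lambda>t. axis k t)) (at 0)"
    by (auto intro!: derivative_eq_intros bounded_linear_imp_has_derivative)
  moreover have "(ternary_form d a has_derivative (\<lambda>h. dotc (form_grad d a z) h)) (at (z + axis k 0))"
    using has_derivative_ternary_form by (simp add: axis_def zero_vec_def[symmetric])
  ultimately have "((\<lambda>t. ternary_form d a (z + axis k t)) has_derivative (\<lambda>t. dotc (form_grad d a z) (axis k t))) (at 0)"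
    using diff_chain_at by (fastforce simp: o_def)
  moreover have "dotc (form_grad d a z) (axis k t) = form_grad d a z $ k * t" for t
    by (simp add: dotc_def axis_def if_distrib cong: if_cong)
  ultimately have "((\<lambda>t. ternary_form d a (z + axis k t)) has_field_derivative form_grad d a z $ k) (at 0)"
    by (simp add: has_field_derivative_def)
  then show ?thesis unfolding partial_deriv_def by (rule DERIV_imp_deriv)
qed

section \<open>Fubini--Study form and volume measure\<close>

lemma hinner_simps:
  "hinner (u + v) w = hinner u w + hinner v w" "hinner u (v + w) = hinner u v + hinner u w"
  "hinner (c *s u) w = c * hinner u w" "hinner u (c *s w) = cnj c * hinner u w"
  "hinner (- u) w = - hinner u w" "hinner u (- w) = - hinner u w"
  "hinner (u - v) w = hinner u w - hinner v w" "hinner u (v - w) = hinner u v - hinner u w"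
  "hinner 0 w = 0" "hinner u 0 = 0"
  by (simp_all add: hinner_def sum.distrib sum_subtractf sum_negf sum_distrib_left algebra_simps)

lemma hinner_scaleR: "hinner (r *\<^sub>R u) w = of_real r * hinner u w" "hinner u (r *\<^sub>R w) = of_real r * hinner u w"
  by (simp_all add: hinner_def sum_distrib_left scaleR_conv_of_real[where 'a = complex] algebra_simps)

lemma cnj_hinner: "cnj (hinner u v) = hinner v u"
  by (simp add: hinner_def mult.commute)

lemma norm_vec_power2: "(norm (z :: complex ^ 'n::finite))\<^sup>2 = (\<Sum>i\<in>UNIV. (cmod (z $ i))\<^sup>2)"
  by (simp add: norm_vec_def L2_set_def sum_nonneg)

lemma hinner_self: "hinner z z = of_real ((norm z)\<^sup>2)"
  by (simp add: hinner_def norm_vec_power2 complex_norm_square del: of_real_power)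

lemma norm_smult_vec: "norm (c *s (z :: complex ^ 'n::finite)) = cmod c * norm z"
proof -
  have "(norm (c *s z))\<^sup>2 = (cmod c * norm z)\<^sup>2"
    by (simp add: norm_vec_power2 power_mult_distrib sum_distrib_left norm_mult)
  then show ?thesis by (simp add: power2_eq_iff_nonneg)
qed

lemma of_real_norm_power2: "(complex_of_real (norm z))\<^sup>2 = hinner z z"
  by (simp add: hinner_self)

lemma fs_form_altdef: "fs_form z u v = Re (hinner z z * hinner u v - hinner u z * hinner z v) / norm z ^ 4"
  by (simp add: fs_form_def of_real_norm_power2)

text \<open>Rescaling the lift by a function changes tangent vectors by multiples of the base point.\<close>

lemma fs_form_rescale:
  assumes "c \<noteq> 0" "z \<noteq> 0"
  shows "fs_form (c *s z) (\<alpha> *s z + c *s u) (\<beta> *s z + c *s v) = fs_form z u v"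
proof -
  have "hinner (c *s z) (c *s z) * hinner (\<alpha> *s z + c *s u) (\<beta> *s z + c *s v)
      - hinner (\<alpha> *s z + c *s u) (c *s z) * hinner (c *s z) (\<beta> *s z + c *s v)
    = (c * cnj c)\<^sup>2 * (hinner z z * hinner u v - hinner u z * hinner z v)"
    by (simp add: hinner_simps algebra_simps power2_eq_square)
  also have "(c * cnj c)\<^sup>2 = of_real (cmod c ^ 4)"
    by (simp add: complex_norm_square[symmetric] power_mult[symmetric])
  finally show ?thesis using assms
    by (simp add: fs_form_altdef norm_smult_vec power_mult_distrib)
qed

lemma fs_form_add: "fs_form z (u + v) w = fs_form z u w + fs_form z v w" "fs_form z w (u + v) = fs_form z w u + fs_form z w v"
  by (simp_all add: fs_form_altdef hinner_simps algebra_simps add_divide_distrib[symmetric] diff_divide_distrib[symmetric])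

lemma fs_form_scaleR: "fs_form z (r *\<^sub>R u) w = r * fs_form z u w" "fs_form z u (r *\<^sub>R w) = r * fs_form z u w"
proof -
  have "hinner z z * hinner (r *\<^sub>R u) w - hinner (r *\<^sub>R u) z * hinner z w = of_real r * (hinner z z * hinner u w - hinner u z * hinner z w)"
    "hinner z z * hinner u (r *\<^sub>R w) - hinner u z * hinner z (r *\<^sub>R w) = of_real r * (hinner z z * hinner u w - hinner u z * hinner z w)"
    by (simp_all add: hinner_scaleR algebra_simps)
  then show "fs_form z (r *\<^sub>R u) w = r * fs_form z u w" "fs_form z u (r *\<^sub>R w) = r * fs_form z u w"
    unfolding fs_form_altdef by simp_all
qed

lemma fs_form_sum: "finite A \<Longrightarrow> fs_form z (\<Sum>i\<in>A. f i) w = (\<Sum>i\<in>A. fs_form z (f i) w)" "finite A \<Longrightarrow> fs_form z w (\<Sum>i\<in>A. f i) = (\<Sum>i\<in>A. fs_form z w (f i))"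
proof -
  have z: "fs_form z 0 w = 0" "fs_form z w 0 = 0" by (simp_all add: fs_form_altdef hinner_simps)
  show "fs_form z (\<Sum>i\<in>A. f i) w = (\<Sum>i\<in>A. fs_form z (f i) w)" if "finite A"
    using that by (induct A rule: finite_induct) (simp_all add: fs_form_add z)
  show "fs_form z w (\<Sum>i\<in>A. f i) = (\<Sum>i\<in>A. fs_form z w (f i))" if "finite A"
    using that by (induct A rule: finite_induct) (simp_all add: fs_form_add z)
qed

lemma continuous_on_hinner [continuous_intros]:
  "continuous_on S f \<Longrightarrow> continuous_on S g \<Longrightarrow> continuous_on S (\<lambda>x. hinner (f x) (g x))"
  unfolding hinner_def by (intro continuous_intros)

lemma continuous_on_fs_form:
  assumes "continuous_on S f" "continuous_on S g" "continuous_on S h" "\<And>x. x \<in> S \<Longrightarrow> f x \<noteq> 0"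
  shows "continuous_on S (\<lambda>x. fs_form (f x) (g x) (h x))"
  unfolding fs_form_altdef by (intro continuous_intros assms) (use assms(4) in auto)

lemma line_eq_iff:
  fixes z w :: "complex ^ 'n::finite"
  assumes "z \<noteq> 0" "w \<noteq> 0"
  shows "range (\<lambda>c. c *s z) = range (\<lambda>c. c *s w) \<longleftrightarrow> (\<exists>c. c \<noteq> 0 \<and> z = c *s w)"
proof
  assume "range (\<lambda>c. c *s z) = range (\<lambda>c. c *s w)"
  moreover have "z \<in> range (\<lambda>c. c *s z)" by (rule range_eqI[of _ _ 1]) simp
  ultimately obtain c where "z = c *s w" by blast
  then show "\<exists>c. c \<noteq> 0 \<and> z = c *s w" using assms(1) by (intro exI[of _ c]) auto
next
  assume "\<exists>c. c \<noteq> 0 \<and> z = c *s w"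
  then obtain c where c: "c \<noteq> 0" "z = c *s w" by blast
  have "k *s w \<in> range (\<lambda>k. k *s z)" for k using c by (intro range_eqI[of _ _ "k / c"]) simp
  then show "range (\<lambda>c. c *s z) = range (\<lambda>c. c *s w)" using c by auto
qed

lemma proj_eq_iff:
  assumes "z \<noteq> 0" "w \<noteq> 0"
  shows "proj z = proj w \<longleftrightarrow> (\<exists>c. c \<noteq> 0 \<and> z = c *s w)"
  unfolding proj_def using assms line_eq_iff[OF assms] by (subst Abs_cproj_inject) blast+

lemma proj_smult: "c \<noteq> 0 \<Longrightarrow> z \<noteq> 0 \<Longrightarrow> proj (c *s z) = proj z"
  by (subst proj_eq_iff) auto

lemma proj_surj: obtains z where "z \<noteq> 0" "proj z = P"
  by (cases P) (auto simp: proj_def)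

lemma open_proj_preimage: "open W \<Longrightarrow> open {z. z \<noteq> 0 \<and> proj z \<in> W}"
  by (simp add: open_cproj_def)

lemma continuous_on_proj:
  fixes f :: "'b::topological_space \<Rightarrow> complex ^ 'a::finite"
  assumes "continuous_on S f" "\<And>x. x \<in> S \<Longrightarrow> f x \<noteq> 0"
  shows "continuous_on S (\<lambda>x. proj (f x))"
proof -
  have "continuous_on (- {0 :: complex ^ 'a}) proj"
  proof (subst continuous_on_open_vimage)
    show "open (- {0 :: complex ^ 'a})" by (intro open_Compl closed_singleton)
    show "\<forall>B. open B \<longrightarrow> open (proj -` B \<inter> - {0 :: complex ^ 'a})"
    proof (intro allI impI)
      fix B :: "'a cproj set" assume "open B"
      moreover have "proj -` B \<inter> - {0} = {z. z \<noteq> 0 \<and> proj z \<in> B}" by auto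
      ultimately show "open (proj -` B \<inter> - {0})" using open_proj_preimage by simp
    qed
  qed
  then show ?thesis by (rule continuous_on_compose2[OF _ assms(1)]) (use assms(2) in auto)
qed

section \<open>Charts and the volume measure\<close>

text \<open>\<open>\<kappa>\<close> extends the inverse of the chart to a differentiable map on
  homogeneous coordinates. Composing it with any other lift gives a differentiable transition map at
  once, with no appeal to the inverse function theorem.\<close>

definition fs_chart :: "'n::finite cproj set \<Rightarrow> (real ^ 'k::finite) set \<Rightarrow> (real ^ 'k \<Rightarrow> complex ^ 'n) \<Rightarrow> 'n cproj set \<Rightarrow> (complex ^ 'n \<Rightarrow> real ^ 'k) \<Rightarrow> bool"
  where "fs_chart M U \<phi> W \<kappa> \<longleftrightarrow> local_param U \<phi> M \<and> open W \<and> (\<lambda>t. proj (\<phi> t)) ` U = M \<inter> W \<and>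
    (\<forall>z. z \<noteq> 0 \<and> proj z \<in> W \<longrightarrow> \<kappa> differentiable (at z)) \<and>
    (\<forall>z. z \<noteq> 0 \<and> proj z \<in> M \<inter> W \<longrightarrow> \<kappa> z \<in> U \<and> proj (\<phi> (\<kappa> z)) = proj z)"

abbreviation fs_density :: "(real ^ 'k::finite \<Rightarrow> complex ^ 'n::finite) \<Rightarrow> real ^ 'k \<Rightarrow> real"
  where "fs_density \<phi> t \<equiv> sqrt (det (gram \<phi> t))"

lemma local_param_continuous:
  assumes "local_param U \<phi> M"
  shows "continuous_on U \<phi>" "continuous_on U (\<lambda>t. proj (\<phi> t))" "open U"
    "t \<in> U \<Longrightarrow> (\<phi> has_derivative frechet_derivative \<phi> (at t)) (at t)"
proof -
  have d: "\<And>t. t \<in> U \<Longrightarrow> \<phi> differentiable (at t)" using assms by (auto simp: local_param_def C1_on_def)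
  show "continuous_on U \<phi>" using d by (intro continuous_at_imp_continuous_on) (auto intro: differentiable_imp_continuous_within)
  then show "continuous_on U (\<lambda>t. proj (\<phi> t))" by (rule continuous_on_proj) (use assms in \<open>auto simp: local_param_def\<close>)
  show "open U" using assms by (simp add: local_param_def)
  show "t \<in> U \<Longrightarrow> (\<phi> has_derivative frechet_derivative \<phi> (at t)) (at t)" using d frechet_derivative_works by blast
qed

lemma continuous_on_fs_density:
  assumes "local_param U \<phi> M"
  shows "continuous_on U (fs_density \<phi>)"
proof -
  have c: "continuous_on U (\<lambda>t. frechet_derivative \<phi> (at t) u)" for u using assms by (auto simp: local_param_def C1_on_def)
  have n: "\<phi> t \<noteq> 0" if "t \<in> U" for t using assms that by (auto simp: local_param_def)
  have g: "continuous_on U (\<lambda>t. gram \<phi> t $ i $ j)" for i j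
    unfolding gram_def fs_pullback_def by (simp, intro continuous_on_fs_form c local_param_continuous(1)[OF assms]) (use n in auto)
  show ?thesis unfolding det_def by (intro continuous_intros g)
qed

lemma matrix_component: "bounded_linear (f :: real ^ 'k \<Rightarrow> real ^ 'k) \<Longrightarrow> f (axis j 1) = (\<Sum>k\<in>UNIV. (matrix f $ k $ j) *\<^sub>R axis k (1::real))"
  by (simp add: matrix_def vec_eq_iff axis_def if_distrib[of "(*) _"] cong: if_cong)

text \<open>The lifts \<open>\<psi>\<close> and \<open>\<phi> \<circ> \<tau>\<close> of the same
  points differ by a scalar function, whose derivative only adds multiples of the base point;
  \<open>fs_form_rescale\<close> removes these. What remains is a congruence of Gram matrices by the
  Jacobian matrix \<open>A\<close> of \<open>\<tau>\<close>, so the determinant changes by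
  \<open>(det A)^2\<close>.\<close>

lemma chart_transition:
  fixes \<phi> :: "real ^ 'k::finite \<Rightarrow> complex ^ 'n::finite"
  assumes ch: "fs_chart M U \<phi> W \<kappa>" and lp: "local_param V \<psi> M" and t: "t \<in> V" "proj (\<psi> t) \<in> W"
  shows "((\<lambda>s. \<kappa> (\<psi> s)) has_derivative frechet_derivative (\<lambda>s. \<kappa> (\<psi> s)) (at t)) (at t)"
    "fs_density \<psi> t = \<bar>det (matrix (frechet_derivative (\<lambda>s. \<kappa> (\<psi> s)) (at t)))\<bar> * fs_density \<phi> (\<kappa> (\<psi> t))"
proof -
  define \<tau> where "\<tau> = (\<lambda>s. \<kappa> (\<psi> s))"
  have lpU: "local_param U \<phi> M" and oW: "open W" using ch by (auto simp: fs_chart_def)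
  have V: "s \<in> V \<Longrightarrow> \<psi> s \<noteq> 0 \<and> proj (\<psi> s) \<in> M" for s using lp by (auto simp: local_param_def)
  define V' where "V' = V \<inter> (\<lambda>s. proj (\<psi> s)) -` W"
  have V': "open V'" "t \<in> V'" unfolding V'_def
    using continuous_open_preimage[OF local_param_continuous(2,3)[OF lp] oW] t by auto
  have \<tau>: "\<tau> s \<in> U \<and> proj (\<phi> (\<tau> s)) = proj (\<psi> s) \<and> \<phi> (\<tau> s) \<noteq> 0" if "s \<in> V'" for s
    using that V[of s] ch lpU by (auto simp: V'_def \<tau>_def fs_chart_def local_param_def)
  have d\<psi>: "(\<psi> has_derivative frechet_derivative \<psi> (at t)) (at t)" by (rule local_param_continuous(4)[OF lp t(1)])
  have "\<kappa> differentiable (at (\<psi> t))" using ch V t by (auto simp: fs_chart_def)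
  then have "\<tau> differentiable (at t)"
    unfolding \<tau>_def using d\<psi> differentiable_chain_at[of \<psi> t \<kappa>] by (auto simp: o_def differentiable_def)
  then have d\<tau>: "(\<tau> has_derivative frechet_derivative \<tau> (at t)) (at t)" using frechet_derivative_works by blast
  define D where "D = frechet_derivative \<tau> (at t)"
  have lin: "bounded_linear D" using d\<tau> by (auto simp: D_def has_derivative_def)
  show "((\<lambda>s. \<kappa> (\<psi> s)) has_derivative frechet_derivative (\<lambda>s. \<kappa> (\<psi> s)) (at t)) (at t)" using d\<tau> by (simp add: \<tau>_def)
  have d\<phi>: "(\<phi> has_derivative frechet_derivative \<phi> (at (\<tau> t))) (at (\<tau> t))"
    using local_param_continuous(4)[OF lpU] \<tau>[OF V'(2)] by blast
  define v where "v = \<phi> (\<tau> t)"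
  define E where "E = (\<lambda>u. frechet_derivative \<phi> (at (\<tau> t)) (D u))"
  have d\<phi>\<tau>: "((\<lambda>s. \<phi> (\<tau> s)) has_derivative E) (at t)"
    unfolding E_def D_def using diff_chain_at[OF d\<tau> d\<phi>] by (simp add: o_def)
  have blh: "bounded_linear (\<lambda>w. hinner w v)"
    by (intro linear_conv_bounded_linear[THEN iffD1] linearI) (simp_all add: hinner_simps hinner_scaleR scaleR_conv_of_real[where 'a = complex])
  \<comment> \<open>Pairing with the fixed vector \<open>v\<close> exhibits the proportionality
    factor as a quotient of differentiable functions, valid where the denominator is nonzero, in
    particular near \<open>t\<close>.\<close>
  define c where "c = (\<lambda>s. hinner (\<psi> s) v / hinner (\<phi> (\<tau> s)) v)"
  have hv: "hinner v v \<noteq> 0" using \<tau>[OF V'(2)] by (simp add: hinner_self v_def)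
  have "\<exists>dc. (c has_derivative dc) (at t)"
    unfolding c_def
    using has_derivative_divide[OF bounded_linear.has_derivative[OF blh d\<psi>] bounded_linear.has_derivative[OF blh d\<phi>\<tau>]] hv
    by (auto simp: v_def)
  then obtain dc where dc: "(c has_derivative dc) (at t)" by blast
  have bbs: "bounded_bilinear (\<lambda>(c::complex) (z::complex ^ 'n). c *s z)"
  proof (rule bounded_bilinear.intro)
    show "\<exists>K. \<forall>a b. norm (a *s (b :: complex ^ 'n)) \<le> norm a * norm b * K" by (intro exI[of _ 1]) (simp add: norm_smult_vec)
  qed (simp_all add: vec_eq_iff algebra_simps)
  have "((\<lambda>s. c s *s \<phi> (\<tau> s)) has_derivative (\<lambda>u. c t *s E u + dc u *s \<phi> (\<tau> t))) (at t)"
    by (rule bounded_bilinear.FDERIV[OF bbs dc d\<phi>\<tau>])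
  moreover have cs: "c s \<noteq> 0 \<and> \<psi> s = c s *s \<phi> (\<tau> s)" if s: "s \<in> V'" "hinner (\<phi> (\<tau> s)) v \<noteq> 0" for s
  proof -
    obtain k where k: "k \<noteq> 0" "\<psi> s = k *s \<phi> (\<tau> s)" using \<tau>[OF s(1)] V[of s] s(1) proj_eq_iff[of "\<psi> s" "\<phi> (\<tau> s)"] by (auto simp: V'_def)
    then have "c s = k" using s(2) by (simp add: c_def hinner_simps)
    then show ?thesis using k by simp
  qed
  moreover have "\<forall>\<^sub>F s in nhds t. c s *s \<phi> (\<tau> s) = \<psi> s"
  proof -
    have "isCont (\<lambda>s. hinner (\<phi> (\<tau> s)) v) t"
      using has_derivative_continuous[OF bounded_linear.has_derivative[OF blh d\<phi>\<tau>]] .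
    then have "((\<lambda>s. hinner (\<phi> (\<tau> s)) v) \<longlongrightarrow> hinner v v) (nhds t)"
      unfolding v_def by (simp add: continuous_at tendsto_nhds_iff)
    then have "\<forall>\<^sub>F s in nhds t. hinner (\<phi> (\<tau> s)) v \<noteq> 0" using hv by (rule tendsto_imp_eventually_ne)
    moreover have "\<forall>\<^sub>F s in nhds t. s \<in> V'" using V' by (rule eventually_nhds_in_open)
    ultimately show ?thesis by eventually_elim (use cs in auto)
  qed
  ultimately have "(\<psi> has_derivative (\<lambda>u. c t *s E u + dc u *s \<phi> (\<tau> t))) (at t)"
    using has_derivative_transform_eventually[of "\<lambda>s. c s *s \<phi> (\<tau> s)" _ t UNIV \<psi>] by (auto simp: eventually_nhds_conv_at)
  then have f\<psi>: "frechet_derivative \<psi> (at t) = (\<lambda>u. c t *s E u + dc u *s \<phi> (\<tau> t))"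
    using frechet_derivative_at by metis
  have ct: "c t \<noteq> 0" "\<psi> t = c t *s \<phi> (\<tau> t)" "\<phi> (\<tau> t) \<noteq> 0" using cs[OF V'(2)] hv \<tau>[OF V'(2)] by (auto simp: v_def)
  have pb: "fs_pullback \<psi> t u w = fs_pullback \<phi> (\<tau> t) (D u) (D w)" for u w
    using fs_form_rescale[OF ct(1,3), of "dc u" "E u" "dc w" "E w"]
    unfolding fs_pullback_def f\<psi> by (simp add: ct(2)[symmetric] E_def add.commute)
  define A where "A = matrix D"
  have Dax: "D (axis j 1) = (\<Sum>k\<in>UNIV. (A $ k $ j) *\<^sub>R axis k (1::real))" for j
    unfolding A_def by (rule matrix_component[OF lin])
  have lin\<phi>: "linear (frechet_derivative \<phi> (at (\<tau> t)))" using d\<phi> by (auto simp: has_derivative_def bounded_linear.linear)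
  have "fs_pullback \<psi> t (axis i 1) (axis j 1) = (\<Sum>k\<in>UNIV. \<Sum>l\<in>UNIV. A $ k $ i * gram \<phi> (\<tau> t) $ k $ l * A $ l $ j)" for i j
  proof -
    have "fs_pullback \<psi> t (axis i 1) (axis j 1) = fs_pullback \<phi> (\<tau> t) (\<Sum>k\<in>UNIV. (A $ k $ i) *\<^sub>R axis k 1) (\<Sum>k\<in>UNIV. (A $ k $ j) *\<^sub>R axis k 1)"
      by (simp only: pb Dax)
    then show ?thesis unfolding fs_pullback_def gram_def
      by (simp add: linear_sum[OF lin\<phi>] linear_scale[OF lin\<phi>] fs_form_sum fs_form_scaleR sum_distrib_left mult_ac) (subst sum.swap, simp add: mult.left_commute)
  qed
  then have "gram \<psi> t = transpose A ** gram \<phi> (\<tau> t) ** A"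
    unfolding gram_def[of \<psi>] vec_eq_iff matrix_matrix_mult_def transpose_def
    by (simp add: sum_distrib_right) (intro allI, rule sum.swap)
  then have "det (gram \<psi> t) = (det A)\<^sup>2 * det (gram \<phi> (\<tau> t))" by (simp add: det_mul det_transpose power2_eq_square)
  then show "fs_density \<psi> t = \<bar>det (matrix (frechet_derivative (\<lambda>s. \<kappa> (\<psi> s)) (at t)))\<bar> * fs_density \<phi> (\<kappa> (\<psi> t))"
    by (simp add: real_sqrt_mult A_def D_def \<tau>_def)
qed

text \<open>For every finite \<open>b\<close>, one integral equals \<open>b\<close> exactly when the
  other does, by the change of variables for absolutely integrable functions. If one integral is
  infinite, this equivalence excludes every finite value of the other.\<close>

lemma nn_integral_change_of_variables:
  fixes \<tau> :: "real ^ 'k::{finite,wellorder} \<Rightarrow> real ^ 'k::_"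
  assumes C: "C \<in> sets borel" "\<tau> ` C \<in> sets borel"
    and der: "\<And>t. t \<in> C \<Longrightarrow> (\<tau> has_derivative \<tau>' t) (at t)" and inj: "inj_on \<tau> C"
    and f: "(\<lambda>x. indicator (\<tau> ` C) x * f x) \<in> borel_measurable borel" "\<And>x. x \<in> \<tau> ` C \<Longrightarrow> f x \<ge> 0"
    and g: "(\<lambda>t. indicator C t * g t) \<in> borel_measurable borel" "\<And>t. t \<in> C \<Longrightarrow> g t = \<bar>det (matrix (\<tau>' t))\<bar> * f (\<tau> t)"
  shows "(\<integral>\<^sup>+x\<in>\<tau> ` C. ennreal (f x) \<partial>lborel) = (\<integral>\<^sup>+t\<in>C. ennreal (g t) \<partial>lborel)"
proof -
  have g0: "g t \<ge> 0" if "t \<in> C" for t using g(2)[OF that] f(2) that by simp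
  have nn: "(\<integral>\<^sup>+x\<in>S. ennreal (h x) \<partial>lborel) = ennreal b \<longleftrightarrow> h absolutely_integrable_on S \<and> integral S h = b"
    if S: "S \<in> sets borel" "(\<lambda>x. indicator S x * h x) \<in> borel_measurable borel" "\<And>x. x \<in> S \<Longrightarrow> h x \<ge> 0" and b: "b \<ge> 0" for S :: "(real ^ 'k::_) set" and h b
  proof -
    have 1: "(\<integral>\<^sup>+x\<in>S. ennreal (h x) \<partial>lborel) = (\<integral>\<^sup>+x. ennreal (indicator S x * h x) \<partial>lborel)"
      by (intro nn_integral_cong) (auto simp: indicator_def)
    have 2: "0 \<le> indicator S x * h x" for x using S(3)[of x] by (auto simp: indicator_def)
    have 3: "(\<integral>\<^sup>+x. ennreal (indicator S x * h x) \<partial>lborel) = ennreal b \<longleftrightarrow>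
       integrable lborel (\<lambda>x. indicator S x * h x) \<and> integral\<^sup>L lborel (\<lambda>x. indicator S x * h x) = b"
      using nn_integral_eq_integrable[of "\<lambda>x. indicator S x * h x" lborel b] S(2) 2 b by auto
    have 4: "integrable lborel (\<lambda>x. indicator S x * h x) \<longleftrightarrow> h absolutely_integrable_on S"
      using integrable_completion[of "\<lambda>x. indicator S x * h x" lborel] S(2) by (simp add: set_integrable_def)
    have 5: "integral S h = integral\<^sup>L lborel (\<lambda>x. indicator S x * h x)" if "h absolutely_integrable_on S"
    proof -
      have "integral S h = set_lebesgue_integral lebesgue S h" using set_lebesgue_integral_eq_integral(2)[OF that] by simp
      also have "\<dots> = integral\<^sup>L lborel (\<lambda>x. indicator S x * h x)"
        using integral_completion[of "\<lambda>x. indicator S x * h x" lborel] S(2) by (simp add: set_lebesgue_integral_def)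
      finally show ?thesis .
    qed
    show ?thesis unfolding 1 3 4 using 5 by auto
  qed
  have iff: "(\<integral>\<^sup>+x\<in>\<tau> ` C. ennreal (f x) \<partial>lborel) = ennreal b \<longleftrightarrow> (\<integral>\<^sup>+t\<in>C. ennreal (g t) \<partial>lborel) = ennreal b" if b: "b \<ge> 0" for b
  proof -
    have CL: "C \<in> sets lebesgue" using C(1) by auto
    have "(\<lambda>x. \<bar>det (matrix (\<tau>' x))\<bar> *\<^sub>R (vec (f (\<tau> x)) :: real ^ 1)) absolutely_integrable_on C \<and>
           integral C (\<lambda>x. \<bar>det (matrix (\<tau>' x))\<bar> *\<^sub>R (vec (f (\<tau> x)) :: real ^ 1)) = vec b
     \<longleftrightarrow> (\<lambda>x. vec (f x) :: real ^ 1) absolutely_integrable_on (\<tau> ` C) \<and> integral (\<tau> ` C) (\<lambda>x. vec (f x) :: real ^ 1) = vec b"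
      by (rule has_absolute_integral_change_of_variables[OF CL has_derivative_at_withinI[OF der] inj]) auto
    moreover have "(\<lambda>x. \<bar>det (matrix (\<tau>' x))\<bar> *\<^sub>R (vec (f (\<tau> x)) :: real ^ 1)) = (\<lambda>x. vec (\<bar>det (matrix (\<tau>' x))\<bar> * f (\<tau> x)))"
      by (auto simp: vec_eq_iff)
    ultimately have "(\<lambda>x. \<bar>det (matrix (\<tau>' x))\<bar> * f (\<tau> x)) absolutely_integrable_on C \<and> integral C (\<lambda>x. \<bar>det (matrix (\<tau>' x))\<bar> * f (\<tau> x)) = b
     \<longleftrightarrow> f absolutely_integrable_on (\<tau> ` C) \<and> integral (\<tau> ` C) f = b"
      by (simp add: absolutely_integrable_on_1_iff integral_on_1_eq vec_eq_iff)
    moreover have "(\<lambda>x. \<bar>det (matrix (\<tau>' x))\<bar> * f (\<tau> x)) absolutely_integrable_on C \<longleftrightarrow> g absolutely_integrable_on C"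
      by (rule set_integrable_cong) (use g(2) in auto)
    moreover have "integral C (\<lambda>x. \<bar>det (matrix (\<tau>' x))\<bar> * f (\<tau> x)) = integral C g"
      by (rule Henstock_Kurzweil_Integration.integral_cong) (use g(2) in auto)
    ultimately show ?thesis using nn[OF C(2) f b] nn[OF C(1) g(1) g0 b] by simp
  qed
  show ?thesis
  proof (cases "(\<integral>\<^sup>+x\<in>\<tau> ` C. ennreal (f x) \<partial>lborel)")
    case (real b) then show ?thesis using iff[of b] by simp
  next
    case top
    then show ?thesis using iff by (cases "(\<integral>\<^sup>+t\<in>C. ennreal (g t) \<partial>lborel)") auto
  qed
qed

lemma sets_param_preimage:
  fixes \<phi> :: "real ^ 'k::finite \<Rightarrow> complex ^ 'n::finite"
  assumes "local_param U \<phi> M" "B \<in> sets (restrict_space borel M)"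
  shows "{t\<in>U. proj (\<phi> t) \<in> B} \<in> sets borel"
proof -
  obtain B' where B': "B' \<in> sets borel" "B = M \<inter> B'" using assms(2) by (auto simp: sets_restrict_space)
  have "(\<lambda>t. proj (\<phi> t)) \<in> borel_measurable (restrict_space borel U)"
    by (rule borel_measurable_continuous_on_restrict[OF local_param_continuous(2)[OF assms(1)]])
  from measurable_sets[OF this B'(1)]
  have "(\<lambda>t. proj (\<phi> t)) -` B' \<inter> U \<in> sets borel"
    using local_param_continuous(3)[OF assms(1)] by (auto simp: sets_restrict_space_iff space_restrict_space)
  moreover have "{t\<in>U. proj (\<phi> t) \<in> B} = (\<lambda>t. proj (\<phi> t)) -` B' \<inter> U"
    using assms(1) B'(2) by (auto simp: local_param_def)
  ultimately show ?thesis by simp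
qed

lemma measurable_fs_density:
  assumes "local_param U \<phi> M" "A \<in> sets borel" "A \<subseteq> U"
  shows "(\<lambda>t. indicator A t * fs_density \<phi> t) \<in> borel_measurable borel"
    "(\<lambda>t. ennreal (fs_density \<phi> t) * indicator A t) \<in> borel_measurable borel"
proof -
  have "(\<lambda>t. indicator U t *\<^sub>R fs_density \<phi> t) \<in> borel_measurable borel"
    by (rule borel_measurable_continuous_on_indicator[OF _ continuous_on_fs_density[OF assms(1)]])
      (use local_param_continuous(3)[OF assms(1)] in auto)
  then have "(\<lambda>t. indicator A t * (indicator U t *\<^sub>R fs_density \<phi> t)) \<in> borel_measurable borel"
    using assms(2) by measurable
  moreover have "(\<lambda>t. indicator A t * (indicator U t *\<^sub>R fs_density \<phi> t)) = (\<lambda>t. indicator A t * fs_density \<phi> t)"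
    using assms(3) by (auto simp: indicator_def fun_eq_iff)
  ultimately show 1: "(\<lambda>t. indicator A t * fs_density \<phi> t) \<in> borel_measurable borel" by simp
  have "(\<lambda>t. ennreal (indicator A t * fs_density \<phi> t)) \<in> borel_measurable borel" using 1 by measurable
  moreover have "(\<lambda>t. ennreal (indicator A t * fs_density \<phi> t)) = (\<lambda>t. ennreal (fs_density \<phi> t) * indicator A t)"
    by (auto simp: indicator_def)
  ultimately show "(\<lambda>t. ennreal (fs_density \<phi> t) * indicator A t) \<in> borel_measurable borel" by simp
qed

text \<open>The transition map \<open>\<tau>\<close> carries the parameters of \<open>B\<close> in
  \<open>V\<close> bijectively onto those in \<open>U\<close>, and \<open>chart_transition\<close>
  says that the densities differ by its Jacobian determinant.\<close>

lemma chart_integral_eq: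
  fixes \<phi> \<psi> :: "real ^ 'k::{finite,wellorder} \<Rightarrow> complex ^ 'n::finite"
  assumes ch: "fs_chart M U \<phi> W \<kappa>" and lp: "local_param V \<psi> M"
    and B: "B \<in> sets (restrict_space borel M)" "B \<subseteq> W" "B \<subseteq> (\<lambda>t. proj (\<psi> t)) ` V"
  shows "(\<integral>\<^sup>+t\<in>{t\<in>U. proj (\<phi> t) \<in> B}. ennreal (fs_density \<phi> t) \<partial>lborel) =
    (\<integral>\<^sup>+t\<in>{t\<in>V. proj (\<psi> t) \<in> B}. ennreal (fs_density \<psi> t) \<partial>lborel)"
proof -
  have lpU: "local_param U \<phi> M" using ch by (auto simp: fs_chart_def)
  define C where "C = {t\<in>V. proj (\<psi> t) \<in> B}"
  define \<tau> where "\<tau> = (\<lambda>s. \<kappa> (\<psi> s))"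
  have V: "s \<in> V \<Longrightarrow> \<psi> s \<noteq> 0 \<and> proj (\<psi> s) \<in> M" for s using lp by (auto simp: local_param_def)
  have U: "s \<in> U \<Longrightarrow> \<phi> s \<noteq> 0 \<and> proj (\<phi> s) \<in> M" for s using lpU by (auto simp: local_param_def)
  have \<tau>: "\<tau> t \<in> U" "proj (\<phi> (\<tau> t)) = proj (\<psi> t)" if "t \<in> C" for t
    using that V[of t] ch B(2) by (auto simp: C_def \<tau>_def fs_chart_def)
  have im: "\<tau> ` C = {t\<in>U. proj (\<phi> t) \<in> B}"
  proof (intro equalityI subsetI)
    fix t assume t: "t \<in> {t\<in>U. proj (\<phi> t) \<in> B}"
    then obtain s where s: "s \<in> V" "proj (\<phi> t) = proj (\<psi> s)" using B(3) by auto
    then have sC: "s \<in> C" using t by (auto simp: C_def)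
    then have "\<tau> s = t" using \<tau>[OF sC] s t lpU by (auto simp: local_param_def inj_on_def)
    then show "t \<in> \<tau> ` C" using sC by blast
  qed (use \<tau> in \<open>auto simp: C_def\<close>)
  have inj: "inj_on \<tau> C"
  proof (rule inj_onI)
    fix s t assume "s \<in> C" "t \<in> C" "\<tau> s = \<tau> t"
    then have "proj (\<psi> s) = proj (\<psi> t)" using \<tau>(2) by metis
    then show "s = t" using \<open>s \<in> C\<close> \<open>t \<in> C\<close> lp by (auto simp: C_def local_param_def inj_on_def)
  qed
  \<comment> \<open>The sign of \<open>det (gram \<phi> t)\<close> has not been established here,
    and \<open>sqrt\<close> of a negative real is negative. Clipping at 0 supplies the
    nonnegativity, and \<open>ennreal\<close> does not notice it.\<close>
  have mx: "(\<lambda>t. indicator A t * max 0 (f t)) = (\<lambda>t. max 0 (indicator A t * f t))" for A and f :: "real ^ 'k::_ \<Rightarrow> real"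
    by (auto simp: indicator_def)
  have "(\<integral>\<^sup>+t\<in>\<tau> ` C. ennreal (max 0 (fs_density \<phi> t)) \<partial>lborel) = (\<integral>\<^sup>+t\<in>C. ennreal (max 0 (fs_density \<psi> t)) \<partial>lborel)"
  proof (rule nn_integral_change_of_variables[OF _ _ _ inj])
    show C: "C \<in> sets borel" unfolding C_def by (rule sets_param_preimage[OF lp B(1)])
    show "(\<lambda>t. indicator C t * max 0 (fs_density \<psi> t)) \<in> borel_measurable borel"
      unfolding mx using measurable_fs_density(1)[OF lp C] by (intro borel_measurable_max) (auto simp: C_def)
    show \<tau>C: "\<tau> ` C \<in> sets borel" unfolding im by (rule sets_param_preimage[OF lpU B(1)])
    show "(\<lambda>t. indicator (\<tau> ` C) t * max 0 (fs_density \<phi> t)) \<in> borel_measurable borel"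
      unfolding mx using measurable_fs_density(1)[OF lpU \<tau>C] by (intro borel_measurable_max) (auto simp: im)
    fix t assume "t \<in> C"
    then have t: "t \<in> V" "proj (\<psi> t) \<in> W" using B(2) by (auto simp: C_def)
    show "(\<tau> has_derivative frechet_derivative \<tau> (at t)) (at t)"
      unfolding \<tau>_def by (rule chart_transition(1)[OF ch lp t])
    show "max 0 (fs_density \<psi> t) = \<bar>det (matrix (frechet_derivative \<tau> (at t)))\<bar> * max 0 (fs_density \<phi> (\<tau> t))"
      unfolding \<tau>_def chart_transition(2)[OF ch lp t] by (simp add: max_mult_distrib_left)
  qed auto
  moreover have "ennreal (max 0 x) = ennreal x" for x by (cases "x \<ge> 0") (auto simp: max_def ennreal_neg)
  ultimately show ?thesis by (simp only: im) (simp only: C_def)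
qed

text \<open>The condition under the definite description in \<open>fs_volume\<close>, named so that
  existence and uniqueness can be treated separately.\<close>

definition volume_property :: "'k::finite itself \<Rightarrow> 'n::finite cproj set \<Rightarrow> 'n cproj measure \<Rightarrow> bool"
  where "volume_property _ M \<mu> \<longleftrightarrow> sets \<mu> = sets (restrict_space borel M) \<and>
    (\<forall>U (\<phi> :: real ^ 'k \<Rightarrow> complex ^ 'n). local_param U \<phi> M \<longrightarrow>
      (\<forall>B\<in>sets \<mu>. B \<subseteq> (\<lambda>t. proj (\<phi> t)) ` U \<longrightarrow>
        emeasure \<mu> B = (\<integral>\<^sup>+t\<in>{t\<in>U. proj (\<phi> t) \<in> B}. ennreal (fs_density \<phi> t) \<partial>lborel)))"

lemma volume_propertyD:
  fixes \<phi> :: "real ^ 'k::finite \<Rightarrow> complex ^ 'n::finite"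
  assumes "volume_property TYPE('k) M \<mu>"
  shows "sets \<mu> = sets (restrict_space borel M)"
    "local_param U \<phi> M \<Longrightarrow> B \<in> sets \<mu> \<Longrightarrow> B \<subseteq> (\<lambda>t. proj (\<phi> t)) ` U \<Longrightarrow>
      emeasure \<mu> B = (\<integral>\<^sup>+t\<in>{t\<in>U. proj (\<phi> t) \<in> B}. ennreal (fs_density \<phi> t) \<partial>lborel)"
  using assms unfolding volume_property_def by blast+

lemma suminf_swap_ennreal: "(\<Sum>i. \<Sum>n. f i n) = (\<Sum>n. \<Sum>i. f i n :: ennreal)"
  using nn_integral_suminf[of "\<lambda>n i. f i n" "count_space UNIV"] by (simp add: nn_integral_count_space_nat)

lemma disjointed_split:
  assumes W: "\<And>i. open (W i)" and M: "M \<subseteq> (\<Union>i. W i)" and B: "B \<in> sets (restrict_space borel M)"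
  shows "B \<inter> disjointed W i \<in> sets (restrict_space borel M)" "disjoint_family (\<lambda>i. B \<inter> disjointed W i)"
    "(\<Union>i. B \<inter> disjointed W i) = B"
proof -
  have "range W \<subseteq> sets borel" using W by (auto intro: borel_open)
  then have "disjointed W i \<in> sets borel" using sets.range_disjointed_sets[of W borel] by auto
  then have "M \<inter> disjointed W i \<in> sets (restrict_space borel M)" by (auto simp: sets_restrict_space)
  moreover have "B \<inter> disjointed W i = B \<inter> (M \<inter> disjointed W i)" using B by (auto simp: sets_restrict_space)
  ultimately show "B \<inter> disjointed W i \<in> sets (restrict_space borel M)" using sets.Int[OF B] by simp
  show "disjoint_family (\<lambda>i. B \<inter> disjointed W i)"
    using disjoint_family_disjointed[of W] by (auto simp: disjoint_family_on_def)
  show "(\<Union>i. B \<inter> disjointed W i) = B"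
    using M B UN_disjointed_eq[of W] by (auto simp: sets_restrict_space)
qed

text \<open>Every measurable set splits along the disjointed chart domains, and on each piece the
  formula of that chart prescribes the measure.\<close>

lemma volume_property_unique:
  fixes \<phi> :: "nat \<Rightarrow> real ^ 'k::finite \<Rightarrow> complex ^ 'n::finite"
  assumes ch: "\<And>i. fs_chart M (U i) (\<phi> i) (W i) (\<kappa> i)" and M: "M \<subseteq> (\<Union>i. W i)"
    and \<mu>: "volume_property TYPE('k) M \<mu>" and \<nu>: "volume_property TYPE('k) M \<nu>"
  shows "\<mu> = \<nu>"
proof (rule measure_eqI)
  show s: "sets \<mu> = sets \<nu>" using \<mu> \<nu> by (simp add: volume_property_def)
  fix B assume B: "B \<in> sets \<mu>"
  have s1: "sets \<mu> = sets (restrict_space borel M)" using \<mu> by (simp add: volume_property_def)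
  have oW: "open (W i)" and lp: "local_param (U i) (\<phi> i) M" and im: "(\<lambda>t. proj (\<phi> i t)) ` U i = M \<inter> W i" for i
    using ch[of i] by (auto simp: fs_chart_def)
  note sp = disjointed_split[OF oW M B[unfolded s1]]
  have e: "emeasure \<mu> (B \<inter> disjointed W i) = emeasure \<nu> (B \<inter> disjointed W i)" for i
  proof -
    have "B \<inter> disjointed W i \<subseteq> (\<lambda>t. proj (\<phi> i t)) ` U i"
      using disjointed_subset[of W i] B im s1 by (auto simp: sets_restrict_space)
    moreover have "B \<inter> disjointed W i \<in> sets \<mu>" "B \<inter> disjointed W i \<in> sets \<nu>" using sp(1)[of i] s1 s by auto
    ultimately show ?thesis using volume_propertyD(2)[OF \<mu> lp[of i]] volume_propertyD(2)[OF \<nu> lp[of i]] by simp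
  qed
  have r: "range (\<lambda>i. B \<inter> disjointed W i) \<subseteq> sets \<mu>" "range (\<lambda>i. B \<inter> disjointed W i) \<subseteq> sets \<nu>"
    using sp(1) s1 s by blast+
  have "emeasure \<mu> B = (\<Sum>i. emeasure \<mu> (B \<inter> disjointed W i))"
    using suminf_emeasure[OF r(1) sp(2)] by (simp only: sp(3))
  also have "\<dots> = emeasure \<nu> B" unfolding e
    using suminf_emeasure[OF r(2) sp(2)] by (simp only: sp(3))
  finally show "emeasure \<mu> B = emeasure \<nu> B" .
qed

lemma nn_integral_disjoint_split:
  fixes A :: "nat \<Rightarrow> 'a set"
  assumes "disjoint_family A" "\<And>i. (\<lambda>x. f x * indicator (A i) x) \<in> borel_measurable M"
  shows "(\<integral>\<^sup>+x\<in>(\<Union>i. A i). f x \<partial>M) = (\<Sum>i. \<integral>\<^sup>+x\<in>A i. f x \<partial>M)"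
proof -
  have "(\<integral>\<^sup>+x\<in>(\<Union>i. A i). f x \<partial>M) = (\<integral>\<^sup>+x. (\<Sum>i. f x * indicator (A i) x) \<partial>M)"
    by (simp add: suminf_indicator[OF assms(1), symmetric])
  also have "\<dots> = (\<Sum>i. \<integral>\<^sup>+x\<in>A i. f x \<partial>M)" by (rule nn_integral_suminf[OF assms(2)])
  finally show ?thesis .
qed

lemma param_integral_split:
  fixes \<phi> :: "real ^ 'k::finite \<Rightarrow> complex ^ 'n::finite"
  assumes lp: "local_param U \<phi> M" and B: "\<And>n::nat. B n \<in> sets (restrict_space borel M)" "disjoint_family B"
  shows "(\<integral>\<^sup>+t\<in>{t\<in>U. proj (\<phi> t) \<in> (\<Union>n. B n)}. ennreal (fs_density \<phi> t) \<partial>lborel) =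
    (\<Sum>n. \<integral>\<^sup>+t\<in>{t\<in>U. proj (\<phi> t) \<in> B n}. ennreal (fs_density \<phi> t) \<partial>lborel)"
proof -
  have "{t\<in>U. proj (\<phi> t) \<in> (\<Union>n. B n)} = (\<Union>n. {t\<in>U. proj (\<phi> t) \<in> B n})" by auto
  moreover have "disjoint_family (\<lambda>n. {t\<in>U. proj (\<phi> t) \<in> B n})" using B(2) by (auto simp: disjoint_family_on_def)
  moreover have "(\<lambda>t. ennreal (fs_density \<phi> t) * indicator {t\<in>U. proj (\<phi> t) \<in> B n} t) \<in> borel_measurable lborel" for n
    using measurable_fs_density(2)[OF lp sets_param_preimage[OF lp B(1)[of n]]] by auto
  ultimately show ?thesis by (simp only: nn_integral_disjoint_split)
qed

text \<open>Disjointing the cover gives a candidate: add up the chart integrals. The formula for an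
  arbitrary parametrization then holds on each piece by \<open>chart_integral_eq\<close>, and the
  pieces are summed again.\<close>

lemma volume_property_exists:
  fixes \<phi> :: "nat \<Rightarrow> real ^ 'k::{finite,wellorder} \<Rightarrow> complex ^ 'n::finite"
  assumes ch: "\<And>i. fs_chart M (U i) (\<phi> i) (W i) (\<kappa> i)" and M: "M \<subseteq> (\<Union>i. W i)"
  shows "\<exists>\<mu>. volume_property TYPE('k) M \<mu>"
proof -
  have oW: "open (W i)" and lp: "local_param (U i) (\<phi> i) M" and im: "(\<lambda>t. proj (\<phi> i t)) ` U i = M \<inter> W i" for i
    using ch[of i] by (auto simp: fs_chart_def)
  define \<nu> where "\<nu> B = (\<Sum>i. \<integral>\<^sup>+t\<in>{t\<in>U i. proj (\<phi> i t) \<in> B \<inter> disjointed W i}. ennreal (fs_density (\<phi> i) t) \<partial>lborel)" for B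
  define \<A> where "\<A> = sets (restrict_space borel M)"
  define \<mu> where "\<mu> = measure_of M \<A> \<nu>"
  have sa: "sigma_algebra M \<A>" using sets.sigma_algebra_axioms[of "restrict_space borel M"] by (simp add: \<A>_def space_restrict_space)
  have ca: "countably_additive \<A> \<nu>"
  proof (rule countably_additiveI)
    fix B :: "nat \<Rightarrow> _" assume B: "range B \<subseteq> \<A>" "disjoint_family B"
    have Bi: "B n \<inter> disjointed W i \<in> sets (restrict_space borel M)" for n i
      using disjointed_split(1)[OF oW M] B by (auto simp: \<A>_def)
    have "\<nu> (\<Union>n. B n) = (\<Sum>i. \<Sum>n. \<integral>\<^sup>+t\<in>{t\<in>U i. proj (\<phi> i t) \<in> B n \<inter> disjointed W i}. ennreal (fs_density (\<phi> i) t) \<partial>lborel)"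
      unfolding \<nu>_def
    proof (intro suminf_cong)
      fix i
      have "(\<Union>n. B n) \<inter> disjointed W i = (\<Union>n. B n \<inter> disjointed W i)" by auto
      moreover have "disjoint_family (\<lambda>n. B n \<inter> disjointed W i)" using B(2) by (auto simp: disjoint_family_on_def)
      ultimately show "(\<integral>\<^sup>+t\<in>{t\<in>U i. proj (\<phi> i t) \<in> (\<Union>n. B n) \<inter> disjointed W i}. ennreal (fs_density (\<phi> i) t) \<partial>lborel)
        = (\<Sum>n. \<integral>\<^sup>+t\<in>{t\<in>U i. proj (\<phi> i t) \<in> B n \<inter> disjointed W i}. ennreal (fs_density (\<phi> i) t) \<partial>lborel)"
        using param_integral_split[OF lp[of i] Bi[of _ i]] by simp
    qed
    also have "\<dots> = (\<Sum>n. \<nu> (B n))" unfolding \<nu>_def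
      by (rule suminf_swap_ennreal)
    finally show "(\<Sum>n. \<nu> (B n)) = \<nu> (\<Union>n. B n)" ..
  qed
  have pos: "positive \<A> \<nu>" by (auto simp: positive_def \<nu>_def)
  have sp: "sets \<mu> = \<A>" unfolding \<mu>_def using sigma_algebra.sets_measure_of_eq[OF sa] by simp
  have em: "emeasure \<mu> B = \<nu> B" if "B \<in> \<A>" for B unfolding \<mu>_def
    by (rule emeasure_measure_of_sigma[OF sa pos ca that])
  have "volume_property TYPE('k) M \<mu>"
    unfolding volume_property_def
  proof (intro conjI allI impI ballI)
    show "sets \<mu> = sets (restrict_space borel M)" using sp by (simp add: \<A>_def)
    fix V and \<psi> :: "real ^ 'k::_ \<Rightarrow> complex ^ 'n" and B
    assume lpV: "local_param V \<psi> M" and B: "B \<in> sets \<mu>" "B \<subseteq> (\<lambda>t. proj (\<psi> t)) ` V"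
    have BA: "B \<in> \<A>" using B(1) sp by simp
    note sB = disjointed_split[OF oW M BA[unfolded \<A>_def]]
    have "emeasure \<mu> B = (\<Sum>i. \<integral>\<^sup>+t\<in>{t\<in>V. proj (\<psi> t) \<in> B \<inter> disjointed W i}. ennreal (fs_density \<psi> t) \<partial>lborel)"
      unfolding em[OF BA] \<nu>_def
    proof (intro suminf_cong chart_integral_eq[OF ch lpV sB(1)])
      show "B \<inter> disjointed W i \<subseteq> W i" for i using disjointed_subset[of W i] by auto
      show "B \<inter> disjointed W i \<subseteq> (\<lambda>t. proj (\<psi> t)) ` V" for i using B(2) by auto
    qed
    also have "\<dots> = (\<integral>\<^sup>+t\<in>{t\<in>V. proj (\<psi> t) \<in> (\<Union>i. B \<inter> disjointed W i)}. ennreal (fs_density \<psi> t) \<partial>lborel)"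
      by (rule param_integral_split[OF lpV sB(1,2), symmetric])
    also have "\<dots> = (\<integral>\<^sup>+t\<in>{t\<in>V. proj (\<psi> t) \<in> B}. ennreal (fs_density \<psi> t) \<partial>lborel)" unfolding sB(3) ..
    finally show "emeasure \<mu> B = (\<integral>\<^sup>+t\<in>{t\<in>V. proj (\<psi> t) \<in> B}. ennreal (fs_density \<psi> t) \<partial>lborel)" .
  qed
  then show ?thesis by blast
qed

lemma fs_volume_property:
  fixes \<phi> :: "nat \<Rightarrow> real ^ 'k::{finite,wellorder} \<Rightarrow> complex ^ 'n::finite"
  assumes "\<And>i. fs_chart M (U i) (\<phi> i) (W i) (\<kappa> i)" "M \<subseteq> (\<Union>i. W i)"
  shows "volume_property TYPE('k) M (fs_volume TYPE('k) M)"
proof -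
  have "\<exists>!\<mu>. volume_property TYPE('k) M \<mu>"
    using volume_property_exists[OF assms] volume_property_unique[OF assms] by blast
  from theI'[OF this] show ?thesis
    unfolding fs_volume_def volume_property_def[abs_def] .
qed

text \<open>On \<open>R\<close> the volume is the image of a weighted Lebesgue measure under the
  parametrization. For sets this is the volume property; once the two measures are equal, it holds
  for functions.\<close>

lemma nn_integral_volume_param:
  fixes \<phi> :: "real ^ 'k::finite \<Rightarrow> complex ^ 'n::finite"
  assumes \<mu>: "volume_property TYPE('k) M \<mu>" and lp: "local_param U \<phi> M" and R: "R \<in> sets \<mu>" "R \<subseteq> (\<lambda>t. proj (\<phi> t)) ` U"
    and f: "f \<in> borel_measurable \<mu>"
  shows "(\<integral>\<^sup>+P\<in>R. f P \<partial>\<mu>) = (\<integral>\<^sup>+t\<in>{t\<in>U. proj (\<phi> t) \<in> R}. f (proj (\<phi> t)) * ennreal (fs_density \<phi> t) \<partial>lborel)"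
proof -
  have s\<mu>: "sets \<mu> = sets (restrict_space borel M)" using \<mu> by (simp add: volume_property_def)
  then have sp\<mu>: "space \<mu> = M" using sets_eq_imp_space_eq[OF s\<mu>] by (simp add: space_restrict_space)
  define A where "A = {t\<in>U. proj (\<phi> t) \<in> R}"
  have A: "A \<in> sets borel" "A \<subseteq> U" unfolding A_def using sets_param_preimage[OF lp] R s\<mu> by auto
  define L where "L = restrict_space lborel A"
  have pm: "(\<lambda>t. proj (\<phi> t)) \<in> measurable L \<mu>"
  proof (rule measurableI)
    fix t assume "t \<in> space L" then show "proj (\<phi> t) \<in> space \<mu>" using lp A by (auto simp: L_def space_restrict_space sp\<mu> local_param_def)
  next
    fix B assume B: "B \<in> sets \<mu>"
    have "{t\<in>U. proj (\<phi> t) \<in> B \<inter> R} \<in> sets borel" by (rule sets_param_preimage[OF lp]) (use B R s\<mu> in auto)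
    moreover have "(\<lambda>t. proj (\<phi> t)) -` B \<inter> space L = {t\<in>U. proj (\<phi> t) \<in> B \<inter> R}"
      by (auto simp: L_def space_restrict_space A_def)
    ultimately show "(\<lambda>t. proj (\<phi> t)) -` B \<inter> space L \<in> sets L" using A by (auto simp: L_def sets_restrict_space_iff A_def)
  qed
  have dm: "(\<lambda>t. ennreal (fs_density \<phi> t)) \<in> borel_measurable L"
    unfolding L_def using measurable_fs_density(2)[OF lp A] A(1) by (subst borel_measurable_restrict_space_iff_ennreal) auto
  define N where "N = distr (density L (\<lambda>t. ennreal (fs_density \<phi> t))) \<mu> (\<lambda>t. proj (\<phi> t))"
  have "density \<mu> (indicator R) = N"
  proof (rule measure_eqI)
    show "sets (density \<mu> (indicator R)) = sets N" by (simp add: N_def)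
    fix B assume "B \<in> sets (density \<mu> (indicator R))"
    then have B: "B \<in> sets \<mu>" by simp
    have e: "(\<lambda>t. proj (\<phi> t)) -` B \<inter> A = {t\<in>U. proj (\<phi> t) \<in> B \<inter> R}" by (auto simp: A_def)
    have "emeasure N B = (\<integral>\<^sup>+t. ennreal (fs_density \<phi> t) * indicator ((\<lambda>t. proj (\<phi> t)) -` B \<inter> space L) t \<partial>L)"
      unfolding N_def using pm dm B by (simp add: emeasure_distr emeasure_density measurable_sets[OF pm B])
    also have "\<dots> = (\<integral>\<^sup>+t. ennreal (fs_density \<phi> t) * indicator ((\<lambda>t. proj (\<phi> t)) -` B \<inter> A) t * indicator A t \<partial>lborel)"
      unfolding L_def using A(1) by (subst nn_integral_restrict_space) (auto simp: space_restrict_space)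
    also have "\<dots> = (\<integral>\<^sup>+t\<in>{t\<in>U. proj (\<phi> t) \<in> B \<inter> R}. ennreal (fs_density \<phi> t) \<partial>lborel)"
      unfolding e by (intro nn_integral_cong) (auto simp: indicator_def A_def)
    also have "\<dots> = emeasure \<mu> (B \<inter> R)"
    proof -
      have "B \<inter> R \<in> sets \<mu>" "B \<inter> R \<subseteq> (\<lambda>t. proj (\<phi> t)) ` U" using B R by auto
      then show ?thesis by (rule volume_propertyD(2)[OF \<mu> lp, symmetric])
    qed
    finally show "emeasure (density \<mu> (indicator R)) B = emeasure N B"
      using B R(1) by (simp add: emeasure_density indicator_inter_arith[symmetric] Int_commute mult.commute)
  qed
  then have "integral\<^sup>N (density \<mu> (indicator R)) f = integral\<^sup>N N f" by simp
  also have "integral\<^sup>N N f = (\<integral>\<^sup>+t. ennreal (fs_density \<phi> t) * f (proj (\<phi> t)) \<partial>L)"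
    unfolding N_def using pm dm f measurable_compose[OF pm f] by (simp add: nn_integral_distr nn_integral_density)
  also have "\<dots> = (\<integral>\<^sup>+t\<in>A. ennreal (fs_density \<phi> t) * f (proj (\<phi> t)) \<partial>lborel)"
    unfolding L_def using A(1) by (subst nn_integral_restrict_space) auto
  also have "integral\<^sup>N (density \<mu> (indicator R)) f = (\<integral>\<^sup>+P\<in>R. f P \<partial>\<mu>)"
    using R(1) f by (simp add: nn_integral_density mult.commute)
  finally show ?thesis by (simp add: A_def mult.commute)
qed

section \<open>Curvature of plane curves\<close>

text \<open>The Hermitian form with real part \<open>fs_form\<close>. Its homogeneity under complex
  scalars is what makes tangent and normal lines of a complex curve tractable.\<close>

definition herm :: "complex ^ 'n::finite \<Rightarrow> complex ^ 'n \<Rightarrow> complex ^ 'n \<Rightarrow> complex"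
  where "herm z u v = (hinner z z * hinner u v - hinner u z * hinner z v) / (hinner z z)\<^sup>2"

lemma fs_form_herm: "fs_form z u v = Re (herm z u v)"
proof -
  have "(hinner z z)\<^sup>2 = of_real (norm z ^ 4)" by (simp add: hinner_self power_mult[symmetric])
  then show ?thesis by (simp add: herm_def fs_form_altdef)
qed

lemma herm_simps:
  "herm z (u + v) w = herm z u w + herm z v w" "herm z w (u + v) = herm z w u + herm z w v"
  "herm z (c *s u) w = c * herm z u w" "herm z u (c *s w) = cnj c * herm z u w"
  "herm z (- u) w = - herm z u w" "herm z u (- w) = - herm z u w"
  "herm z (u - v) w = herm z u w - herm z v w" "herm z w (u - v) = herm z w u - herm z w v"
proof -
  show add: "herm z (u + v) w = herm z u w + herm z v w" "herm z w (u + v) = herm z w u + herm z w v" for u v w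
    by (simp_all add: herm_def hinner_simps add_divide_distrib[symmetric] algebra_simps)
  show "herm z (c *s u) w = c * herm z u w" "herm z u (c *s w) = cnj c * herm z u w"
    by (simp_all add: herm_def hinner_simps algebra_simps diff_divide_distrib)
  show minus: "herm z (- u) w = - herm z u w" "herm z u (- w) = - herm z u w" for u w
    by (simp_all add: herm_def hinner_simps minus_divide_left)
  show "herm z (u - v) w = herm z u w - herm z v w" "herm z w (u - v) = herm z w u - herm z w v"
    using add(1)[of u "- v"] add(2)[of w u "- v"] by (simp_all add: minus)
qed

lemma cnj_herm: "cnj (herm z u v) = herm z v u"
  by (simp add: herm_def cnj_hinner mult.commute)

lemma herm_base: "herm z (c *s z) v = 0" "herm z v (c *s z) = 0"
  by (simp_all add: herm_def hinner_simps)

lemma herm_self: "herm z u u = of_real (fs_form z u u)"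
proof -
  have "Im (herm z u u) = 0" using cnj_herm[of z u u] by (metis complex_cnj Im_complex_of_real Reals_cnj_iff complex_is_Real_iff)
  then show ?thesis by (simp add: fs_form_herm complex_eq_iff)
qed

lemma fs_form_self:
  assumes "z \<noteq> 0"
  shows "fs_form z u u = (norm (u - (hinner u z / hinner z z) *s z))\<^sup>2 / (norm z)\<^sup>2"
proof -
  define c where "c = hinner u z / hinner z z"
  have nz: "hinner z z \<noteq> 0" using assms by (simp add: hinner_self)
  have c: "cnj c = hinner z u / hinner z z" by (simp add: c_def cnj_hinner)
  have "hinner (u - c *s z) (u - c *s z) = hinner u u - hinner u z * hinner z u / hinner z z"
    using nz by (simp add: hinner_simps c c_def field_simps)
  then have "herm z u u = hinner (u - c *s z) (u - c *s z) / hinner z z"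
    unfolding \<open>hinner (u - c *s z) (u - c *s z) = _\<close> using nz by (simp add: herm_def field_simps power2_eq_square)
  then have "of_real (fs_form z u u) = complex_of_real ((norm (u - c *s z))\<^sup>2 / (norm z)\<^sup>2)"
    by (simp only: herm_self[symmetric] hinner_self of_real_divide)
  then show ?thesis unfolding c_def using of_real_eq_iff by blast
qed

lemma fs_form_nonneg: "fs_form z u u \<ge> 0"
  by (cases "z = 0") (simp add: fs_form_def hinner_simps, simp add: fs_form_self)

lemma fs_form_eq_0_iff:
  assumes "z \<noteq> 0"
  shows "fs_form z u u = 0 \<longleftrightarrow> (\<exists>c. u = c *s z)"
proof
  assume "fs_form z u u = 0"
  then show "\<exists>c. u = c *s z" using assms by (simp add: fs_form_self) blast
next
  assume "\<exists>c. u = c *s z"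
  then show "fs_form z u u = 0" by (auto simp: fs_form_herm herm_base)
qed

section \<open>The Levi-Civita connection in an affine chart\<close>

definition chart_incl :: "3 \<Rightarrow> complex ^ 2 \<Rightarrow> complex ^ 3"
  where "chart_incl k w = (if k = 1 then vector [0, w $ 1, w $ 2]
    else if k = 2 then vector [w $ 1, 0, w $ 2] else vector [w $ 1, w $ 2, 0])"

lemma affine_lift_eq: "affine_lift k w = axis k 1 + chart_incl k w"
  using exhaust_3[of k] by (auto simp: affine_lift_def chart_incl_def vec_eq_iff forall_3 axis_def)

lemma chart_incl_add: "chart_incl k (u + v) = chart_incl k u + chart_incl k v"
  using exhaust_3[of k] by (auto simp: chart_incl_def vec_eq_iff forall_3)

lemma chart_incl_smult: "chart_incl k (c *s u) = c *s chart_incl k u"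
  using exhaust_3[of k] by (auto simp: chart_incl_def vec_eq_iff forall_3)

lemma chart_incl_scaleR: "chart_incl k (r *\<^sub>R u) = r *\<^sub>R chart_incl k u"
  using exhaust_3[of k] by (auto simp: chart_incl_def vec_eq_iff forall_3)

lemma chart_incl_minus: "chart_incl k (- u) = - chart_incl k u" "chart_incl k (u - v) = chart_incl k u - chart_incl k v"
  using exhaust_3[of k] by (auto simp: chart_incl_def vec_eq_iff forall_3)

lemmas chart_incl_simps = chart_incl_add chart_incl_smult chart_incl_minus

lemma bounded_linear_chart_incl: "bounded_linear (chart_incl k)"
  by (intro linear_conv_bounded_linear[THEN iffD1] linearI) (simp_all add: chart_incl_add chart_incl_scaleR)

lemma chart_incl_component: "chart_incl k w $ k = 0" "affine_lift k w $ k = 1"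
  using exhaust_3[of k] by (auto simp: chart_incl_def affine_lift_def)

lemma affine_lift_nonzero: "affine_lift k w \<noteq> 0"
  using chart_incl_component(2)[of k w] by (metis zero_index zero_neq_one)

lemma has_derivative_affine_lift: "(affine_lift k has_derivative chart_incl k) (at w)"
  unfolding affine_lift_eq[abs_def]
  by (auto intro!: derivative_eq_intros bounded_linear_imp_has_derivative bounded_linear_chart_incl)

lemma fs_pullback_affine:
  "fs_pullback (affine_lift k) p u v = fs_form (affine_lift k p) (chart_incl k u) (chart_incl k v)"
  using frechet_derivative_at[OF has_derivative_affine_lift[of k p]] by (simp add: fs_pullback_def)

text \<open>Null vectors of the form are multiples of the base point. The lift has
  \<open>k\<close>-th coordinate 1 and a chart vector has 0 there, so the multiple is
  trivial.\<close>

lemma fs_pullback_affine_pos: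
  assumes "fs_pullback (affine_lift k) p u u = 0"
  shows "u = 0"
proof -
  obtain c where c: "chart_incl k u = c *s affine_lift k p"
    using assms fs_form_eq_0_iff[OF affine_lift_nonzero] by (auto simp: fs_pullback_affine)
  then have "chart_incl k u $ k = c * affine_lift k p $ k" by simp
  then have "c = 0" by (simp add: chart_incl_component)
  then have "chart_incl k u = 0" using c by simp
  then show ?thesis using exhaust_3[of k] by (auto simp: chart_incl_def vec_eq_iff forall_3 forall_2)
qed

lemma bounded_bilinear_hinner: "bounded_bilinear (hinner :: complex ^ 'n::finite \<Rightarrow> _)"
proof (rule bounded_bilinear.intro)
  show "\<exists>K. \<forall>a b :: complex ^ 'n. norm (hinner a b) \<le> norm a * norm b * K"
  proof (intro exI allI)
    fix u v :: "complex ^ 'n"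
    have "norm (hinner u v) \<le> (\<Sum>i\<in>UNIV. cmod (u $ i) * cmod (v $ i))"
      unfolding hinner_def by (rule order_trans[OF norm_sum]) (simp add: norm_mult)
    also have "\<dots> \<le> (\<Sum>i\<in>(UNIV::'n set). norm u * norm v)"
      by (intro sum_mono mult_mono) (auto intro: Finite_Cartesian_Product.norm_nth_le)
    finally show "norm (hinner u v) \<le> norm u * norm v * CARD('n)" by (simp add: mult.commute)
  qed
qed (simp_all add: hinner_simps hinner_scaleR scaleR_conv_of_real[where 'a = complex])

lemma has_vector_derivative_divide:
  fixes f g :: "real \<Rightarrow> complex"
  assumes "(f has_vector_derivative f') (at t)" "(g has_vector_derivative g') (at t)" "g t \<noteq> 0"
  shows "((\<lambda>s. f s / g s) has_vector_derivative (f' * g t - f t * g') / (g t * g t)) (at t)"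
proof -
  have "((\<lambda>s. f s / g s) has_derivative (\<lambda>h. (h *\<^sub>R f' * g t - f t * (h *\<^sub>R g')) / (g t * g t))) (at t)"
    using has_derivative_divide'[OF assms(1,2)[unfolded has_vector_derivative_def] assms(3)] .
  moreover have "(h *\<^sub>R f' * g t - f t * (h *\<^sub>R g')) / (g t * g t) = h *\<^sub>R ((f' * g t - f t * g') / (g t * g t))" for h
    by (simp add: scaleR_conv_of_real algebra_simps diff_divide_distrib)
  ultimately show ?thesis by (simp add: has_vector_derivative_def)
qed

text \<open>The Christoffel operator of the Fubini-Study metric in an affine chart with lift \<open>Z\<close>; it is
  complex bilinear because the metric is Kaehler.\<close>

definition fs_christoffel :: "3 \<Rightarrow> complex ^ 2 \<Rightarrow> complex ^ 2 \<Rightarrow> complex ^ 2 \<Rightarrow> complex ^ 2"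
  where "fs_christoffel k p u v = (let z = affine_lift k p in
    - ((hinner (chart_incl k u) z / hinner z z) *s v + (hinner (chart_incl k v) z / hinner z z) *s u))"

text \<open>The product rule along a curve with moving base point and fields. With constant fields
  it yields the derivatives in the Koszul formula; with a normal and a tangent field it
  differentiates their orthogonality.\<close>

lemma metric_compatibility:
  fixes q u v :: "real \<Rightarrow> complex ^ 2"
  assumes q: "(q has_vector_derivative q') (at t)" and u: "(u has_vector_derivative u') (at t)" and v: "(v has_vector_derivative v') (at t)"
  shows "((\<lambda>s. fs_pullback (affine_lift k) (q s) (u s) (v s)) has_real_derivative
    fs_pullback (affine_lift k) (q t) (fs_christoffel k (q t) q' (u t) + u') (v t)
    + fs_pullback (affine_lift k) (q t) (u t) (fs_christoffel k (q t) q' (v t) + v')) (at t)"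
proof -
  let ?i = "chart_incl k"
  define Z where "Z s = affine_lift k (q s)" for s
  have Z: "(Z has_vector_derivative ?i q') (at t)"
    using diff_chain_at[OF q[unfolded has_vector_derivative_def] has_derivative_affine_lift[of k]]
    by (simp add: has_vector_derivative_def o_def Z_def[abs_def] chart_incl_scaleR)
  have U: "((\<lambda>s. ?i (u s)) has_vector_derivative ?i u') (at t)" and V: "((\<lambda>s. ?i (v s)) has_vector_derivative ?i v') (at t)"
    using bounded_linear.has_vector_derivative[OF bounded_linear_chart_incl] u v by auto
  note B = bounded_bilinear.has_vector_derivative[OF bounded_bilinear_hinner]
  \<comment> \<open>Naming the products reduces the claim to a rational identity. A suffix 1 marks a
    derivative in the first slot, a suffix 2 one in the conjugated second slot.\<close>
  define N where "N = hinner (Z t) (Z t)"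
  have N: "N \<noteq> 0" using affine_lift_nonzero by (simp add: N_def Z_def hinner_self)
  define a where "a = hinner (?i (u t)) (?i (v t))"
  define b where "b = hinner (?i (u t)) (Z t)"
  define c where "c = hinner (Z t) (?i (v t))"
  define a1 where "a1 = hinner (?i u') (?i (v t))"
  define a2 where "a2 = hinner (?i (u t)) (?i v')"
  define b1 where "b1 = hinner (?i u') (Z t)"
  define b2 where "b2 = hinner (?i (u t)) (?i q')"
  define c1 where "c1 = hinner (?i q') (?i (v t))"
  define c2 where "c2 = hinner (Z t) (?i v')"
  define n1 where "n1 = hinner (?i q') (Z t)"
  define n2 where "n2 = hinner (Z t) (?i q')"
  have dN: "((\<lambda>s. hinner (Z s) (Z s)) has_vector_derivative n2 + n1) (at t)" using B[OF Z Z] by (simp add: n1_def n2_def)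
  have da: "((\<lambda>s. hinner (?i (u s)) (?i (v s))) has_vector_derivative a2 + a1) (at t)" using B[OF U V] by (simp add: a1_def a2_def)
  have db: "((\<lambda>s. hinner (?i (u s)) (Z s)) has_vector_derivative b2 + b1) (at t)" using B[OF U Z] by (simp add: b1_def b2_def)
  have dc: "((\<lambda>s. hinner (Z s) (?i (v s))) has_vector_derivative c2 + c1) (at t)" using B[OF Z V] by (simp add: c1_def c2_def)
  have num: "((\<lambda>s. hinner (Z s) (Z s) * hinner (?i (u s)) (?i (v s)) - hinner (?i (u s)) (Z s) * hinner (Z s) (?i (v s)))
     has_vector_derivative (N * (a2 + a1) + (n2 + n1) * a - (b * (c2 + c1) + (b2 + b1) * c))) (at t)"
    using has_vector_derivative_diff[OF has_vector_derivative_mult[OF dN da] has_vector_derivative_mult[OF db dc]]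
    by (simp add: N_def a_def b_def c_def)
  have den: "((\<lambda>s. (hinner (Z s) (Z s))\<^sup>2) has_vector_derivative (N * (n2 + n1) + (n2 + n1) * N)) (at t)"
    using has_vector_derivative_mult[OF dN dN] by (simp add: N_def power2_eq_square)
  have "((\<lambda>s. herm (Z s) (?i (u s)) (?i (v s))) has_vector_derivative
    ((N * (a2 + a1) + (n2 + n1) * a - (b * (c2 + c1) + (b2 + b1) * c)) * N\<^sup>2 - (N * a - b * c) * (N * (n2 + n1) + (n2 + n1) * N)) / (N\<^sup>2 * N\<^sup>2)) (at t)"
    using has_vector_derivative_divide[OF num den] N unfolding herm_def by (simp add: N_def a_def b_def c_def)
  \<comment> \<open>The terms with suffix 1 are complex linear in the derivatives, those with suffix
    2 conjugate linear. Each group is the Hermitian form with one covariant derivative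
    inserted.\<close>
  also have "((N * (a2 + a1) + (n2 + n1) * a - (b * (c2 + c1) + (b2 + b1) * c)) * N\<^sup>2 - (N * a - b * c) * (N * (n2 + n1) + (n2 + n1) * N)) / (N\<^sup>2 * N\<^sup>2)
    = (- (n1 / N * ((N * a - b * c) / N\<^sup>2) + b / N * ((N * c1 - n1 * c) / N\<^sup>2)) + (N * a1 - b1 * c) / N\<^sup>2)
      + (- (n2 / N * ((N * a - b * c) / N\<^sup>2) + c / N * ((N * b2 - b * n2) / N\<^sup>2)) + (N * a2 - b * c2) / N\<^sup>2)"
    using N by (simp add: field_simps power2_eq_square)
  also have "- (n1 / N * ((N * a - b * c) / N\<^sup>2) + b / N * ((N * c1 - n1 * c) / N\<^sup>2)) + (N * a1 - b1 * c) / N\<^sup>2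
     = herm (Z t) (?i (fs_christoffel k (q t) q' (u t) + u')) (?i (v t))"
    by (simp add: fs_christoffel_def Let_def Z_def[symmetric] chart_incl_simps herm_simps del: minus_add_distrib)
       (simp add: herm_def N_def a_def b_def c_def a1_def b1_def c1_def n1_def mult_ac)
  also have "- (n2 / N * ((N * a - b * c) / N\<^sup>2) + c / N * ((N * b2 - b * n2) / N\<^sup>2)) + (N * a2 - b * c2) / N\<^sup>2
     = herm (Z t) (?i (u t)) (?i (fs_christoffel k (q t) q' (v t) + v'))"
    by (simp add: fs_christoffel_def Let_def Z_def[symmetric] chart_incl_simps herm_simps cnj_hinner del: minus_add_distrib)
       (simp add: herm_def N_def a_def b_def c_def a2_def b2_def c2_def n2_def mult_ac)
  finally have "((\<lambda>s. Re (herm (Z s) (?i (u s)) (?i (v s)))) has_vector_derivative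
     Re (herm (Z t) (?i (fs_christoffel k (q t) q' (u t) + u')) (?i (v t)) + herm (Z t) (?i (u t)) (?i (fs_christoffel k (q t) q' (v t) + v')))) (at t)"
    by (rule bounded_linear.has_vector_derivative[OF bounded_linear_Re])
  then show ?thesis
    by (simp add: has_real_derivative_iff_has_vector_derivative fs_pullback_affine fs_form_herm Z_def)
qed

lemma fs_pullback_affine_add:
  "fs_pullback (affine_lift k) p (u + v) w = fs_pullback (affine_lift k) p u w + fs_pullback (affine_lift k) p v w"
  "fs_pullback (affine_lift k) p (u - v) w = fs_pullback (affine_lift k) p u w - fs_pullback (affine_lift k) p v w"
  by (simp_all add: fs_pullback_affine fs_form_herm chart_incl_simps herm_simps)

lemma fs_pullback_affine_commute: "fs_pullback (affine_lift k) p u v = fs_pullback (affine_lift k) p v u"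
  using cnj_herm[of "affine_lift k p" "chart_incl k u" "chart_incl k v"]
  unfolding fs_pullback_affine fs_form_herm by (metis cnj.simps(1))

lemma differentiable_fs_pullback_affine:
  "(\<lambda>q. fs_pullback (affine_lift k) q u v) differentiable (at p)"
proof -
  note B = bounded_bilinear.FDERIV[OF bounded_bilinear_hinner]
  have nz: "(hinner (affine_lift k p) (affine_lift k p))\<^sup>2 \<noteq> 0" by (simp add: hinner_self affine_lift_nonzero)
  have "\<exists>D. ((\<lambda>q. herm (affine_lift k q) (chart_incl k u) (chart_incl k v)) has_derivative D) (at p)"
    unfolding herm_def
    by (rule exI, rule has_derivative_divide', (rule has_derivative_diff has_derivative_mult has_derivative_power B has_derivative_affine_lift has_derivative_const)+, rule nz)
  then show ?thesis unfolding fs_pullback_affine fs_form_herm differentiable_def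
    using bounded_linear.has_derivative[OF bounded_linear_Re] by blast
qed

lemma frechet_fs_pullback_affine:
  "frechet_derivative (\<lambda>q. fs_pullback (affine_lift k) q u v) (at p) x =
    fs_pullback (affine_lift k) p (fs_christoffel k p x u) v + fs_pullback (affine_lift k) p u (fs_christoffel k p x v)"
proof -
  let ?f = "\<lambda>q. fs_pullback (affine_lift k) q u v"
  have D: "(?f has_derivative frechet_derivative ?f (at p)) (at p)"
    using differentiable_fs_pullback_affine frechet_derivative_works by blast
  have l: "((\<lambda>s. p + s *\<^sub>R x) has_vector_derivative x) (at 0)"
    by (auto intro!: derivative_eq_intros)
  have "((\<lambda>s. ?f (p + s *\<^sub>R x)) has_derivative (\<lambda>h. frechet_derivative ?f (at p) (h *\<^sub>R x))) (at 0)"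
    using diff_chain_at[OF l[unfolded has_vector_derivative_def], of ?f] D by (simp add: o_def)
  moreover have "frechet_derivative ?f (at p) (h *\<^sub>R x) = frechet_derivative ?f (at p) x * h" for h
    using D by (simp add: has_derivative_def bounded_linear.linear linear_scale)
  ultimately have 1: "((\<lambda>s. ?f (p + s *\<^sub>R x)) has_real_derivative frechet_derivative ?f (at p) x) (at 0)"
    by (simp add: has_field_derivative_def mult_commute_abs)
  have 2: "((\<lambda>s. ?f (p + s *\<^sub>R x)) has_real_derivative
     fs_pullback (affine_lift k) p (fs_christoffel k p x u) v + fs_pullback (affine_lift k) p u (fs_christoffel k p x v)) (at 0)"
    using metric_compatibility[OF l has_vector_derivative_const has_vector_derivative_const, of k u v] by simp
  show ?thesis by (rule DERIV_unique[OF 1 2])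
qed

lemma fs_christoffel_commute: "fs_christoffel k p u v = fs_christoffel k p v u"
  by (simp add: fs_christoffel_def Let_def add.commute)

text \<open>Metric compatibility turns each derivative into two products with
  \<open>fs_christoffel\<close>. Its symmetry cancels all but one equal pair in the Koszul sum, and
  definiteness of the metric makes the solution unique.\<close>

lemma christoffel_affine: "christoffel (fs_pullback (affine_lift k)) p u v = fs_christoffel k p u v"
proof -
  let ?g = "fs_pullback (affine_lift k)"
  have kz: "frechet_derivative (\<lambda>q. ?g q v x) (at p) u + frechet_derivative (\<lambda>q. ?g q u x) (at p) v
      - frechet_derivative (\<lambda>q. ?g q u v) (at p) x = 2 * ?g p (fs_christoffel k p u v) x" for x
    unfolding frechet_fs_pullback_affine
    by (simp add: fs_christoffel_commute[of k p v u] fs_christoffel_commute[of k p x u] fs_christoffel_commute[of k p x v]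
        fs_pullback_affine_commute[of k p v] fs_pullback_affine_commute[of k p u])
  show ?thesis unfolding christoffel_def kz
  proof (rule the_equality)
    fix y assume "\<forall>x. 2 * ?g p y x = 2 * ?g p (fs_christoffel k p u v) x"
    then have "?g p (y - fs_christoffel k p u v) (y - fs_christoffel k p u v) = 0" by (simp add: fs_pullback_affine_add(2))
    then show "y = fs_christoffel k p u v" using fs_pullback_affine_pos by fastforce
  qed auto
qed

section \<open>Second derivatives of forms and Euler's relations\<close>

definition form_hess :: "nat \<Rightarrow> (nat \<Rightarrow> nat \<Rightarrow> complex) \<Rightarrow> complex ^ 3 \<Rightarrow> complex ^ 3 \<Rightarrow> complex ^ 3"
  where "form_hess d a z h = (\<chi> i. if d = 0 then 0 else dotc (form_grad (d - 1) (partial_coeffs d a i) z) h)"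

lemma dotc_simps:
  "dotc (u + v) w = dotc u w + dotc v w" "dotc u (v + w) = dotc u v + dotc u w"
  "dotc (c *s u) w = c * dotc u w" "dotc u (c *s w) = c * dotc u w"
  "dotc (- u) w = - dotc u w" "dotc u (- w) = - dotc u w"
  "dotc (u - v) w = dotc u w - dotc v w" "dotc u (v - w) = dotc u v - dotc u w"
  "dotc 0 w = 0" "dotc u 0 = 0"
  by (simp_all add: dotc_def sum.distrib sum_subtractf sum_negf sum_distrib_left algebra_simps)

lemma has_derivative_vec_lambda:
  fixes f :: "'a::euclidean_space \<Rightarrow> 'b::euclidean_space ^ 'n::finite"
  assumes "\<And>i. ((\<lambda>x. f x $ i) has_derivative (\<lambda>h. f' h $ i)) (at x)"
  shows "(f has_derivative f') (at x)"
  unfolding has_derivative_componentwise_within[of f f' x UNIV]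
  using assms by (auto simp: Basis_vec_def inner_axis intro: has_derivative_inner_left)

lemma has_derivative_form_grad: "(form_grad d a has_derivative form_hess d a z) (at z)"
proof (rule has_derivative_vec_lambda)
  fix i
  show "((\<lambda>z. form_grad d a z $ i) has_derivative (\<lambda>h. form_hess d a z h $ i)) (at z)"
    using has_derivative_ternary_form[of "d - 1" "partial_coeffs d a i" z] by (cases "d = 0") (simp_all add: form_grad_def form_hess_def)
qed

lemma form_hess_linear: "form_hess d a z (u + v) = form_hess d a z u + form_hess d a z v"
  "form_hess d a z (c *s u) = c *s form_hess d a z u"
  by (simp_all add: form_hess_def vec_eq_iff dotc_simps)

lemma form_grad_scale: "form_grad d a (c *s z) = c ^ (d - 1) *s form_grad d a z"
  by (simp add: form_grad_def vec_eq_iff ternary_form_scale)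

text \<open>For \<open>d < 2\<close> the Hessian is 0, so the truncated exponent
  \<open>d - 2\<close> does no harm.\<close>

lemma form_hess_scale: "form_hess d a (c *s z) h = c ^ (d - 2) *s form_hess d a z h"
  by (simp add: form_hess_def vec_eq_iff form_grad_scale dotc_simps numeral_2_eq_2)

lemma bounded_linear_smult_left: "bounded_linear (\<lambda>c::complex. c *s (z :: complex ^ 'n::finite))"
  by (intro linear_conv_bounded_linear[THEN iffD1] linearI) (simp_all add: vec_eq_iff algebra_simps)

lemma euler_form: "dotc (form_grad d a z) z = of_nat d * ternary_form d a z"
proof -
  have 1: "((\<lambda>c. ternary_form d a (c *s z)) has_derivative (\<lambda>h. dotc (form_grad d a (1 *s z)) (h *s z))) (at 1)"
    using diff_chain_at[OF bounded_linear_imp_has_derivative[OF bounded_linear_smult_left] has_derivative_ternary_form, where x = "1 :: complex"]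
    by (simp add: o_def)
  have 2: "((\<lambda>c. ternary_form d a (c *s z)) has_field_derivative of_nat d * ternary_form d a z) (at 1)"
    unfolding ternary_form_scale by (auto intro!: derivative_eq_intros)
  have "((\<lambda>c. ternary_form d a (c *s z)) has_field_derivative dotc (form_grad d a z) z) (at 1)"
    using 1 by (simp add: has_field_derivative_def dotc_simps mult.commute[of _ "dotc _ _"])
  then show ?thesis using 2 DERIV_unique by blast
qed

lemma euler_grad: "form_hess d a z z = of_nat (d - 1) *s form_grad d a z"
  unfolding vec_eq_iff form_hess_def by (cases "d = 0") (simp_all add: euler_form, simp_all add: form_grad_def algebra_simps)

lemma has_derivative_dotc:
  assumes "(f has_derivative f') (at t)" "(g has_derivative g') (at t)"
  shows "((\<lambda>s. dotc (f s) (g s)) has_derivative (\<lambda>h. dotc (f t) (g' h) + dotc (f' h) (g t))) (at t)"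
proof -
  have c: "((\<lambda>s. f s $ i) has_derivative (\<lambda>h. f' h $ i)) (at t)" "((\<lambda>s. g s $ i) has_derivative (\<lambda>h. g' h $ i)) (at t)" for i
    using bounded_linear.has_derivative[OF bounded_linear_vec_nth] assms by auto
  show ?thesis unfolding dotc_def
    by (auto intro!: derivative_eq_intros c simp: sum.distrib)
qed

text \<open>This is Euler's relation for \<open>F\<close>, differentiated. It stands in for the
  symmetry of the Hessian.\<close>

lemma form_hess_base_right: "dotc (form_hess d a z h) z = of_nat (d - 1) * dotc (form_grad d a z) h"
proof (cases "d = 0")
  case True then show ?thesis by (simp add: form_hess_def dotc_def)
next
  case False
  have 1: "((\<lambda>z. dotc (form_grad d a z) z) has_derivative (\<lambda>h. dotc (form_grad d a z) h + dotc (form_hess d a z h) z)) (at z)"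
    by (rule has_derivative_dotc[OF has_derivative_form_grad has_derivative_ident])
  have 2: "((\<lambda>z. dotc (form_grad d a z) z) has_derivative (\<lambda>h. of_nat d * dotc (form_grad d a z) h)) (at z)"
    unfolding euler_form by (auto intro!: derivative_eq_intros has_derivative_ternary_form)
  have "dotc (form_grad d a z) h + dotc (form_hess d a z h) z = of_nat d * dotc (form_grad d a z) h"
    using fun_cong[OF has_derivative_unique[OF 1 2]] .
  moreover have "of_nat d = 1 + (of_nat (d - 1) :: complex)" using False by (cases d) auto
  ultimately show ?thesis by (simp add: algebra_simps)
qed

definition cnjv :: "complex ^ 'n::finite \<Rightarrow> complex ^ 'n" where "cnjv u = (\<chi> i. cnj (u $ i))"

lemma hinner_cnjv: "hinner (cnjv u) v = cnj (dotc u v)" "hinner u (cnjv v) = dotc u v" "norm (cnjv u) = norm u"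
proof -
  show "hinner (cnjv u) v = cnj (dotc u v)" "hinner u (cnjv v) = dotc u v" by (simp_all add: hinner_def dotc_def cnjv_def)
  have "(norm (cnjv u))\<^sup>2 = (norm u)\<^sup>2" by (simp add: norm_vec_power2 cnjv_def)
  then show "norm (cnjv u) = norm u" by simp
qed

section \<open>The curve in an affine chart\<close>

locale smooth_form =
  fixes d :: nat and a :: "nat \<Rightarrow> nat \<Rightarrow> complex"
  assumes smooth: "\<And>z. z \<noteq> 0 \<Longrightarrow> ternary_form d a z = 0 \<Longrightarrow> form_grad d a z \<noteq> 0"
begin

abbreviation F where "F \<equiv> ternary_form d a"
abbreviation G where "G \<equiv> form_grad d a"

definition curve where "curve = {proj z | z. z \<noteq> 0 \<and> F z = 0}"

lemma proj_in_curve: "z \<noteq> 0 \<Longrightarrow> proj z \<in> curve \<longleftrightarrow> F z = 0"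
  by (auto simp: curve_def proj_eq_iff ternary_form_scale)

lemma affine_part_curve: "affine_part k curve = {w. F (affine_lift k w) = 0}"
  by (auto simp: affine_part_def proj_in_curve affine_lift_nonzero)

text \<open>In the chart \<open>k\<close>: the gradient of the equation, a tangent field, and the horizontal lift of
  \<open>cnjv G\<close>, which is a normal field.\<close>

definition gm :: "3 \<Rightarrow> complex ^ 2 \<Rightarrow> complex ^ 2"
  where "gm k q = (\<chi> i. dotc (G (affine_lift k q)) (chart_incl k (axis i 1)))"

definition tau :: "3 \<Rightarrow> complex ^ 2 \<Rightarrow> complex ^ 2"
  where "tau k q = vector [- gm k q $ 2, gm k q $ 1]"

definition nu :: "3 \<Rightarrow> complex ^ 2 \<Rightarrow> complex ^ 2"
  where "nu k q = (\<chi> i. cnj (gm k q $ i) - cnj (G (affine_lift k q) $ k) * q $ i)"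

lemma dotc_G_incl: "dotc (G (affine_lift k q)) (chart_incl k u) = gm k q $ 1 * u $ 1 + gm k q $ 2 * u $ 2"
  using exhaust_3[of k] by (auto simp: dotc_def sum_3 gm_def chart_incl_def axis_def)

lemma dotc_G_tau: "dotc (G (affine_lift k q)) (chart_incl k (tau k q)) = 0"
  by (simp add: dotc_G_incl tau_def)

text \<open>The vector \<open>cnjv G\<close> need not have vanishing \<open>k\<close>-th coordinate.
  Correcting it by a multiple of the base point brings it into the chart without changing any
  Fubini-Study product.\<close>

lemma chart_incl_nu: "chart_incl k (nu k q) = cnjv (G (affine_lift k q)) - cnj (G (affine_lift k q) $ k) *s affine_lift k q"
proof -
  have "gm 1 q $ 1 = G (affine_lift 1 q) $ 2" "gm 1 q $ 2 = G (affine_lift 1 q) $ 3"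
    "gm 2 q $ 1 = G (affine_lift 2 q) $ 1" "gm 2 q $ 2 = G (affine_lift 2 q) $ 3"
    "gm 3 q $ 1 = G (affine_lift 3 q) $ 1" "gm 3 q $ 2 = G (affine_lift 3 q) $ 2"
    by (simp_all add: gm_def dotc_def sum_3 chart_incl_def axis_def)
  then show ?thesis using exhaust_3[of k]
    by (auto simp: chart_incl_def nu_def vec_eq_iff forall_3 cnjv_def affine_lift_def)
qed

text \<open>\<open>gm\<close> holds the components of the gradient other than the
  \<open>k\<close>-th. If they vanish, Euler's relation on the curve kills the \<open>k\<close>-th
  as well, against smoothness.\<close>

lemma gm_nonzero:
  assumes "F (affine_lift k q) = 0"
  shows "gm k q \<noteq> 0"
proof
  assume 0: "gm k q = 0"
  have "dotc (G (affine_lift k q)) (affine_lift k q) = 0" using assms by (simp add: euler_form)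
  then have "dotc (G (affine_lift k q)) (axis k 1) = 0"
    unfolding affine_lift_eq[of k q] dotc_simps using dotc_G_incl[of k q q] 0 by (simp add: affine_lift_eq[symmetric])
  moreover have "dotc (G (affine_lift k q)) (axis k 1) = G (affine_lift k q) $ k"
    by (simp add: dotc_def axis_def if_distrib cong: if_cong)
  ultimately have k: "G (affine_lift k q) $ k = 0" by simp
  have "gm k q $ 1 = 0" "gm k q $ 2 = 0" using 0 by auto
  then have "G (affine_lift k q) = 0"
    using k exhaust_3[of k] by (auto simp: gm_def dotc_def sum_3 chart_incl_def axis_def vec_eq_iff forall_3)
  then show False using smooth[OF affine_lift_nonzero assms] by simp
qed

lemma tau_nonzero: "F (affine_lift k q) = 0 \<Longrightarrow> tau k q \<noteq> 0"
  using gm_nonzero[of k q] by (auto simp: tau_def vec_eq_iff forall_2)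

lemma kernel_gm:
  assumes "F (affine_lift k q) = 0" "dotc (G (affine_lift k q)) (chart_incl k u) = 0"
  shows "\<exists>c. u = c *s tau k q"
proof -
  have e: "gm k q $ 1 * u $ 1 + gm k q $ 2 * u $ 2 = 0" using assms(2) by (simp add: dotc_G_incl)
  have "gm k q $ 1 \<noteq> 0 \<or> gm k q $ 2 \<noteq> 0" using gm_nonzero[OF assms(1)] by (auto simp: vec_eq_iff forall_2)
  then show ?thesis
  proof
    assume n: "gm k q $ 1 \<noteq> 0"
    have "u $ 1 = - gm k q $ 2 * u $ 2 / gm k q $ 1" using e n by (simp add: field_simps eq_neg_iff_add_eq_0)
    then show ?thesis using n by (intro exI[of _ "u $ 2 / gm k q $ 1"]) (simp add: tau_def vec_eq_iff forall_2)
  next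
    assume n: "gm k q $ 2 \<noteq> 0"
    have "u $ 2 = - gm k q $ 1 * u $ 1 / gm k q $ 2" using e n by (simp add: field_simps eq_neg_iff_add_eq_0 add.commute)
    then show ?thesis using n by (intro exI[of _ "- u $ 1 / gm k q $ 2"]) (simp add: tau_def vec_eq_iff forall_2)
  qed
qed

text \<open>The implicit function theorem in an arbitrary frame, since it is needed for several.
  Tangent curves use a first direction tangent to the curve, graph patches use the frame of the
  projection, and at a branch point the two directions are exchanged.\<close>

lemma graph_over_tangent:
  fixes e0 e1 e2 :: "complex ^ 3"
  assumes "F (e0 + x0 *s e1 + y0 *s e2) = 0" "dotc (G (e0 + x0 *s e1 + y0 *s e2)) e2 \<noteq> 0"
  shows "\<exists>D D' h. open D \<and> open D' \<and> x0 \<in> D \<and> y0 \<in> D' \<and> h x0 = y0 \<and> (\<forall>x\<in>D. h x \<in> D') \<and>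
    (\<forall>x\<in>D. \<forall>y\<in>D'. F (e0 + x *s e1 + y *s e2) = 0 \<longleftrightarrow> y = h x) \<and>
    (\<forall>x\<in>D. dotc (G (e0 + x *s e1 + h x *s e2)) e2 \<noteq> 0) \<and>
    (\<forall>x\<in>D. (h has_field_derivative - dotc (G (e0 + x *s e1 + h x *s e2)) e1 / dotc (G (e0 + x *s e1 + h x *s e2)) e2) (at x))"
proof -
  have bl: "((\<lambda>z. e0 + fst z *s e1 + snd z *s e2) has_derivative (\<lambda>v. fst v *s e1 + snd v *s e2)) (at p)" for p :: "complex \<times> complex"
    by (rule derivative_eq_intros refl bounded_linear.has_derivative[OF bounded_linear_smult_left])+ simp
  have der: "((\<lambda>z. F (e0 + fst z *s e1 + snd z *s e2)) has_derivative
      (\<lambda>v. dotc (G (e0 + x *s e1 + y *s e2)) e1 * fst v + dotc (G (e0 + x *s e1 + y *s e2)) e2 * snd v)) (at (x, y))" for x y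
    using diff_chain_at[OF bl[of "(x, y)"] has_derivative_ternary_form[of d a]] by (simp add: o_def dotc_simps mult.commute)
  have cont: "continuous_on UNIV (\<lambda>z. dotc (G (e0 + fst z *s e1 + snd z *s e2)) e)" for e
  proof -
    have "continuous_on UNIV (\<lambda>z. e0 + fst z *s e1 + snd z *s e2)"
      by (intro continuous_at_imp_continuous_on ballI has_derivative_continuous[OF bl])
    moreover have "continuous_on UNIV (\<lambda>z. dotc (G z) e)"
      using has_derivative_continuous[OF has_derivative_dotc[OF has_derivative_form_grad has_derivative_const]]
      by (auto intro!: continuous_at_imp_continuous_on)
    ultimately show ?thesis using continuous_on_compose2[of UNIV "\<lambda>z. dotc (G z) e"] by blast
  qed
  show ?thesis
  proof (rule implicit_function_complex[of "\<lambda>x y. F (e0 + x *s e1 + y *s e2)" "\<lambda>x y. dotc (G (e0 + x *s e1 + y *s e2)) e1"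
       "\<lambda>x y. dotc (G (e0 + x *s e1 + y *s e2)) e2", OF der cont cont assms], goal_cases)
    case (1 D D' h)
    show ?case
      by (intro exI[of _ D] exI[of _ D'] exI[of _ h] conjI ballI) (fact 1 | rule 1, assumption+)+
  qed
qed

text \<open>One inclusion differentiates the equation along a curve. Conversely, over its tangent
  direction the curve is a graph with slope 0 at the point, so a straight line in the parameter
  lifts to a curve with any prescribed velocity \<open>c *s tau k q\<close>.\<close>

lemma tangent_space_curve:
  assumes q: "F (affine_lift k q) = 0"
  shows "tangent_space (affine_part k curve) q = {c *s tau k q | c. True}"
proof (intro equalityI subsetI)
  fix u assume "u \<in> tangent_space (affine_part k curve) q"
  then obtain c where c: "c 0 = q" "\<forall>\<^sub>F t in nhds 0. F (affine_lift k (c t)) = 0" "(c has_vector_derivative u) (at 0)"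
    by (auto simp: tangent_space_def affine_part_curve)
  have "((\<lambda>t. affine_lift k (c t)) has_derivative (\<lambda>h. chart_incl k (h *\<^sub>R u))) (at 0)"
    using diff_chain_at[OF c(3)[unfolded has_vector_derivative_def] has_derivative_affine_lift] by (simp add: o_def)
  from diff_chain_at[OF this has_derivative_ternary_form]
  have "((\<lambda>t. F (affine_lift k (c t))) has_derivative (\<lambda>h. dotc (G (affine_lift k q)) (chart_incl k (h *\<^sub>R u)))) (at 0)"
    by (simp add: o_def c(1))
  moreover have "((\<lambda>t. F (affine_lift k (c t))) has_derivative (\<lambda>h. 0)) (at 0)"
  proof (rule has_derivative_transform_eventually[OF has_derivative_const[of 0]])
    show "\<forall>\<^sub>F t in at 0. 0 = F (affine_lift k (c t))" using c(2) by (auto simp: eventually_at_filter elim: eventually_mono)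
  qed (use q c(1) in auto)
  ultimately have "(\<lambda>h. dotc (G (affine_lift k q)) (chart_incl k (h *\<^sub>R u))) = (\<lambda>h. 0)" by (rule has_derivative_unique)
  then have "dotc (G (affine_lift k q)) (chart_incl k (1 *\<^sub>R u)) = 0" by (rule fun_cong)
  then show "u \<in> {c *s tau k q | c. True}" using kernel_gm[OF q] by auto
next
  fix u assume "u \<in> {c *s tau k q | c. True}"
  then obtain c where u: "u = c *s tau k q" by blast
  \<comment> \<open>A direction transversal to the curve, in which the equation can be solved. One
    of the two coordinate directions serves.\<close>
  obtain f2 where f2: "dotc (G (affine_lift k q)) (chart_incl k f2) \<noteq> 0"
  proof -
    have "gm k q $ 1 \<noteq> 0 \<or> gm k q $ 2 \<noteq> 0" using gm_nonzero[OF q] by (auto simp: vec_eq_iff forall_2)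
    then have "dotc (G (affine_lift k q)) (chart_incl k (axis 1 1)) \<noteq> 0 \<or> dotc (G (affine_lift k q)) (chart_incl k (axis 2 1)) \<noteq> 0"
      by (simp add: gm_def)
    then show ?thesis using that by blast
  qed
  define e1 where "e1 = chart_incl k (tau k q)"
  define e2 where "e2 = chart_incl k f2"
  have "F (affine_lift k q + 0 *s e1 + 0 *s e2) = 0" "dotc (G (affine_lift k q + 0 *s e1 + 0 *s e2)) e2 \<noteq> 0"
    using q f2 by (simp_all add: e2_def)
  from graph_over_tangent[OF this] obtain D D' h where h: "open D" "0 \<in> D" "h 0 = 0" "\<forall>x\<in>D. h x \<in> D'"
    "\<forall>x\<in>D. \<forall>y\<in>D'. F (affine_lift k q + x *s e1 + y *s e2) = 0 \<longleftrightarrow> y = h x"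
    "\<forall>x\<in>D. (h has_field_derivative - dotc (G (affine_lift k q + x *s e1 + h x *s e2)) e1 / dotc (G (affine_lift k q + x *s e1 + h x *s e2)) e2) (at x)"
    by (elim exE conjE) (rule that)
  have h0: "(h has_field_derivative 0) (at 0)" using bspec[OF h(6) h(2)] by (simp add: h(3) e1_def dotc_G_tau)
  define \<gamma> where "\<gamma> = (\<lambda>t::real. q + (of_real t * c) *s tau k q + h (of_real t * c) *s f2)"
  have lift: "affine_lift k (\<gamma> t) = affine_lift k q + (of_real t * c) *s e1 + h (of_real t * c) *s e2" for t
    by (simp add: \<gamma>_def affine_lift_eq chart_incl_simps e1_def e2_def)
  have "((\<lambda>t. h (of_real t * c)) has_vector_derivative 0) (at 0)"
  proof -
    have "((\<lambda>t::real. of_real t * c) has_vector_derivative c) (at 0)"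
      by (auto simp: has_vector_derivative_def scaleR_conv_of_real intro!: derivative_eq_intros)
    moreover have "(h has_field_derivative 0) (at (of_real 0 * c))" using h0 by simp
    ultimately show ?thesis using field_vector_diff_chain_at[of "\<lambda>t. of_real t * c" c 0 h 0] by (simp add: o_def)
  qed
  then have dh: "((\<lambda>t. h (of_real t * c) *s f2) has_vector_derivative 0) (at 0)"
    using bounded_linear.has_vector_derivative[OF bounded_linear_smult_left] by fastforce
  have dl: "((\<lambda>t. (of_real t * c) *s tau k q) has_vector_derivative u) (at 0)"
  proof -
    have "((\<lambda>t::real. of_real t * c) has_vector_derivative c) (at 0)"
      by (auto simp: has_vector_derivative_def scaleR_conv_of_real intro!: derivative_eq_intros)
    from bounded_linear.has_vector_derivative[OF bounded_linear_smult_left this] show ?thesis by (simp add: u)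
  qed
  have d\<gamma>: "(\<gamma> has_vector_derivative u) (at 0)"
    unfolding \<gamma>_def using has_vector_derivative_add[OF has_vector_derivative_add[OF has_vector_derivative_const dl] dh] by simp
  have "\<forall>\<^sub>F t in nhds 0. of_real t * c \<in> D"
  proof -
    have "((\<lambda>t::real. of_real t * c) \<longlongrightarrow> of_real 0 * c) (nhds 0)" by (intro tendsto_intros filterlim_ident)
    then show ?thesis using h(1,2) by (auto simp: tendsto_def)
  qed
  then have "\<forall>\<^sub>F t in nhds 0. \<gamma> t \<in> affine_part k curve"
    by eventually_elim (use h(4,5) in \<open>auto simp: affine_part_curve lift\<close>)
  moreover have "\<gamma> 0 = q" by (simp add: \<gamma>_def h(3))
  ultimately show "u \<in> tangent_space (affine_part k curve) q" unfolding tangent_space_def using d\<gamma> by blast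
qed

end

lemma complex_line_real_basis:
  fixes t :: "complex ^ 'n::finite"
  assumes "t \<noteq> 0"
  shows "independent {t, \<i> *s t}" "span {t, \<i> *s t} = {c *s t | c. True}" "t \<noteq> \<i> *s t"
proof -
  obtain j where j: "t $ j \<noteq> 0" using assms by (auto simp: vec_eq_iff)
  have ni: "t \<noteq> k *\<^sub>R (\<i> *s t)" for k
  proof
    assume "t = k *\<^sub>R (\<i> *s t)"
    then have "t $ j = (k *\<^sub>R (\<i> *s t)) $ j" by simp
    then have "t $ j * (1 - of_real k * \<i>) = 0" by (simp add: scaleR_conv_of_real[where 'a = complex] algebra_simps)
    then have "1 - of_real k * \<i> = 0" using j by simp
    then show False by (simp add: complex_eq_iff)
  qed
  show "t \<noteq> \<i> *s t" using ni[of 1] by simp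
  have "\<i> *s t \<noteq> 0" using j by (auto simp: vec_eq_iff)
  then show "independent {t, \<i> *s t}"
    using ni by (auto simp: independent_insert span_singleton)
  show "span {t, \<i> *s t} = {c *s t | c. True}"
  proof (intro equalityI subsetI)
    fix x assume "x \<in> span {t, \<i> *s t}"
    then obtain k l where "x - k *\<^sub>R t = l *\<^sub>R (\<i> *s t)" by (auto simp: span_insert span_singleton)
    then have "x = Complex k l *s t"
      by (simp add: vec_eq_iff scaleR_conv_of_real[where 'a = complex] Complex_eq algebra_simps)
    then show "x \<in> {c *s t | c. True}" by blast
  next
    fix x assume "x \<in> {c *s t | c. True}"
    then obtain c where "x = c *s t" by blast
    then have "x = Re c *\<^sub>R t + Im c *\<^sub>R (\<i> *s t)"
      by (simp add: vec_eq_iff complex_eq_iff algebra_simps)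
    moreover have "Re c *\<^sub>R t + Im c *\<^sub>R (\<i> *s t) \<in> span {t, \<i> *s t}"
      by (intro span_add span_scale span_base) auto
    ultimately show "x \<in> span {t, \<i> *s t}" by simp
  qed
qed

text \<open>In the real basis \<open>t\<close>, \<open>\<i> *s t\<close> the matrix has diagonal
  \<open>p + Re \<beta>\<close>, \<open>p - Re \<beta>\<close> and both other entries
  \<open>Im \<beta>\<close>. The definite description ranges over all bases, so the value has to be
  confirmed for an arbitrary one.\<close>

lemma endo_det_complex_line:
  fixes t :: "complex ^ 'n::finite"
  assumes t: "t \<noteq> 0" and L: "\<And>\<zeta>. L (\<zeta> *s t) = (of_real p * \<zeta> + \<beta> * cnj \<zeta>) *s t"
  shows "endo_det {c *s t | c. True} L = p\<^sup>2 - (cmod \<beta>)\<^sup>2"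
proof -
  define P where "P = (\<lambda>c. \<exists>(e :: 2 \<Rightarrow> complex ^ 'n) (A :: real ^ 2 ^ 2).
    inj e \<and> independent (range e) \<and> span (range e) = {c *s t | c. True} \<and>
    (\<forall>j. L (e j) = (\<Sum>i\<in>UNIV. A $ i $ j *\<^sub>R e i)) \<and> c = det A)"
  have h1: "P (p\<^sup>2 - (cmod \<beta>)\<^sup>2)"
  proof -
    define e :: "2 \<Rightarrow> complex ^ 'n" where "e = (\<lambda>i. if i = 1 then t else \<i> *s t)"
    define A :: "real ^ 2 ^ 2" where "A = vector [vector [p + Re \<beta>, Im \<beta>], vector [Im \<beta>, p - Re \<beta>]]"
    have r: "range e = {t, \<i> *s t}" unfolding UNIV_2 e_def by auto
    have "inj e" using complex_line_real_basis(3)[OF t] by (auto simp: inj_on_def forall_2 e_def)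
    moreover have "L (e j) = (\<Sum>i\<in>UNIV. A $ i $ j *\<^sub>R e i)" for j
    proof -
      have "L t = (p + Re \<beta>) *\<^sub>R t + Im \<beta> *\<^sub>R (\<i> *s t)"
        using L[of 1] by (simp add: vec_eq_iff scaleR_conv_of_real[where 'a = complex]) (simp add: complex_eq_iff algebra_simps)
      moreover have "L (\<i> *s t) = Im \<beta> *\<^sub>R t + (p - Re \<beta>) *\<^sub>R (\<i> *s t)"
        using L[of \<i>] by (simp add: vec_eq_iff scaleR_conv_of_real[where 'a = complex]) (simp add: complex_eq_iff algebra_simps)
      ultimately show ?thesis using exhaust_2[of j] by (auto simp: sum_2 A_def e_def)
    qed
    moreover have "det A = p\<^sup>2 - (cmod \<beta>)\<^sup>2"
      unfolding cmod_power2 by (simp add: det_2 A_def power2_eq_square algebra_simps)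
    ultimately show ?thesis unfolding P_def
      using complex_line_real_basis(1,2)[OF t] r by (intro exI[of _ e] exI[of _ A]) auto
  qed
  have h2: "c = p\<^sup>2 - (cmod \<beta>)\<^sup>2" if Pc: "P c" for c
  proof -
    obtain e :: "2 \<Rightarrow> complex ^ 'n" and A :: "real ^ 2 ^ 2" where e: "inj e" "independent (range e)" "span (range e) = {c *s t | c. True}"
      "\<And>j. L (e j) = (\<Sum>i\<in>UNIV. A $ i $ j *\<^sub>R e i)" "c = det A" using Pc unfolding P_def by blast
    have "\<exists>\<zeta>. e j = \<zeta> *s t" for j using span_base[of "e j" "range e"] e(3) by auto
    then obtain \<zeta> where \<zeta>: "\<And>j. e j = \<zeta> j *s t" by metis
    obtain k where k: "t $ k \<noteq> 0" using t by (auto simp: vec_eq_iff)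
    have eq: "of_real p * \<zeta> j + \<beta> * cnj (\<zeta> j) = of_real (A $ 1 $ j) * \<zeta> 1 + of_real (A $ 2 $ j) * \<zeta> 2" for j
    proof -
      have "((of_real p * \<zeta> j + \<beta> * cnj (\<zeta> j)) *s t) $ k = (A $ 1 $ j *\<^sub>R (\<zeta> 1 *s t) + A $ 2 $ j *\<^sub>R (\<zeta> 2 *s t)) $ k"
        using e(4)[of j] L[of "\<zeta> j"] unfolding \<zeta> sum_2 by simp
      then have "(of_real p * \<zeta> j + \<beta> * cnj (\<zeta> j)) * t $ k = (of_real (A $ 1 $ j) * \<zeta> 1 + of_real (A $ 2 $ j) * \<zeta> 2) * t $ k"
        by (simp add: scaleR_conv_of_real[where 'a = complex] algebra_simps)
      then show ?thesis using k by simp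
    qed
    define x1 where "x1 = Re (\<zeta> 1)" define y1 where "y1 = Im (\<zeta> 1)"
    define x2 where "x2 = Re (\<zeta> 2)" define y2 where "y2 = Im (\<zeta> 2)"
    define b where "b = Re \<beta>" define b' where "b' = Im \<beta>"
    define a11 a12 a21 a22 where "a11 = A $ 1 $ 1" and "a12 = A $ 1 $ 2" and "a21 = A $ 2 $ 1" and "a22 = A $ 2 $ 2"
    have q: "p * x1 + (b * x1 + b' * y1) = a11 * x1 + a21 * x2" "p * y1 + (b' * x1 - b * y1) = a11 * y1 + a21 * y2"
      "p * x2 + (b * x2 + b' * y2) = a12 * x1 + a22 * x2" "p * y2 + (b' * x2 - b * y2) = a12 * y1 + a22 * y2"
      using eq[of 1] eq[of 2]
      by (simp_all add: complex_eq_iff x1_def y1_def x2_def y2_def b_def b'_def a11_def a12_def a21_def a22_def)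
    have ind: "f = 0 \<and> g = 0" if "f *\<^sub>R e 1 + g *\<^sub>R e 2 = 0" for f g
    proof -
      have ne: "e 1 \<noteq> e 2" using injD[OF e(1), of 1 2] by auto
      have "independent {e 1, e 2}" using e(2) by (rule independent_mono) auto
      moreover have "(\<Sum>v\<in>{e 1, e 2}. (if v = e 1 then f else g) *\<^sub>R v) = 0" using that ne by simp
      ultimately have "v \<in> {e 1, e 2} \<Longrightarrow> (if v = e 1 then f else g) = 0" for v
        using independentD[of "{e 1, e 2}" "{e 1, e 2}" "\<lambda>v. if v = e 1 then f else g" v] by simp
      from this[of "e 1"] this[of "e 2"] ne show ?thesis by simp
    qed
    \<comment> \<open>The determinant of the basis vectors in real coordinates along
      \<open>t\<close>; it is nonzero because they are independent over the reals.\<close>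
    have \<delta>: "x1 * y2 - y1 * x2 \<noteq> 0"
    proof
      assume z: "x1 * y2 - y1 * x2 = 0"
      have comb: "r *\<^sub>R e 1 + s *\<^sub>R e 2 = (of_real r * \<zeta> 1 + of_real s * \<zeta> 2) *s t" for r s
        unfolding \<zeta> by (simp add: vec_eq_iff scaleR_conv_of_real[where 'a = complex] distrib_right)
      have "of_real x2 * \<zeta> 1 + of_real (- x1) * \<zeta> 2 = 0" "of_real y2 * \<zeta> 1 + of_real (- y1) * \<zeta> 2 = 0"
        using z unfolding complex_eq_iff x1_def x2_def y1_def y2_def by (simp_all add: mult.commute)
      then have h: "x2 *\<^sub>R e 1 + (- x1) *\<^sub>R e 2 = 0" "y2 *\<^sub>R e 1 + (- y1) *\<^sub>R e 2 = 0"
        unfolding comb by simp_all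
      have "x1 = 0" "y1 = 0" using ind[OF h(1)] ind[OF h(2)] by simp_all
      then have "\<zeta> 1 = 0" by (simp add: complex_eq_iff x1_def y1_def)
      then have "1 *\<^sub>R e 1 + 0 *\<^sub>R e 2 = 0" by (simp add: \<zeta>)
      from ind[OF this] show False by simp
    qed
    \<comment> \<open>Multiplicativity of the determinant, written out: the coordinate matrix of the
      basis times \<open>A\<close> is the matrix of \<open>L\<close> times the coordinate
      matrix.\<close>
    have "c * (x1 * y2 - y1 * x2) = (a11 * x1 + a21 * x2) * (a12 * y1 + a22 * y2) - (a11 * y1 + a21 * y2) * (a12 * x1 + a22 * x2)"
    proof -
      have c: "c = a11 * a22 - a12 * a21" using e(5) by (simp add: det_2 a11_def a12_def a21_def a22_def)
      show ?thesis unfolding c by (simp add: algebra_simps)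
    qed
    also have "\<dots> = (p\<^sup>2 - (b\<^sup>2 + b'\<^sup>2)) * (x1 * y2 - y1 * x2)"
      unfolding q[symmetric] by (simp add: power2_eq_square algebra_simps)
    finally have "c = p\<^sup>2 - (b\<^sup>2 + b'\<^sup>2)" using \<delta> by simp
    then show ?thesis by (simp add: cmod_power2 b_def b'_def)
  qed
  have "(THE c. P c) = p\<^sup>2 - (cmod \<beta>)\<^sup>2" by (rule the_equality) (rule h1, rule h2)
  then show ?thesis unfolding endo_det_def P_def .
qed

lemma continuous_on_affine_lift [continuous_intros]:
  "continuous_on S f \<Longrightarrow> continuous_on S (\<lambda>x. affine_lift k (f x))"
  by (rule continuous_on_compose2[of UNIV "affine_lift k"])
    (auto intro!: continuous_at_imp_continuous_on has_derivative_continuous[OF has_derivative_affine_lift])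

lemma continuous_on_chart_incl [continuous_intros]:
  "continuous_on S f \<Longrightarrow> continuous_on S (\<lambda>x. chart_incl k (f x))"
  by (rule bounded_linear.continuous_on[OF bounded_linear_chart_incl])

lemma continuous_on_dotc [continuous_intros]:
  "continuous_on S f \<Longrightarrow> continuous_on S g \<Longrightarrow> continuous_on S (\<lambda>x. dotc (f x) (g x))"
  unfolding dotc_def by (intro continuous_intros)

lemma continuous_on_form_grad [continuous_intros]:
  assumes "continuous_on S f"
  shows "continuous_on S (\<lambda>x. form_grad d a (f x))"
proof -
  have "continuous_on UNIV (form_grad d a)"
    by (auto intro!: continuous_at_imp_continuous_on has_derivative_continuous[OF has_derivative_form_grad])
  then show ?thesis by (rule continuous_on_compose2[OF _ assms]) auto
qed

lemma continuous_on_form_hess [continuous_intros]: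
  assumes "continuous_on S f" "continuous_on S h"
  shows "continuous_on S (\<lambda>x. form_hess d a (f x) (h x))"
proof -
  have "continuous_on S (\<lambda>x. if d = 0 then 0 else dotc (form_grad (d - 1) (partial_coeffs d a i) (f x)) (h x))" for i
    by (cases "d = 0") (auto intro!: continuous_intros assms)
  then show ?thesis unfolding form_hess_def by (intro continuous_on_vec_lambda)
qed

lemma continuous_on_herm [continuous_intros]:
  assumes "continuous_on S f" "continuous_on S g" "continuous_on S h" "\<And>x. x \<in> S \<Longrightarrow> f x \<noteq> 0"
  shows "continuous_on S (\<lambda>x. herm (f x) (g x) (h x))"
  unfolding herm_def by (intro continuous_intros assms) (use assms(4) in \<open>auto simp: hinner_self\<close>)

lemma C1_onI:
  assumes "\<And>t. t \<in> U \<Longrightarrow> (f has_derivative f' t) (at t)" "\<And>u. continuous_on U (\<lambda>t. f' t u)"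
  shows "C1_on U f"
proof -
  have "frechet_derivative f (at t) = f' t" if "t \<in> U" for t using frechet_derivative_at[OF assms(1)[OF that]] by simp
  then have "continuous_on U (\<lambda>t. frechet_derivative f (at t) u)" for u
    using assms(2)[of u] by (auto cong: continuous_on_cong)
  then show ?thesis using assms(1) by (auto simp: C1_on_def differentiable_def)
qed

section \<open>Normal spaces and the shape operator\<close>

context smooth_form
begin

lemma herm_nu:
  assumes "F (affine_lift k q) = 0"
  shows "herm (affine_lift k q) (chart_incl k (nu k q)) (chart_incl k u)
    = cnj (dotc (G (affine_lift k q)) (chart_incl k u)) / hinner (affine_lift k q) (affine_lift k q)"
proof -
  have "dotc (G (affine_lift k q)) (affine_lift k q) = 0" using assms by (simp add: euler_form)
  then show ?thesis unfolding chart_incl_nu herm_simps herm_base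
    by (simp add: herm_def hinner_cnjv hinner_self affine_lift_nonzero power2_eq_square)
qed

lemma herm_nu_tau:
  assumes "F (affine_lift k q) = 0"
  shows "herm (affine_lift k q) (chart_incl k (nu k q)) (chart_incl k (tau k q)) = 0"
  by (simp add: herm_nu[OF assms] dotc_G_tau)

lemma dotc_G_nu:
  assumes "F (affine_lift k q) = 0"
  shows "dotc (G (affine_lift k q)) (chart_incl k (nu k q)) = of_real ((norm (G (affine_lift k q)))\<^sup>2)"
proof -
  have "dotc (G (affine_lift k q)) (affine_lift k q) = 0" using assms by (simp add: euler_form)
  moreover have "dotc u (cnjv u) = hinner u u" for u :: "complex ^ 3" by (simp add: dotc_def hinner_def cnjv_def)
  ultimately show ?thesis by (simp add: chart_incl_nu dotc_simps hinner_self)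
qed

lemma herm_tau_pos:
  assumes "F (affine_lift k q) = 0"
  shows "fs_form (affine_lift k q) (chart_incl k (tau k q)) (chart_incl k (tau k q)) > 0"
  using fs_form_nonneg[of "affine_lift k q" "chart_incl k (tau k q)"] fs_pullback_affine_pos[of k q "tau k q"] tau_nonzero[OF assms]
  by (force simp: fs_pullback_affine less_le)

text \<open>The tangent space is a complex line. Real orthogonality to all multiples of
  \<open>tau\<close> makes the Hermitian product vanish, as the multiple by that product itself
  shows.\<close>

lemma normal_space_curve_iff:
  assumes q: "F (affine_lift k q) = 0"
  shows "v \<in> normal_space (fs_pullback (affine_lift k)) (affine_part k curve) q \<longleftrightarrow>
    herm (affine_lift k q) (chart_incl k v) (chart_incl k (tau k q)) = 0"
proof -
  let ?h = "herm (affine_lift k q) (chart_incl k v) (chart_incl k (tau k q))"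
  have "v \<in> normal_space (fs_pullback (affine_lift k)) (affine_part k curve) q \<longleftrightarrow> (\<forall>c. Re (cnj c * ?h) = 0)"
    by (auto simp: normal_space_def tangent_space_curve[OF q] fs_pullback_affine fs_form_herm chart_incl_smult herm_simps)
  also have "\<dots> \<longleftrightarrow> ?h = 0"
  proof
    assume "\<forall>c. Re (cnj c * ?h) = 0"
    then have "Re (cnj ?h * ?h) = 0" by blast
    then have "(Re ?h)\<^sup>2 + (Im ?h)\<^sup>2 = 0" by (simp add: power2_eq_square)
    then show "?h = 0" unfolding sum_power2_eq_zero_iff by (simp add: complex_eq_iff)
  qed auto
  finally show ?thesis .
qed

text \<open>Cramer's rule expands every vector in \<open>tau\<close> and \<open>nu\<close>;
  orthogonality to \<open>tau\<close> then removes the tangential coordinate.\<close>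

lemma normal_space_curve:
  assumes q: "F (affine_lift k q) = 0"
  shows "normal_space (fs_pullback (affine_lift k)) (affine_part k curve) q = {c *s nu k q | c. True}"
proof (intro equalityI subsetI)
  fix v assume "v \<in> {c *s nu k q | c. True}"
  then show "v \<in> normal_space (fs_pullback (affine_lift k)) (affine_part k curve) q"
    by (auto simp: normal_space_curve_iff[OF q] chart_incl_smult herm_simps herm_nu_tau[OF q])
next
  fix v assume "v \<in> normal_space (fs_pullback (affine_lift k)) (affine_part k curve) q"
  then have h0: "herm (affine_lift k q) (chart_incl k v) (chart_incl k (tau k q)) = 0" by (simp add: normal_space_curve_iff[OF q])
  \<comment> \<open>The determinant of \<open>tau\<close> and \<open>nu\<close> is minus the squared
    norm of the gradient, nonzero by smoothness.\<close>
  define \<delta> where "\<delta> = tau k q $ 1 * nu k q $ 2 - tau k q $ 2 * nu k q $ 1"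
  have "\<delta> = - dotc (G (affine_lift k q)) (chart_incl k (nu k q))"
    by (simp add: \<delta>_def dotc_G_incl tau_def algebra_simps)
  then have \<delta>: "\<delta> \<noteq> 0" using smooth[OF affine_lift_nonzero q] by (simp add: dotc_G_nu[OF q])
  define x where "x = (v $ 1 * nu k q $ 2 - v $ 2 * nu k q $ 1) / \<delta>"
  define y where "y = (tau k q $ 1 * v $ 2 - tau k q $ 2 * v $ 1) / \<delta>"
  have v: "v = x *s tau k q + y *s nu k q"
  proof -
    have eq: "\<delta> * v $ 1 = (v $ 1 * nu k q $ 2 - v $ 2 * nu k q $ 1) * tau k q $ 1 + (tau k q $ 1 * v $ 2 - tau k q $ 2 * v $ 1) * nu k q $ 1"
      "\<delta> * v $ 2 = (v $ 1 * nu k q $ 2 - v $ 2 * nu k q $ 1) * tau k q $ 2 + (tau k q $ 1 * v $ 2 - tau k q $ 2 * v $ 1) * nu k q $ 2"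
      unfolding \<delta>_def by algebra+
    have xy: "v $ 1 * nu k q $ 2 - v $ 2 * nu k q $ 1 = \<delta> * x" "tau k q $ 1 * v $ 2 - tau k q $ 2 * v $ 1 = \<delta> * y"
      using \<delta> by (simp_all add: x_def y_def)
    have "\<delta> * v $ 1 = \<delta> * (x * tau k q $ 1 + y * nu k q $ 1)" "\<delta> * v $ 2 = \<delta> * (x * tau k q $ 2 + y * nu k q $ 2)"
      using eq unfolding xy by (simp_all only: distrib_left mult.assoc)
    then show ?thesis using \<delta> by (simp add: vec_eq_iff forall_2)
  qed
  have "x * herm (affine_lift k q) (chart_incl k (tau k q)) (chart_incl k (tau k q)) = 0"
    using h0 unfolding v chart_incl_simps herm_simps herm_nu_tau[OF q] by simp
  then have "x = 0" using herm_tau_pos[OF q] by (simp add: herm_self)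
  then show "v \<in> {c *s nu k q | c. True}" using v by auto
qed

definition gm_deriv :: "3 \<Rightarrow> complex ^ 2 \<Rightarrow> complex ^ 2 \<Rightarrow> complex ^ 2"
  where "gm_deriv k q h = (\<chi> i. dotc (form_hess d a (affine_lift k q) (chart_incl k h)) (chart_incl k (axis i 1)))"

lemma has_derivative_G_lift: "((\<lambda>q. G (affine_lift k q)) has_derivative (\<lambda>h. form_hess d a (affine_lift k q) (chart_incl k h))) (at q)"
  using diff_chain_at[OF has_derivative_affine_lift has_derivative_form_grad] by (simp add: o_def)

lemma has_derivative_gm: "(gm k has_derivative gm_deriv k q) (at q)"
proof (rule has_derivative_vec_lambda)
  show "((\<lambda>q. gm k q $ i) has_derivative (\<lambda>h. gm_deriv k q h $ i)) (at q)" for i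
    using has_derivative_dotc[OF has_derivative_G_lift has_derivative_const] by (simp add: gm_def gm_deriv_def dotc_simps)
qed

definition tau_deriv :: "3 \<Rightarrow> complex ^ 2 \<Rightarrow> complex ^ 2 \<Rightarrow> complex ^ 2"
  where "tau_deriv k q h = vector [- gm_deriv k q h $ 2, gm_deriv k q h $ 1]"

lemma has_derivative_tau: "(tau k has_derivative tau_deriv k q) (at q)"
proof (rule has_derivative_vec_lambda)
  have c: "((\<lambda>q. gm k q $ i) has_derivative (\<lambda>h. gm_deriv k q h $ i)) (at q)" for i
    by (rule bounded_linear.has_derivative[OF bounded_linear_vec_nth has_derivative_gm])
  show "((\<lambda>q. tau k q $ i) has_derivative (\<lambda>h. tau_deriv k q h $ i)) (at q)" for i
    using exhaust_2[of i] c has_derivative_minus[OF c] by (auto simp: tau_def tau_deriv_def)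
qed

lemma tau_deriv_smult: "tau_deriv k q (c *s h) = c *s tau_deriv k q h"
  by (simp add: tau_deriv_def gm_deriv_def chart_incl_smult form_hess_linear dotc_simps vec_eq_iff forall_2)

text \<open>The relation \<open>dotc_G_tau\<close> holds at every point of the chart, not only on
  the curve, so it can be differentiated in all directions. The Hessian that appears is the source
  of the second fundamental form.\<close>

lemma dotc_G_tau_deriv:
  "dotc (G (affine_lift k q)) (chart_incl k (tau_deriv k q h)) = - dotc (form_hess d a (affine_lift k q) (chart_incl k h)) (chart_incl k (tau k q))"
proof -
  have 1: "((\<lambda>q. dotc (G (affine_lift k q)) (chart_incl k (tau k q))) has_derivative
     (\<lambda>h. dotc (G (affine_lift k q)) (chart_incl k (tau_deriv k q h)) + dotc (form_hess d a (affine_lift k q) (chart_incl k h)) (chart_incl k (tau k q)))) (at q)"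
    by (rule has_derivative_dotc[OF has_derivative_G_lift bounded_linear.has_derivative[OF bounded_linear_chart_incl has_derivative_tau]])
  have 2: "((\<lambda>q. dotc (G (affine_lift k q)) (chart_incl k (tau k q))) has_derivative (\<lambda>h. 0)) (at q)"
    by (simp add: dotc_G_tau)
  show ?thesis using fun_cong[OF has_derivative_unique[OF 1 2], of h] by (simp add: eq_neg_iff_add_eq_0)
qed

text \<open>Supplies a normal extension of every normal vector at \<open>p\<close>, the witness that
  the definite description of \<open>shape_operator\<close> needs.\<close>

lemma normal_field_nu: "normal_field (fs_pullback (affine_lift k)) (affine_part k curve) p (\<lambda>q. \<sigma> *s nu k q)"
proof -
  define nu' where "nu' q h = (\<chi> i. cnj (gm_deriv k q h $ i) - (cnj (G (affine_lift k q) $ k) * h $ i + cnj (form_hess d a (affine_lift k q) (chart_incl k h) $ k) * q $ i))" for q h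
  have "(nu k has_derivative nu' q) (at q)" for q
  proof (rule has_derivative_vec_lambda)
    fix i
    have c: "((\<lambda>q. cnj (gm k q $ i)) has_derivative (\<lambda>h. cnj (gm_deriv k q h $ i))) (at q)"
      "((\<lambda>q. cnj (G (affine_lift k q) $ k)) has_derivative (\<lambda>h. cnj (form_hess d a (affine_lift k q) (chart_incl k h) $ k))) (at q)"
      by (intro has_derivative_cnj bounded_linear.has_derivative[OF bounded_linear_vec_nth] has_derivative_gm has_derivative_G_lift)+
    have d: "((\<lambda>q::complex ^ 2. q $ i) has_derivative (\<lambda>h. h $ i)) (at q)"
      by (intro bounded_linear_imp_has_derivative bounded_linear_vec_nth)
    show "((\<lambda>q. nu k q $ i) has_derivative (\<lambda>h. nu' q h $ i)) (at q)"
      unfolding nu_def nu'_def using has_derivative_diff[OF c(1) has_derivative_mult[OF c(2) d]] by simp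
  qed
  then have der: "((\<lambda>q. \<sigma> *s nu k q) has_derivative (\<lambda>h. \<sigma> *s nu' q h)) (at q)" for q
    by (intro has_derivative_vec_lambda) (auto intro!: derivative_eq_intros bounded_linear.has_derivative[OF bounded_linear_vec_nth])
  have "C1_on UNIV (\<lambda>q. \<sigma> *s nu k q)"
  proof (rule C1_onI[OF der])
    show "continuous_on UNIV (\<lambda>q. \<sigma> *s nu' q h)" for h
      unfolding nu'_def gm_deriv_def vector_scalar_mult_def by (simp, intro continuous_on_vec_lambda continuous_intros)
  qed
  moreover have "\<sigma> *s nu k q \<in> normal_space (fs_pullback (affine_lift k)) (affine_part k curve) q" if "q \<in> affine_part k curve" for q
    using that normal_space_curve[of k q] by (auto simp: affine_part_curve)
  ultimately show ?thesis unfolding normal_field_def by (intro exI[of _ UNIV]) auto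
qed

lemma tangential_curve:
  assumes q: "F (affine_lift k q) = 0"
  shows "tangential (fs_pullback (affine_lift k)) (affine_part k curve) q y =
    (herm (affine_lift k q) (chart_incl k y) (chart_incl k (tau k q)) / herm (affine_lift k q) (chart_incl k (tau k q)) (chart_incl k (tau k q))) *s tau k q"
    (is "_ = (?R / ?A) *s _")
proof -
  have A: "?A \<noteq> 0" using herm_tau_pos[OF q] by (simp add: herm_self)
  show ?thesis unfolding tangential_def tangent_space_curve[OF q] normal_space_curve_iff[OF q] chart_incl_simps herm_simps
  proof (rule the_equality)
    show "(?R / ?A) *s tau k q \<in> {c *s tau k q | c. True} \<and> ?R - herm (affine_lift k q) (chart_incl k ((?R / ?A) *s tau k q)) (chart_incl k (tau k q)) = 0"
      using A by (auto simp: chart_incl_simps herm_simps)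
  next
    fix x assume "x \<in> {c *s tau k q | c. True} \<and> ?R - herm (affine_lift k q) (chart_incl k x) (chart_incl k (tau k q)) = 0"
    then obtain c where "x = c *s tau k q" "?R - c * ?A = 0" by (auto simp: chart_incl_simps herm_simps)
    then show "x = (?R / ?A) *s tau k q" using A by (simp add: field_simps)
  qed
qed

text \<open>Differentiate the orthogonality relation between the normal field \<open>V\<close> and the tangent fields
  \<open>c *s tau\<close> along the curve.\<close>

lemma herm_cov_deriv_tau:
  assumes p: "F (affine_lift k p) = 0" and V: "normal_field (fs_pullback (affine_lift k)) (affine_part k curve) p V" "V p = \<sigma> *s nu k p"
  shows "herm (affine_lift k p) (chart_incl k (cov_deriv (fs_pullback (affine_lift k)) p (\<xi> *s tau k p) V)) (chart_incl k (tau k p))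
    = \<sigma> * cnj \<xi> * cnj (dotc (form_hess d a (affine_lift k p) (chart_incl k (tau k p))) (chart_incl k (tau k p))) / hinner (affine_lift k p) (affine_lift k p)"
proof -
  let ?g = "fs_pullback (affine_lift k)" and ?S = "affine_part k curve" and ?x = "\<xi> *s tau k p" and ?i = "chart_incl k" and ?Z = "affine_lift k p"
  obtain W where W: "open W" "p \<in> W" "C1_on W V" "\<And>q. q \<in> W \<inter> ?S \<Longrightarrow> V q \<in> normal_space ?g ?S q"
    using V(1) by (auto simp: normal_field_def)
  define DV where "DV = frechet_derivative V (at p)"
  have DV: "(V has_derivative DV) (at p)" unfolding DV_def
    using W(2,3) frechet_derivative_works by (auto simp: C1_on_def)
  have "?x \<in> tangent_space ?S p" by (auto simp: tangent_space_curve[OF p])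
  then obtain c where c: "c 0 = p" "\<forall>\<^sub>F t in nhds 0. c t \<in> ?S" "(c has_vector_derivative ?x) (at 0)"
    by (auto simp: tangent_space_def)
  have Vc: "((\<lambda>t. V (c t)) has_vector_derivative DV ?x) (at 0)"
    using diff_chain_at[OF c(3)[unfolded has_vector_derivative_def], of V DV] DV c(1)
    by (simp add: o_def has_vector_derivative_def has_derivative_def bounded_linear.linear linear_scale)
  have linT: "tau_deriv k p (r *\<^sub>R h) = r *\<^sub>R tau_deriv k p h" for r h
    using has_derivative_tau[of k p] by (simp add: has_derivative_def bounded_linear.linear linear_scale)
  have tc: "((\<lambda>t. tau k (c t)) has_vector_derivative tau_deriv k p ?x) (at 0)"
    using diff_chain_at[OF c(3)[unfolded has_vector_derivative_def], of "tau k" "tau_deriv k p"] has_derivative_tau[of k p] c(1) linT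
    by (simp add: o_def has_vector_derivative_def)
  have blz: "bounded_linear (\<lambda>v :: complex ^ 2. \<zeta> *s v)" for \<zeta>
    by (intro linear_conv_bounded_linear[THEN iffD1] linearI) (simp_all add: vec_eq_iff algebra_simps)
  define Y where "Y = cov_deriv ?g p ?x V"
  have Y: "Y = fs_christoffel k p ?x (V p) + DV ?x" by (simp add: Y_def cov_deriv_def christoffel_affine DV_def)
  \<comment> \<open>The Christoffel term is a combination of its two arguments, here both multiples
    of \<open>tau\<close>. It is therefore tangent and pairs to 0 with the normal vector.\<close>
  have \<Gamma>: "\<exists>m. fs_christoffel k p ?x (\<zeta> *s tau k p) = m *s tau k p" for \<zeta>
    unfolding fs_christoffel_def Let_def
    by (rule exI[of _ "- (hinner (?i ?x) ?Z / hinner ?Z ?Z * \<zeta> + hinner (?i (\<zeta> *s tau k p)) ?Z / hinner ?Z ?Z * \<xi>)"])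
       (simp add: vec_eq_iff algebra_simps)
  \<comment> \<open>Differentiating the orthogonality relation yields only a real part. Letting
    \<open>\<zeta>\<close> range over all complex numbers recovers the complex identity.\<close>
  have "Re (cnj \<zeta> * (herm ?Z (?i Y) (?i (tau k p)) - \<sigma> * cnj \<xi> * cnj (dotc (form_hess d a ?Z (?i (tau k p))) (?i (tau k p))) / hinner ?Z ?Z)) = 0" for \<zeta>
  proof -
    have \<zeta>c: "((\<lambda>t. \<zeta> *s tau k (c t)) has_vector_derivative \<zeta> *s tau_deriv k p ?x) (at 0)"
      by (rule bounded_linear.has_vector_derivative[OF blz tc])
    have D1: "((\<lambda>t. ?g (c t) (V (c t)) (\<zeta> *s tau k (c t))) has_real_derivative
      ?g p (fs_christoffel k p ?x (V p) + DV ?x) (\<zeta> *s tau k p) + ?g p (V p) (fs_christoffel k p ?x (\<zeta> *s tau k p) + \<zeta> *s tau_deriv k p ?x)) (at 0)"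
      using metric_compatibility[OF c(3) Vc \<zeta>c, of k] by (simp add: c(1))
    have evW: "\<forall>\<^sub>F t in nhds 0. c t \<in> W"
    proof -
      have "isCont c 0" using c(3) has_vector_derivative_continuous by blast
      then have "(c \<longlongrightarrow> p) (nhds 0)" using c(1) by (simp add: continuous_at tendsto_nhds_iff)
      then show ?thesis using W(1,2) by (auto simp: tendsto_def)
    qed
    have "\<forall>\<^sub>F t in nhds 0. ?g (c t) (V (c t)) (\<zeta> *s tau k (c t)) = 0"
      using evW c(2)
    proof eventually_elim
      case (elim t)
      then have "V (c t) \<in> normal_space ?g ?S (c t)" using W(4) by blast
      then show ?case using tangent_space_curve[of k "c t"] elim(2) by (auto simp: normal_space_def affine_part_curve)
    qed
    then have "((\<lambda>t. ?g (c t) (V (c t)) (\<zeta> *s tau k (c t))) has_real_derivative 0) (at 0)"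
      by (subst DERIV_cong_ev[OF refl _ refl]) auto
    then have 0: "?g p Y (\<zeta> *s tau k p) + ?g p (V p) (fs_christoffel k p ?x (\<zeta> *s tau k p) + \<zeta> *s tau_deriv k p ?x) = 0"
      unfolding Y using D1 DERIV_unique by blast
    obtain m where m: "fs_christoffel k p ?x (\<zeta> *s tau k p) = m *s tau k p" using \<Gamma> by blast
    have "Re (cnj \<zeta> * herm ?Z (?i Y) (?i (tau k p)) + cnj \<zeta> * (\<sigma> * cnj \<xi> * (- cnj (dotc (form_hess d a ?Z (?i (tau k p))) (?i (tau k p))) / hinner ?Z ?Z))) = 0"
      using 0 unfolding m fs_pullback_affine fs_form_herm V(2) tau_deriv_smult chart_incl_simps herm_simps herm_nu_tau[OF p] herm_nu[OF p] dotc_G_tau_deriv dotc_simps dotc_G_tau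
      by (simp add: mult_ac)
    then show ?thesis by (simp add: algebra_simps)
  qed
  then have z: "Re (cnj \<zeta> * X) = 0" if "X = herm ?Z (?i Y) (?i (tau k p)) - \<sigma> * cnj \<xi> * cnj (dotc (form_hess d a ?Z (?i (tau k p))) (?i (tau k p))) / hinner ?Z ?Z" for \<zeta> X
    using that by simp
  define X where "X = herm ?Z (?i Y) (?i (tau k p)) - \<sigma> * cnj \<xi> * cnj (dotc (form_hess d a ?Z (?i (tau k p))) (?i (tau k p))) / hinner ?Z ?Z"
  have "Re (cnj X * X) = 0" by (rule z[OF X_def])
  then have "(Re X)\<^sup>2 + (Im X)\<^sup>2 = 0" by (simp add: power2_eq_square)
  then have "X = 0" unfolding sum_power2_eq_zero_iff by (simp add: complex_eq_iff)
  then show ?thesis by (simp add: X_def Y_def)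
qed

text \<open>In \<open>herm_cov_deriv_tau\<close> the field enters only through its value at
  \<open>p\<close>, so all normal extensions give the same tangential part and the definite
  description has a unique solution.\<close>

lemma shape_operator_curve:
  assumes p: "F (affine_lift k p) = 0"
  shows "shape_operator (fs_pullback (affine_lift k)) (affine_part k curve) p (\<sigma> *s nu k p) (\<xi> *s tau k p) =
    (- (\<sigma> * cnj \<xi> * cnj (dotc (form_hess d a (affine_lift k p) (chart_incl k (tau k p))) (chart_incl k (tau k p)))
       / (hinner (affine_lift k p) (affine_lift k p) * herm (affine_lift k p) (chart_incl k (tau k p)) (chart_incl k (tau k p))))) *s tau k p"
  (is "_ = ?y")
proof -
  have y: "- tangential (fs_pullback (affine_lift k)) (affine_part k curve) p (cov_deriv (fs_pullback (affine_lift k)) p (\<xi> *s tau k p) V) = ?y"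
    if "normal_field (fs_pullback (affine_lift k)) (affine_part k curve) p V" "V p = \<sigma> *s nu k p" for V
    unfolding tangential_curve[OF p] herm_cov_deriv_tau[OF p that] by (simp add: vec_eq_iff)
  show ?thesis unfolding shape_operator_def
  proof (rule the_equality)
    show "\<exists>V. normal_field (fs_pullback (affine_lift k)) (affine_part k curve) p V \<and> V p = \<sigma> *s nu k p \<and>
      ?y = - tangential (fs_pullback (affine_lift k)) (affine_part k curve) p (cov_deriv (fs_pullback (affine_lift k)) p (\<xi> *s tau k p) V)"
      using y[OF normal_field_nu] normal_field_nu by (intro exI[of _ "\<lambda>q. \<sigma> *s nu k q"]) auto
  qed (use y in auto)
qed

end

section \<open>The volume of the projective plane\<close>

text \<open>The pattern is the real form of a Hermitian matrix with diagonal \<open>p\<close>,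
  \<open>q\<close> and an off-diagonal entry of squared modulus
  \<open>\<alpha>^2 + \<beta>^2\<close>. Passing to the real form squares the complex
  determinant.\<close>

lemma det_hermitian_real_4:
  fixes m :: "4 \<Rightarrow> 4 \<Rightarrow> real"
  assumes "m 1 1 = p" "m 1 2 = 0" "m 1 3 = \<alpha>" "m 1 4 = \<beta>" "m 2 1 = 0" "m 2 2 = p" "m 2 3 = - \<beta>" "m 2 4 = \<alpha>"
    "m 3 1 = \<alpha>" "m 3 2 = - \<beta>" "m 3 3 = q" "m 3 4 = 0" "m 4 1 = \<beta>" "m 4 2 = \<alpha>" "m 4 3 = 0" "m 4 4 = q"
  shows "det (\<chi> i j. m i j) = (p * q - \<alpha>\<^sup>2 - \<beta>\<^sup>2)\<^sup>2"
proof -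
  have f1234: "finite {2::4, 3, 4}" "1 \<notin> {2::4, 3, 4}" by auto
  have f234: "finite {3::4, 4}" "2 \<notin> {3::4, 4}" by auto
  have f34: "finite {4::4}" "3 \<notin> {4::4}" by auto
  show ?thesis
    unfolding det_def UNIV_4
    unfolding sum_over_permutations_insert[OF f1234]
    unfolding sum_over_permutations_insert[OF f234]
    unfolding sum_over_permutations_insert[OF f34]
    unfolding permutes_sing
    by (simp add: sign_swap_id permutation_swap_id permutation_compose sign_compose sign_id swap_id_eq assms)
       (simp add: power2_eq_square algebra_simps)
qed

definition pair_of_real :: "real ^ 4 \<Rightarrow> complex ^ 2"
  where "pair_of_real t = vector [Complex (t $ 1) (t $ 2), Complex (t $ 3) (t $ 4)]"

definition real_of_pair :: "complex ^ 2 \<Rightarrow> real ^ 4"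
  where "real_of_pair w = (\<chi> i. if i = 1 then Re (w $ 1) else if i = 2 then Im (w $ 1) else if i = 3 then Re (w $ 2) else Im (w $ 2))"

lemma pair_real_inverse [simp]: "pair_of_real (real_of_pair w) = w" "real_of_pair (pair_of_real t) = t"
  by (simp_all add: pair_of_real_def real_of_pair_def vec_eq_iff forall_2 forall_4)

lemma norm_pair_of_real: "norm (pair_of_real t) = norm t"
proof -
  have "(norm (pair_of_real t))\<^sup>2 = (norm t)\<^sup>2"
    unfolding norm_vec_power2 by (simp add: pair_of_real_def sum_2 cmod_power2 norm_vec_def L2_set_def sum_4 sum_nonneg)
  then show ?thesis by simp
qed

lemma bounded_linear_pair_of_real: "bounded_linear pair_of_real"
  by (intro linear_conv_bounded_linear[THEN iffD1] linearI) (simp_all add: pair_of_real_def vec_eq_iff forall_2 complex_eq_iff)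

lemma hinner_chart: "hinner (chart_incl k u) (chart_incl k v) = hinner u v"
  "hinner (chart_incl k u) (affine_lift k w) = hinner u w" "hinner (affine_lift k w) (chart_incl k u) = hinner w u"
  "hinner (affine_lift k w) (affine_lift k w) = 1 + hinner w w"
  using exhaust_3[of k] by (auto simp: hinner_def chart_incl_def affine_lift_def sum_3 sum_2)

definition cp2_param :: "3 \<Rightarrow> real ^ 4 \<Rightarrow> complex ^ 3"
  where "cp2_param k t = affine_lift k (pair_of_real t)"

lemma has_derivative_cp2_param: "(cp2_param k has_derivative (\<lambda>h. chart_incl k (pair_of_real h))) (at t)"
  unfolding cp2_param_def[abs_def]
  using diff_chain_at[OF bounded_linear_imp_has_derivative[OF bounded_linear_pair_of_real] has_derivative_affine_lift]
  by (simp add: o_def)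

text \<open>With \<open>n = 1 + |w|^2\<close> the complex Gram matrix is
  \<open>(n I - M) / n^2\<close>, where \<open>M\<close> has rank at most one and trace
  \<open>|w|^2\<close>. Its determinant is \<open>n * (n - |w|^2) / n^4 = 1 / n^3\<close>, and the
  real determinant is the square of that.\<close>

lemma det_gram_cp2_param: "det (gram (cp2_param k) t) = ((1 / (1 + (norm t)\<^sup>2) ^ 3))\<^sup>2"
proof -
  define w where "w = pair_of_real t"
  define w1 where "w1 = w $ 1"
  define w2 where "w2 = w $ 2"
  define n where "n = 1 + (norm t)\<^sup>2"
  have n0: "n > 0" unfolding n_def by (smt (verit) zero_le_power2)
  have nw: "n = 1 + (cmod w1)\<^sup>2 + (cmod w2)\<^sup>2"
    unfolding n_def norm_pair_of_real[symmetric] norm_vec_power2 by (simp add: sum_2 w1_def w2_def w_def)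
  have hw: "1 + hinner w w = of_real n"
    by (simp add: hinner_def sum_2 nw w1_def[symmetric] w2_def[symmetric] complex_norm_square del: of_real_power)
  define \<gamma> where "\<gamma> = - (cnj w1 * w2) / of_real (n\<^sup>2)"
  define p where "p = (1 + (cmod w2)\<^sup>2) / n\<^sup>2"
  define q where "q = (1 + (cmod w1)\<^sup>2) / n\<^sup>2"
  define b where "b i = (if i = 1 then vector [1, 0] else if i = 2 then vector [\<i>, 0] else if i = 3 then vector [0, 1] else vector [0, \<i>] :: complex ^ 2)" for i :: 4
  have ax: "pair_of_real (axis i 1) = b i" for i
    using exhaust_4[of i] by (auto simp: pair_of_real_def b_def axis_def vec_eq_iff forall_2 complex_eq_iff)
  define m where "m i j = Re (((of_real n) * hinner (b i) (b j) - hinner (b i) w * hinner w (b j)) / (of_real n)\<^sup>2)" for i j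
  have g: "gram (cp2_param k) t = (\<chi> i j. m i j)"
    unfolding gram_def fs_pullback_def frechet_derivative_at[OF has_derivative_cp2_param, symmetric] ax
    by (simp add: cp2_param_def fs_form_herm herm_def hinner_chart hw w_def[symmetric] m_def)
  have hv: "hinner (vector [x, y]) v = x * cnj (v $ 1) + y * cnj (v $ 2)" "hinner v (vector [x, y]) = v $ 1 * cnj x + v $ 2 * cnj y"
    for x y and v :: "complex ^ 2"
    by (simp_all add: hinner_def sum_2)
  have s: "(cmod w1)\<^sup>2 = (Re w1)\<^sup>2 + (Im w1)\<^sup>2" "(cmod w2)\<^sup>2 = (Re w2)\<^sup>2 + (Im w2)\<^sup>2" by (simp_all add: cmod_power2)
  have nws: "n = 1 + ((Re w1)\<^sup>2 + (Im w1)\<^sup>2) + ((Re w2)\<^sup>2 + (Im w2)\<^sup>2)" using nw by (simp add: s)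
  have rd: "Re (z / (of_real n)\<^sup>2) = Re z / n\<^sup>2" "Im (z / (of_real n)\<^sup>2) = Im z / n\<^sup>2" for z
    by (simp_all flip: of_real_power)
  have "det (gram (cp2_param k) t) = (p * q - (Re \<gamma>)\<^sup>2 - (Im \<gamma>)\<^sup>2)\<^sup>2"
    unfolding g
    by (rule det_hermitian_real_4; simp add: m_def b_def hv w1_def[symmetric] w2_def[symmetric] rd p_def q_def \<gamma>_def s nws;
      simp add: power2_eq_square minus_divide_left algebra_simps)
  also have "p * q - (Re \<gamma>)\<^sup>2 - (Im \<gamma>)\<^sup>2 = 1 / n ^ 3"
  proof -
    have "(Re \<gamma>)\<^sup>2 + (Im \<gamma>)\<^sup>2 = (cmod \<gamma>)\<^sup>2" by (simp add: cmod_power2)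
    also have "\<dots> = (cmod w1)\<^sup>2 * (cmod w2)\<^sup>2 / (n\<^sup>2)\<^sup>2"
      by (simp add: \<gamma>_def norm_mult norm_divide power_mult_distrib power_divide flip: of_real_power)
    finally have "p * q - (Re \<gamma>)\<^sup>2 - (Im \<gamma>)\<^sup>2 = ((1 + (cmod w2)\<^sup>2) * (1 + (cmod w1)\<^sup>2) - (cmod w1)\<^sup>2 * (cmod w2)\<^sup>2) / (n\<^sup>2)\<^sup>2"
      by (simp add: p_def q_def power2_eq_square diff_divide_distrib)
    also have "(1 + (cmod w2)\<^sup>2) * (1 + (cmod w1)\<^sup>2) - (cmod w1)\<^sup>2 * (cmod w2)\<^sup>2 = n" by (simp add: nw algebra_simps)
    also have "n / (n\<^sup>2)\<^sup>2 = 1 / n ^ 3" using n0 by (simp add: field_simps power2_eq_square power3_eq_cube)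
    finally show ?thesis .
  qed
  finally show ?thesis by (simp add: n_def)
qed

definition chart_coords :: "3 \<Rightarrow> complex ^ 3 \<Rightarrow> complex ^ 2"
  where "chart_coords k z = (if k = 1 then vector [z $ 2 / z $ 1, z $ 3 / z $ 1]
    else if k = 2 then vector [z $ 1 / z $ 2, z $ 3 / z $ 2] else vector [z $ 1 / z $ 3, z $ 2 / z $ 3])"

lemma affine_lift_chart_coords:
  fixes z :: "complex ^ 3"
  assumes "z $ k \<noteq> 0"
  shows "z = z $ k *s affine_lift k (chart_coords k z)"
proof -
  consider "k = 1" | "k = 2" | "k = 3" using exhaust_3[of k] by blast
  then show ?thesis using assms by cases (simp_all add: affine_lift_def chart_coords_def vec_eq_iff forall_3)
qed

definition chart_dom :: "3 \<Rightarrow> 3 cproj set"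
  where "chart_dom k = {proj z | z. z $ k \<noteq> 0}"

lemma proj_in_chart_dom: "z \<noteq> 0 \<Longrightarrow> proj z \<in> chart_dom k \<longleftrightarrow> z $ k \<noteq> 0"
proof -
  assume z: "z \<noteq> 0"
  show ?thesis
  proof
    assume "proj z \<in> chart_dom k"
    then obtain y where y: "proj z = proj y" "y $ k \<noteq> 0" by (auto simp: chart_dom_def)
    then have "y \<noteq> 0" by auto
    then show "z $ k \<noteq> 0" using y proj_eq_iff[OF z] by auto
  qed (auto simp: chart_dom_def)
qed

lemma open_chart_dom: "open (chart_dom k)"
proof -
  have "{z :: complex ^ 3. z \<noteq> 0 \<and> proj z \<in> chart_dom k} = {z. z $ k \<noteq> 0}"
    using proj_in_chart_dom by (auto simp: vec_eq_iff)
  moreover have "open {z :: complex ^ 3. z $ k \<noteq> 0}"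
    by (intro open_Collect_neq continuous_intros)
  ultimately show ?thesis by (simp add: open_cproj_def)
qed

lemma differentiable_chart_coords:
  fixes z :: "complex ^ 3"
  assumes "z $ k \<noteq> 0"
  shows "(\<lambda>z. real_of_pair (chart_coords k z)) differentiable (at z)"
proof -
  have bl: "bounded_linear real_of_pair"
    by (intro linear_conv_bounded_linear[THEN iffD1] linearI) (simp_all add: real_of_pair_def vec_eq_iff)
  have lin: "((\<lambda>z::complex ^ 3. z $ i) has_derivative (\<lambda>h. h $ i)) (at z)" for i
    by (intro bounded_linear_imp_has_derivative bounded_linear_vec_nth)
  have d: "\<exists>D. ((\<lambda>z. z $ i / z $ k) has_derivative D) (at z)" for i
    using has_derivative_divide'[OF lin[of i] lin[of k] assms] by blast
  obtain D where D: "\<And>i. ((\<lambda>z. z $ i / z $ k) has_derivative D i) (at z)" using d by metis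
  have "\<exists>D. ((\<lambda>z. vector [z $ i / z $ k, z $ j / z $ k] :: complex ^ 2) has_derivative D) (at z)" for i j
  proof -
    have "((\<lambda>z. vector [z $ i / z $ k, z $ j / z $ k] :: complex ^ 2) has_derivative (\<lambda>h. vector [D i h, D j h])) (at z)"
    proof (rule has_derivative_vec_lambda)
      show "((\<lambda>z. (vector [z $ i / z $ k, z $ j / z $ k] :: complex ^ 2) $ l) has_derivative (\<lambda>h. (vector [D i h, D j h] :: complex ^ 2) $ l)) (at z)" for l
        using exhaust_2[of l] D by auto
    qed
    then show ?thesis by blast
  qed
  then have "\<exists>D. (chart_coords k has_derivative D) (at z)"
    unfolding chart_coords_def[abs_def] using exhaust_3[of k] by auto
  then obtain D' where "(chart_coords k has_derivative D') (at z)" by blast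
  from bounded_linear.has_derivative[OF bl this] show ?thesis by (auto simp: differentiable_def)
qed

lemma fs_chart_cp2: "fs_chart UNIV UNIV (cp2_param k) (chart_dom k) (\<lambda>z. real_of_pair (chart_coords k z))"
  unfolding fs_chart_def
proof (intro conjI allI impI)
  have c1: "C1_on UNIV (cp2_param k)"
    unfolding C1_on_def frechet_derivative_at[OF has_derivative_cp2_param, symmetric]
    using has_derivative_cp2_param by (auto simp: differentiable_def)
  have inj: "inj (\<lambda>t. proj (cp2_param k t))"
  proof (rule injI)
    fix s t assume "proj (cp2_param k s) = proj (cp2_param k t)"
    then obtain c where c: "cp2_param k s = c *s cp2_param k t"
      using proj_eq_iff[of "cp2_param k s" "cp2_param k t"] by (auto simp: cp2_param_def affine_lift_nonzero)
    then have "c = 1" using chart_incl_component(2)[of k] by (metis cp2_param_def mult.right_neutral vector_smult_component)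
    then have "affine_lift k (pair_of_real s) = affine_lift k (pair_of_real t)" using c by (simp add: cp2_param_def)
    then have "pair_of_real s = pair_of_real t"
      using exhaust_3[of k] by (auto simp: affine_lift_def vec_eq_iff forall_3 forall_2)
    then show "s = t" by (metis pair_real_inverse(2))
  qed
  have "det (gram (cp2_param k) t) \<noteq> 0" for t
    unfolding det_gram_cp2_param by (simp, smt (verit) zero_le_power2)
  then show "local_param UNIV (cp2_param k) UNIV"
    unfolding local_param_def using c1 inj by (auto simp: cp2_param_def affine_lift_nonzero)
  show "open (chart_dom k)" by (rule open_chart_dom)
  show "(\<lambda>t. proj (cp2_param k t)) ` UNIV = UNIV \<inter> chart_dom k"
  proof (intro equalityI subsetI)
    fix P assume "P \<in> UNIV \<inter> chart_dom k"
    then obtain z where z: "P = proj z" "z $ k \<noteq> 0" by (auto simp: chart_dom_def)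
    have "P = proj (cp2_param k (real_of_pair (chart_coords k z)))"
      using affine_lift_chart_coords[OF z(2)] proj_smult[OF z(2) affine_lift_nonzero] z(1) by (simp add: cp2_param_def) metis
    then show "P \<in> (\<lambda>t. proj (cp2_param k t)) ` UNIV" by blast
  qed (auto simp: cp2_param_def proj_in_chart_dom affine_lift_nonzero chart_incl_component)
  fix z :: "complex ^ 3"
  show "(\<lambda>z. real_of_pair (chart_coords k z)) differentiable (at z)" if "z \<noteq> 0 \<and> proj z \<in> chart_dom k"
    using that proj_in_chart_dom differentiable_chart_coords by blast
  show "real_of_pair (chart_coords k z) \<in> UNIV" by simp
  show "proj (cp2_param k (real_of_pair (chart_coords k z))) = proj z" if "z \<noteq> 0 \<and> proj z \<in> UNIV \<inter> chart_dom k"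
  proof -
    have "z $ k \<noteq> 0" using that proj_in_chart_dom by blast
    then show ?thesis using affine_lift_chart_coords proj_smult[OF _ affine_lift_nonzero] by (simp add: cp2_param_def) metis
  qed
qed

lemma nn_integral_cp2_density: "(\<integral>\<^sup>+t. ennreal (1 / (1 + (norm (t :: real ^ 4))\<^sup>2) ^ 3) \<partial>lborel) = ennreal (pi\<^sup>2 / 2)"
proof -
  have p: "1 + t\<^sup>2 > 0" for t :: real by (smt (verit) zero_le_power2)
  have V: "unit_ball_vol 4 = pi\<^sup>2 / 2"
    using unit_ball_vol_even[of 2] by (simp add: fact_numeral)
  have "(\<integral>\<^sup>+t. ennreal (1 / (1 + (norm (t :: real ^ 4))\<^sup>2) ^ 3) \<partial>lborel)
      = (\<integral>\<^sup>+r\<in>{0..}. ennreal (pi\<^sup>2 / 2 * (4 * r ^ 3)) * ennreal (1 / (1 + r\<^sup>2) ^ 3) \<partial>lborel)"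
    using nn_integral_norm[where 'a = "real ^ 4", of "\<lambda>r. ennreal (1 / (1 + r\<^sup>2) ^ 3)"] by (simp add: V)
  also have "\<dots> = (\<integral>\<^sup>+r\<in>{0..}. ennreal (2 * pi\<^sup>2 * r ^ 3 / (1 + r\<^sup>2) ^ 3) \<partial>lborel)"
    by (intro nn_integral_cong) (auto simp: ennreal_mult[symmetric] indicator_def mult_ac)
  also have "\<dots> = ennreal (pi\<^sup>2 / 2 - pi\<^sup>2 / 2 * (1 - inverse (1 + 0\<^sup>2))\<^sup>2)"
  \<comment> \<open>The antiderivative is \<open>pi^2 / 2 * (r^2 / (1 + r^2))^2\<close>, written so
    that its limit at infinity is visible.\<close>
  proof (rule nn_integral_FTC_atLeast[where F = "\<lambda>r. pi\<^sup>2 / 2 * (1 - inverse (1 + r\<^sup>2))\<^sup>2"])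
    fix r :: real assume r: "0 \<le> r"
    define n where "n = 1 + r\<^sup>2"
    have n: "n > 0" "1 - inverse n = r\<^sup>2 / n" using p[of r] by (simp_all add: n_def field_simps)
    have "((\<lambda>r. pi\<^sup>2 / 2 * (1 - inverse (1 + r\<^sup>2))\<^sup>2) has_real_derivative pi\<^sup>2 / 2 * (2 * (1 - inverse n) * (2 * r * (inverse n)\<^sup>2))) (at r)"
      using p[of r] by (auto intro!: derivative_eq_intros simp: n_def power2_eq_square)
    also have "pi\<^sup>2 / 2 * (2 * (1 - inverse n) * (2 * r * (inverse n)\<^sup>2)) = 2 * pi\<^sup>2 * r ^ 3 / n ^ 3"
      unfolding n(2) using n(1) by (simp add: field_simps power2_eq_square power3_eq_cube)
    finally show "((\<lambda>r. pi\<^sup>2 / 2 * (1 - inverse (1 + r\<^sup>2))\<^sup>2) has_real_derivative 2 * pi\<^sup>2 * r ^ 3 / (1 + r\<^sup>2) ^ 3) (at r)"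
      by (simp add: n_def)
    show "0 \<le> 2 * pi\<^sup>2 * r ^ 3 / (1 + r\<^sup>2) ^ 3" using r p[of r] by simp
  next
    have "filterlim (\<lambda>t::real. 1 + t\<^sup>2) at_top at_top"
      by (intro filterlim_tendsto_add_at_top[OF tendsto_const] filterlim_pow_at_top filterlim_ident) auto
    then have "((\<lambda>t::real. pi\<^sup>2 / 2 * (1 - inverse (1 + t\<^sup>2))\<^sup>2) \<longlongrightarrow> pi\<^sup>2 / 2 * (1 - 0)\<^sup>2) at_top"
      by (intro tendsto_intros tendsto_inverse_0_at_top)
    then show "((\<lambda>t::real. pi\<^sup>2 / 2 * (1 - inverse (1 + t\<^sup>2))\<^sup>2) \<longlongrightarrow> pi\<^sup>2 / 2) at_top" by simp
  qed auto
  finally show ?thesis by simp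
qed

text \<open>One affine chart carries the whole volume: seen in either of the other charts, the
  points it misses lie over a real hyperplane, which is a null set.\<close>

theorem volume_cp2: "emeasure (fs_volume TYPE(4) (UNIV :: 3 cproj set)) UNIV = ennreal (pi\<^sup>2 / 2)"
proof -
  define \<mu> where "\<mu> = fs_volume TYPE(4) (UNIV :: 3 cproj set)"
  \<comment> \<open>The three charts as a sequence, with the last one repeated, because the cover in
    \<open>fs_volume_property\<close> is indexed by the natural numbers.\<close>
  define kk :: "nat \<Rightarrow> 3" where "kk i = (if i = 0 then 1 else if i = 1 then 2 else 3)" for i
  have cov: "(UNIV :: 3 cproj set) \<subseteq> (\<Union>i. chart_dom (kk i))"
  proof
    fix P :: "3 cproj"
    obtain z where z: "z \<noteq> 0" "proj z = P" by (rule proj_surj)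
    then obtain k where "z $ k \<noteq> 0" by (auto simp: vec_eq_iff)
    then have "P \<in> chart_dom k" using z by (auto simp: chart_dom_def)
    moreover have "\<exists>i. kk i = k" using exhaust_3[of k]
      by (metis kk_def zero_neq_one n_not_Suc_n numeral_2_eq_2 One_nat_def zero_neq_numeral)
    ultimately show "P \<in> (\<Union>i. chart_dom (kk i))" by auto
  qed
  have vp: "volume_property TYPE(4) UNIV \<mu>"
    unfolding \<mu>_def by (rule fs_volume_property[OF fs_chart_cp2 cov])
  have s\<mu>: "sets \<mu> = sets borel" using volume_propertyD(1)[OF vp] by simp
  have lp: "local_param UNIV (cp2_param k) UNIV" and im: "range (\<lambda>t. proj (cp2_param k t)) = chart_dom k" for k
    using fs_chart_cp2[of k] by (auto simp: fs_chart_def)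
  have b: "chart_dom k \<in> sets \<mu>" for k using open_chart_dom s\<mu> by auto
  have null: "emeasure \<mu> (chart_dom k - chart_dom 3) = 0" if k: "k \<noteq> 3" for k
  proof -
    have "emeasure \<mu> (chart_dom k - chart_dom 3) = (\<integral>\<^sup>+t\<in>{t\<in>UNIV. proj (cp2_param k t) \<in> chart_dom k - chart_dom 3}. ennreal (fs_density (cp2_param k) t) \<partial>lborel)"
      by (rule volume_propertyD(2)[OF vp lp]) (use b im in auto)
    also have "\<dots> = 0"
    proof -
      have N: "{t :: real ^ 4. t $ 3 = 0} \<in> null_sets lborel"
      proof -
        have "{t :: real ^ 4. t $ 3 = 0} \<in> null_sets lebesgue"
          using negligible_standard_hyperplane_cart[of 3] by (simp add: negligible_iff_null_sets)
        moreover have "closed {t :: real ^ 4. t $ 3 = 0}" by (intro closed_Collect_eq continuous_intros)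
        ultimately show ?thesis by (auto simp: null_sets_def)
      qed
      have "t $ 3 = 0" if "proj (cp2_param k t) \<in> chart_dom k - chart_dom 3" for t
      proof -
        have "affine_lift k (pair_of_real t) $ 3 = 0"
          using that proj_in_chart_dom[OF affine_lift_nonzero] by (auto simp: cp2_param_def)
        then have "pair_of_real t $ 2 = 0" using k exhaust_3[of k] by (auto simp: affine_lift_def)
        then show ?thesis by (simp add: pair_of_real_def complex_eq_iff)
      qed
      then have "AE t in lborel. ennreal (fs_density (cp2_param k) t) * indicator {t\<in>UNIV. proj (cp2_param k t) \<in> chart_dom k - chart_dom 3} t = 0"
        using AE_not_in[OF N] by (auto elim!: eventually_mono simp: indicator_def)
      then show ?thesis by (subst nn_integral_cong_AE) auto
    qed
    finally show ?thesis .
  qed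
  have U: "UNIV = chart_dom 3 \<union> ((chart_dom 1 - chart_dom 3) \<union> (chart_dom 2 - chart_dom 3))"
    using cov by (auto simp: kk_def split: if_splits)
  have n0: "(chart_dom 1 - chart_dom 3) \<union> (chart_dom 2 - chart_dom 3) \<in> null_sets \<mu>"
    using null[of 1] null[of 2] b by (intro null_sets.Un) (auto intro!: null_setsI)
  have "emeasure \<mu> UNIV = emeasure \<mu> (chart_dom 3)"
    using emeasure_Un_null_set[OF b n0, of 3] U by simp
  also have "\<dots> = (\<integral>\<^sup>+t\<in>{t\<in>UNIV. proj (cp2_param 3 t) \<in> chart_dom 3}. ennreal (fs_density (cp2_param 3) t) \<partial>lborel)"
    by (rule volume_propertyD(2)[OF vp lp b]) (use im in auto)
  also have "\<dots> = (\<integral>\<^sup>+t. ennreal (1 / (1 + (norm (t :: real ^ 4))\<^sup>2) ^ 3) \<partial>lborel)"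
  proof (intro nn_integral_cong)
    fix t :: "real ^ 4"
    have "proj (cp2_param 3 t) \<in> chart_dom 3" using im by blast
    moreover have "fs_density (cp2_param 3) t = 1 / (1 + (norm t)\<^sup>2) ^ 3" unfolding det_gram_cp2_param by simp
    ultimately show "ennreal (fs_density (cp2_param 3) t) * indicator {t\<in>UNIV. proj (cp2_param 3 t) \<in> chart_dom 3} t = ennreal (1 / (1 + (norm t)\<^sup>2) ^ 3)"
      by simp
  qed
  finally show ?thesis by (simp add: nn_integral_cp2_density \<mu>_def)
qed

section \<open>The integral over the normal disc\<close>

lemma sinc_mult_self: "sinc r * r = sin r"
  by simp

text \<open>A differentiable antiderivative of the absolute value, up to a factor 2. It spares a
  case split at the zero of \<open>1 - K * u\<close>.\<close>

lemma has_real_derivative_mult_abs: "((\<lambda>x::real. x * \<bar>x\<bar>) has_real_derivative 2 * \<bar>x\<bar>) (at x)"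
proof -
  consider "x > 0" | "x < 0" | "x = 0" by linarith
  then show ?thesis
  proof cases
    case 1
    have "((\<lambda>x. x * x) has_real_derivative 2 * \<bar>x\<bar>) (at x)" using 1 by (auto intro!: derivative_eq_intros)
    moreover have "\<forall>\<^sub>F s in nhds x. s * s = s * \<bar>s\<bar>"
      using eventually_nhds_in_open[of "{0<..}" x] 1 by (auto elim!: eventually_mono)
    ultimately show ?thesis by (subst (asm) DERIV_cong_ev[OF refl _ refl])
  next
    case 2
    have "((\<lambda>x. - (x * x)) has_real_derivative 2 * \<bar>x\<bar>) (at x)" using 2 by (auto intro!: derivative_eq_intros)
    moreover have "\<forall>\<^sub>F s in nhds x. - (s * s) = s * \<bar>s\<bar>"
      using eventually_nhds_in_open[of "{..<0}" x] 2 by (auto elim!: eventually_mono)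
    ultimately show ?thesis by (subst (asm) DERIV_cong_ev[OF refl _ refl])
  next
    case 3
    have "((\<lambda>h. ((0 + h) * \<bar>0 + h\<bar> - 0 * \<bar>0\<bar>) / h) \<longlongrightarrow> (0::real)) (at 0)"
    proof (rule Lim_null_comparison)
      show "\<forall>\<^sub>F h in at (0::real). norm (((0 + h) * \<bar>0 + h\<bar> - 0 * \<bar>0\<bar>) / h) \<le> \<bar>h\<bar>" by (auto intro!: always_eventually)
      show "((\<lambda>h. \<bar>h\<bar>) \<longlongrightarrow> (0::real)) (at 0)" by (auto intro!: tendsto_eq_intros)
    qed
    then show ?thesis using 3 by (simp add: DERIV_def)
  qed
qed

text \<open>With \<open>u = sin r ^ 2\<close> the integral becomes \<open>pi\<close> times that of \<open>\<bar>1 - K * u\<bar>\<close> over the unit interval.\<close>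

lemma normal_disc_integral:
  assumes K: "K \<ge> 1"
  shows "(\<integral>\<^sup>+s. ennreal (\<bar>1 - K * (sin (norm (s :: real ^ 2)))\<^sup>2\<bar> * cos (norm s) * sinc (norm s)) * indicator {..<pi / 2} (norm s) \<partial>lborel)
    = ennreal (pi / 2 * (K - 2 + 2 / K))"
proof -
  define h where "h r = ennreal (\<bar>1 - K * (sin r)\<^sup>2\<bar> * cos r * sinc r) * indicator {..<pi / 2} r" for r
  have [measurable]: "h \<in> borel_measurable borel" unfolding h_def[abs_def] by measurable
  have "(\<integral>\<^sup>+s. h (norm (s :: real ^ 2)) \<partial>lborel) = (\<integral>\<^sup>+r\<in>{0..}. ennreal (pi * (2 * r)) * h r \<partial>lborel)"
    using nn_integral_norm[where 'a = "real ^ 2", of h] by (simp add: unit_ball_vol_2)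
  also have "\<dots> = (\<integral>\<^sup>+r\<in>{0..pi / 2}. ennreal (2 * pi * (\<bar>1 - K * (sin r)\<^sup>2\<bar> * cos r * sin r)) \<partial>lborel)"
  proof (intro nn_integral_cong)
    fix r :: real
    show "ennreal (pi * (2 * r)) * h r * indicator {0..} r = ennreal (2 * pi * (\<bar>1 - K * (sin r)\<^sup>2\<bar> * cos r * sin r)) * indicator {0..pi / 2} r"
    proof (cases "r \<in> {0..<pi / 2}")
      case True
      define s where "s = sinc r"
      have s: "s * r = sin r" using sinc_mult_self[of r] by (simp only: s_def)
      have "h r = ennreal (\<bar>1 - K * (sin r)\<^sup>2\<bar> * cos r * s)"
        unfolding h_def s_def[symmetric] using True by simp
      then have "ennreal (pi * (2 * r)) * h r = ennreal (pi * (2 * r) * (\<bar>1 - K * (sin r)\<^sup>2\<bar> * cos r * s))"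
        using True by (simp only: ennreal_mult' mult_nonneg_nonneg pi_ge_zero atLeastLessThan_iff)
      also have "pi * (2 * r) * (\<bar>1 - K * (sin r)\<^sup>2\<bar> * cos r * s) = 2 * pi * (\<bar>1 - K * (sin r)\<^sup>2\<bar> * cos r * (s * r))"
        by simp
      also have "\<dots> = 2 * pi * (\<bar>1 - K * (sin r)\<^sup>2\<bar> * cos r * sin r)" unfolding s ..
      finally show ?thesis using True by simp
    next
      case False
      \<comment> \<open>The disc excludes \<open>r = pi / 2\<close> while the closed interval
        contains it; there the factor \<open>cos r\<close> vanishes.\<close>
      then consider "r = pi / 2" | "r \<notin> {0..pi / 2}" by fastforce
      then show ?thesis
      proof cases
        case 1
        then have "cos r = 0" by (simp only: cos_pi_half)
        moreover have "h r = 0" using 1 by (simp add: h_def)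
        ultimately show ?thesis by simp
      qed (auto simp: h_def indicator_def)
    qed
  qed
  also have "\<dots> = ennreal (- pi / (2 * K) * ((1 - K * (sin (pi / 2))\<^sup>2) * \<bar>1 - K * (sin (pi / 2))\<^sup>2\<bar>) - (- pi / (2 * K) * ((1 - K * (sin 0)\<^sup>2) * \<bar>1 - K * (sin 0)\<^sup>2\<bar>)))"
  \<comment> \<open>The antiderivative composes \<open>has_real_derivative_mult_abs\<close> with
    \<open>1 - K * (sin r)^2\<close>, so it remains valid across the sign change.\<close>
  proof (rule nn_integral_FTC_Icc[where F = "\<lambda>r. - pi / (2 * K) * ((1 - K * (sin r)\<^sup>2) * \<bar>1 - K * (sin r)\<^sup>2\<bar>)"])
    fix r assume r: "r \<in> {0..pi / 2}"
    have d: "((\<lambda>r. 1 - K * (sin r)\<^sup>2) has_real_derivative - K * (2 * sin r * cos r)) (at r)"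
      by (auto intro!: derivative_eq_intros)
    have "((\<lambda>r. - pi / (2 * K) * ((1 - K * (sin r)\<^sup>2) * \<bar>1 - K * (sin r)\<^sup>2\<bar>)) has_real_derivative - pi / (2 * K) * (2 * \<bar>1 - K * (sin r)\<^sup>2\<bar> * (- K * (2 * sin r * cos r)))) (at r)"
      by (intro DERIV_cmult DERIV_chain2[OF has_real_derivative_mult_abs d])
    moreover have "- pi / (2 * K) * (2 * \<bar>1 - K * (sin r)\<^sup>2\<bar> * (- K * (2 * sin r * cos r))) = 2 * pi * (\<bar>1 - K * (sin r)\<^sup>2\<bar> * cos r * sin r)"
      using K by (simp add: field_simps)
    ultimately show "((\<lambda>r. - pi / (2 * K) * ((1 - K * (sin r)\<^sup>2) * \<bar>1 - K * (sin r)\<^sup>2\<bar>)) has_real_derivative 2 * pi * (\<bar>1 - K * (sin r)\<^sup>2\<bar> * cos r * sin r)) (at r)"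
      by simp
    show "0 \<le> 2 * pi * (\<bar>1 - K * (sin r)\<^sup>2\<bar> * cos r * sin r)"
      using r by (intro mult_nonneg_nonneg) (auto intro!: cos_ge_zero sin_ge_zero)
  qed (auto intro!: borel_measurable_continuous_onI continuous_intros)
  also have "- pi / (2 * K) * ((1 - K * (sin (pi / 2))\<^sup>2) * \<bar>1 - K * (sin (pi / 2))\<^sup>2\<bar>) - (- pi / (2 * K) * ((1 - K * (sin 0)\<^sup>2) * \<bar>1 - K * (sin 0)\<^sup>2\<bar>))
     = pi / 2 * (K - 2 + 2 / K)"
    using K by (simp add: field_simps power2_eq_square)
  finally show ?thesis by (simp add: h_def)
qed

context smooth_form
begin

text \<open>On the tangent line the endomorphism is
  \<open>\<zeta> \<mapsto> cos r * \<zeta> + \<beta> * cnj \<zeta>\<close>, with determinant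
  \<open>cos^2 r - |\<beta>|^2\<close>. The number \<open>lam2\<close> is the squared singular value
  for a unit normal; the length \<open>r\<close> and the factor \<open>sinc r\<close> combine to
  \<open>sin r\<close>.\<close>

lemma curvature_integrand_curve:
  fixes k p \<sigma>
  defines "Z \<equiv> affine_lift k p" and "T \<equiv> chart_incl k (tau k p)"
  defines "lam2 \<equiv> (cmod (dotc (form_hess d a Z T) T))\<^sup>2 / ((norm Z)\<^sup>2 * (norm (G Z))\<^sup>2 * (fs_form Z T T)\<^sup>2)"
  defines "r \<equiv> sqrt (fs_pullback (affine_lift k) p (\<sigma> *s nu k p) (\<sigma> *s nu k p))"
  assumes p: "F (affine_lift k p) = 0"
  shows "curvature_integrand (fs_pullback (affine_lift k)) (affine_part k curve) p (\<sigma> *s nu k p) =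
    \<bar>1 - (1 + lam2) * (sin r)\<^sup>2\<bar> * cos r * sinc r"
proof -
  define A where "A = fs_form Z T T"
  have A: "A > 0" unfolding A_def Z_def T_def by (rule herm_tau_pos[OF p])
  have Z0: "Z \<noteq> 0" "norm Z > 0" by (simp_all add: Z_def affine_lift_nonzero)
  have G0: "norm (G Z) > 0" using smooth[OF affine_lift_nonzero p] by (simp add: Z_def)
  define Q where "Q = dotc (form_hess d a Z T) T"
  define N where "N = (norm Z)\<^sup>2"
  have N: "N > 0" "hinner Z Z = of_real N" using Z0 by (simp_all add: N_def hinner_self)
  define s where "s = sinc r"
  have s: "s * r = sin r" using sinc_mult_self[of r] by (simp only: s_def)
  define \<beta> where "\<beta> = of_real s * (\<sigma> * cnj Q / (of_real N * of_real A))"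
  have "fs_pullback (affine_lift k) p (\<sigma> *s nu k p) (\<sigma> *s nu k p) = Re (\<sigma> * (cnj \<sigma> * of_real ((norm (G Z))\<^sup>2) / of_real N))"
    unfolding fs_pullback_affine fs_form_herm chart_incl_smult herm_simps herm_nu[OF p] dotc_G_nu[OF p]
    by (simp add: Z_def[symmetric] N)
  also have "\<dots> = (cmod \<sigma>)\<^sup>2 * (norm (G Z))\<^sup>2 / N"
    by (simp add: mult.assoc[symmetric] complex_norm_square[symmetric] del: of_real_power)
  finally have g: "fs_pullback (affine_lift k) p (\<sigma> *s nu k p) (\<sigma> *s nu k p) = (cmod \<sigma>)\<^sup>2 * (norm (G Z))\<^sup>2 / N" .
  have r2: "r\<^sup>2 = (cmod \<sigma>)\<^sup>2 * (norm (G Z))\<^sup>2 / N" unfolding r_def g using N by simp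
  have L: "cos r *\<^sub>R (\<zeta> *s tau k p) - s *\<^sub>R shape_operator (fs_pullback (affine_lift k)) (affine_part k curve) p (\<sigma> *s nu k p) (\<zeta> *s tau k p)
    = (of_real (cos r) * \<zeta> + \<beta> * cnj \<zeta>) *s tau k p" for \<zeta>
    unfolding shape_operator_curve[OF p] T_def[symmetric] Z_def[symmetric] N(2) herm_self A_def[symmetric] Q_def[symmetric] \<beta>_def
    by (simp add: vec_eq_iff scaleR_conv_of_real[where 'a = complex] algebra_simps)
  have "endo_det (tangent_space (affine_part k curve) p) (\<lambda>x. cos r *\<^sub>R x - s *\<^sub>R shape_operator (fs_pullback (affine_lift k)) (affine_part k curve) p (\<sigma> *s nu k p) x)
     = (cos r)\<^sup>2 - (cmod \<beta>)\<^sup>2"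
    unfolding tangent_space_curve[OF p] by (rule endo_det_complex_line[OF tau_nonzero[OF p] L])
  moreover have "(cmod \<beta>)\<^sup>2 = lam2 * (sin r)\<^sup>2"
  proof -
    have "(cmod \<beta>)\<^sup>2 = s\<^sup>2 * ((cmod \<sigma>)\<^sup>2 * (cmod Q)\<^sup>2 / (N\<^sup>2 * A\<^sup>2))"
      using N(1) A by (simp add: \<beta>_def norm_mult norm_divide power_mult_distrib power_divide)
    also have "(cmod \<sigma>)\<^sup>2 = r\<^sup>2 * N / (norm (G Z))\<^sup>2" using r2 N(1) G0 by (simp add: field_simps)
    also have "s\<^sup>2 * (r\<^sup>2 * N / (norm (G Z))\<^sup>2 * (cmod Q)\<^sup>2 / (N\<^sup>2 * A\<^sup>2)) = (s * r)\<^sup>2 * ((cmod Q)\<^sup>2 / (N * (norm (G Z))\<^sup>2 * A\<^sup>2))"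
      using N(1) A G0 by (simp add: field_simps power2_eq_square)
    finally show ?thesis unfolding s by (simp add: lam2_def N_def A_def Q_def mult.commute)
  qed
  moreover have "(cos r)\<^sup>2 = 1 - (sin r)\<^sup>2" by (simp add: cos_squared_eq)
  ultimately have E: "endo_det (tangent_space (affine_part k curve) p) (\<lambda>x. cos r *\<^sub>R x - s *\<^sub>R shape_operator (fs_pullback (affine_lift k)) (affine_part k curve) p (\<sigma> *s nu k p) x)
     = 1 - (1 + lam2) * (sin r)\<^sup>2" by (simp add: algebra_simps)
  show ?thesis
    unfolding curvature_integrand_def Let_def r_def[symmetric] s_def[symmetric] E by simp
qed

text \<open>For the real metric a vector \<open>n\<close> and \<open>\<i> *s n\<close> are
  orthogonal and equally long, so it is enough to normalise \<open>nu\<close>.\<close>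

lemma orthonormal_basis_exists:
  assumes p: "F (affine_lift k p) = 0"
  shows "\<exists>e. orthonormal_normal_basis (fs_pullback (affine_lift k)) (affine_part k curve) p e"
proof -
  let ?g = "fs_pullback (affine_lift k) p"
  have n0: "nu k p \<noteq> 0"
  proof
    assume "nu k p = 0"
    then have "chart_incl k (nu k p) = 0" using chart_incl_smult[of k 0 "nu k p"] by simp
    then show False using dotc_G_nu[OF p] smooth[OF affine_lift_nonzero p] by (simp add: dotc_simps)
  qed
  then have "?g (nu k p) (nu k p) \<noteq> 0" using fs_pullback_affine_pos by blast
  moreover have "?g (nu k p) (nu k p) \<ge> 0" by (simp add: fs_pullback_affine fs_form_nonneg)
  ultimately have g0: "?g (nu k p) (nu k p) > 0" by simp
  define c where "c = 1 / sqrt (?g (nu k p) (nu k p))"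
  have c: "c > 0" "c * (c * ?g (nu k p) (nu k p)) = 1" using g0 by (simp_all add: c_def)
  define n where "n = of_real c *s nu k p"
  have n: "n \<noteq> 0" using n0 c(1) by (simp add: n_def)
  define h where "h = herm (affine_lift k p) (chart_incl k n) (chart_incl k n)"
  have h: "h = 1"
  proof -
    have "h = of_real c * (of_real c * of_real (?g (nu k p) (nu k p)))"
      by (simp only: h_def n_def chart_incl_smult herm_simps(3,4)) (simp add: herm_self fs_pullback_affine)
    also have "\<dots> = of_real (c * (c * ?g (nu k p) (nu k p)))" by simp
    finally show ?thesis unfolding c(2) by simp
  qed
  define e :: "2 \<Rightarrow> complex ^ 2" where "e = (\<lambda>i. if i = 1 then n else \<i> *s n)"
  have "?g (e i) (e j) = (if i = j then 1 else 0)" for i j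
    using exhaust_2[of i] exhaust_2[of j] h
    by (auto simp: e_def fs_pullback_affine fs_form_herm chart_incl_smult herm_simps h_def[symmetric])
  moreover have "span (range e) = normal_space (fs_pullback (affine_lift k)) (affine_part k curve) p"
  proof -
    have "range e = {n, \<i> *s n}" unfolding UNIV_2 e_def by auto
    then have "span (range e) = {c *s n | c. True}" using complex_line_real_basis(2)[OF n] by simp
    also have "\<dots> = {c *s nu k p | c. True}"
    proof (intro equalityI subsetI)
      fix x assume "x \<in> {c *s nu k p | c. True}"
      then obtain b where "x = b *s nu k p" by blast
      then have "x = (b / of_real c) *s n" using c(1) by (simp add: n_def)
      then show "x \<in> {c *s n | c. True}" by blast
    qed (auto simp: n_def)
    finally show ?thesis by (simp add: normal_space_curve[OF p])
  qed
  ultimately show ?thesis unfolding orthonormal_normal_basis_def by blast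
qed

text \<open>The integrand depends on a normal vector only through its length, and an orthonormal
  basis identifies lengths with those in \<open>real ^ 2\<close>. Any basis that the choice operator
  returns therefore gives the same radial integral.\<close>

lemma fibre_integral_curve:
  fixes k p
  defines "Z \<equiv> affine_lift k p" and "T \<equiv> chart_incl k (tau k p)"
  defines "K \<equiv> 1 + (cmod (dotc (form_hess d a Z T) T))\<^sup>2 / ((norm Z)\<^sup>2 * (norm (G Z))\<^sup>2 * (fs_form Z T T)\<^sup>2)"
  assumes p: "F (affine_lift k p) = 0"
  shows "fibre_integral (fs_pullback (affine_lift k)) (affine_part k curve) p = ennreal (pi / 2 * (K - 2 + 2 / K))"
proof -
  let ?g = "fs_pullback (affine_lift k)" and ?S = "affine_part k curve"
  define e where "e = (SOME e. orthonormal_normal_basis ?g ?S p e)"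
  have e: "orthonormal_normal_basis ?g ?S p e" unfolding e_def by (rule someI_ex[OF orthonormal_basis_exists[OF p]])
  define f where "f = (\<lambda>s :: real ^ 2. \<Sum>i\<in>UNIV. s $ i *\<^sub>R e i)"
  have nl: "normal_lebesgue ?g ?S p = distr lborel borel f" by (simp add: normal_lebesgue_def e_def f_def)
  have cf: "continuous_on UNIV f" unfolding f_def by (intro continuous_intros)
  have [measurable]: "f \<in> borel_measurable borel" by (rule borel_measurable_continuous_onI[OF cf])
  have fn: "f s \<in> normal_space ?g ?S p" for s
  proof -
    have "f s \<in> span (range e)" unfolding f_def by (intro span_sum span_scale span_base) auto
    then show ?thesis using e by (simp add: orthonormal_normal_basis_def)
  qed
  have gf: "?g p (f s) (f s) = (norm s)\<^sup>2" for s
  proof -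
    have "?g p (f s) (f s) = (\<Sum>i\<in>UNIV. \<Sum>j\<in>UNIV. s $ i * (s $ j * ?g p (e i) (e j)))"
    proof -
      have ci: "chart_incl k (f s) = (\<Sum>i\<in>UNIV. s $ i *\<^sub>R chart_incl k (e i))"
        unfolding f_def by (simp add: linear_sum[OF bounded_linear.linear[OF bounded_linear_chart_incl]] chart_incl_scaleR)
      show ?thesis unfolding fs_pullback_affine ci
        by (simp add: fs_form_sum fs_form_scaleR sum_distrib_left) (subst sum.swap, simp add: mult.left_commute)
    qed
    also have "\<dots> = (\<Sum>i\<in>UNIV. (s $ i)\<^sup>2)" using e by (simp add: orthonormal_normal_basis_def power2_eq_square if_distrib sum_2 cong: if_cong)
    finally show ?thesis by (simp add: norm_vec_def L2_set_def sum_nonneg)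
  qed
  define \<Phi> where "\<Phi> r = ennreal (\<bar>1 - K * (sin r)\<^sup>2\<bar> * cos r * sinc r) * indicator {..<pi / 2} r" for r
  have [measurable]: "\<Phi> \<in> borel_measurable borel" unfolding \<Phi>_def[abs_def] by measurable
  have cg: "continuous_on UNIV (\<lambda>v. ?g p v v)"
    unfolding fs_pullback_affine fs_form_herm by (intro continuous_intros) (auto simp: affine_lift_nonzero)
  have [measurable]: "(\<lambda>v. ?g p v v) \<in> borel_measurable borel" by (rule borel_measurable_continuous_onI[OF cg])
  \<comment> \<open>The formula for the integrand is available on normal vectors only. The image
    measure is concentrated on the normal plane, which must be Borel for the statement almost
    everywhere.\<close>
  have closedN: "normal_space ?g ?S p \<in> sets borel"
  proof -
    have "closed ((\<lambda>v. herm (affine_lift k p) (chart_incl k v) (chart_incl k (tau k p))) -` {0})"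
      by (intro continuous_closed_vimage) (auto intro!: continuous_intros continuous_on_interior[of UNIV] simp: affine_lift_nonzero)
    moreover have "normal_space ?g ?S p = (\<lambda>v. herm (affine_lift k p) (chart_incl k v) (chart_incl k (tau k p))) -` {0}"
      using normal_space_curve_iff[OF p] by auto
    ultimately show ?thesis by simp
  qed
  have "fibre_integral ?g ?S p = (\<integral>\<^sup>+v. ennreal (curvature_integrand ?g ?S p v) * indicator {v. sqrt (?g p v v) < pi / 2} v \<partial>distr lborel borel f)"
    by (simp add: fibre_integral_def nl)
  also have "\<dots> = (\<integral>\<^sup>+v. \<Phi> (sqrt (?g p v v)) \<partial>distr lborel borel f)"
  proof (rule nn_integral_cong_AE)
    have "AE v in distr lborel borel f. v \<in> normal_space ?g ?S p"
      using closedN fn by (subst AE_distr_iff) auto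
    then show "AE v in distr lborel borel f. ennreal (curvature_integrand ?g ?S p v) * indicator {v. sqrt (?g p v v) < pi / 2} v = \<Phi> (sqrt (?g p v v))"
    proof eventually_elim
      case (elim v)
      then obtain \<sigma> where v: "v = \<sigma> *s nu k p" using normal_space_curve[OF p] by auto
      show ?case unfolding v \<Phi>_def K_def Z_def T_def curvature_integrand_curve[OF p] by (simp add: indicator_def)
    qed
  qed
  also have "\<dots> = (\<integral>\<^sup>+s. \<Phi> (norm (s :: real ^ 2)) \<partial>lborel)"
    by (subst nn_integral_distr) (auto simp: gf)
  also have "\<dots> = ennreal (pi / 2 * (K - 2 + 2 / K))"
    unfolding \<Phi>_def by (rule normal_disc_integral) (simp add: K_def)
  finally show ?thesis .
qed

lemma affine_lift_exists:
  fixes z :: "complex ^ 3"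
  assumes "z $ k \<noteq> 0"
  shows "\<exists>w. z = z $ k *s affine_lift k w"
proof -
  consider "k = 1" | "k = 2" | "k = 3" using exhaust_3[of k] by blast
  then show ?thesis
  proof cases
    case 1 then show ?thesis using assms
      by (intro exI[of _ "vector [z $ 2 / z $ k, z $ 3 / z $ k]"]) (simp add: affine_lift_def vec_eq_iff forall_3)
  next
    case 2 then show ?thesis using assms
      by (intro exI[of _ "vector [z $ 1 / z $ k, z $ 3 / z $ k]"]) (simp add: affine_lift_def vec_eq_iff forall_3)
  next
    case 3 then show ?thesis using assms
      by (intro exI[of _ "vector [z $ 1 / z $ k, z $ 2 / z $ k]"]) (simp add: affine_lift_def vec_eq_iff forall_3)
  qed
qed

lemma chart_incl_exists:
  fixes z :: "complex ^ 3"
  assumes "z $ k = 0"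
  shows "\<exists>w. z = chart_incl k w"
proof -
  consider "k = 1" | "k = 2" | "k = 3" using exhaust_3[of k] by blast
  then show ?thesis
  proof cases
    case 1 then show ?thesis using assms
      by (intro exI[of _ "vector [z $ 2, z $ 3]"]) (simp add: chart_incl_def vec_eq_iff forall_3)
  next
    case 2 then show ?thesis using assms
      by (intro exI[of _ "vector [z $ 1, z $ 3]"]) (simp add: chart_incl_def vec_eq_iff forall_3)
  next
    case 3 then show ?thesis using assms
      by (intro exI[of _ "vector [z $ 1, z $ 2]"]) (simp add: chart_incl_def vec_eq_iff forall_3)
  qed
qed

text \<open>The value \<open>K - 1\<close> is the square of the principal curvature; it does not depend on the choice of
  the representative \<open>z\<close> and of the tangent vector \<open>T\<close>.\<close>

lemma curvature_density_curve:
  assumes z: "z \<noteq> 0" "F z = 0" and T: "dotc (G z) T = 0" "fs_form z T T \<noteq> 0"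
  defines "K \<equiv> 1 + (cmod (dotc (form_hess d a z T) T))\<^sup>2 / ((norm z)\<^sup>2 * (norm (G z))\<^sup>2 * (fs_form z T T)\<^sup>2)"
  shows "curvature_density curve (proj z) = ennreal (pi / 2 * (K - 2 + 2 / K))"
proof -
  \<comment> \<open>The definition selects some chart and point; all that is known of them is that
    they represent \<open>proj z\<close>.\<close>
  define kw where "kw = (SOME kw. case kw of (k, w) \<Rightarrow> proj (affine_lift k w) = proj z)"
  obtain k w where kw: "kw = (k, w)" by (cases kw)
  have "\<exists>kw. case kw of (k, w) \<Rightarrow> proj (affine_lift k w) = proj z"
  proof -
    obtain k where k: "z $ k \<noteq> 0" using z(1) by (auto simp: vec_eq_iff)
    obtain w where w: "z = z $ k *s affine_lift k w" using affine_lift_exists[OF k] by blast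
    have "proj (z $ k *s affine_lift k w) = proj (affine_lift k w)" by (rule proj_smult[OF k affine_lift_nonzero])
    then show ?thesis using w by (intro exI[of _ "(k, w)"]) simp
  qed
  from someI_ex[OF this] have P: "proj (affine_lift k w) = proj z" by (simp add: kw_def[symmetric] kw)
  define Z where "Z = affine_lift k w"
  obtain c where c: "c \<noteq> 0" "z = c *s Z" using P proj_eq_iff[OF z(1) affine_lift_nonzero, of k w] by (auto simp: Z_def)
  have Z: "Z \<noteq> 0" "F Z = 0" using c z by (auto simp: ternary_form_scale Z_def affine_lift_nonzero)
  have GT: "dotc (G Z) T = 0" using T(1) c by (simp add: form_grad_scale dotc_simps)
  have GZ: "dotc (G Z) Z = 0" by (simp add: euler_form Z)
  \<comment> \<open>Subtracting the multiple of \<open>Z\<close> with the same \<open>k\<close>-th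
    coordinate leaves a vector of the chart, still annihilated by the gradient and hence a multiple
    of \<open>tau\<close>.\<close>
  define \<alpha> where "\<alpha> = T $ k"
  have "(T - \<alpha> *s Z) $ k = 0" by (simp add: \<alpha>_def Z_def chart_incl_component)
  then obtain u where u: "T - \<alpha> *s Z = chart_incl k u" using chart_incl_exists by blast
  have "dotc (G Z) (chart_incl k u) = 0" unfolding u[symmetric] dotc_simps using GT GZ by simp
  then obtain \<kappa> where \<kappa>: "u = \<kappa> *s tau k w" using kernel_gm[of k w u] Z by (auto simp: Z_def)
  define t where "t = chart_incl k (tau k w)"
  have Tt: "T = \<alpha> *s Z + \<kappa> *s t" using u unfolding \<kappa> chart_incl_smult t_def by (simp add: algebra_simps)
  have Gt: "dotc (G Z) t = 0" by (simp add: Z_def t_def dotc_G_tau)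
  define Q where "Q = dotc (form_hess d a Z t) t"
  \<comment> \<open>By Euler's relations each term containing the base point is a multiple of
    \<open>dotc (G Z) Z\<close> or \<open>dotc (G Z) t\<close>, both 0.\<close>
  have Q: "dotc (form_hess d a Z T) T = \<kappa>\<^sup>2 * Q"
    unfolding Tt form_hess_linear dotc_simps euler_grad form_hess_base_right GZ Gt Q_def by (simp add: power2_eq_square)
  define A where "A = fs_form Z t t"
  have A0: "A > 0" unfolding A_def Z_def t_def by (rule herm_tau_pos) (use Z in \<open>simp add: Z_def\<close>)
  have A: "fs_form z T T = (cmod (\<kappa> / c))\<^sup>2 * A"
  proof -
    have Teq: "\<alpha> *s Z + c *s ((\<kappa> / c) *s t) = T" using c(1) by (simp add: Tt)
    have "fs_form z T T = fs_form Z ((\<kappa> / c) *s t) ((\<kappa> / c) *s t)"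
      using fs_form_rescale[OF c(1) Z(1), of \<alpha> "(\<kappa> / c) *s t" \<alpha> "(\<kappa> / c) *s t"] unfolding Teq c(2)[symmetric] .
    also have "\<dots> = Re ((\<kappa> / c) * (cnj (\<kappa> / c) * of_real A))" by (simp only: fs_form_herm herm_simps(3,4)) (simp add: herm_self A_def mult_ac)
    also have "(\<kappa> / c) * (cnj (\<kappa> / c) * of_real A) = of_real ((cmod (\<kappa> / c))\<^sup>2 * A)"
      by (simp only: mult.assoc[symmetric] complex_norm_square[symmetric] of_real_mult)
    finally show ?thesis by simp
  qed
  have \<kappa>0: "\<kappa> \<noteq> 0" using T(2) A by auto
  have "(cmod (dotc (form_hess d a z T) T))\<^sup>2 / ((norm z)\<^sup>2 * (norm (G z))\<^sup>2 * (fs_form z T T)\<^sup>2)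
    = (cmod Q)\<^sup>2 / ((norm Z)\<^sup>2 * (norm (G Z))\<^sup>2 * A\<^sup>2)"
  \<comment> \<open>For \<open>d < 2\<close> the Hessian vanishes. Otherwise
    \<open>d = e + 2\<close>, and the scaling exponents \<open>e\<close> of the Hessian and
    \<open>e + 1\<close> of the gradient balance.\<close>
  proof (cases "d < 2")
    case True
    then have "form_hess d a Z h = 0" for Z h
      by (auto simp: form_hess_def vec_eq_iff dotc_def form_grad_def)
    then show ?thesis by (simp add: Q_def dotc_simps)
  next
    case False
    then have "d = Suc (Suc (d - 2))" by simp
    then obtain e where e: "d = Suc (Suc e)" by blast
    define C where "C = cmod c"
    define k' where "k' = cmod \<kappa>"
    have C: "C > 0" "k' > 0" using c(1) \<kappa>0 by (auto simp: C_def k'_def)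
    have G0: "norm (G Z) > 0" using smooth[OF Z] by simp
    have "(cmod (dotc (form_hess d a z T) T))\<^sup>2 = (C ^ e)\<^sup>2 * (k' ^ 4 * (cmod Q)\<^sup>2)"
      unfolding c(2) form_hess_scale dotc_simps Q by (simp add: e norm_mult norm_power power_mult_distrib C_def k'_def flip: power_mult)
    moreover have "(norm z)\<^sup>2 * (norm (G z))\<^sup>2 * (fs_form z T T)\<^sup>2 = (C ^ e)\<^sup>2 * (k' ^ 4 * ((norm Z)\<^sup>2 * (norm (G Z))\<^sup>2 * A\<^sup>2))"
    proof -
      have A': "fs_form z T T = (k' / C)\<^sup>2 * A" using A by (simp add: norm_divide C_def k'_def)
      show ?thesis
        unfolding A'
        unfolding c(2) form_grad_scale norm_smult_vec norm_power C_def[symmetric]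
        using C by (simp add: e field_simps power2_eq_square power4_eq_xxxx)
    qed
    ultimately show ?thesis using C by simp
  qed
  then have K: "K = 1 + (cmod Q)\<^sup>2 / ((norm Z)\<^sup>2 * (norm (G Z))\<^sup>2 * A\<^sup>2)" by (simp add: K_def)
  have "curvature_density curve (proj z) = fibre_integral (fs_pullback (affine_lift k)) (affine_part k curve) w"
    unfolding curvature_density_def kw_def[symmetric] kw by simp
  also have "\<dots> = ennreal (pi / 2 * (K - 2 + 2 / K))"
    using fibre_integral_curve[of k w] Z unfolding K Q_def A_def Z_def t_def by simp
  finally show ?thesis .
qed

end

section \<open>Projection of the curve from a point\<close>

text \<open>The cross product without conjugation. For \<open>dotc\<close> its value annihilates
  both arguments, so it gives the line through two points and, dually, the intersection of two
  lines.\<close>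

definition crossc :: "complex ^ 3 \<Rightarrow> complex ^ 3 \<Rightarrow> complex ^ 3"
  where "crossc u v = vector [u $ 2 * v $ 3 - u $ 3 * v $ 2, u $ 3 * v $ 1 - u $ 1 * v $ 3, u $ 1 * v $ 2 - u $ 2 * v $ 1]"

lemma crossc_dotc: "dotc (crossc u v) u = 0" "dotc (crossc u v) v = 0" "dotc u (crossc u v) = 0" "dotc v (crossc u v) = 0"
  by (simp_all add: crossc_def dotc_def sum_3 algebra_simps)

lemma crossc_triple: "dotc (crossc u v) w = dotc (crossc v w) u" "dotc (crossc u v) w = - dotc (crossc u w) v"
  by (simp_all add: crossc_def dotc_def sum_3 algebra_simps)

lemma crossc_eq_0:
  assumes "crossc u v = 0" "u \<noteq> 0"
  shows "\<exists>c. v = c *s u"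
proof -
  have e: "u $ 2 * v $ 3 = u $ 3 * v $ 2" "u $ 3 * v $ 1 = u $ 1 * v $ 3" "u $ 1 * v $ 2 = u $ 2 * v $ 1"
    using assms(1) by (simp_all add: crossc_def vec_eq_iff forall_3)
  obtain k where k: "u $ k \<noteq> 0" using assms(2) by (auto simp: vec_eq_iff)
  have "v = (v $ k / u $ k) *s u"
    using exhaust_3[of k] e k by (auto simp: vec_eq_iff forall_3 field_simps)
  then show ?thesis by blast
qed

lemma dotc_cnjv: "dotc (cnjv u) u = of_real ((norm u)\<^sup>2)" "dotc u (cnjv u) = of_real ((norm u)\<^sup>2)"
proof -
  have "dotc (cnjv u) u = hinner u u" "dotc u (cnjv u) = hinner u u" by (simp_all add: dotc_def cnjv_def hinner_def mult.commute)
  then show "dotc (cnjv u) u = of_real ((norm u)\<^sup>2)" "dotc u (cnjv u) = of_real ((norm u)\<^sup>2)" by (simp_all add: hinner_self)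
qed

definition complex_of_vec :: "real ^ 2 \<Rightarrow> complex" where "complex_of_vec t = Complex (t $ 1) (t $ 2)"
definition vec_of_complex :: "complex \<Rightarrow> real ^ 2" where "vec_of_complex z = vector [Re z, Im z]"

lemma vec_complex_inverse [simp]: "complex_of_vec (vec_of_complex z) = z" "vec_of_complex (complex_of_vec t) = t"
  by (simp_all add: complex_of_vec_def vec_of_complex_def vec_eq_iff forall_2)

lemma bounded_linear_complex_of_vec: "bounded_linear complex_of_vec"
  by (intro linear_conv_bounded_linear[THEN iffD1] linearI) (simp_all add: complex_of_vec_def complex_eq_iff)

lemma bounded_linear_vec_of_complex: "bounded_linear vec_of_complex"
  by (intro linear_conv_bounded_linear[THEN iffD1] linearI) (simp_all add: vec_of_complex_def vec_eq_iff forall_2)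

text \<open>\<open>local_param\<close> lives on \<open>real ^ 2\<close>, the potential theory on
  \<open>complex\<close>. Agreement on boxes identifies the two Lebesgue measures.\<close>

lemma distr_complex_of_vec: "distr lborel borel complex_of_vec = lborel"
proof -
  have c: "continuous_on UNIV complex_of_vec"
    by (intro bounded_linear.continuous_on[OF bounded_linear_complex_of_vec] continuous_on_id)
  have [measurable]: "complex_of_vec \<in> borel_measurable borel" by (rule borel_measurable_continuous_onI[OF c])
  have "lborel = distr lborel borel complex_of_vec"
  proof (rule lborel_eqI)
    fix l u :: complex assume lu: "\<And>b. b \<in> Basis \<Longrightarrow> l \<bullet> b \<le> u \<bullet> b"
    have B: "Basis = {axis 1 1, axis 2 1 :: real ^ 2}" by (auto simp: Basis_vec_def UNIV_2)
    have ne: "axis 1 1 \<noteq> (axis 2 1 :: real ^ 2)" by (simp add: axis_eq_axis)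
    have "complex_of_vec -` box l u \<inter> space lborel = box (vec_of_complex l) (vec_of_complex u)"
      by (auto simp: box_def B Basis_complex_def complex_of_vec_def vec_of_complex_def inner_axis inner_complex_def)
    then have "emeasure (distr lborel borel complex_of_vec) (box l u) = emeasure lborel (box (vec_of_complex l) (vec_of_complex u))"
      by (simp add: emeasure_distr)
    also have "\<dots> = ennreal (\<Prod>b\<in>Basis. (vec_of_complex u - vec_of_complex l) \<bullet> b)"
      using lu[of 1] lu[of \<i>] by (intro emeasure_lborel_box) (auto simp: B Basis_complex_def vec_of_complex_def inner_axis inner_complex_def)
    also have "(\<Prod>b\<in>Basis. (vec_of_complex u - vec_of_complex l) \<bullet> b) = (\<Prod>b\<in>Basis. (u - l) \<bullet> b)"
      using ne by (simp add: B Basis_complex_def vec_of_complex_def inner_axis inner_complex_def)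
    finally show "emeasure (distr lborel borel complex_of_vec) (box l u) = ennreal (prod ((\<bullet>) (u - l)) Basis)" by simp
  qed simp
  then show ?thesis by simp
qed

lemma nn_integral_complex_of_vec:
  assumes "f \<in> borel_measurable borel"
  shows "(\<integral>\<^sup>+t. f (complex_of_vec t) \<partial>lborel) = (\<integral>\<^sup>+x. f x \<partial>lborel)"
proof -
  have c: "continuous_on UNIV complex_of_vec"
    by (intro bounded_linear.continuous_on[OF bounded_linear_complex_of_vec] continuous_on_id)
  have [measurable]: "complex_of_vec \<in> borel_measurable borel" by (rule borel_measurable_continuous_onI[OF c])
  have "(\<integral>\<^sup>+x. f x \<partial>lborel) = (\<integral>\<^sup>+x. f x \<partial>distr lborel borel complex_of_vec)" by (simp add: distr_complex_of_vec)
  also have "\<dots> = (\<integral>\<^sup>+t. f (complex_of_vec t) \<partial>lborel)" using assms by (subst nn_integral_distr) auto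
  finally show ?thesis ..
qed

section \<open>Affine frames and graph patches\<close>

text \<open>The triple product is the determinant of the frame. The frame gives affine coordinates
  \<open>x\<close>, \<open>y\<close> on the projective plane in which projection from
  \<open>[e2]\<close> is the map to \<open>x\<close>.\<close>

locale curve_frame = smooth_form +
  fixes e0 e1 e2 :: "complex ^ 3"
  assumes frame: "dotc (crossc e0 e1) e2 \<noteq> 0"
begin

definition l0 where "l0 = (1 / dotc (crossc e0 e1) e2) *s crossc e1 e2"
definition l1 where "l1 = (1 / dotc (crossc e0 e1) e2) *s crossc e2 e0"
definition l2 where "l2 = (1 / dotc (crossc e0 e1) e2) *s crossc e0 e1"

lemma dual_frame:
  "dotc l0 e0 = 1" "dotc l0 e1 = 0" "dotc l0 e2 = 0" "dotc l1 e0 = 0" "dotc l1 e1 = 1" "dotc l1 e2 = 0"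
  "dotc l2 e0 = 0" "dotc l2 e1 = 0" "dotc l2 e2 = 1"
  using frame crossc_triple(1)[of e0 e1 e2] crossc_triple(1)[of e1 e2 e0]
  by (simp_all add: l0_def l1_def l2_def dotc_simps crossc_dotc)

lemma frame_expansion: "z = dotc l0 z *s e0 + dotc l1 z *s e1 + dotc l2 z *s e2"
proof -
  define \<Delta> where "\<Delta> = dotc (crossc e0 e1) e2"
  have "\<Delta> *s z = dotc (crossc e1 e2) z *s e0 + dotc (crossc e2 e0) z *s e1 + dotc (crossc e0 e1) z *s e2"
    unfolding \<Delta>_def vec_eq_iff forall_3 crossc_def dotc_def sum_3 by (simp add: algebra_simps)
  then have "(1 / \<Delta>) *s (\<Delta> *s z) = (1 / \<Delta>) *s (dotc (crossc e1 e2) z *s e0 + dotc (crossc e2 e0) z *s e1 + dotc (crossc e0 e1) z *s e2)"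
    by simp
  then show ?thesis using frame
    by (simp add: l0_def l1_def l2_def dotc_simps \<Delta>_def[symmetric] vector_add_ldistrib)
qed

lemma dotc_nonzero_on_frame:
  assumes "u \<noteq> 0"
  shows "dotc u e0 \<noteq> 0 \<or> dotc u e1 \<noteq> 0 \<or> dotc u e2 \<noteq> 0"
proof (rule ccontr)
  assume "\<not> ?thesis"
  then have "dotc u (cnjv u) = 0" by (subst frame_expansion[of "cnjv u"]) (simp add: dotc_simps)
  then show False using assms by (simp add: dotc_cnjv)
qed

definition pt :: "complex \<Rightarrow> complex \<Rightarrow> complex ^ 3" where "pt x y = e0 + x *s e1 + y *s e2"

lemma dual_pt: "dotc l0 (pt x y) = 1" "dotc l1 (pt x y) = x" "dotc l2 (pt x y) = y"
  by (simp_all add: pt_def dotc_simps dual_frame)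

lemma pt_nonzero: "pt x y \<noteq> 0"
  using dual_pt(1)[of x y] by (auto simp: dotc_simps)

definition rect :: "complex set \<Rightarrow> complex set \<Rightarrow> 3 cproj set"
  where "rect D D' = {proj (pt x y) | x y. x \<in> D \<and> y \<in> D'}"

lemma proj_in_rect:
  assumes "z \<noteq> 0"
  shows "proj z \<in> rect D D' \<longleftrightarrow> dotc l0 z \<noteq> 0 \<and> dotc l1 z / dotc l0 z \<in> D \<and> dotc l2 z / dotc l0 z \<in> D'"
proof
  assume "proj z \<in> rect D D'"
  then obtain x y c where "x \<in> D" "y \<in> D'" "c \<noteq> 0" "z = c *s pt x y"
    using proj_eq_iff[OF assms pt_nonzero] by (auto simp: rect_def)
  then show "dotc l0 z \<noteq> 0 \<and> dotc l1 z / dotc l0 z \<in> D \<and> dotc l2 z / dotc l0 z \<in> D'"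
    by (simp add: dotc_simps dual_pt)
next
  assume r: "dotc l0 z \<noteq> 0 \<and> dotc l1 z / dotc l0 z \<in> D \<and> dotc l2 z / dotc l0 z \<in> D'"
  have "z = dotc l0 z *s pt (dotc l1 z / dotc l0 z) (dotc l2 z / dotc l0 z)"
    using r frame_expansion[of z] by (simp add: pt_def vector_add_ldistrib)
  then have "proj z = proj (pt (dotc l1 z / dotc l0 z) (dotc l2 z / dotc l0 z))"
    using proj_smult[OF _ pt_nonzero] r by metis
  then show "proj z \<in> rect D D'" using r by (auto simp: rect_def)
qed

lemma proj_pt_in_rect: "proj (pt x y) \<in> rect D D' \<longleftrightarrow> x \<in> D \<and> y \<in> D'"
  by (simp add: proj_in_rect[OF pt_nonzero] dual_pt)

lemma proj_pt_eq_iff: "proj (pt x y) = proj (pt x' y') \<longleftrightarrow> x = x' \<and> y = y'"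
  using proj_pt_in_rect[of x y "{x'}" "{y'}"] by (auto simp: rect_def)

lemma open_rect:
  assumes "open D" "open D'"
  shows "open (rect D D')"
proof -
  have "{z. z \<noteq> 0 \<and> proj z \<in> rect D D'} = {z. dotc l0 z \<noteq> 0} \<inter> (\<lambda>z. (dotc l1 z / dotc l0 z, dotc l2 z / dotc l0 z)) -` (D \<times> D')"
  proof (rule set_eqI)
    show "z \<in> {z. z \<noteq> 0 \<and> proj z \<in> rect D D'} \<longleftrightarrow> z \<in> {z. dotc l0 z \<noteq> 0} \<inter> (\<lambda>z. (dotc l1 z / dotc l0 z, dotc l2 z / dotc l0 z)) -` (D \<times> D')" for z
      by (cases "z = 0") (auto simp: proj_in_rect dotc_simps)
  qed
  moreover have "open ({z. dotc l0 z \<noteq> 0} \<inter> (\<lambda>z. (dotc l1 z / dotc l0 z, dotc l2 z / dotc l0 z)) -` (D \<times> D'))"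
    by (intro continuous_open_preimage continuous_intros open_Collect_neq open_Times assms) auto
  ultimately show ?thesis by (simp add: open_cproj_def)
qed

text \<open>Implicit differentiation of \<open>F (pt x y) = 0\<close> in \<open>x\<close>;
  accordingly \<open>tg\<close> is the velocity of a lifted branch.\<close>

definition slope :: "complex \<Rightarrow> complex \<Rightarrow> complex"
  where "slope x y = - dotc (G (pt x y)) e1 / dotc (G (pt x y)) e2"

definition tg :: "complex \<Rightarrow> complex \<Rightarrow> complex ^ 3"
  where "tg x y = e1 + slope x y *s e2"

definition area_density :: "complex \<Rightarrow> complex \<Rightarrow> real"
  where "area_density x y = fs_form (pt x y) (tg x y) (tg x y)"

lemma dual_tg: "dotc l0 (tg x y) = 0" "dotc l1 (tg x y) = 1"
  by (simp_all add: tg_def dotc_simps dual_frame)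

lemma dotc_G_tg: "dotc (G (pt x y)) e2 \<noteq> 0 \<Longrightarrow> dotc (G (pt x y)) (tg x y) = 0"
  by (simp add: tg_def slope_def dotc_simps)

text \<open>The coordinates of \<open>tg\<close> along \<open>e0\<close> and \<open>e1\<close> are 0
  and 1, while \<open>pt x y\<close> has \<open>e0\<close>-coordinate 1. So \<open>tg\<close> is
  never a multiple of the base point.\<close>

lemma area_density_pos: "area_density x y > 0"
proof -
  have "area_density x y \<noteq> 0"
  proof
    assume "area_density x y = 0"
    then obtain c where c: "tg x y = c *s pt x y" using fs_form_eq_0_iff[OF pt_nonzero] by (auto simp: area_density_def)
    have "dotc l0 (tg x y) = dotc l0 (c *s pt x y)" by (simp only: c)
    then have "c = 0" by (simp add: dotc_simps dual_pt dual_tg)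
    then have "tg x y = 0" using c by simp
    then show False using dual_tg(2)[of x y] by (simp add: dotc_simps)
  qed
  then show ?thesis using fs_form_nonneg[of "pt x y" "tg x y"] by (simp add: area_density_def)
qed

text \<open>\<open>D'\<close> isolates one sheet: over \<open>D\<close> the curve has exactly one
  point with \<open>y\<close> in \<open>D'\<close>. Other sheets may lie over the same
  \<open>D\<close>.\<close>

definition graph_patch :: "complex set \<Rightarrow> complex set \<Rightarrow> (complex \<Rightarrow> complex) \<Rightarrow> bool"
  where "graph_patch D D' h \<longleftrightarrow> open D \<and> open D' \<and> (\<forall>x\<in>D. h x \<in> D') \<and>
    (\<forall>x\<in>D. \<forall>y\<in>D'. F (pt x y) = 0 \<longleftrightarrow> y = h x) \<and> (\<forall>x\<in>D. dotc (G (pt x (h x))) e2 \<noteq> 0) \<and>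
    (\<forall>x\<in>D. (h has_field_derivative slope x (h x)) (at x))"

lemma graph_patch_exists:
  assumes "F (pt x0 y0) = 0" "dotc (G (pt x0 y0)) e2 \<noteq> 0"
  shows "\<exists>D D' h. graph_patch D D' h \<and> x0 \<in> D \<and> y0 \<in> D' \<and> h x0 = y0"
  using graph_over_tangent[OF assms[unfolded pt_def]] unfolding graph_patch_def slope_def pt_def by blast

lemma graph_patch_has_derivative:
  assumes "graph_patch D D' h" "x \<in> D"
  shows "((\<lambda>x. pt x (h x)) has_derivative (\<lambda>k. k *s tg x (h x))) (at x)"
proof -
  have "(h has_field_derivative slope x (h x)) (at x)" using assms by (auto simp: graph_patch_def)
  then have h: "(h has_derivative (\<lambda>k. slope x (h x) * k)) (at x)" by (simp add: has_field_derivative_def)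
  have "((\<lambda>x. e0 + x *s e1 + h x *s e2) has_derivative (\<lambda>k. 0 + k *s e1 + (slope x (h x) * k) *s e2)) (at x)"
    by (intro has_derivative_add has_derivative_const bounded_linear.has_derivative[OF bounded_linear_smult_left] has_derivative_ident h)
  moreover have "0 + k *s e1 + (slope x (h x) * k) *s e2 = k *s tg x (h x)" for k
    by (simp add: tg_def vector_add_ldistrib mult.commute)
  ultimately show ?thesis by (simp add: pt_def)
qed

lemma graph_patch_continuous:
  assumes "graph_patch D D' h"
  shows "continuous_on D h" "continuous_on D (\<lambda>x. pt x (h x))" "continuous_on D (\<lambda>x. tg x (h x))" "continuous_on D (\<lambda>x. area_density x (h x))"
proof -
  show "continuous_on D h"
    using assms by (intro continuous_at_imp_continuous_on) (auto simp: graph_patch_def intro: DERIV_isCont)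
  show p: "continuous_on D (\<lambda>x. pt x (h x))"
    using graph_patch_has_derivative[OF assms] by (intro continuous_at_imp_continuous_on) (auto intro: has_derivative_continuous)
  have "continuous_on D (\<lambda>x. slope x (h x))"
    unfolding slope_def by (intro continuous_intros p) (use assms in \<open>auto simp: graph_patch_def\<close>)
  then show t: "continuous_on D (\<lambda>x. tg x (h x))"
    unfolding tg_def by (intro continuous_intros bounded_linear.continuous_on[OF bounded_linear_smult_left])
  show "continuous_on D (\<lambda>x. area_density x (h x))"
    unfolding area_density_def by (intro continuous_on_fs_form p t) (simp add: pt_nonzero)
qed

text \<open>The lift is holomorphic, so the pulled back metric is conformal: its Gram matrix is
  \<open>area_density\<close> times the identity, and the square root of the determinant is
  \<open>area_density\<close> again. The inverse coordinate is a fraction of linear forms,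
  differentiable wherever \<open>dotc l0 z\<close> is nonzero.\<close>

lemma fs_chart_graph_patch:
  assumes gp: "graph_patch D D' h"
  shows "fs_chart curve (complex_of_vec -` D) (\<lambda>t. pt (complex_of_vec t) (h (complex_of_vec t))) (rect D D') (\<lambda>z. vec_of_complex (dotc l1 z / dotc l0 z))"
    and "t \<in> complex_of_vec -` D \<Longrightarrow> fs_density (\<lambda>t. pt (complex_of_vec t) (h (complex_of_vec t))) t = area_density (complex_of_vec t) (h (complex_of_vec t))"
proof -
  define U where "U = complex_of_vec -` D"
  define \<phi> where "\<phi> = (\<lambda>t. pt (complex_of_vec t) (h (complex_of_vec t)))"
  have D: "open D" "open D'" "\<And>x. x \<in> D \<Longrightarrow> h x \<in> D'" "\<And>x y. x \<in> D \<Longrightarrow> y \<in> D' \<Longrightarrow> F (pt x y) = 0 \<longleftrightarrow> y = h x"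
    using gp by (auto simp: graph_patch_def)
  have cc: "continuous_on UNIV complex_of_vec"
    by (intro bounded_linear.continuous_on[OF bounded_linear_complex_of_vec] continuous_on_id)
  have oU: "open U" unfolding U_def by (intro open_vimage D cc)
  have der: "(\<phi> has_derivative (\<lambda>k. complex_of_vec k *s tg (complex_of_vec t) (h (complex_of_vec t)))) (at t)" if "t \<in> U" for t
    using diff_chain_at[OF bounded_linear_imp_has_derivative[OF bounded_linear_complex_of_vec] graph_patch_has_derivative[OF gp]] that
    by (simp add: o_def \<phi>_def U_def)
  have c1: "C1_on U \<phi>"
  proof (rule C1_onI[OF der])
    fix k
    have "continuous_on U (\<lambda>t. tg (complex_of_vec t) (h (complex_of_vec t)))"
      by (rule continuous_on_compose2[OF graph_patch_continuous(3)[OF gp] continuous_on_subset[OF cc]]) (auto simp: U_def)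
    moreover have "bounded_linear (\<lambda>v :: complex ^ 3. c *s v)" for c
      by (intro linear_conv_bounded_linear[THEN iffD1] linearI) (simp_all add: vec_eq_iff algebra_simps)
    ultimately show "continuous_on U (\<lambda>t. complex_of_vec k *s tg (complex_of_vec t) (h (complex_of_vec t)))"
      using bounded_linear.continuous_on by blast
  qed
  have gram: "gram \<phi> t = mat (area_density (complex_of_vec t) (h (complex_of_vec t)))" if t: "t \<in> U" for t
  proof -
    let ?a = "area_density (complex_of_vec t) (h (complex_of_vec t))"
    have "fs_pullback \<phi> t u v = Re (complex_of_vec u * cnj (complex_of_vec v)) * ?a" for u v
    proof -
      have "fs_pullback \<phi> t u v = Re (complex_of_vec u * (cnj (complex_of_vec v) * of_real ?a))"
        unfolding fs_pullback_def frechet_derivative_at[OF der[OF t], symmetric] fs_form_herm herm_simps(3,4)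
        by (simp only: mult.left_commute herm_self area_density_def \<phi>_def)
      then show ?thesis by (simp add: mult.assoc[symmetric])
    qed
    then show ?thesis
      by (simp add: gram_def mat_def vec_eq_iff forall_2 complex_of_vec_def axis_def)
  qed
  have det: "det (gram \<phi> t) = (area_density (complex_of_vec t) (h (complex_of_vec t)))\<^sup>2" if "t \<in> U" for t
    unfolding gram[OF that] by (simp add: det_2 mat_def power2_eq_square)
  show "t \<in> complex_of_vec -` D \<Longrightarrow> fs_density (\<lambda>t. pt (complex_of_vec t) (h (complex_of_vec t))) t = area_density (complex_of_vec t) (h (complex_of_vec t))"
    using det[of t] area_density_pos by (simp add: U_def \<phi>_def less_imp_le)
  have F0: "F (pt x (h x)) = 0" if "x \<in> D" for x using D(3,4) that by blast
  have lp: "local_param U \<phi> curve"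
    unfolding local_param_def
  proof (intro conjI ballI)
    show "inj_on (\<lambda>t. proj (\<phi> t)) U"
      by (rule inj_onI) (metis \<phi>_def proj_pt_eq_iff vec_complex_inverse(2))
    show "det (gram \<phi> t) \<noteq> 0" if "t \<in> U" for t using det[OF that] area_density_pos by (simp add: less_imp_neq[symmetric])
  qed (use oU c1 F0 in \<open>auto simp: \<phi>_def pt_nonzero proj_in_curve U_def\<close>)
  have im: "(\<lambda>t. proj (\<phi> t)) ` U = curve \<inter> rect D D'"
  proof (intro equalityI subsetI)
    fix P assume "P \<in> curve \<inter> rect D D'"
    then obtain x y where xy: "P = proj (pt x y)" "x \<in> D" "y \<in> D'" "proj (pt x y) \<in> curve" by (auto simp: rect_def)
    then have "y = h x" using D(4) proj_in_curve[OF pt_nonzero] by blast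
    then have "P = proj (\<phi> (vec_of_complex x))" "vec_of_complex x \<in> U" using xy by (auto simp: \<phi>_def U_def)
    then show "P \<in> (\<lambda>t. proj (\<phi> t)) ` U" by blast
  qed (use D(3) F0 in \<open>auto simp: \<phi>_def proj_pt_in_rect proj_in_curve pt_nonzero U_def\<close>)
  have "fs_chart curve U \<phi> (rect D D') (\<lambda>z. vec_of_complex (dotc l1 z / dotc l0 z))"
    unfolding fs_chart_def
  proof (intro conjI allI impI)
    fix z :: "complex ^ 3"
    assume z: "z \<noteq> 0 \<and> proj z \<in> rect D D'"
    then have n: "dotc l0 z \<noteq> 0" using proj_in_rect by blast
    have lin: "(dotc l has_derivative dotc l) (at z)" for l
      using has_derivative_dotc[OF has_derivative_const has_derivative_ident, of l z] by (simp add: dotc_simps)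
    show "(\<lambda>z. vec_of_complex (dotc l1 z / dotc l0 z)) differentiable (at z)"
      using bounded_linear.has_derivative[OF bounded_linear_vec_of_complex has_derivative_divide'[OF lin[of l1] lin[of l0] n]]
      by (auto simp: differentiable_def)
  next
    fix z :: "complex ^ 3"
    assume z: "z \<noteq> 0 \<and> proj z \<in> curve \<inter> rect D D'"
    then obtain x y where xy: "proj z = proj (pt x y)" "x \<in> D" "y \<in> D'" by (auto simp: rect_def)
    then obtain c where c: "c \<noteq> 0" "z = c *s pt x y" using proj_eq_iff[OF _ pt_nonzero] z by blast
    have "y = h x" using D(4) xy z proj_in_curve[OF pt_nonzero] by auto
    moreover have "dotc l1 z / dotc l0 z = x" using c by (simp add: dotc_simps dual_pt)
    ultimately show "vec_of_complex (dotc l1 z / dotc l0 z) \<in> U" "proj (\<phi> (vec_of_complex (dotc l1 z / dotc l0 z))) = proj z"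
      using xy by (auto simp: U_def \<phi>_def)
  qed (use lp im open_rect D in auto)
  then show "fs_chart curve (complex_of_vec -` D) (\<lambda>t. pt (complex_of_vec t) (h (complex_of_vec t))) (rect D D') (\<lambda>z. vec_of_complex (dotc l1 z / dotc l0 z))"
    by (simp add: U_def \<phi>_def)
qed

end

section \<open>The volume measure of the curve\<close>

context smooth_form
begin

text \<open>The frame is adapted to the point: \<open>cnjv (G z)\<close> is transversal to the
  curve, and the conjugate of a cross product completes the frame, since a vector pairs with its
  conjugate to its squared norm.\<close>

lemma curve_chart_exists:
  assumes "P \<in> curve"
  shows "\<exists>(U :: (real ^ 2) set) \<phi> W \<kappa>. fs_chart curve U \<phi> W \<kappa> \<and> P \<in> W"
proof -
  obtain z where z: "P = proj z" "z \<noteq> 0" "F z = 0" using assms by (auto simp: curve_def)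
  have G0: "G z \<noteq> 0" by (rule smooth[OF z(2,3)])
  define e2 where "e2 = cnjv (G z)"
  define e1 where "e1 = cnjv (crossc z e2)"
  have Gz: "dotc (G z) z = 0" by (simp add: euler_form z)
  have Ge2: "dotc (G z) e2 \<noteq> 0" using G0 by (simp add: e2_def dotc_cnjv)
  have "crossc z e2 \<noteq> 0"
  proof
    assume "crossc z e2 = 0"
    then obtain c where c: "e2 = c *s z" using crossc_eq_0 z(2) by blast
    then show False using Ge2 Gz by (simp add: dotc_simps)
  qed
  moreover have "dotc (crossc z e1) e2 = - dotc (crossc z e2) e1" by (rule crossc_triple(2))
  ultimately have "dotc (crossc z e1) e2 \<noteq> 0" by (simp add: e1_def dotc_cnjv)
  then interpret curve_frame d a z e1 e2 by unfold_locales
  have p0: "pt 0 0 = z" by (simp add: pt_def)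
  obtain D D' h where gp: "graph_patch D D' h" "0 \<in> D" "0 \<in> D'"
    using graph_patch_exists[of 0 0] z Ge2 by (auto simp: p0)
  have "P \<in> rect D D'" using proj_pt_in_rect[of 0 0 D D'] gp by (simp add: p0 z)
  then show ?thesis using fs_chart_graph_patch(1)[OF gp(1)] by blast
qed

text \<open>The Lindelof property of the space of homogeneous coordinates, applied to the open
  preimages.\<close>

lemma lindelof_cproj:
  fixes W :: "'b \<Rightarrow> 3 cproj set"
  assumes "\<And>i. i \<in> I \<Longrightarrow> open (W i)" "S \<subseteq> (\<Union>i\<in>I. W i)"
  shows "\<exists>J. countable J \<and> J \<subseteq> I \<and> S \<subseteq> (\<Union>i\<in>J. W i)"
proof -
  define V where "V i = {z. z \<noteq> 0 \<and> proj z \<in> W i}" for i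
  have "\<And>X. X \<in> V ` I \<Longrightarrow> open X" using assms(1) open_proj_preimage by (auto simp: V_def)
  then obtain \<F> where \<F>: "\<F> \<subseteq> V ` I" "countable \<F>" "\<Union>\<F> = \<Union>(V ` I)" by (rule Lindelof)
  then obtain J where J: "countable J" "J \<subseteq> I" "\<F> = V ` J" using countable_subset_image[of \<F> V I] by blast
  have "S \<subseteq> (\<Union>i\<in>J. W i)"
  proof
    fix P assume P: "P \<in> S"
    obtain z where z: "z \<noteq> 0" "proj z = P" by (rule proj_surj)
    obtain i where "i \<in> I" "P \<in> W i" using P assms(2) by blast
    then have "z \<in> \<Union>(V ` I)" using z by (auto simp: V_def)
    then have "z \<in> \<Union>(V ` J)" using \<F>(3) J(3) by simp
    then show "P \<in> (\<Union>i\<in>J. W i)" using z by (auto simp: V_def)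
  qed
  then show ?thesis using J by blast
qed

lemma fs_chart_empty: "fs_chart M {} \<phi> {} \<kappa>"
  by (simp add: fs_chart_def local_param_def C1_on_def)

definition \<mu> where "\<mu> = fs_volume TYPE(2) curve"

lemma volume_property_curve: "volume_property TYPE(2) curve \<mu>"
proof -
  define C where "C = (\<lambda>(U :: (real ^ 2) set, \<phi>, W, \<kappa>). fs_chart curve U \<phi> W \<kappa>)"
  have "\<forall>P\<in>curve. \<exists>c. C c \<and> P \<in> fst (snd (snd c))"
    using curve_chart_exists unfolding C_def by fastforce
  then obtain ch where ch: "\<And>P. P \<in> curve \<Longrightarrow> C (ch P) \<and> P \<in> fst (snd (snd (ch P)))" by metis
  have "\<exists>J. countable J \<and> J \<subseteq> curve \<and> curve \<subseteq> (\<Union>P\<in>J. fst (snd (snd (ch P))))"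
  proof (rule lindelof_cproj)
    fix P assume "P \<in> curve"
    then have "C (ch P)" using ch by blast
    then show "open (fst (snd (snd (ch P))))" by (auto simp: C_def fs_chart_def split: prod.splits)
  qed (use ch in auto)
  then obtain J where J: "countable J" "J \<subseteq> curve" "curve \<subseteq> (\<Union>P\<in>J. fst (snd (snd (ch P))))" by blast
  \<comment> \<open>The cover must be a sequence; an empty cover is replaced by empty
    charts.\<close>
  define en where "en i = (if J = {} then ({}, \<lambda>_. 0, {}, \<lambda>_. 0) else ch (from_nat_into J i))" for i :: nat
  have Cen: "C (en i)" for i
  proof (cases "J = {}")
    case True then show ?thesis by (simp add: en_def C_def fs_chart_empty)
  next
    case False then show ?thesis using ch J(2) from_nat_into[OF False, of i] by (auto simp: en_def)
  qed
  have cov: "curve \<subseteq> (\<Union>i. fst (snd (snd (en i))))"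
  proof
    fix P assume "P \<in> curve"
    then obtain Q where Q: "Q \<in> J" "P \<in> fst (snd (snd (ch Q)))" using J(3) by blast
    then obtain i where "from_nat_into J i = Q" using from_nat_into_surj[OF J(1)] by blast
    then show "P \<in> (\<Union>i. fst (snd (snd (en i))))" using Q by (auto simp: en_def intro!: exI[of _ i])
  qed
  have "fs_chart curve (fst (en i)) (fst (snd (en i))) (fst (snd (snd (en i)))) (snd (snd (snd (en i))))" for i
    using Cen[of i] by (simp add: C_def split: prod.splits)
  then show ?thesis unfolding \<mu>_def by (rule fs_volume_property) (rule cov)
qed

lemma sets_\<mu>: "sets \<mu> = sets (restrict_space borel curve)" "space \<mu> = curve"
proof -
  show s: "sets \<mu> = sets (restrict_space borel curve)" by (rule volume_propertyD(1)[OF volume_property_curve])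
  show "space \<mu> = curve" using sets_eq_imp_space_eq[OF s] by (simp add: space_restrict_space)
qed

end

section \<open>Properness of the projection and discreteness of the branch points\<close>

text \<open>Dividing by \<open>y\<close> moves the zero to \<open>(1 / y) *s u + v\<close>. For
  large \<open>y\<close> this is close to \<open>v\<close>, where the form does not vanish.\<close>

lemma form_root_bound:
  assumes v: "ternary_form d a v \<noteq> 0"
  shows "\<exists>C. \<forall>u y. norm u \<le> B \<longrightarrow> ternary_form d a (u + y *s v) = 0 \<longrightarrow> cmod y \<le> C"
proof -
  have "continuous_on UNIV (ternary_form d a)" using continuous_on_ternary_form[OF continuous_on_id] by simp
  then have "\<forall>\<^sub>F z in nhds v. ternary_form d a z \<noteq> 0"
    using v by (auto simp: continuous_on_eq_continuous_at isCont_def tendsto_at_iff_tendsto_nhds intro!: tendsto_imp_eventually_ne)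
  then obtain \<delta> where \<delta>: "\<delta> > 0" "\<And>z. dist z v < \<delta> \<Longrightarrow> ternary_form d a z \<noteq> 0"
    by (auto simp: eventually_nhds_metric)
  show ?thesis
  proof (intro exI[of _ "\<bar>B\<bar> / \<delta>"] allI impI)
    fix u y assume u: "norm u \<le> B" and 0: "ternary_form d a (u + y *s v) = 0"
    show "cmod y \<le> \<bar>B\<bar> / \<delta>"
    proof (cases "y = 0")
      case False
      then have "u + y *s v = y *s ((1 / y) *s u + v)" by (simp add: vector_add_ldistrib)
      then have "y ^ d * ternary_form d a ((1 / y) *s u + v) = 0" using 0 by (metis ternary_form_scale)
      then have "ternary_form d a ((1 / y) *s u + v) = 0" using False by simp
      then have "\<delta> \<le> dist ((1 / y) *s u + v) v" using \<delta>(2)[of "(1 / y) *s u + v"] by (cases "\<delta> \<le> dist ((1 / y) *s u + v) v") auto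
      also have "\<dots> = norm u / cmod y" by (simp add: dist_norm norm_smult_vec norm_divide)
      finally show ?thesis using u \<delta>(1) False by (simp add: field_simps)
    qed (use \<delta> in simp)
  qed
qed

lemma open_cproj_Compl_point: "open (- {P :: 3 cproj})"
proof -
  obtain z0 where z0: "z0 \<noteq> 0" "proj z0 = P" by (rule proj_surj)
  have "{z. z \<noteq> 0 \<and> proj z \<in> - {P}} = {z. crossc z0 z \<noteq> 0}"
  proof (rule Collect_cong)
    fix z :: "complex ^ 3"
    have c: "crossc z0 (c *s z0) = 0" for c by (simp add: crossc_def vec_eq_iff forall_3)
    show "z \<noteq> 0 \<and> proj z \<in> - {P} \<longleftrightarrow> crossc z0 z \<noteq> 0"
    proof (cases "z = 0")
      case True then show ?thesis using c[of 0] by simp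
    next
      case False
      then have "proj z = P \<longleftrightarrow> (\<exists>c. z = c *s z0)" using proj_eq_iff[of z z0] z0 by auto
      then show ?thesis using False c crossc_eq_0[of z0 z] z0(1) by auto
    qed
  qed
  moreover have "continuous_on UNIV (\<lambda>z. crossc z0 z)"
    by (intro bounded_linear.continuous_on[OF _ continuous_on_id] linear_conv_bounded_linear[THEN iffD1] linearI)
      (simp_all add: crossc_def vec_eq_iff forall_3 algebra_simps)
  ultimately show ?thesis by (simp add: open_cproj_def open_Collect_neq)
qed

text \<open>The centre of projection lies off the curve. Hence all polynomials \<open>P x\<close>
  have degree \<open>d\<close> and the same leading coefficient, and no root escapes to infinity
  over a bounded set of \<open>x\<close>.\<close>

locale branched_cover = curve_frame +
  assumes F_e2: "F e2 \<noteq> 0"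
begin

lemma tendsto_pt: "(f \<longlongrightarrow> x) A \<Longrightarrow> (g \<longlongrightarrow> y) A \<Longrightarrow> ((\<lambda>n. pt (f n) (g n)) \<longlongrightarrow> pt x y) A"
  unfolding pt_def by (intro tendsto_intros bounded_linear.tendsto[OF bounded_linear_smult_left])

lemma tendsto_F_pt:
  assumes "(f \<longlongrightarrow> x) A" "(g \<longlongrightarrow> y) A"
  shows "((\<lambda>n. F (pt (f n) (g n))) \<longlongrightarrow> F (pt x y)) A"
  using continuous_on_ternary_form[OF continuous_on_id, of UNIV d a] tendsto_pt[OF assms]
  by (auto simp: continuous_on_eq_continuous_at intro: isCont_tendsto_compose)

lemma tendsto_dotc_G_pt:
  assumes "(f \<longlongrightarrow> x) A" "(g \<longlongrightarrow> y) A"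
  shows "((\<lambda>n. dotc (G (pt (f n) (g n))) e) \<longlongrightarrow> dotc (G (pt x y)) e) A"
proof -
  have "isCont (\<lambda>z. dotc (G z) e) (pt x y)"
    by (rule has_derivative_continuous[OF has_derivative_dotc[OF has_derivative_form_grad has_derivative_const]])
  then show ?thesis using tendsto_pt[OF assms] by (rule isCont_tendsto_compose)
qed

definition Y where "Y x = {y. F (pt x y) = 0}"

text \<open>The branch points of the projection from \<open>[e2]\<close>.\<close>

definition E where "E = {x. \<exists>y\<in>Y x. dotc (G (pt x y)) e2 = 0}"

abbreviation P where "P x \<equiv> form_poly d a (e0 + x *s e1) e2"

lemma poly_P: "poly (P x) y = F (pt x y)" "degree (P x) = d" "lead_coeff (P x) = F e2" "P x \<noteq> 0"
  using form_poly_lead[OF F_e2] by (simp_all add: poly_form_poly pt_def)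

lemma Y_roots: "Y x = {y. poly (P x) y = 0}"
  by (simp add: Y_def poly_P)

lemma finite_Y: "finite (Y x)"
  unfolding Y_roots using poly_roots_finite[OF poly_P(4)] .

lemma Y_bound: "\<exists>C. \<forall>x y. cmod x \<le> B \<longrightarrow> y \<in> Y x \<longrightarrow> cmod y \<le> C"
proof -
  obtain C where C: "\<And>u y. norm u \<le> norm e0 + B * norm e1 \<Longrightarrow> F (u + y *s e2) = 0 \<Longrightarrow> cmod y \<le> C"
    using form_root_bound[OF F_e2] by metis
  have "norm (e0 + x *s e1) \<le> norm e0 + B * norm e1" if "cmod x \<le> B" for x
    using norm_triangle_ineq[of e0 "x *s e1"] mult_right_mono[OF that, of "norm e1"] by (simp add: norm_smult_vec)
  then show ?thesis using C by (auto simp: Y_def pt_def)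
qed

text \<open>Properness of the projection: fibres over bounded sets are bounded, so points of fibres
  accumulate, and by continuity they accumulate on the curve.\<close>

lemma Y_subsequence:
  assumes "x \<longlonglongrightarrow> x0" "\<And>n. y n \<in> Y (x n)"
  shows "\<exists>k y0. strict_mono (k :: nat \<Rightarrow> nat) \<and> (y \<circ> k) \<longlonglongrightarrow> y0 \<and> y0 \<in> Y x0"
proof -
  obtain B where B: "\<And>n. cmod (x n) \<le> B" using convergent_imp_Bseq[OF convergentI[OF assms(1)]] by (auto simp: Bseq_def)
  obtain C where C: "\<And>x y. cmod x \<le> B \<Longrightarrow> y \<in> Y x \<Longrightarrow> cmod y \<le> C" using Y_bound by metis
  have "bounded (range y)" using C[OF B assms(2)] by (auto simp: bounded_iff)
  then obtain y0 k where k: "strict_mono k" "(y \<circ> k) \<longlonglongrightarrow> y0" using bounded_imp_convergent_subsequence by metis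
  have "((\<lambda>n. F (pt ((x \<circ> k) n) ((y \<circ> k) n))) \<longlonglongrightarrow> F (pt x0 y0))"
    by (rule tendsto_F_pt[OF LIMSEQ_subseq_LIMSEQ[OF assms(1) k(1)] k(2)])
  moreover have "F (pt ((x \<circ> k) n) ((y \<circ> k) n)) = 0" for n using assms(2)[of "k n"] by (simp add: Y_def)
  ultimately have "F (pt x0 y0) = 0" using LIMSEQ_unique[OF _ tendsto_const] by simp
  then show ?thesis using k by (auto simp: Y_def)
qed

text \<open>At a limit of ramification points the derivative along \<open>e2\<close> vanishes, so by
  smoothness and Euler's relation the one along \<open>e1\<close> does not. The curve is there a
  graph \<open>x = h y\<close> with \<open>deriv h = 0\<close> at points accumulating at
  \<open>y0\<close>. The identity theorem makes \<open>h\<close> constant, although the branch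
  points differ from \<open>x0\<close>.\<close>

lemma not_islimpt_E: "\<not> x0 islimpt E"
proof
  assume "x0 islimpt E"
  then obtain x where x: "\<And>n. x n \<in> E - {x0}" "x \<longlonglongrightarrow> x0" by (auto simp: islimpt_sequential)
  have "\<forall>n. \<exists>y. y \<in> Y (x n) \<and> dotc (G (pt (x n) y)) e2 = 0" using x(1) by (auto simp: E_def)
  then obtain y where y: "\<And>n. y n \<in> Y (x n)" "\<And>n. dotc (G (pt (x n) (y n))) e2 = 0" by metis
  obtain k y0 where k: "strict_mono k" "(y \<circ> k) \<longlonglongrightarrow> y0" "y0 \<in> Y x0" using Y_subsequence[OF x(2) y(1)] by blast
  have xk: "(x \<circ> k) \<longlonglongrightarrow> x0" by (rule LIMSEQ_subseq_LIMSEQ[OF x(2) k(1)])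
  have "(\<lambda>n. dotc (G (pt ((x \<circ> k) n) ((y \<circ> k) n))) e2) \<longlonglongrightarrow> dotc (G (pt x0 y0)) e2"
    by (rule tendsto_dotc_G_pt[OF xk k(2)])
  then have "dotc (G (pt x0 y0)) e2 = 0" using y(2) LIMSEQ_unique[OF _ tendsto_const] by simp
  moreover have "dotc (G (pt x0 y0)) (pt x0 y0) = 0" using k(3) by (simp add: euler_form Y_def)
  ultimately have e1: "dotc (G (pt x0 y0)) e1 \<noteq> 0"
    using dotc_nonzero_on_frame[OF smooth[OF pt_nonzero]] k(3) by (auto simp: Y_def pt_def dotc_simps)
  \<comment> \<open>The coordinates exchange their roles, so that \<open>y\<close> becomes the
    parameter of the graph.\<close>
  have pt': "pt x y = e0 + y *s e2 + x *s e1" for x y by (simp add: pt_def)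
  have "F (pt x0 y0) = 0" using k(3) by (simp add: Y_def)
  from graph_over_tangent[OF this[unfolded pt'] e1[unfolded pt'], folded pt'] obtain D D' h where h:
    "open D" "open D'" "y0 \<in> D" "x0 \<in> D'" "h y0 = x0"
    "\<forall>y\<in>D. \<forall>x\<in>D'. F (pt x y) = 0 \<longleftrightarrow> x = h y"
    "\<forall>y\<in>D. (h has_field_derivative - dotc (G (pt (h y) y)) e2 / dotc (G (pt (h y) y)) e1) (at y)"
    by (elim exE conjE) (rule that)
  obtain r where r: "r > 0" "ball y0 r \<subseteq> D" using h(1,3) open_contains_ball by blast
  have hol: "h holomorphic_on ball y0 r"
    by (rule holomorphic_onI) (use h(7) r(2) in \<open>meson field_differentiable_at_within field_differentiable_def subsetD\<close>)
  have "\<forall>\<^sub>F n in sequentially. (y \<circ> k) n \<in> ball y0 r \<and> (x \<circ> k) n \<in> D'"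
    using topological_tendstoD[OF k(2) open_ball, of y0 r] topological_tendstoD[OF xk h(2,4)] r(1) by (auto intro: eventually_conj)
  then obtain N where N: "\<And>n. n \<ge> N \<Longrightarrow> y (k n) \<in> ball y0 r \<and> x (k n) \<in> D'" by (auto simp: eventually_sequentially)
  have hy: "h (y (k n)) = x (k n)" "deriv h (y (k n)) = 0" "y (k n) \<noteq> y0" if "n \<ge> N" for n
  proof -
    have D: "y (k n) \<in> D" "x (k n) \<in> D'" using N[OF that] r(2) by auto
    show 1: "h (y (k n)) = x (k n)" using bspec[OF bspec[OF h(6) D(1)] D(2)] y(1)[of "k n"] by (simp add: Y_def)
    show "deriv h (y (k n)) = 0" using DERIV_imp_deriv[OF bspec[OF h(7) D(1)]] y(2)[of "k n"] by (simp add: 1)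
    show "y (k n) \<noteq> y0" using 1 h(5) x(1)[of "k n"] by auto
  qed
  have "deriv h w = 0" if "w \<in> ball y0 r" for w
  proof (rule analytic_continuation[of "deriv h" "ball y0 r" "(\<lambda>n. y (k n)) ` {N..}" y0])
    show "deriv h holomorphic_on ball y0 r" using hol by (rule holomorphic_deriv) simp
    show "y0 islimpt (\<lambda>n. y (k n)) ` {N..}"
      unfolding islimpt_sequential
      using hy(3) k(2) by (intro exI[of _ "\<lambda>n. y (k (n + N))"]) (auto simp: o_def intro: LIMSEQ_ignore_initial_segment)
  qed (use that r(1) N hy(2) in auto)
  then have "(h has_field_derivative 0) (at w within ball y0 r)" if "w \<in> ball y0 r" for w
    using that holomorphic_derivI[OF hol open_ball, of w] by (metis has_field_derivative_at_within)
  then obtain c where c: "\<And>w. w \<in> ball y0 r \<Longrightarrow> h w = c"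
    using has_field_derivative_zero_constant[OF convex_ball, of y0 r h] by blast
  have "x (k N) = x0" using c[of "y (k N)"] c[of y0] hy(1)[of N] N[of N] h(5) r(1) by simp
  then show False using x(1)[of "k N"] by simp
qed

lemma closed_E: "closed E"
  using not_islimpt_E by (auto simp: closed_limpt)

lemma finite_E: "finite (E \<inter> cball 0 R)"
proof -
  have "finite (cball 0 R \<inter> E)"
    by (rule finite_not_islimpt_in_compact) (use not_islimpt_E in auto)
  then show ?thesis by (simp add: Int_commute)
qed

lemma countable_E: "countable E"
proof -
  have "E = (\<Union>n::nat. E \<inter> cball 0 (real n))" using real_arch_simple by auto
  then show ?thesis using finite_E by (metis countable_UN countable_finite countableI_type)
qed

lemma open_rect_E: "open (rect (- E) UNIV)"
  by (intro open_rect) (use closed_E in auto)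

text \<open>The points left out lie in finite fibres over the countable set \<open>E\<close>, or on
  the line at infinity \<open>dotc l0 z = 0\<close>, where they are roots of one nonzero
  polynomial.\<close>

lemma countable_ramification: "countable (curve - rect (- E) UNIV)"
proof -
  have "curve - rect (- E) UNIV \<subseteq> (\<Union>x\<in>E. (\<lambda>y. proj (pt x y)) ` Y x) \<union> (\<lambda>y. proj (e1 + y *s e2)) ` {y. poly (form_poly d a e1 e2) y = 0}"
  proof
    fix Q assume Q: "Q \<in> curve - rect (- E) UNIV"
    obtain z where z: "z \<noteq> 0" "Q = proj z" "F z = 0" using Q by (auto simp: curve_def)
    show "Q \<in> (\<Union>x\<in>E. (\<lambda>y. proj (pt x y)) ` Y x) \<union> (\<lambda>y. proj (e1 + y *s e2)) ` {y. poly (form_poly d a e1 e2) y = 0}"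
    proof (cases "dotc l0 z = 0")
      case False
      then have "proj z \<in> rect UNIV UNIV" by (simp add: proj_in_rect z)
      then obtain x y where xy: "proj z = proj (pt x y)" by (auto simp: rect_def)
      have "x \<in> E" using Q proj_pt_in_rect[of x y "- E" UNIV] by (auto simp: z xy)
      moreover have "y \<in> Y x" using Q proj_in_curve[OF pt_nonzero] by (simp add: Y_def z xy)
      ultimately show ?thesis by (auto simp: z xy)
    next
      case True
      then have e: "z = dotc l1 z *s e1 + dotc l2 z *s e2" using frame_expansion[of z] by simp
      \<comment> \<open>Otherwise the point would be the centre \<open>[e2]\<close>, which is not on
        the curve.\<close>
      have n: "dotc l1 z \<noteq> 0"
      proof
        assume "dotc l1 z = 0"
        then have ze: "z = dotc l2 z *s e2" using e by simp
        then have "dotc l2 z \<noteq> 0" using z(1) by auto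
        moreover have "dotc l2 z ^ d * F e2 = 0" using z(3) ternary_form_scale[of d a "dotc l2 z" e2] ze by simp
        ultimately show False using F_e2 by simp
      qed
      define w where "w = e1 + (dotc l2 z / dotc l1 z) *s e2"
      have zw: "z = dotc l1 z *s w" using e n by (simp add: w_def vector_add_ldistrib)
      then have w0: "w \<noteq> 0" using z(1) by auto
      have Qw: "Q = proj w" using proj_smult[OF n w0] zw z(2) by metis
      then have "F w = 0" using Q proj_in_curve[OF w0] by simp
      then show ?thesis using Qw by (auto simp: w_def poly_form_poly)
    qed
  qed
  moreover have "finite {y. poly (form_poly d a e1 e2) y = 0}" by (rule poly_roots_finite[OF form_poly_lead(3)[OF F_e2]])
  ultimately show ?thesis
    by (elim countable_subset) (intro countable_Un countable_UN countable_E countable_image countable_finite[OF finite_Y] countable_finite)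
qed

lemma curve_point_null:
  assumes "Q \<in> curve"
  shows "{Q} \<in> null_sets \<mu>"
proof -
  obtain U :: "(real ^ 2) set" and \<phi> W \<kappa> where ch: "fs_chart curve U \<phi> W \<kappa>" "Q \<in> W" using curve_chart_exists[OF assms] by blast
  then have lp: "local_param U \<phi> curve" and im: "{Q} \<subseteq> (\<lambda>t. proj (\<phi> t)) ` U" using assms by (auto simp: fs_chart_def)
  have "closed {Q}" using open_cproj_Compl_point by (simp add: closed_def)
  then have "{Q} \<in> sets borel" by (rule borel_closed)
  then have s: "{Q} \<in> sets \<mu>" using assms by (auto simp: sets_\<mu> sets_restrict_space intro!: image_eqI[of _ _ "{Q}"])
  obtain t0 where t0: "t0 \<in> U" "proj (\<phi> t0) = Q" using im by auto
  have "inj_on (\<lambda>t. proj (\<phi> t)) U" using lp by (simp add: local_param_def)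
  then have t0: "{t\<in>U. proj (\<phi> t) \<in> {Q}} \<subseteq> {t0}" using t0 by (auto dest: inj_onD)
  have "emeasure \<mu> {Q} = (\<integral>\<^sup>+t\<in>{t\<in>U. proj (\<phi> t) \<in> {Q}}. ennreal (fs_density \<phi> t) \<partial>lborel)"
    by (rule volume_propertyD(2)[OF volume_property_curve lp s im])
  also have "\<dots> \<le> (\<integral>\<^sup>+t\<in>{t0}. \<infinity> \<partial>lborel)"
    by (intro nn_integral_mono) (use t0 in \<open>auto simp: indicator_def\<close>)
  also have "\<dots> = 0" by (subst nn_integral_0_iff) (auto simp: indicator_def)
  finally show ?thesis using s by (auto simp: null_sets_def)
qed

lemma AE_unramified: "AE Q in \<mu>. Q \<in> rect (- E) UNIV"
proof -
  have "(\<Union>Q\<in>curve - rect (- E) UNIV. {Q}) \<in> null_sets \<mu>"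
    by (rule null_sets_UN'[OF countable_ramification]) (rule curve_point_null, simp)
  then show ?thesis by (rule AE_I') (auto simp: sets_\<mu>(2))
qed

end

section \<open>Fibrewise integration over the curve\<close>

context branched_cover
begin

text \<open>Off \<open>E\<close> the projection is a covering: the implicit branches through the
  roots at \<open>x0\<close> stay distinct by continuity, and properness admits no further roots
  nearby.\<close>

lemma local_branches:
  assumes x0: "x0 \<notin> E"
  shows "\<exists>\<epsilon>>0. \<exists>h. ball x0 \<epsilon> \<subseteq> - E \<and> (\<forall>y\<in>Y x0. h y x0 = y \<and> (\<exists>D D'. graph_patch D D' (h y) \<and> ball x0 \<epsilon> \<subseteq> D)) \<and>
    (\<forall>x\<in>ball x0 \<epsilon>. bij_betw (\<lambda>y. h y x) (Y x0) (Y x))"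
proof -
  have "\<forall>y\<in>Y x0. \<exists>D D' h. graph_patch D D' h \<and> x0 \<in> D \<and> y \<in> D' \<and> h x0 = y"
    using x0 by (intro ballI graph_patch_exists) (auto simp: E_def Y_def)
  then obtain D D' h where gp: "\<And>y. y \<in> Y x0 \<Longrightarrow> graph_patch (D y) (D' y) (h y)"
    and D: "\<And>y. y \<in> Y x0 \<Longrightarrow> x0 \<in> D y" "\<And>y. y \<in> Y x0 \<Longrightarrow> y \<in> D' y" "\<And>y. y \<in> Y x0 \<Longrightarrow> h y x0 = y" by metis
  have op: "open (D y)" "open (D' y)" if "y \<in> Y x0" for y using gp[OF that] by (auto simp: graph_patch_def)
  have graph: "F (pt x w) = 0 \<longleftrightarrow> w = h y x" if "y \<in> Y x0" "x \<in> D y" "w \<in> D' y" for x y w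
    using gp[OF that(1)] that(2,3) by (auto simp: graph_patch_def)
  have hD': "h y x \<in> D' y" if "y \<in> Y x0" "x \<in> D y" for x y
    using gp[OF that(1)] that(2) by (auto simp: graph_patch_def)
  have 1: "\<forall>\<^sub>F x in nhds x0. x \<in> - E \<and> (\<forall>y\<in>Y x0. x \<in> D y)"
  proof (intro eventually_conj eventually_ball_finite finite_Y ballI)
    show "\<forall>\<^sub>F x in nhds x0. x \<in> - E" using closed_E x0 by (intro eventually_nhds_in_open) auto
    show "\<forall>\<^sub>F x in nhds x0. x \<in> D y" if "y \<in> Y x0" for y using op(1) D(1) that by (intro eventually_nhds_in_open)
  qed
  \<comment> \<open>Roots outside all the boxes, over points tending to \<open>x0\<close>, would
    accumulate at some root over \<open>x0\<close>, although that root lies in its own open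
    box.\<close>
  have 2: "\<forall>\<^sub>F x in nhds x0. Y x \<subseteq> (\<Union>y\<in>Y x0. D' y)"
  proof (rule eventually_nhds_iff_sequentially[THEN iffD2], intro allI impI, rule ccontr)
    fix f assume f: "f \<longlonglongrightarrow> x0" and n: "\<not> (\<forall>\<^sub>F n in sequentially. Y (f n) \<subseteq> (\<Union>y\<in>Y x0. D' y))"
    obtain r :: "nat \<Rightarrow> nat" where r: "strict_mono r" "\<forall>n. \<not> Y (f (r n)) \<subseteq> (\<Union>y\<in>Y x0. D' y)"
      using not_eventually_sequentiallyD[OF n] by (elim exE conjE) (rule that, assumption+)
    from r(2) have "\<forall>n. \<exists>y. y \<in> Y ((f \<circ> r) n) \<and> y \<notin> (\<Union>y\<in>Y x0. D' y)" unfolding o_apply by blast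
    then obtain y where y: "\<And>n. y n \<in> Y ((f \<circ> r) n)" "\<And>n. y n \<notin> (\<Union>y\<in>Y x0. D' y)" by metis
    obtain k y0 where k: "(y \<circ> k) \<longlonglongrightarrow> y0" "y0 \<in> Y x0"
      using Y_subsequence[OF LIMSEQ_subseq_LIMSEQ[OF f r(1)] y(1)] by blast
    have "\<forall>\<^sub>F n in sequentially. (y \<circ> k) n \<in> D' y0" by (rule topological_tendstoD[OF k(1) op(2)[OF k(2)] D(2)[OF k(2)]])
    then show False using y(2) k(2) by (auto simp: eventually_sequentially)
  qed
  have 3: "\<forall>\<^sub>F x in nhds x0. \<forall>y\<in>Y x0. \<forall>y'\<in>Y x0. y \<noteq> y' \<longrightarrow> h y x \<noteq> h y' x"
  proof (intro eventually_ball_finite finite_Y ballI)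
    fix y y' assume y: "y \<in> Y x0" "y' \<in> Y x0"
    have c: "(h y \<longlongrightarrow> y) (nhds x0)" if "y \<in> Y x0" for y
    proof -
      have "isCont (h y) x0" using gp[OF that] D(1)[OF that] by (auto simp: graph_patch_def intro: DERIV_isCont)
      then have "(h y \<longlongrightarrow> h y x0) (nhds x0)" by (simp only: isCont_def tendsto_at_iff_tendsto_nhds)
      then show ?thesis by (simp only: D(3)[OF that])
    qed
    show "\<forall>\<^sub>F x in nhds x0. y \<noteq> y' \<longrightarrow> h y x \<noteq> h y' x"
    proof (cases "y = y'")
      case False
      have "((\<lambda>x. h y x - h y' x) \<longlongrightarrow> y - y') (nhds x0)" by (intro tendsto_diff c y)
      then have "\<forall>\<^sub>F x in nhds x0. h y x - h y' x \<noteq> 0" by (rule tendsto_imp_eventually_ne) (use False in simp)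
      then show ?thesis by eventually_elim simp
    qed simp
  qed
  have "\<forall>\<^sub>F x in nhds x0. (x \<in> - E \<and> (\<forall>y\<in>Y x0. x \<in> D y)) \<and> Y x \<subseteq> (\<Union>y\<in>Y x0. D' y) \<and> (\<forall>y\<in>Y x0. \<forall>y'\<in>Y x0. y \<noteq> y' \<longrightarrow> h y x \<noteq> h y' x)"
    by (intro eventually_conj 1 2 3)
  then obtain \<epsilon> where \<epsilon>: "\<epsilon> > 0" "\<And>x. dist x x0 < \<epsilon> \<Longrightarrow> (x \<in> - E \<and> (\<forall>y\<in>Y x0. x \<in> D y)) \<and> Y x \<subseteq> (\<Union>y\<in>Y x0. D' y) \<and> (\<forall>y\<in>Y x0. \<forall>y'\<in>Y x0. y \<noteq> y' \<longrightarrow> h y x \<noteq> h y' x)"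
    by (auto simp: eventually_nhds_metric)
  have "bij_betw (\<lambda>y. h y x) (Y x0) (Y x)" if x: "x \<in> ball x0 \<epsilon>" for x
  proof -
    have \<epsilon>x: "\<And>y. y \<in> Y x0 \<Longrightarrow> x \<in> D y" "Y x \<subseteq> (\<Union>y\<in>Y x0. D' y)" "\<And>y y'. y \<in> Y x0 \<Longrightarrow> y' \<in> Y x0 \<Longrightarrow> y \<noteq> y' \<Longrightarrow> h y x \<noteq> h y' x"
      using \<epsilon>(2)[of x] x by (auto simp: dist_commute)
    have "h y x \<in> Y x" if "y \<in> Y x0" for y
      using graph[OF that \<epsilon>x(1)[OF that] hD'[OF that \<epsilon>x(1)[OF that]]] by (simp add: Y_def)
    moreover have "\<exists>y\<in>Y x0. w = h y x" if w: "w \<in> Y x" for w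
    proof -
      obtain y where y: "y \<in> Y x0" "w \<in> D' y" using \<epsilon>x(2) w by blast
      then show ?thesis using graph[OF y(1) \<epsilon>x(1)[OF y(1)] y(2)] w by (auto simp: Y_def)
    qed
    ultimately show ?thesis using \<epsilon>x(3) by (fastforce simp: bij_betw_def inj_on_def)
  qed
  moreover have "ball x0 \<epsilon> \<subseteq> - E" "\<And>y. y \<in> Y x0 \<Longrightarrow> ball x0 \<epsilon> \<subseteq> D y" using \<epsilon>(2) by (auto simp: dist_commute)
  ultimately show ?thesis using \<epsilon>(1) D(3) gp by (intro exI[of _ \<epsilon>] conjI exI[of _ h]) (auto, blast)
qed

text \<open>The parameter integral is moved to the complex plane, so that different patches share
  the one variable \<open>x\<close> and can be added.\<close>

lemma graph_patch_integral:
  assumes gp: "graph_patch D D' h" and R: "R \<in> sets \<mu>" "R \<subseteq> rect D D'" and f: "f \<in> borel_measurable \<mu>"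
  defines "H \<equiv> \<lambda>x. f (proj (pt x (h x))) * ennreal (area_density x (h x)) * indicator {x\<in>D. proj (pt x (h x)) \<in> R} x"
  shows "H \<in> borel_measurable borel" "(\<integral>\<^sup>+Q\<in>R. f Q \<partial>\<mu>) = (\<integral>\<^sup>+x. H x \<partial>lborel)"
proof -
  have oD: "open D" using gp by (simp add: graph_patch_def)
  have "continuous_on (- {0}) (proj :: complex ^ 3 \<Rightarrow> 3 cproj)" by (rule continuous_on_proj[OF continuous_on_id]) auto
  then have "continuous_on D (\<lambda>x. proj (pt x (h x)))"
    by (rule continuous_on_compose2[OF _ graph_patch_continuous(2)[OF gp]]) (auto simp: pt_nonzero)
  then have "(\<lambda>x. proj (pt x (h x))) \<in> measurable (restrict_space borel D) borel" by (rule borel_measurable_continuous_on_restrict)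
  then have m: "(\<lambda>x. proj (pt x (h x))) \<in> measurable (restrict_space borel D) \<mu>"
    unfolding measurable_cong_sets[OF refl sets_\<mu>(1)]
    using gp by (intro measurable_restrict_space2) (auto simp: space_restrict_space proj_in_curve pt_nonzero graph_patch_def)
  define A where "A = {x\<in>D. proj (pt x (h x)) \<in> R}"
  have "A = (\<lambda>x. proj (pt x (h x))) -` R \<inter> space (restrict_space borel D)" by (auto simp: A_def space_restrict_space)
  then have "A \<in> sets (restrict_space borel D)" using measurable_sets[OF m R(1)] by simp
  then have A: "A \<in> sets borel" using oD by (simp add: sets_restrict_space_iff)
  have "(\<lambda>x. f (proj (pt x (h x))) * ennreal (area_density x (h x))) \<in> borel_measurable (restrict_space borel D)"
    by (intro borel_measurable_times_ennreal measurable_compose[OF m f] measurable_compose[OF _ measurable_ennreal]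
      borel_measurable_continuous_on_restrict graph_patch_continuous(4)[OF gp])
  then have "(\<lambda>x. f (proj (pt x (h x))) * ennreal (area_density x (h x)) * indicator D x) \<in> borel_measurable borel"
    using oD by (simp add: borel_measurable_restrict_space_iff_ennreal)
  from borel_measurable_times_ennreal[OF this borel_measurable_indicator[OF A]]
  have "(\<lambda>x. f (proj (pt x (h x))) * ennreal (area_density x (h x)) * indicator D x * indicator A x) \<in> borel_measurable borel" .
  moreover have "(\<lambda>x. f (proj (pt x (h x))) * ennreal (area_density x (h x)) * indicator D x * indicator A x) = H"
    by (auto simp: H_def A_def indicator_def)
  ultimately show H: "H \<in> borel_measurable borel" by simp
  define \<phi> where "\<phi> = (\<lambda>t. pt (complex_of_vec t) (h (complex_of_vec t)))"
  have ch: "fs_chart curve (complex_of_vec -` D) \<phi> (rect D D') (\<lambda>z. vec_of_complex (dotc l1 z / dotc l0 z))"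
    unfolding \<phi>_def by (rule fs_chart_graph_patch(1)[OF gp])
  have dens: "fs_density \<phi> t = area_density (complex_of_vec t) (h (complex_of_vec t))" if "complex_of_vec t \<in> D" for t
    using fs_chart_graph_patch(2)[OF gp, of t] that by (simp add: \<phi>_def)
  have "R \<subseteq> curve" using sets.sets_into_space[OF R(1)] by (simp add: sets_\<mu>)
  then have "R \<subseteq> (\<lambda>t. proj (\<phi> t)) ` (complex_of_vec -` D)" using ch R(2) by (auto simp: fs_chart_def)
  then have "(\<integral>\<^sup>+Q\<in>R. f Q \<partial>\<mu>) = (\<integral>\<^sup>+t\<in>{t\<in>complex_of_vec -` D. proj (\<phi> t) \<in> R}. f (proj (\<phi> t)) * ennreal (fs_density \<phi> t) \<partial>lborel)"
    using ch by (intro nn_integral_volume_param[OF volume_property_curve _ R(1) _ f]) (auto simp: fs_chart_def)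
  also have "\<dots> = (\<integral>\<^sup>+t. H (complex_of_vec t) \<partial>lborel)"
    by (intro nn_integral_cong) (auto simp: H_def \<phi>_def[symmetric] dens indicator_def, simp_all add: \<phi>_def)
  also have "\<dots> = (\<integral>\<^sup>+x. H x \<partial>lborel)" by (rule nn_integral_complex_of_vec[OF H])
  finally show "(\<integral>\<^sup>+Q\<in>R. f Q \<partial>\<mu>) = (\<integral>\<^sup>+x. H x \<partial>lborel)" .
qed

definition fibre_sum :: "(3 cproj \<Rightarrow> ennreal) \<Rightarrow> complex \<Rightarrow> ennreal"
  where "fibre_sum f x = (\<Sum>y\<in>Y x. f (proj (pt x y)) * ennreal (area_density x y))"

lemma countable_graph_cover:
  "\<exists>D D' h. (\<forall>i::nat. graph_patch (D i) (D' i) (h i)) \<and> curve \<inter> rect (- E) UNIV \<subseteq> (\<Union>i. rect (D i) (D' i))"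
proof -
  define I where "I = {(D, D', h). graph_patch D D' h}"
  have "\<exists>J. countable J \<and> J \<subseteq> I \<and> curve \<inter> rect (- E) UNIV \<subseteq> (\<Union>i\<in>J. case i of (D, D', h) \<Rightarrow> rect D D')"
  proof (rule lindelof_cproj)
    show "open (case i of (D, D', h) \<Rightarrow> rect D D')" if "i \<in> I" for i
      using that by (auto simp: I_def graph_patch_def intro!: open_rect)
    show "curve \<inter> rect (- E) UNIV \<subseteq> (\<Union>i\<in>I. case i of (D, D', h) \<Rightarrow> rect D D')"
    proof
      fix Q assume "Q \<in> curve \<inter> rect (- E) UNIV"
      then obtain x y where Q: "Q = proj (pt x y)" "x \<notin> E" "F (pt x y) = 0" by (auto simp: rect_def proj_in_curve pt_nonzero)
      then have "dotc (G (pt x y)) e2 \<noteq> 0" by (auto simp: E_def Y_def)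
      then obtain D D' h where "graph_patch D D' h" "x \<in> D" "y \<in> D'" using graph_patch_exists[OF Q(3)] by blast
      then show "Q \<in> (\<Union>i\<in>I. case i of (D, D', h) \<Rightarrow> rect D D')"
        by (auto simp: I_def Q(1) proj_pt_in_rect intro!: bexI[of _ "(D, D', h)"])
    qed
  qed
  then obtain J where J: "countable J" "J \<subseteq> I" "curve \<inter> rect (- E) UNIV \<subseteq> (\<Union>i\<in>J. case i of (D, D', h) \<Rightarrow> rect D D')" by blast
  define J' where "J' = insert ({}, {}, \<lambda>_. 0) J"
  have J': "countable J'" "J' \<noteq> {}" "J' \<subseteq> I" using J by (auto simp: J'_def I_def graph_patch_def)
  define en where "en = from_nat_into J'"
  have "en i \<in> I" for i using from_nat_into[OF J'(2)] J'(3) by (auto simp: en_def)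
  then have gp: "graph_patch (fst (en i)) (fst (snd (en i))) (snd (snd (en i)))" for i by (auto simp: I_def case_prod_unfold)
  have "curve \<inter> rect (- E) UNIV \<subseteq> (\<Union>i. rect (fst (en i)) (fst (snd (en i))))"
  proof
    fix Q assume "Q \<in> curve \<inter> rect (- E) UNIV"
    then have "Q \<in> (\<Union>i\<in>J. case i of (D, D', h) \<Rightarrow> rect D D')" using J(3) by blast
    then obtain j where j: "j \<in> J'" "Q \<in> (case j of (D, D', h) \<Rightarrow> rect D D')" unfolding J'_def by blast
    then obtain i where "en i = j" using from_nat_into_surj[OF J'(1)] unfolding en_def by blast
    then show "Q \<in> (\<Union>i. rect (fst (en i)) (fst (snd (en i))))" using j(2) by (auto split: prod.splits intro!: exI[of _ i])
  qed
  then show ?thesis using gp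
    by (intro exI[of _ "\<lambda>i. fst (en i)"] exI[of _ "\<lambda>i. fst (snd (en i))"] exI[of _ "\<lambda>i. snd (snd (en i))"] conjI allI)
qed

text \<open>Cut the unramified part into countably many disjoint pieces, each inside a graph patch.
  Over a fixed \<open>x\<close> the pieces together contribute one term for each point of the fibre,
  and the ramified part is a null set.\<close>

lemma nn_integral_curve:
  assumes f: "f \<in> borel_measurable \<mu>"
  shows "(\<lambda>x. fibre_sum f x * indicator (- E) x) \<in> borel_measurable borel"
    "(\<integral>\<^sup>+Q. f Q \<partial>\<mu>) = (\<integral>\<^sup>+x\<in>- E. fibre_sum f x \<partial>lborel)"
proof -
  obtain D D' h where gp: "\<And>i::nat. graph_patch (D i) (D' i) (h i)"
    and cov: "curve \<inter> rect (- E) UNIV \<subseteq> (\<Union>i. rect (D i) (D' i))" using countable_graph_cover by blast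
  define W where "W i = rect (D i) (D' i)" for i
  define R where "R i = curve \<inter> (rect (- E) UNIV \<inter> disjointed W i)" for i
  have oW: "open (W i)" for i using gp[of i] by (auto simp: W_def graph_patch_def intro: open_rect)
  have sR: "R i \<in> sets \<mu>" for i
  proof -
    have "disjointed W i \<in> sets borel" using oW by (intro range_subsetD[OF sets.range_disjointed_sets]) auto
    then have "rect (- E) UNIV \<inter> disjointed W i \<in> sets borel" using borel_open[OF open_rect_E] by blast
    then show ?thesis by (auto simp: sets_\<mu> sets_restrict_space R_def)
  qed
  have dR: "disjoint_family R" using disjoint_family_disjointed[of W] by (auto simp: disjoint_family_on_def R_def)
  have UR: "(\<Union>i. R i) = curve \<inter> rect (- E) UNIV"
    using cov UN_disjointed_eq[of W] by (auto simp: R_def W_def)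
  have RW: "R i \<subseteq> rect (D i) (D' i)" for i using disjointed_subset[of W i] by (auto simp: R_def W_def)
  define H where "H i x = f (proj (pt x (h i x))) * ennreal (area_density x (h i x)) * indicator {x\<in>D i. proj (pt x (h i x)) \<in> R i} x" for i x
  have H: "H i \<in> borel_measurable borel" "(\<integral>\<^sup>+Q\<in>R i. f Q \<partial>\<mu>) = (\<integral>\<^sup>+x. H i x \<partial>lborel)" for i
    using graph_patch_integral[OF gp sR RW f] by (simp_all add: H_def[abs_def])
  have sum: "(\<Sum>i. H i x) = fibre_sum f x * indicator (- E) x" for x
  proof (cases "x \<in> E")
    case True
    then have "H i x = 0" for i using proj_pt_in_rect[of x "h i x" "- E" UNIV] by (auto simp: H_def R_def indicator_def)
    then show ?thesis using True by simp
  next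
    case False
    define g where "g y = f (proj (pt x y)) * ennreal (area_density x y)" for y
    \<comment> \<open>A piece contains at most one point over \<open>x\<close>, the value of its own
      branch. So \<open>H i x\<close> is one term of the fibre or 0.\<close>
    have "H i x = (\<Sum>y\<in>Y x. g y * indicator (R i) (proj (pt x y)))" for i
    proof -
      have ind: "indicator (R i) (proj (pt x y)) = (if y = h i x then indicator {x\<in>D i. proj (pt x (h i x)) \<in> R i} x else (0::ennreal))"
        if "y \<in> Y x" for y
      proof -
        have "x \<in> D i \<and> y = h i x" if "proj (pt x y) \<in> R i"
        proof -
          have "x \<in> D i" "y \<in> D' i" using subsetD[OF RW that] by (simp_all add: proj_pt_in_rect)
          moreover have "F (pt x y) = 0" using \<open>y \<in> Y x\<close> by (simp add: Y_def)
          ultimately show ?thesis using gp[of i] unfolding graph_patch_def by blast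
        qed
        note R = this
        show ?thesis
        proof (cases "proj (pt x y) \<in> R i")
          case True
          then have "x \<in> D i" "proj (pt x (h i x)) \<in> R i" "y = h i x" using R by blast+
          then show ?thesis by (simp only: indicator_simps mem_Collect_eq if_True True simp_thms)
        next
          case False
          then show ?thesis by (cases "y = h i x") (simp_all add: indicator_def)
        qed
      qed
      have "(\<Sum>y\<in>Y x. g y * indicator (R i) (proj (pt x y))) = (\<Sum>y\<in>Y x. if y = h i x then H i x else 0)"
      proof (intro sum.cong refl)
        fix y assume "y \<in> Y x"
        note * = ind[OF this]
        show "g y * indicator (R i) (proj (pt x y)) = (if y = h i x then H i x else 0)"
          unfolding * by (cases "y = h i x") (simp_all add: H_def g_def)
      qed
      also have "\<dots> = (if h i x \<in> Y x then H i x else 0)" by (simp add: finite_Y)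
      also have "\<dots> = H i x"
      proof (cases "x \<in> D i")
        case True
        then have "h i x \<in> D' i" "F (pt x (h i x)) = 0" using gp[of i] unfolding graph_patch_def by blast+
        then show ?thesis by (simp add: Y_def)
      next
        case False then show ?thesis by (simp add: H_def)
      qed
      finally show ?thesis by simp
    qed
    then have "(\<Sum>i. H i x) = (\<Sum>i. \<Sum>y\<in>Y x. g y * indicator (R i) (proj (pt x y)))" by simp
    also have "\<dots> = (\<Sum>y\<in>Y x. \<Sum>i. g y * indicator (R i) (proj (pt x y)))" by (rule suminf_sum) simp
    also have "\<dots> = (\<Sum>y\<in>Y x. g y)"
    proof (rule sum.cong[OF refl])
      fix y assume y: "y \<in> Y x"
      \<comment> \<open>Each point of the fibre lies in exactly one of the disjoint pieces, hence
        its indicators sum to 1.\<close>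
      have "proj (pt x y) \<in> (\<Union>i. R i)" using y False by (simp add: UR proj_in_curve pt_nonzero Y_def proj_pt_in_rect)
      then have "(\<Sum>i. indicator (R i) (proj (pt x y)) :: ennreal) = 1" by (simp only: suminf_indicator[OF dR] indicator_simps)
      then show "(\<Sum>i. g y * indicator (R i) (proj (pt x y))) = g y" by (simp add: ennreal_suminf_cmult)
    qed
    finally show ?thesis using False by (simp add: fibre_sum_def g_def)
  qed
  show "(\<lambda>x. fibre_sum f x * indicator (- E) x) \<in> borel_measurable borel"
    unfolding sum[symmetric] by (intro borel_measurable_suminf_order H(1))
  have "(\<integral>\<^sup>+Q. f Q \<partial>\<mu>) = (\<integral>\<^sup>+Q\<in>(\<Union>i. R i). f Q \<partial>\<mu>)"
  proof (rule nn_integral_cong_AE)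
    have "AE Q in \<mu>. Q \<in> curve" using AE_space[of \<mu>] by (simp add: sets_\<mu>)
    with AE_unramified show "AE Q in \<mu>. f Q = f Q * indicator (\<Union>i. R i) Q"
      by eventually_elim (simp add: UR)
  qed
  also have "\<dots> = (\<Sum>i. \<integral>\<^sup>+Q\<in>R i. f Q \<partial>\<mu>)"
    by (rule nn_integral_disjoint_split[OF dR]) (rule borel_measurable_times_ennreal[OF f borel_measurable_indicator[OF sR]])
  also have "\<dots> = (\<integral>\<^sup>+x. (\<Sum>i. H i x) \<partial>lborel)"
    unfolding H(2) by (rule nn_integral_suminf[symmetric]) (use H(1) in simp)
  finally show "(\<integral>\<^sup>+Q. f Q \<partial>\<mu>) = (\<integral>\<^sup>+x\<in>- E. fibre_sum f x \<partial>lborel)" by (simp only: sum)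
qed

end

section \<open>Areas of the projective images of the curve\<close>

lemma C2_with_cong:
  assumes "C2_with S g g1 g2" "open S" "\<And>x. x \<in> S \<Longrightarrow> g x = g' x"
  shows "C2_with S g' g1 g2"
  unfolding C2_with_def
proof (intro conjI ballI)
  show "continuous_on S g'" using C2_withD(1)[OF assms(1)] assms(3) by (simp cong: continuous_on_cong)
  fix v x assume v: "v \<in> {1, \<i> :: complex}" and x: "x \<in> S"
  have "open ((\<lambda>s::real. x + of_real s * v) -` S)" by (intro open_vimage assms(2) continuous_intros)
  then show "((\<lambda>s. g' (x + of_real s * v)) has_real_derivative g1 v x) (at 0)"
    by (rule has_field_derivative_transform_within_open[OF C2_withD(4)[OF assms(1) v x]]) (use x assms(3) in auto)
qed (use C2_withD[OF assms(1)] in auto)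

lemma C2_with_sum:
  assumes "\<And>j. j \<in> J \<Longrightarrow> C2_with S (g j) (g1 j) (g2 j)"
  shows "C2_with S (\<lambda>x. \<Sum>j\<in>J. g j x) (\<lambda>v x. \<Sum>j\<in>J. g1 j v x) (\<lambda>v x. \<Sum>j\<in>J. g2 j v x)"
  unfolding C2_with_def
  by (intro conjI ballI continuous_on_sum DERIV_sum C2_withD[OF assms])

lemma C2_with_divide:
  assumes "C2_with S g g1 g2"
  shows "C2_with S (\<lambda>x. g x / k) (\<lambda>v x. g1 v x / k) (\<lambda>v x. g2 v x / k)"
  unfolding C2_with_def divide_inverse
  by (intro conjI ballI continuous_on_mult continuous_on_const DERIV_cmult_right C2_withD[OF assms])

text \<open>\<open>C2_with\<close> carries its derivatives as data, and data found on overlapping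
  neighbourhoods must agree to be glued. Expressing them through \<open>deriv\<close> makes the
  choice canonical.\<close>

definition dir_deriv :: "(complex \<Rightarrow> real) \<Rightarrow> complex \<Rightarrow> complex \<Rightarrow> real"
  where "dir_deriv u v x = deriv (\<lambda>s. u (x + of_real s * v)) 0"

lemma C2_with_unique:
  assumes "C2_with S u w1 w2" "open S" "x \<in> S" "v \<in> {1, \<i>}"
  shows "w1 v x = dir_deriv u v x" "w2 v x = dir_deriv (dir_deriv u v) v x"
proof -
  have 1: "w1 v x = dir_deriv u v x" if "x \<in> S" for x
    using DERIV_imp_deriv[OF C2_withD(4)[OF assms(1,4) that]] by (simp add: dir_deriv_def)
  then show "w1 v x = dir_deriv u v x" using assms(3) .
  have "open ((\<lambda>s::real. x + of_real s * v) -` S)" by (intro open_vimage assms(2) continuous_intros)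
  then have "((\<lambda>s. dir_deriv u v (x + of_real s * v)) has_real_derivative w2 v x) (at 0)"
    by (rule has_field_derivative_transform_within_open[OF C2_withD(5)[OF assms(1,4,3)]]) (use assms(3) 1 in auto)
  then show "w2 v x = dir_deriv (dir_deriv u v) v x" unfolding dir_deriv_def[of "dir_deriv u v"] by (rule DERIV_imp_deriv[symmetric])
qed

lemma C2_with_glue:
  assumes "\<And>x. x \<in> S \<Longrightarrow> \<exists>T w1 w2. open T \<and> x \<in> T \<and> C2_with T u w1 w2"
  shows "C2_with S u (dir_deriv u) (\<lambda>v. dir_deriv (dir_deriv u v) v)"
proof -
  have *: "isCont u x \<and> (\<forall>v\<in>{1, \<i>}. isCont (dir_deriv u v) x \<and> isCont (dir_deriv (dir_deriv u v) v) x \<and>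
      ((\<lambda>s. u (x + of_real s * v)) has_real_derivative dir_deriv u v x) (at 0) \<and>
        ((\<lambda>s. dir_deriv u v (x + of_real s * v)) has_real_derivative dir_deriv (dir_deriv u v) v x) (at 0))" if x: "x \<in> S" for x
  proof -
    obtain T w1 w2 where T: "open T" "x \<in> T" and w: "C2_with T u w1 w2" using assms[OF x] by blast
    have op: "open ((\<lambda>s::real. x + of_real s * v) -` T)" for v by (intro open_vimage T continuous_intros)
    show ?thesis
    proof (intro conjI ballI)
      show "isCont u x" using C2_withD(1)[OF w] T by (simp add: continuous_on_eq_continuous_at)
      fix v assume v: "v \<in> {1, \<i> :: complex}"
      note eq = C2_with_unique[OF w T(1) _ v]
      have "continuous_on T (dir_deriv u v)" "continuous_on T (dir_deriv (dir_deriv u v) v)"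
        using C2_withD(2,3)[OF w v] eq by (simp_all cong: continuous_on_cong)
      then show "isCont (dir_deriv u v) x" "isCont (dir_deriv (dir_deriv u v) v) x"
        using T by (simp_all add: continuous_on_eq_continuous_at)
      show "((\<lambda>s. u (x + of_real s * v)) has_real_derivative dir_deriv u v x) (at 0)"
        using C2_withD(4)[OF w v T(2)] eq(1)[OF T(2)] by simp
      show "((\<lambda>s. dir_deriv u v (x + of_real s * v)) has_real_derivative dir_deriv (dir_deriv u v) v x) (at 0)"
        unfolding eq(2)[OF T(2), symmetric]
        by (rule has_field_derivative_transform_within_open[OF C2_withD(5)[OF w v T(2)] op]) (use eq(1) T(2) in auto)
    qed
  qed
  show ?thesis unfolding C2_with_def using * by (auto intro!: continuous_at_imp_continuous_on)
qed

text \<open>The term with \<open>deriv f'\<close> carries \<open>v^2\<close>, which is 1 and -1 in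
  the two directions. It cancels in the Laplacian and leaves \<open>4 |f'|^2\<close>.\<close>

lemma C2_with_norm_square:
  fixes f f' :: "complex \<Rightarrow> complex"
  assumes S: "open S" and f: "\<And>x. x \<in> S \<Longrightarrow> (f has_field_derivative f' x) (at x)"
  shows "C2_with S (\<lambda>x. (cmod (f x))\<^sup>2) (\<lambda>v x. 2 * Re (cnj (f x) * f' x * v))
    (\<lambda>v x. 2 * (cmod (f' x))\<^sup>2 + 2 * Re (cnj (f x) * deriv f' x * v\<^sup>2))"
  unfolding C2_with_def
proof (intro conjI ballI)
  have "f holomorphic_on S" using f S by (auto simp: holomorphic_on_open)
  moreover have "deriv f x = f' x" if "x \<in> S" for x by (rule DERIV_imp_deriv[OF f[OF that]])
  ultimately have hol: "f holomorphic_on S" "f' holomorphic_on S"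
    using holomorphic_deriv[of f S] S by (auto cong: holomorphic_cong)
  then have hol2: "deriv f' holomorphic_on S" using S holomorphic_deriv by blast
  note cont = hol[THEN holomorphic_on_imp_continuous_on] hol2[THEN holomorphic_on_imp_continuous_on]
  show "continuous_on S (\<lambda>x. (cmod (f x))\<^sup>2)" by (intro continuous_intros cont)
  fix v :: complex assume v: "v \<in> {1, \<i>}"
  show "continuous_on S (\<lambda>x. 2 * Re (cnj (f x) * f' x * v))"
    "continuous_on S (\<lambda>x. 2 * (cmod (f' x))\<^sup>2 + 2 * Re (cnj (f x) * deriv f' x * v\<^sup>2))"
    by (intro continuous_intros cont)+
  fix x assume x: "x \<in> S"
  have l: "((\<lambda>s::real. x + of_real s * v) has_vector_derivative v) (at 0)"
    by (auto simp: has_vector_derivative_def scaleR_conv_of_real intro!: derivative_eq_intros)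
  have ch: "((\<lambda>s::real. g (x + of_real s * v)) has_vector_derivative v * g') (at 0)" if "(g has_field_derivative g') (at x)" for g g'
    using field_vector_diff_chain_at[OF l, of g g'] that by (simp add: o_def)
  have fd: "((\<lambda>s::real. f (x + of_real s * v)) has_vector_derivative v * f' x) (at 0)" by (rule ch[OF f[OF x]])
  have f'd: "((\<lambda>s::real. f' (x + of_real s * v)) has_vector_derivative v * deriv f' x) (at 0)"
    by (rule ch[OF holomorphic_derivI[OF hol(2) S x]])
  have cd: "((\<lambda>s. cnj (g s)) has_vector_derivative cnj g') (at (0::real))" if "(g has_vector_derivative g') (at 0)" for g g'
    using bounded_linear.has_vector_derivative[OF bounded_linear_cnj that] .
  have rd: "((\<lambda>s. Re (g s)) has_real_derivative Re g') (at (0::real))" if "(g has_vector_derivative g') (at 0)" for g g'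
    using bounded_linear.has_vector_derivative[OF bounded_linear_Re that] by (simp add: has_real_derivative_iff_has_vector_derivative)
  have "((\<lambda>s. Re (f (x + of_real s * v) * cnj (f (x + of_real s * v)))) has_real_derivative
      Re (f (x + of_real 0 * v) * cnj (v * f' x) + v * f' x * cnj (f (x + of_real 0 * v)))) (at 0)"
    by (intro rd has_vector_derivative_mult fd cd)
  moreover have "Re (w * cnj w) = (cmod w)\<^sup>2" for w by (simp add: complex_mult_cnj cmod_power2)
  ultimately have "((\<lambda>s. (cmod (f (x + of_real s * v)))\<^sup>2) has_real_derivative
      Re (f x * cnj (v * f' x) + v * f' x * cnj (f x))) (at 0)" by simp
  moreover have "Re (f x * cnj (v * f' x) + v * f' x * cnj (f x)) = 2 * Re (cnj (f x) * f' x * v)" by (simp add: algebra_simps)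
  ultimately show "((\<lambda>s. (cmod (f (x + of_real s * v)))\<^sup>2) has_real_derivative 2 * Re (cnj (f x) * f' x * v)) (at 0)" by simp
  have "((\<lambda>s. Re (cnj (f (x + of_real s * v)) * (f' (x + of_real s * v) * v))) has_real_derivative
      Re (cnj (f (x + of_real 0 * v)) * ((v * deriv f' x) * v) + cnj (v * f' x) * (f' (x + of_real 0 * v) * v))) (at 0)"
    by (intro rd has_vector_derivative_mult has_vector_derivative_mult_left fd f'd cd)
  then have *: "((\<lambda>s. 2 * Re (cnj (f (x + of_real s * v)) * f' (x + of_real s * v) * v)) has_real_derivative
      2 * Re (cnj (f x) * ((v * deriv f' x) * v) + cnj (v * f' x) * (f' x * v))) (at 0)"
    by (intro DERIV_cmult) (simp add: mult.assoc)
  have "Re (cnj (v * f' x) * (f' x * v)) = (cmod (f' x))\<^sup>2"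
    using v by (auto simp: cmod_power2) (simp_all add: power2_eq_square)
  moreover have "cnj (f x) * ((v * deriv f' x) * v) = cnj (f x) * deriv f' x * v\<^sup>2" by (simp add: power2_eq_square mult_ac)
  ultimately have eq: "2 * Re (cnj (f x) * ((v * deriv f' x) * v) + cnj (v * f' x) * (f' x * v)) =
      2 * (cmod (f' x))\<^sup>2 + 2 * Re (cnj (f x) * deriv f' x * v\<^sup>2)" by (simp only: plus_complex.sel distrib_left add.commute)
  show "((\<lambda>s. 2 * Re (cnj (f (x + of_real s * v)) * f' (x + of_real s * v) * v)) has_real_derivative
      2 * (cmod (f' x))\<^sup>2 + 2 * Re (cnj (f x) * deriv f' x * v\<^sup>2)) (at 0)" using * unfolding eq .
qed

text \<open>Differentiating the logarithm subtracts the squared gradient of \<open>|q|^2\<close>,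
  which turns \<open>|q'|^2 / |q|^2\<close> into the Gram expression of the Fubini-Study form. The
  Laplacian carries a factor 4, removed by the division.\<close>

lemma C2_with_log_norm:
  fixes q q' :: "complex \<Rightarrow> complex ^ 'n::finite"
  assumes S: "open S" and q: "\<And>x i. x \<in> S \<Longrightarrow> ((\<lambda>x. q x $ i) has_field_derivative q' x $ i) (at x)"
    and q0: "\<And>x. x \<in> S \<Longrightarrow> q x \<noteq> 0"
  shows "\<exists>w1 w2. C2_with S (\<lambda>x. ln ((norm (q x))\<^sup>2) / 4) w1 w2 \<and> (\<forall>x\<in>S. lap w2 x = fs_form (q x) (q' x) (q' x))"
proof -
  define n where "n x = (\<Sum>i\<in>UNIV. (cmod (q x $ i))\<^sup>2)" for x
  define n1 where "n1 v x = (\<Sum>i\<in>UNIV. 2 * Re (cnj (q x $ i) * q' x $ i * v))" for v x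
  define n2 where "n2 v x = (\<Sum>i\<in>UNIV. 2 * (cmod (q' x $ i))\<^sup>2 + 2 * Re (cnj (q x $ i) * deriv (\<lambda>x. q' x $ i) x * v\<^sup>2))" for v x
  have nq: "n x = (norm (q x))\<^sup>2" for x by (simp add: n_def norm_vec_power2)
  have pos: "n x > 0" if "x \<in> S" for x using q0[OF that] by (simp add: nq)
  have n: "C2_with S n n1 n2" unfolding n_def[abs_def] n1_def[abs_def] n2_def[abs_def]
    by (intro C2_with_sum C2_with_norm_square S q)
  have "C2_with S (\<lambda>x. ln (n x)) (\<lambda>v x. inverse (n x) * n1 v x) (\<lambda>v x. - (inverse (n x))\<^sup>2 * (n1 v x)\<^sup>2 + inverse (n x) * n2 v x)"
  proof (rule C2_with_compose[OF n, where r = ln and r' = inverse and r'' = "\<lambda>t. - (inverse t)\<^sup>2"])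
    show "(ln has_real_derivative inverse (n x)) (at (n x))" if "x \<in> S" for x
      using pos[OF that] by (auto intro!: derivative_eq_intros simp: divide_inverse)
    show "(inverse has_real_derivative - (inverse (n x))\<^sup>2) (at (n x))" if "x \<in> S" for x
      using pos[OF that] by (auto intro!: derivative_eq_intros simp: power2_eq_square)
    show "continuous_on (n ` S) (\<lambda>t. - (inverse t)\<^sup>2)" using pos by (intro continuous_intros) force
  qed
  note C0 = C2_with_divide[OF this, of 4]
  have C: "C2_with S (\<lambda>x. ln ((norm (q x))\<^sup>2) / 4) (\<lambda>v x. (inverse (n x) * n1 v x) / 4) (\<lambda>v x. (- (inverse (n x))\<^sup>2 * (n1 v x)\<^sup>2 + inverse (n x) * n2 v x) / 4)"
    unfolding nq[symmetric] by (rule C0)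
  have "lap (\<lambda>v x. (- (inverse (n x))\<^sup>2 * (n1 v x)\<^sup>2 + inverse (n x) * n2 v x) / 4) x = fs_form (q x) (q' x) (q' x)" if x: "x \<in> S" for x
  proof -
    have h: "n1 v x = 2 * Re (v * hinner (q' x) (q x))" for v
      unfolding n1_def hinner_def sum_distrib_left Re_sum by (intro sum.cong refl) (simp only: mult_ac)
    have n1s: "(n1 1 x)\<^sup>2 + (n1 \<i> x)\<^sup>2 = 4 * (cmod (hinner (q' x) (q x)))\<^sup>2"
      by (simp add: h cmod_power2 power_mult_distrib)
    have n2s: "n2 1 x + n2 \<i> x = 4 * (norm (q' x))\<^sup>2"
    proof -
      have "n2 1 x + n2 \<i> x = (\<Sum>i\<in>UNIV. 4 * (cmod (q' x $ i))\<^sup>2)"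
        unfolding n2_def sum.distrib[symmetric] by (intro sum.cong) simp_all
      then show ?thesis by (simp only: norm_vec_power2 sum_distrib_left)
    qed
    have gen: "(- (inverse N)\<^sup>2 * (4 * c) + inverse N * (4 * w)) / 4 = (N * w - c) / N\<^sup>2" if "N > 0" for N c w :: real
      using that by (simp add: field_simps power2_eq_square)
    have hz: "Re (hinner (q' x) (q x) * hinner (q x) (q' x)) = (cmod (hinner (q' x) (q x)))\<^sup>2"
    proof -
      have "hinner (q x) (q' x) = cnj (hinner (q' x) (q x))" by (simp add: hinner_def mult.commute)
      then show ?thesis by (simp add: complex_mult_cnj cmod_power2)
    qed
    have "lap (\<lambda>v x. (- (inverse (n x))\<^sup>2 * (n1 v x)\<^sup>2 + inverse (n x) * n2 v x) / 4) x =
      (- (inverse (n x))\<^sup>2 * ((n1 1 x)\<^sup>2 + (n1 \<i> x)\<^sup>2) + inverse (n x) * (n2 1 x + n2 \<i> x)) / 4"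
      unfolding lap_def add_divide_distrib[symmetric] distrib_left by simp
    also have "\<dots> = (n x * (norm (q' x))\<^sup>2 - (cmod (hinner (q' x) (q x)))\<^sup>2) / (n x)\<^sup>2"
      unfolding n1s n2s by (rule gen[OF pos[OF x]])
    also have "\<dots> = fs_form (q x) (q' x) (q' x)"
    proof -
      have "Re (hinner (q x) (q x) * hinner (q' x) (q' x)) = (norm (q x))\<^sup>2 * (norm (q' x))\<^sup>2"
        by (simp only: hinner_self of_real_mult[symmetric] Re_complex_of_real)
      moreover have "((norm (q x))\<^sup>2)\<^sup>2 = norm (q x) ^ 4" by simp
      ultimately show ?thesis by (simp only: fs_form_altdef minus_complex.sel hz nq)
    qed
    finally show ?thesis .
  qed
  with C show ?thesis by (intro exI conjI ballI) assumption+
qed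

section \<open>Sums of potentials over the fibres\<close>

context branched_cover
begin

text \<open>At a root the derivative of \<open>P x\<close> is \<open>dotc (G (pt x y)) e2\<close>,
  nonzero off \<open>E\<close>. So the roots are simple, and sums with multiplicity become sums over
  \<open>Y x\<close>.\<close>

lemma proots_unramified:
  assumes x: "x \<notin> E"
  shows "proots (P x) = mset_set (Y x)"
proof (rule multiset_eqI)
  fix y
  show "count (proots (P x)) y = count (mset_set (Y x)) y"
  proof (cases "y \<in> Y x")
    case False
    then have "order y (P x) = 0" by (intro order_0I) (simp add: Y_roots)
    then show ?thesis using False by (simp add: poly_P(4))
  next
    case True
    have 1: "((\<lambda>y. e0 + x *s e1 + y *s e2) has_derivative (\<lambda>k. k *s e2)) (at y)"
      by (rule derivative_eq_intros refl bounded_linear.has_derivative[OF bounded_linear_smult_left])+ simp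
    have "((\<lambda>y. F (pt x y)) has_derivative (\<lambda>k. dotc (G (pt x y)) (k *s e2))) (at y)"
      using diff_chain_at[OF 1 has_derivative_ternary_form[of d a]] by (simp add: o_def pt_def)
    then have "((\<lambda>y. poly (P x) y) has_field_derivative dotc (G (pt x y)) e2) (at y)"
      by (simp add: has_field_derivative_def dotc_simps poly_P mult.commute[of _ "dotc _ _"])
    then have "poly (pderiv (P x)) y = dotc (G (pt x y)) e2" using poly_DERIV DERIV_unique by blast
    then have ne: "poly (pderiv (P x)) y \<noteq> 0" using x True by (auto simp: E_def)
    then have "pderiv (P x) \<noteq> 0" by auto
    moreover have "order y (P x) \<noteq> 0" using True poly_P(4) by (simp add: Y_roots order_root)
    ultimately have "order y (P x) = Suc (order y (pderiv (P x)))" by (intro order_pderiv) (use True in \<open>auto simp: Y_roots\<close>)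
    moreover have "order y (pderiv (P x)) = 0" using ne by (rule order_0I)
    ultimately show ?thesis using True by (simp add: poly_P(4) finite_Y)
  qed
qed

end

text \<open>Covers the identity and the Gauss map at once. Homogeneity governs the growth of the
  potential, and complex linearity of the derivative makes \<open>\<Phi>\<close> holomorphic along
  branches.\<close>

locale projective_map = branched_cover +
  fixes m :: nat and \<Phi> :: "complex ^ 3 \<Rightarrow> complex ^ 3" and \<Phi>' :: "complex ^ 3 \<Rightarrow> complex ^ 3 \<Rightarrow> complex ^ 3"
  assumes \<Phi>_deriv: "\<And>z. (\<Phi> has_derivative \<Phi>' z) (at z)"
    and \<Phi>'_linear: "\<And>z c u. \<Phi>' z (c *s u) = c *s \<Phi>' z u"
    and \<Phi>_scale: "\<And>c z. \<Phi> (c *s z) = c ^ m *s \<Phi> z"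
    and \<Phi>_nonzero: "\<And>z. z \<noteq> 0 \<Longrightarrow> F z = 0 \<Longrightarrow> \<Phi> z \<noteq> 0"
begin

definition pullback_density :: "complex \<Rightarrow> complex \<Rightarrow> real"
  where "pullback_density x y = fs_form (\<Phi> (pt x y)) (\<Phi>' (pt x y) (tg x y)) (\<Phi>' (pt x y) (tg x y))"

text \<open>The argument is a vector rather than the coordinate \<open>x\<close>, so that the same
  function also describes a neighbourhood of infinity, through the vectors
  \<open>s *s e0 + e1\<close>.\<close>

definition U :: "complex ^ 3 \<Rightarrow> real"
  where "U w = (\<Sum>y\<in>#proots (form_poly d a w e2). ln ((norm (\<Phi> (w + y *s e2)))\<^sup>2) / 4)"

lemma U_tendsto:
  fixes w :: "nat \<Rightarrow> complex ^ 3"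
  assumes w: "w \<longlonglongrightarrow> w0" and ne: "\<And>y. w0 + y *s e2 \<noteq> 0"
  shows "(\<lambda>n. U (w n)) \<longlonglongrightarrow> U w0"
proof -
  obtain B where B: "\<And>n. norm (w n) \<le> B" using convergent_imp_Bseq[OF convergentI[OF w]] by (auto simp: Bseq_def)
  obtain C where C: "\<And>u y. norm u \<le> B \<Longrightarrow> F (u + y *s e2) = 0 \<Longrightarrow> cmod y \<le> C" using form_root_bound[OF F_e2] by metis
  have line: "(\<lambda>n. w (k n) + y n *s e2) \<longlonglongrightarrow> w0 + y0 *s e2" if "strict_mono k" "y \<longlonglongrightarrow> y0" for k y y0
    using LIMSEQ_subseq_LIMSEQ[OF w that(1)] that(2)
    by (intro tendsto_intros bounded_linear.tendsto[OF bounded_linear_smult_left]) (simp_all add: o_def)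
  show ?thesis unfolding U_def
  proof (rule sum_over_roots_tendsto[where d = d and c = "F e2" and B = C])
    show "(\<lambda>n. poly (form_poly d a (w n) e2) y) \<longlonglongrightarrow> poly (form_poly d a w0 e2) y" for y
      unfolding poly_form_poly
      using line[OF strict_mono_id tendsto_const, of y] continuous_on_ternary_form[OF continuous_on_id, of UNIV d a]
      by (auto simp: continuous_on_eq_continuous_at intro: isCont_tendsto_compose)
    show "cmod y \<le> C" if "poly (form_poly d a (w n) e2) y = 0" for n y using C[OF B] that by (simp add: poly_form_poly)
    show "(\<lambda>n. ln ((norm (\<Phi> (w (k n) + y' n *s e2)))\<^sup>2) / 4) \<longlonglongrightarrow> ln ((norm (\<Phi> (w0 + y *s e2)))\<^sup>2) / 4"
      if "strict_mono k" "y' \<longlonglongrightarrow> y" "poly (form_poly d a w0 e2) y = 0" for y y' k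
    proof -
      have "\<Phi> (w0 + y *s e2) \<noteq> 0" using that(3) ne by (intro \<Phi>_nonzero) (simp_all add: poly_form_poly)
      moreover have "(\<lambda>n. \<Phi> (w (k n) + y' n *s e2)) \<longlonglongrightarrow> \<Phi> (w0 + y *s e2)"
        by (rule isCont_tendsto_compose[OF has_derivative_continuous[OF \<Phi>_deriv] line[OF that(1,2)]])
      ultimately show ?thesis by (intro tendsto_intros) auto
    qed
  qed (use form_poly_lead[OF F_e2] F_e2 in auto)
qed

text \<open>The roots over \<open>x *s w\<close> are \<open>x\<close> times those over
  \<open>w\<close>. Homogeneity of \<open>\<Phi>\<close> then adds \<open>m / 4 * ln |x|^2\<close>
  to each of the \<open>d\<close> summands.\<close>

lemma U_scale:
  assumes x: "x \<noteq> 0" and ne: "\<And>y. w + y *s e2 \<noteq> 0"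
  shows "U (x *s w) = real d * real m / 4 * ln ((cmod x)\<^sup>2) + U w"
proof -
  have "\<exists>r. form_poly d a w e2 = smult (F e2) (\<Prod>j<d. [:- r j, 1:])"
    using complex_poly_decompose'[of "form_poly d a w e2"] form_poly_lead[OF F_e2, of w] by metis
  then obtain r where r: "form_poly d a w e2 = smult (F e2) (\<Prod>j<d. [:- r j, 1:])" by blast
  have scale: "x *s w + (x * y) *s e2 = x *s (w + y *s e2)" for y by (simp add: vector_add_ldistrib)
  have "form_poly d a (x *s w) e2 = smult (F e2) (\<Prod>j<d. [:- (x * r j), 1:])"
  proof (rule poly_eq_poly_eq_iff[THEN iffD1], rule ext)
    fix y
    have "poly (form_poly d a (x *s w) e2) y = F (x *s w + (x * (y / x)) *s e2)" using x by (simp add: poly_form_poly)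
    also have "\<dots> = x ^ d * poly (form_poly d a w e2) (y / x)" by (simp only: scale ternary_form_scale poly_form_poly)
    also have "\<dots> = F e2 * ((\<Prod>j<d. x) * (\<Prod>j<d. y / x - r j))" by (simp add: r poly_prod)
    also have "(\<Prod>j<d. x) * (\<Prod>j<d. y / x - r j) = (\<Prod>j<d. y - x * r j)"
      unfolding prod.distrib[symmetric] using x by (intro prod.cong) (simp_all add: algebra_simps)
    finally show "poly (form_poly d a (x *s w) e2) y = poly (smult (F e2) (\<Prod>j<d. [:- (x * r j), 1:])) y"
      by (simp add: poly_prod)
  qed
  then have "U (x *s w) = (\<Sum>j<d. ln ((norm (\<Phi> (x *s w + (x * r j) *s e2)))\<^sup>2) / 4)"
    by (simp add: U_def proots_smult_prod_linear[OF F_e2] sum_unfold_sum_mset multiset.map_comp o_def)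
  also have "\<dots> = (\<Sum>j<d. real m / 4 * ln ((cmod x)\<^sup>2) + ln ((norm (\<Phi> (w + r j *s e2)))\<^sup>2) / 4)"
  proof (rule sum.cong[OF refl])
    fix j assume j: "j \<in> {..<d}"
    have "poly (form_poly d a w e2) (r j) = 0" using j by (auto simp: r poly_prod)
    then have "\<Phi> (w + r j *s e2) \<noteq> 0" using ne by (intro \<Phi>_nonzero) (simp_all add: poly_form_poly)
    then have pos: "(norm (\<Phi> (w + r j *s e2)))\<^sup>2 > 0" "((cmod x)\<^sup>2) ^ m > 0" using x by simp_all
    have "(norm (\<Phi> (x *s w + (x * r j) *s e2)))\<^sup>2 = ((cmod x)\<^sup>2) ^ m * (norm (\<Phi> (w + r j *s e2)))\<^sup>2"
      by (simp only: scale \<Phi>_scale norm_smult_vec norm_power power_mult_distrib mult.commute[of 2 m] power_mult[symmetric])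
    then have "ln ((norm (\<Phi> (x *s w + (x * r j) *s e2)))\<^sup>2) = ln (((cmod x)\<^sup>2) ^ m) + ln ((norm (\<Phi> (w + r j *s e2)))\<^sup>2)"
      using ln_mult_pos[OF pos(2,1)] by simp
    also have "ln (((cmod x)\<^sup>2) ^ m) = real m * ln ((cmod x)\<^sup>2)" by (rule ln_realpow)
    finally show "ln ((norm (\<Phi> (x *s w + (x * r j) *s e2)))\<^sup>2) / 4 = real m / 4 * ln ((cmod x)\<^sup>2) + ln ((norm (\<Phi> (w + r j *s e2)))\<^sup>2) / 4"
      by (simp add: add_divide_distrib)
  qed
  also have "\<dots> = real d * real m / 4 * ln ((cmod x)\<^sup>2) + U w"
    by (simp add: sum.distrib U_def r proots_smult_prod_linear[OF F_e2] sum_unfold_sum_mset multiset.map_comp o_def)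
  finally show ?thesis .
qed

lemma line_nonzero: "s *s e0 + e1 + y *s e2 \<noteq> 0" "e0 + x *s e1 + y *s e2 \<noteq> 0"
proof -
  have "dotc l1 (s *s e0 + e1 + y *s e2) = 1" by (simp add: dotc_simps dual_frame)
  then show "s *s e0 + e1 + y *s e2 \<noteq> 0" by (metis dotc_simps(10) zero_neq_one)
  show "e0 + x *s e1 + y *s e2 \<noteq> 0" using pt_nonzero by (simp add: pt_def)
qed

lemma U_continuous: "continuous_on UNIV (\<lambda>x. U (e0 + x *s e1))"
  unfolding continuous_on_sequentially o_def
  by (auto intro!: U_tendsto tendsto_intros bounded_linear.tendsto[OF bounded_linear_smult_left] simp: line_nonzero)

text \<open>Writing \<open>e0 + x *s e1\<close> as \<open>x *s (inverse x *s e0 + e1)\<close> splits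
  off the logarithm, and the rest converges by continuity of the potential along
  \<open>s *s e0 + e1\<close> at \<open>s = 0\<close>.\<close>

lemma U_at_infinity: "((\<lambda>x. U (e0 + x *s e1) - real d * real m / 4 * ln (1 + (cmod x)\<^sup>2)) \<longlongrightarrow> U e1) at_infinity"
proof -
  \<comment> \<open>The logarithm in the inverted variable accounts for the difference between
    \<open>ln |x|^2\<close> and \<open>ln (1 + |x|^2)\<close>; it vanishes at 0.\<close>
  define g where "g s = U (s *s e0 + e1) - real d * real m / 4 * ln (1 + (cmod s)\<^sup>2)" for s
  have "continuous_on UNIV (\<lambda>s. U (s *s e0 + e1))"
    unfolding continuous_on_sequentially o_def
    by (auto intro!: U_tendsto tendsto_intros bounded_linear.tendsto[OF bounded_linear_smult_left] simp: line_nonzero)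
  moreover have "1 + (cmod s)\<^sup>2 \<noteq> 0" for s using zero_le_power2[of "cmod s"] by linarith
  ultimately have "continuous_on UNIV g" unfolding g_def by (intro continuous_intros) auto
  then have "isCont g 0" by (simp add: continuous_on_eq_continuous_at)
  then have "((\<lambda>x. g (inverse x)) \<longlongrightarrow> g 0) at_infinity" using tendsto_inverse_0 by (rule isCont_tendsto_compose)
  then have 1: "((\<lambda>x. g (inverse x)) \<longlongrightarrow> U e1) at_infinity" by (simp add: g_def)
  have "\<forall>\<^sub>F x in at_infinity. g (inverse x) = U (e0 + x *s e1) - real d * real m / 4 * ln (1 + (cmod x)\<^sup>2)"
  proof (rule eventually_mono[OF eventually_not_equal_at_infinity[of 0]])
    fix x :: complex assume x: "x \<noteq> 0"
    have "e0 + x *s e1 = x *s (inverse x *s e0 + e1)" using x by (simp add: vector_add_ldistrib)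
    then have "U (e0 + x *s e1) = real d * real m / 4 * ln ((cmod x)\<^sup>2) + U (inverse x *s e0 + e1)"
      by (simp only: U_scale[OF x line_nonzero(1)])
    moreover have "ln (1 + (cmod x)\<^sup>2) = ln ((cmod x)\<^sup>2) + ln (1 + (cmod (inverse x))\<^sup>2)"
    proof -
      have "1 + (cmod x)\<^sup>2 = (cmod x)\<^sup>2 * (1 + (cmod (inverse x))\<^sup>2)" using x by (simp add: norm_inverse distrib_left flip: power_mult_distrib)
      moreover have "1 + (cmod (inverse x))\<^sup>2 > 0" using zero_le_power2[of "cmod (inverse x)"] by linarith
      ultimately show ?thesis using x by (simp add: ln_mult)
    qed
    ultimately show "g (inverse x) = U (e0 + x *s e1) - real d * real m / 4 * ln (1 + (cmod x)\<^sup>2)"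
      by (simp only: g_def distrib_left)
  qed
  then show ?thesis by (rule Lim_transform_eventually[OF 1])
qed

text \<open>Near an unramified point the fibre consists of finitely many holomorphic branches, each
  of which contributes a term treated by \<open>C2_with_log_norm\<close>.\<close>

lemma U_local:
  assumes x0: "x0 \<notin> E"
  shows "\<exists>T w1 w2. open T \<and> x0 \<in> T \<and> C2_with T (\<lambda>x. U (e0 + x *s e1)) w1 w2 \<and> lap w2 x0 = (\<Sum>y\<in>Y x0. pullback_density x0 y)"
proof -
  obtain \<epsilon> h where \<epsilon>: "\<epsilon> > 0" "ball x0 \<epsilon> \<subseteq> - E" and h0: "\<And>y. y \<in> Y x0 \<Longrightarrow> h y x0 = y"
    and gp: "\<And>y. y \<in> Y x0 \<Longrightarrow> \<exists>D D'. graph_patch D D' (h y) \<and> ball x0 \<epsilon> \<subseteq> D"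
    and bij: "\<And>x. x \<in> ball x0 \<epsilon> \<Longrightarrow> bij_betw (\<lambda>y. h y x) (Y x0) (Y x)" using local_branches[OF x0] by blast
  have "\<exists>w1 w2. C2_with (ball x0 \<epsilon>) (\<lambda>x. ln ((norm (\<Phi> (pt x (h y x))))\<^sup>2) / 4) w1 w2 \<and>
    (\<forall>x\<in>ball x0 \<epsilon>. lap w2 x = pullback_density x (h y x))" if y: "y \<in> Y x0" for y
    unfolding pullback_density_def
  proof (rule C2_with_log_norm[OF open_ball])
    fix x assume x: "x \<in> ball x0 \<epsilon>"
    obtain D D' where D: "graph_patch D D' (h y)" "x \<in> D" using gp[OF y] x by blast
    have d: "((\<lambda>x. \<Phi> (pt x (h y x))) has_derivative (\<lambda>k. \<Phi>' (pt x (h y x)) (k *s tg x (h y x)))) (at x)"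
      using diff_chain_at[OF graph_patch_has_derivative[OF D] \<Phi>_deriv] by (simp add: o_def)
    show "((\<lambda>x. \<Phi> (pt x (h y x)) $ i) has_field_derivative \<Phi>' (pt x (h y x)) (tg x (h y x)) $ i) (at x)" for i
      using bounded_linear.has_derivative[OF bounded_linear_vec_nth d, of i]
      by (simp add: has_field_derivative_def \<Phi>'_linear mult.commute[of _ "_ $ _"])
    have "h y x \<in> Y x" using bij_betwE[OF bij[OF x]] y by blast
    then show "\<Phi> (pt x (h y x)) \<noteq> 0" by (intro \<Phi>_nonzero pt_nonzero) (simp add: Y_def)
  qed
  then have "\<forall>y\<in>Y x0. \<exists>w1 w2. C2_with (ball x0 \<epsilon>) (\<lambda>x. ln ((norm (\<Phi> (pt x (h y x))))\<^sup>2) / 4) w1 w2 \<and>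
    (\<forall>x\<in>ball x0 \<epsilon>. lap w2 x = pullback_density x (h y x))" ..
  from bchoice[OF this] obtain w1 where "\<forall>y\<in>Y x0. \<exists>w2. C2_with (ball x0 \<epsilon>) (\<lambda>x. ln ((norm (\<Phi> (pt x (h y x))))\<^sup>2) / 4) (w1 y) w2 \<and>
    (\<forall>x\<in>ball x0 \<epsilon>. lap w2 x = pullback_density x (h y x))" ..
  from bchoice[OF this] obtain w2 where "\<forall>y\<in>Y x0. C2_with (ball x0 \<epsilon>) (\<lambda>x. ln ((norm (\<Phi> (pt x (h y x))))\<^sup>2) / 4) (w1 y) (w2 y) \<and>
    (\<forall>x\<in>ball x0 \<epsilon>. lap (w2 y) x = pullback_density x (h y x))" ..
  then have w: "\<And>y. y \<in> Y x0 \<Longrightarrow> C2_with (ball x0 \<epsilon>) (\<lambda>x. ln ((norm (\<Phi> (pt x (h y x))))\<^sup>2) / 4) (w1 y) (w2 y)"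
    "\<And>y x. y \<in> Y x0 \<Longrightarrow> x \<in> ball x0 \<epsilon> \<Longrightarrow> lap (w2 y) x = pullback_density x (h y x)" by simp_all
  have "C2_with (ball x0 \<epsilon>) (\<lambda>x. U (e0 + x *s e1)) (\<lambda>v x. \<Sum>y\<in>Y x0. w1 y v x) (\<lambda>v x. \<Sum>y\<in>Y x0. w2 y v x)"
  proof (rule C2_with_cong[OF C2_with_sum[OF w(1)] open_ball])
    fix x assume x: "x \<in> ball x0 \<epsilon>"
    have xE: "x \<notin> E" using \<epsilon>(2) x by blast
    have "U (e0 + x *s e1) = (\<Sum>y\<in>Y x. ln ((norm (\<Phi> (pt x y)))\<^sup>2) / 4)"
      using proots_unramified[OF xE] by (simp add: U_def pt_def sum_unfold_sum_mset)
    also have "\<dots> = (\<Sum>y\<in>Y x0. ln ((norm (\<Phi> (pt x (h y x))))\<^sup>2) / 4)" by (rule sum.reindex_bij_betw[OF bij[OF x], symmetric])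
    finally show "(\<Sum>y\<in>Y x0. ln ((norm (\<Phi> (pt x (h y x))))\<^sup>2) / 4) = U (e0 + x *s e1)" ..
  qed
  moreover have "lap (\<lambda>v x. \<Sum>y\<in>Y x0. w2 y v x) x0 = (\<Sum>y\<in>Y x0. lap (w2 y) x0)" by (simp add: lap_def sum.distrib)
  moreover have "(\<Sum>y\<in>Y x0. lap (w2 y) x0) = (\<Sum>y\<in>Y x0. pullback_density x0 y)"
    using w(2)[of _ x0] \<epsilon>(1) h0 by (intro sum.cong) auto
  ultimately have "open (ball x0 \<epsilon>) \<and> x0 \<in> ball x0 \<epsilon> \<and> C2_with (ball x0 \<epsilon>) (\<lambda>x. U (e0 + x *s e1)) (\<lambda>v x. \<Sum>y\<in>Y x0. w1 y v x) (\<lambda>v x. \<Sum>y\<in>Y x0. w2 y v x) \<and>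
    lap (\<lambda>v x. \<Sum>y\<in>Y x0. w2 y v x) x0 = (\<Sum>y\<in>Y x0. pullback_density x0 y)" using \<epsilon>(1) by simp
  then show ?thesis by (intro exI)
qed

lemma pullback_density_nonneg: "pullback_density x y \<ge> 0"
  by (simp add: pullback_density_def fs_form_nonneg)

text \<open>The logarithmic growth of the potential has coefficient \<open>d * m / 4\<close>, and
  \<open>4 * pi\<close> times this is the mass of its Laplacian.\<close>

theorem pullback_area:
  "continuous_on (- E) (\<lambda>x. \<Sum>y\<in>Y x. pullback_density x y)"
  "(\<integral>\<^sup>+x\<in>- E. ennreal (\<Sum>y\<in>Y x. pullback_density x y) \<partial>lborel) = ennreal (pi * (real d * real m))"
proof -
  define u where "u x = U (e0 + x *s e1)" for x
  define w2 where "w2 = (\<lambda>v. dir_deriv (dir_deriv u v) v)"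
  have C2: "C2_with (- E) u (dir_deriv u) w2"
    unfolding w2_def
  proof (rule C2_with_glue)
    fix x assume "x \<in> - E"
    then have "x \<notin> E" by simp
    from U_local[OF this, folded u_def] show "\<exists>T w1 w2. open T \<and> x \<in> T \<and> C2_with T u w1 w2" by (elim exE conjE) (intro exI conjI)
  qed
  have lap: "lap w2 x = (\<Sum>y\<in>Y x. pullback_density x y)" if "x \<notin> E" for x
  proof -
    obtain T v1 v2 where T: "open T" "x \<in> T" "C2_with T u v1 v2" "lap v2 x = (\<Sum>y\<in>Y x. pullback_density x y)"
      using U_local[OF \<open>x \<notin> E\<close>, folded u_def] by (elim exE conjE) (rule that)
    then show ?thesis using C2_with_unique(2)[OF T(3,1,2)] by (simp add: lap_def w2_def)
  qed
  show "continuous_on (- E) (\<lambda>x. \<Sum>y\<in>Y x. pullback_density x y)"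
    by (rule continuous_on_eq[OF C2_with_continuous_lap[OF C2]]) (simp add: lap)
  have "(\<integral>\<^sup>+x\<in>- E. ennreal (lap w2 x) \<partial>lborel) = ennreal (4 * pi * (real d * real m / 4))"
  proof (rule nn_integral_lap_logarithmic_growth[OF _ closed_E finite_E C2])
    show "continuous_on UNIV u" unfolding u_def by (rule U_continuous)
    show "0 \<le> lap w2 x" if "x \<notin> E" for x using that by (simp add: lap sum_nonneg pullback_density_nonneg)
    show "((\<lambda>x. u x - real d * real m / 4 * ln (1 + (cmod x)\<^sup>2)) \<longlongrightarrow> U e1) at_infinity" unfolding u_def by (rule U_at_infinity)
  qed simp
  moreover have "(\<integral>\<^sup>+x\<in>- E. ennreal (lap w2 x) \<partial>lborel) = (\<integral>\<^sup>+x\<in>- E. ennreal (\<Sum>y\<in>Y x. pullback_density x y) \<partial>lborel)"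
    by (intro nn_integral_cong) (auto simp: lap indicator_def)
  ultimately show "(\<integral>\<^sup>+x\<in>- E. ennreal (\<Sum>y\<in>Y x. pullback_density x y) \<partial>lborel) = ennreal (pi * (real d * real m))"
    by simp
qed

end

section \<open>Integration of the curvature density\<close>

lemma crossc_crossc: "crossc (crossc u v) w = dotc u w *s v - dotc v w *s u"
  by (simp add: crossc_def dotc_def sum_3 vec_eq_iff forall_3 algebra_simps)

lemma crossc_anti: "crossc u v = - crossc v u"
  by (simp add: crossc_def vec_eq_iff forall_3 algebra_simps)

lemma crossc_scale: "crossc (c *s u) v = c *s crossc u v" "crossc u (c *s v) = c *s crossc u v"
  by (simp_all add: crossc_def vec_eq_iff forall_3 algebra_simps)

text \<open>Lagrange's identity, for the Hermitian product.\<close>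

lemma fs_form_crossc: "fs_form z u u = (norm (crossc z u))\<^sup>2 / norm z ^ 4"
proof -
  have "hinner z z * hinner u u - hinner u z * hinner z u = hinner (crossc z u) (crossc z u)"
    by (simp add: hinner_def crossc_def sum_3 algebra_simps)
  then show ?thesis by (simp add: fs_form_altdef hinner_self)
qed

lemma continuous_on_crossc [continuous_intros]:
  assumes "continuous_on S f" "continuous_on S g"
  shows "continuous_on S (\<lambda>x. crossc (f x) (g x))"
proof -
  have "crossc u v = (u $ 2 * v $ 3 - u $ 3 * v $ 2) *s axis 1 1 + (u $ 3 * v $ 1 - u $ 1 * v $ 3) *s axis 2 1 + (u $ 1 * v $ 2 - u $ 2 * v $ 1) *s axis 3 1" for u v
    by (simp add: crossc_def vec_eq_iff forall_3 axis_def)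
  then show ?thesis
    by (simp only:) (intro continuous_intros bounded_linear.continuous_on[OF bounded_linear_smult_left] assms)
qed

lemma continuous_on_cnjv [continuous_intros]:
  assumes "continuous_on S f"
  shows "continuous_on S (\<lambda>x. cnjv (f x))"
  unfolding cnjv_def by (intro continuous_intros assms)

context smooth_form
begin

text \<open>Both \<open>crossc z T\<close> and \<open>G z\<close> annihilate \<open>z\<close> and
  \<open>T\<close>, so they are proportional; likewise \<open>crossc (G z) H\<close> and
  \<open>z\<close>, with respect to \<open>G z\<close> and \<open>H\<close>. Evaluating
  \<open>crossc (crossc z T) H\<close> in two ways gives \<open>- dotc H T\<close> as the product of
  the two factors. This links the area of the Gauss image to the curvature.\<close>

lemma fs_form_form_grad:
  assumes z: "z \<noteq> 0" "F z = 0" and T: "dotc (G z) T = 0"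
  shows "fs_form (G z) (form_hess d a z T) (form_hess d a z T) * fs_form z T T
    = (cmod (dotc (form_hess d a z T) T))\<^sup>2 / ((norm z)\<^sup>2 * (norm (G z))\<^sup>2)"
proof -
  define H where "H = form_hess d a z T"
  have G0: "G z \<noteq> 0" by (rule smooth[OF z])
  have Gz: "dotc (G z) z = 0" by (simp add: euler_form z)
  have Hz: "dotc H z = 0" by (simp add: H_def form_hess_base_right T)
  have dc: "dotc u v = dotc v u" for u v :: "complex ^ 3" by (simp add: dotc_def mult.commute)
  have "crossc (crossc z T) (G z) = 0" by (simp add: crossc_crossc dc[of _ "G z"] Gz T)
  then have "crossc (G z) (crossc z T) = 0" using crossc_anti[of "G z"] by simp
  then obtain c where c: "crossc z T = c *s G z" using crossc_eq_0 G0 by blast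
  have "crossc (crossc (G z) H) z = 0" by (simp add: crossc_crossc Gz Hz)
  then have "crossc z (crossc (G z) H) = 0" using crossc_anti[of z] by simp
  then obtain c' where c': "crossc (G z) H = c' *s z" using crossc_eq_0 z(1) by blast
  have "(c * c') *s z = crossc (crossc z T) H" by (simp add: c crossc_scale c')
  also have "\<dots> = - dotc H T *s z" by (simp add: crossc_crossc dc[of _ H] Hz)
  finally have cc: "c * c' = - dotc H T" unfolding vector_mul_rcancel using z(1) by blast
  have n: "norm z > 0" "norm (G z) > 0" using z(1) G0 by simp_all
  have "fs_form (G z) H H * fs_form z T T = (cmod (c * c'))\<^sup>2 / ((norm z)\<^sup>2 * (norm (G z))\<^sup>2)"
    unfolding fs_form_crossc c c' norm_smult_vec norm_mult using n
    by (simp add: field_simps power_mult_distrib power2_eq_square power4_eq_xxxx)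
  then show ?thesis by (simp add: cc H_def)
qed

text \<open>A tangent direction that varies continuously with \<open>z\<close>, needed for the
  measurability of the curvature density.\<close>

definition tangent_vector :: "complex ^ 3 \<Rightarrow> complex ^ 3"
  where "tangent_vector z = crossc (G z) (cnjv z)"

lemma tangent_vector:
  assumes "z \<noteq> 0" "F z = 0"
  shows "dotc (G z) (tangent_vector z) = 0" "fs_form z (tangent_vector z) (tangent_vector z) \<noteq> 0"
proof -
  show "dotc (G z) (tangent_vector z) = 0" by (simp add: tangent_vector_def crossc_dotc)
  have "crossc (tangent_vector z) z = - of_real ((norm z)\<^sup>2) *s G z"
    by (simp add: tangent_vector_def crossc_crossc euler_form assms dotc_cnjv)
  then have "crossc z (tangent_vector z) = of_real ((norm z)\<^sup>2) *s G z" using crossc_anti[of z] by simp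
  then have "crossc z (tangent_vector z) \<noteq> 0" using smooth[OF assms] assms(1) by simp
  then show "fs_form z (tangent_vector z) (tangent_vector z) \<noteq> 0" using assms(1) by (simp add: fs_form_crossc)
qed

text \<open>The choice in the definition of \<open>curvature_density\<close> gives no regularity.
  The explicit value is continuous on the cone over the curve, and the quotient topology hands
  continuity down to the curve.\<close>

lemma curvature_density_measurable: "curvature_density curve \<in> borel_measurable \<mu>"
proof -
  define Z where "Z = {z. z \<noteq> 0 \<and> F z = 0}"
  define K where "K z = 1 + (cmod (dotc (form_hess d a z (tangent_vector z)) (tangent_vector z)))\<^sup>2 /
    ((norm z)\<^sup>2 * (norm (G z))\<^sup>2 * (fs_form z (tangent_vector z) (tangent_vector z))\<^sup>2)" for z
  have K1: "K z \<ge> 1" for z by (simp add: K_def)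
  have T: "continuous_on Z tangent_vector" unfolding tangent_vector_def[abs_def] by (intro continuous_intros)
  have contK: "continuous_on Z K" unfolding K_def[abs_def]
    by (intro continuous_intros continuous_on_fs_form T) (use smooth tangent_vector in \<open>auto simp: Z_def\<close>)
  have "K z \<noteq> 0" for z using K1[of z] by linarith
  then have \<kappa>: "continuous_on Z (\<lambda>z. ennreal (pi / 2 * (K z - 2 + 2 / K z)))"
    by (auto intro!: continuous_on_ennreal continuous_intros contK)
  have val: "curvature_density curve (proj z) = ennreal (pi / 2 * (K z - 2 + 2 / K z))" if "z \<in> Z" for z
    unfolding K_def using that tangent_vector by (intro curvature_density_curve) (auto simp: Z_def)
  have "continuous_on curve (curvature_density curve)"
    unfolding continuous_on_closed_invariant
  proof (intro allI impI)
    fix B :: "ennreal set" assume "closed B"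
    then obtain A where A: "closed A" "A \<inter> Z = (\<lambda>z. ennreal (pi / 2 * (K z - 2 + 2 / K z))) -` B \<inter> Z"
      using \<kappa> unfolding continuous_on_closed_invariant by blast
    define C where "C = curvature_density curve -` B \<inter> curve"
    have C: "proj z \<in> C \<longleftrightarrow> z \<in> A \<inter> Z" if "z \<noteq> 0" for z
      using that val[of z] A(2) by (auto simp: C_def Z_def proj_in_curve)
    have "{z. z \<noteq> 0 \<and> proj z \<in> - C} = - {0} \<inter> - (A \<inter> {z. F z = 0})"
      using C by (auto simp: Z_def)
    moreover have "open (- {0} \<inter> - (A \<inter> {z. F z = 0}))"
      by (intro open_Int open_Compl closed_Int A(1) closed_singleton closed_Collect_eq continuous_on_ternary_form continuous_on_id continuous_on_const)
    ultimately have "closed C" unfolding closed_def[of C] open_cproj_def by simp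
    moreover have "C \<inter> curve = curvature_density curve -` B \<inter> curve" by (auto simp: C_def)
    ultimately show "\<exists>A. closed A \<and> A \<inter> curve = curvature_density curve -` B \<inter> curve" by blast
  qed
  then show ?thesis
    unfolding measurable_cong_sets[OF sets_\<mu>(1) refl] by (rule borel_measurable_continuous_on_restrict)
qed

text \<open>A form that vanishes identically has zero gradient everywhere, against smoothness. The
  degree enters at the origin, where a form of degree 0 need not vanish.\<close>

lemma form_nonzero_exists: "d \<ge> 1 \<Longrightarrow> \<exists>z. z \<noteq> 0 \<and> F z \<noteq> 0"
proof (rule ccontr)
  assume d: "d \<ge> 1" and "\<not> (\<exists>z. z \<noteq> 0 \<and> F z \<noteq> 0)"
  moreover have "F 0 = 0" using ternary_form_scale[of d a 0 0] d by (simp add: power_0_left)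
  ultimately have 0: "F = (\<lambda>z. 0)" by (metis ext)
  define z :: "complex ^ 3" where "z = axis 1 1"
  have z0: "z \<noteq> 0" by (simp add: z_def axis_eq_0_iff)
  have "((\<lambda>z. 0) has_derivative (\<lambda>h. dotc (G z) h)) (at z)" using has_derivative_ternary_form[of d a z] unfolding 0 .
  then have "(\<lambda>h. dotc (G z) h) = (\<lambda>h. 0)" using has_derivative_unique has_derivative_const by blast
  then have "dotc (G z) (cnjv (G z)) = 0" by (rule fun_cong)
  then show False using smooth[OF z0] 0 by (simp add: dotc_cnjv)
qed

lemma branched_cover_exists:
  assumes "d \<ge> 1"
  shows "\<exists>e0 e1 e2. branched_cover d a e0 e1 e2"
proof -
  obtain e2 where e2: "e2 \<noteq> 0" "F e2 \<noteq> 0" using form_nonzero_exists[OF assms] by blast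
  have "\<exists>e0. crossc e0 e2 \<noteq> 0"
  proof (rule ccontr)
    assume n: "\<not> ?thesis"
    have "crossc (axis 1 1) e2 = 0" "crossc (axis 2 1) e2 = 0" using n by blast+
    then show False using e2(1) by (simp add: crossc_def vec_eq_iff forall_3 axis_def)
  qed
  then obtain e0 where e0: "crossc e0 e2 \<noteq> 0" by blast
  \<comment> \<open>Choosing the conjugate cross product as the middle vector turns the determinant
    into minus a squared norm.\<close>
  have "dotc (crossc e0 (cnjv (crossc e0 e2))) e2 = - dotc (crossc e0 e2) (cnjv (crossc e0 e2))" by (rule crossc_triple(2))
  then have "dotc (crossc e0 (cnjv (crossc e0 e2))) e2 \<noteq> 0" using e0 by (simp add: dotc_cnjv)
  then show ?thesis using e2(2)
    by (intro exI[of _ e0] exI[of _ "cnjv (crossc e0 e2)"] exI[of _ e2]) (unfold_locales)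
qed

end

section \<open>The two bounds on the curvature integral\<close>

context branched_cover
begin

text \<open>By \<open>fs_form_form_grad\<close> the squared principal curvature is the quotient of
  the area densities, so \<open>K = (A + b) / A\<close> with \<open>A\<close> the area density of
  the curve. Multiplying the disc integral by \<open>A\<close> clears the denominators.\<close>

lemma curvature_fibre_sum:
  assumes x: "x \<notin> E"
  defines "b \<equiv> \<lambda>y. fs_form (G (pt x y)) (form_hess d a (pt x y) (tg x y)) (form_hess d a (pt x y) (tg x y))"
  shows "fibre_sum (curvature_density curve) x = ennreal (\<Sum>y\<in>Y x. pi / 2 *
    (b y - area_density x y + 2 * (area_density x y)\<^sup>2 / (area_density x y + b y)))"
proof -
  have b0: "b y \<ge> 0" for y by (simp add: b_def fs_form_nonneg)
  \<comment> \<open>The expression equals \<open>(b^2 + A^2) / (A + b)\<close>. Its sign allows the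
    sum over the fibre to pass through \<open>ennreal\<close>.\<close>
  have pos: "b y - A + 2 * A\<^sup>2 / (A + b y) \<ge> 0" if "A > 0" for A y
  proof -
    have "b y - A + 2 * A\<^sup>2 / (A + b y) = ((b y)\<^sup>2 + A\<^sup>2) / (A + b y)"
      using that b0[of y] by (simp add: field_simps power2_eq_square)
    then show ?thesis using that b0[of y] by simp
  qed
  have "fibre_sum (curvature_density curve) x = (\<Sum>y\<in>Y x. ennreal (pi / 2 *
    (b y - area_density x y + 2 * (area_density x y)\<^sup>2 / (area_density x y + b y))))"
    unfolding fibre_sum_def
  proof (rule sum.cong[OF refl])
    fix y assume y: "y \<in> Y x"
    define A where "A = area_density x y"
    have A: "A > 0" by (simp add: A_def area_density_pos)
    have F0: "F (pt x y) = 0" using y by (simp add: Y_def)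
    have tan: "dotc (G (pt x y)) (tg x y) = 0" using x y by (intro dotc_G_tg) (auto simp: E_def)
    define N where "N = (cmod (dotc (form_hess d a (pt x y) (tg x y)) (tg x y)))\<^sup>2 / ((norm (pt x y))\<^sup>2 * (norm (G (pt x y)))\<^sup>2)"
    have "b y * A = N"
      using fs_form_form_grad[OF pt_nonzero F0 tan] by (simp add: b_def A_def area_density_def N_def)
    then have K: "N / A\<^sup>2 = b y / A" using A by (simp add: power2_eq_square field_simps)
    have "curvature_density curve (proj (pt x y)) = ennreal (pi / 2 * ((1 + N / A\<^sup>2) - 2 + 2 / (1 + N / A\<^sup>2)))"
      using curvature_density_curve[OF pt_nonzero F0 tan] A by (simp add: A_def area_density_def N_def)
    then have "curvature_density curve (proj (pt x y)) * ennreal A = ennreal (pi / 2 * ((1 + b y / A) - 2 + 2 / (1 + b y / A)) * A)"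
      unfolding K using A by (simp only: ennreal_mult''[OF less_imp_le])
    also have "pi / 2 * ((1 + b y / A) - 2 + 2 / (1 + b y / A)) * A = pi / 2 * (b y - A + 2 * A\<^sup>2 / (A + b y))"
    proof -
      define S where "S = A + b y"
      have S: "S > 0" "b y = S - A" using A b0[of y] by (simp_all add: S_def)
      have "1 + b y / A = S / A" using A by (simp add: S field_simps)
      moreover have "(S / A - 2 + 2 / (S / A)) * A = S - A - A + 2 * A\<^sup>2 / S"
        using A S(1) by (simp add: field_simps power2_eq_square)
      ultimately show ?thesis unfolding S_def[symmetric] by (simp only: S(2) mult.assoc)
    qed
    finally show "curvature_density curve (proj (pt x y)) * ennreal (area_density x y) =
      ennreal (pi / 2 * (b y - area_density x y + 2 * (area_density x y)\<^sup>2 / (area_density x y + b y)))"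
      by (simp only: A_def)
  qed
  also have "\<dots> = ennreal (\<Sum>y\<in>Y x. pi / 2 * (b y - area_density x y + 2 * (area_density x y)\<^sup>2 / (area_density x y + b y)))"
    using pos[OF area_density_pos] by (intro sum_ennreal) simp
  finally show ?thesis .
qed

lemma curvature_integral_bounds:
  assumes d: "d \<ge> 1"
  shows "ennreal (pi\<^sup>2 / 2 * ((real d)\<^sup>2 - 2 * real d + 2)) \<le> (\<integral>\<^sup>+Q. curvature_density curve Q \<partial>\<mu>)"
    "(\<integral>\<^sup>+Q. curvature_density curve Q \<partial>\<mu>) \<le> ennreal (pi\<^sup>2 / 2 * (real d)\<^sup>2)"
proof -
  \<comment> \<open>The area theorem is used for the identity, whose density is
    \<open>area_density\<close>, and for the gradient, which is homogeneous of degree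
    \<open>d - 1\<close> and has no zero on the curve by smoothness.\<close>
  interpret id: projective_map d a e0 e1 e2 1 "\<lambda>z. z" "\<lambda>z u. u" by unfold_locales auto
  interpret grad: projective_map d a e0 e1 e2 "d - 1" G "form_hess d a"
    by unfold_locales (auto simp: has_derivative_form_grad form_hess_linear form_grad_scale smooth)
  define A where "A x = (\<Sum>y\<in>Y x. id.pullback_density x y)" for x
  define B where "B x = (\<Sum>y\<in>Y x. grad.pullback_density x y)" for x
  define PA where "PA x = ennreal (A x) * indicator (- E) x" for x
  define PB where "PB x = ennreal (B x) * indicator (- E) x" for x
  define f where "f x = fibre_sum (curvature_density curve) x * indicator (- E) x" for x
  have nn: "A x \<ge> 0" "B x \<ge> 0" for x
    by (simp_all add: A_def B_def sum_nonneg id.pullback_density_nonneg grad.pullback_density_nonneg)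
  have meas: "(\<lambda>x. ennreal (g x) * indicator (- E) x) \<in> borel_measurable borel" if "continuous_on (- E) g" for g :: "complex \<Rightarrow> real"
  proof -
    have "(\<lambda>x. ennreal (indicator (- E) x * g x)) \<in> borel_measurable borel"
      using measurable_indicator_continuous[OF _ that] closed_E by (intro measurable_compose[OF _ measurable_ennreal]) auto
    moreover have "ennreal (indicator (- E) x * g x) = ennreal (g x) * indicator (- E) x" for x by (simp add: indicator_def)
    ultimately show ?thesis by simp
  qed
  have [measurable]: "PA \<in> borel_measurable borel" "PB \<in> borel_measurable borel" "f \<in> borel_measurable borel"
    using meas[OF id.pullback_area(1)] meas[OF grad.pullback_area(1)] nn_integral_curve(1)[OF curvature_density_measurable]
    unfolding PA_def[abs_def] PB_def[abs_def] A_def B_def f_def[abs_def] .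
  have IA: "(\<integral>\<^sup>+x. PA x \<partial>lborel) = ennreal (pi * real d)"
    using id.pullback_area(2) by (simp add: PA_def A_def)
  have IB: "(\<integral>\<^sup>+x. PB x \<partial>lborel) = ennreal (pi * (real d * (real d - 1)))"
    using grad.pullback_area(2) d by (simp add: PB_def B_def of_nat_diff)
  have If: "(\<integral>\<^sup>+Q. curvature_density curve Q \<partial>\<mu>) = (\<integral>\<^sup>+x. f x \<partial>lborel)"
    unfolding f_def by (rule nn_integral_curve(2)[OF curvature_density_measurable])
  have pd: "id.pullback_density x y = area_density x y" "grad.pullback_density x y \<ge> 0" "area_density x y > 0"
    "grad.pullback_density x y = fs_form (G (pt x y)) (form_hess d a (pt x y) (tg x y)) (form_hess d a (pt x y) (tg x y))" for x y
    by (simp_all only: area_density_pos) (simp_all add: id.pullback_density_def area_density_def grad.pullback_density_def fs_form_nonneg)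
  have fE: "f x = ennreal (\<Sum>y\<in>Y x. pi / 2 * (grad.pullback_density x y - area_density x y +
      2 * (area_density x y)\<^sup>2 / (area_density x y + grad.pullback_density x y)))" if "x \<notin> E" for x
    using curvature_fibre_sum[OF that] that by (simp add: f_def pd(4))
  have em: "ennreal (c * (p + q)) = ennreal c * (ennreal p + ennreal q)" if "c \<ge> 0" "p \<ge> 0" "q \<ge> 0" for c p q :: real
    using that by (subst ennreal_mult) (auto simp: ennreal_plus)
  have em2: "ennreal (c * (p + q) + c' * r) = ennreal c * (ennreal p + ennreal q) + ennreal c' * ennreal r"
    "ennreal (c' * r + c * (p + q)) = ennreal c' * ennreal r + ennreal c * (ennreal p + ennreal q)"
    if "c \<ge> 0" "p \<ge> 0" "q \<ge> 0" "c' \<ge> 0" "r \<ge> 0" for c p q c' r :: real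
    using that by (simp_all add: ennreal_plus em ennreal_mult)
  have epl: "ennreal (p + q) \<le> ennreal p + ennreal q" if "q \<ge> 0" for p q :: real
  proof (cases "p \<ge> 0")
    case False
    then have "ennreal (p + q) \<le> ennreal q" by (intro ennreal_leI) simp
    then show ?thesis using False by (simp add: ennreal_neg)
  qed (use that in \<open>simp add: ennreal_plus\<close>)
  have upper: "f x \<le> ennreal (pi / 2) * (PA x + PB x)" for x
  proof (cases "x \<in> E")
    case False
    have "t - s + 2 * s\<^sup>2 / (s + t) \<le> s + t" if "s > 0" "t \<ge> 0" for s t :: real
    proof -
      have "s\<^sup>2 / (s + t) \<le> s" using that by (simp add: field_simps power2_eq_square)
      then show ?thesis by simp
    qed
    then have "(\<Sum>y\<in>Y x. pi / 2 * (grad.pullback_density x y - area_density x y +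
        2 * (area_density x y)\<^sup>2 / (area_density x y + grad.pullback_density x y)))
      \<le> (\<Sum>y\<in>Y x. pi / 2 * (area_density x y + grad.pullback_density x y))"
      using pd by (intro sum_mono mult_left_mono) auto
    also have "\<dots> = pi / 2 * (A x + B x)" by (simp only: A_def B_def pd(1) sum.distrib[symmetric] sum_distrib_left)
    finally have "f x \<le> ennreal (pi / 2 * (A x + B x))" unfolding fE[OF False] by (rule ennreal_leI)
    also have "\<dots> = ennreal (pi / 2) * (PA x + PB x)" using False nn em[of "pi / 2" "A x" "B x"] by (simp add: PA_def PB_def)
    finally show ?thesis .
  qed (simp add: f_def)
  have "(\<integral>\<^sup>+x. f x \<partial>lborel) \<le> (\<integral>\<^sup>+x. ennreal (pi / 2) * (PA x + PB x) \<partial>lborel)" by (intro nn_integral_mono upper)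
  also have "\<dots> = ennreal (pi / 2) * (ennreal (pi * real d) + ennreal (pi * (real d * (real d - 1))))"
    by (simp add: nn_integral_cmult nn_integral_add IA IB)
  also have "\<dots> = ennreal (pi / 2 * (pi * real d + pi * (real d * (real d - 1))))"
    by (rule em[symmetric]) (use d in simp_all)
  also have "pi / 2 * (pi * real d + pi * (real d * (real d - 1))) = pi\<^sup>2 / 2 * (real d)\<^sup>2" by (simp add: power2_eq_square algebra_simps)
  finally show "(\<integral>\<^sup>+Q. curvature_density curve Q \<partial>\<mu>) \<le> ennreal (pi\<^sup>2 / 2 * (real d)\<^sup>2)" by (simp add: If)
  define k where "k = real d"
  have k: "k \<ge> 1" using d by (simp add: k_def)
  text \<open>The tangent line of \<open>s \<mapsto> 1 / s\<close> at the mean value \<open>s / a = d\<close>: \<open>a\<^sup>2 / s \<ge> 2 a / d - s / d\<^sup>2\<close>.\<close>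
  have lower: "ennreal (pi / 2) * (PA x + PB x) + ennreal (2 * pi / k) * PA x \<le> f x + ennreal pi * PA x + ennreal (pi / k\<^sup>2) * (PA x + PB x)" for x
  proof (cases "x \<in> E")
    case False
    have ineq: "pi / 2 * (s + t) + 2 * pi / k * s \<le> pi / 2 * (t - s + 2 * s\<^sup>2 / (s + t)) + pi * s + pi / k\<^sup>2 * (s + t)" if "s > 0" "t \<ge> 0" for s t
    proof -
      \<comment> \<open>With \<open>S = s + t\<close> this square is
        \<open>S * (s / S - 1 / k)^2\<close>, the gap between the convex function and its tangent
        line. It vanishes exactly when \<open>S / s = k\<close>.\<close>
      have "0 \<le> (s * k - (s + t))\<^sup>2 / ((s + t) * k\<^sup>2)" using that by simp
      also have "\<dots> = s\<^sup>2 / (s + t) - 2 * s / k + (s + t) / k\<^sup>2"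
        using that k by (simp add: divide_simps) (simp add: power2_eq_square algebra_simps)
      finally have "0 \<le> pi * (s\<^sup>2 / (s + t) - 2 * s / k + (s + t) / k\<^sup>2)" by simp
      then show ?thesis by (simp add: algebra_simps add_divide_distrib)
    qed
    have "pi / 2 * (A x + B x) + 2 * pi / k * A x = (\<Sum>y\<in>Y x. pi / 2 * (area_density x y + grad.pullback_density x y) + 2 * pi / k * area_density x y)"
      by (simp only: A_def B_def pd(1) sum.distrib[symmetric] sum_distrib_left)
    also have "\<dots> \<le> (\<Sum>y\<in>Y x. pi / 2 * (grad.pullback_density x y - area_density x y +
        2 * (area_density x y)\<^sup>2 / (area_density x y + grad.pullback_density x y)) + pi * area_density x y
        + pi / k\<^sup>2 * (area_density x y + grad.pullback_density x y))"
      by (intro sum_mono ineq pd)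
    also have "\<dots> = (\<Sum>y\<in>Y x. pi / 2 * (grad.pullback_density x y - area_density x y +
        2 * (area_density x y)\<^sup>2 / (area_density x y + grad.pullback_density x y))) + pi * A x + pi / k\<^sup>2 * (A x + B x)"
      unfolding A_def B_def pd(1) sum.distrib[symmetric] sum_distrib_left ..
    finally have "ennreal (pi / 2 * (A x + B x) + 2 * pi / k * A x) \<le> ennreal ((\<Sum>y\<in>Y x. pi / 2 * (grad.pullback_density x y - area_density x y +
        2 * (area_density x y)\<^sup>2 / (area_density x y + grad.pullback_density x y))) + (pi * A x + pi / k\<^sup>2 * (A x + B x)))"
      by (intro ennreal_leI) simp
    also have "\<dots> \<le> f x + ennreal (pi * A x + pi / k\<^sup>2 * (A x + B x))"
      unfolding fE[OF False] by (rule epl) (use nn[of x] k in simp)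
    finally have *: "ennreal (pi / 2 * (A x + B x) + 2 * pi / k * A x) \<le> f x + ennreal (pi * A x + pi / k\<^sup>2 * (A x + B x))" .
    have "ennreal (pi / 2 * (A x + B x) + 2 * pi / k * A x) = ennreal (pi / 2) * (ennreal (A x) + ennreal (B x)) + ennreal (2 * pi / k) * ennreal (A x)"
      by (rule em2(1)) (use nn[of x] k in simp_all)
    moreover have "ennreal (pi * A x + pi / k\<^sup>2 * (A x + B x)) = ennreal pi * ennreal (A x) + ennreal (pi / k\<^sup>2) * (ennreal (A x) + ennreal (B x))"
      by (rule em2(2)) (use nn[of x] k in simp_all)
    ultimately show ?thesis using * False by (simp add: PA_def PB_def add.assoc)
  qed (simp add: f_def PA_def PB_def)
  \<comment> \<open>The inequality is arranged with only nonnegative terms on both sides, so it can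
    be integrated in the extended reals; the finite surplus is subtracted afterwards.\<close>
  have "(\<integral>\<^sup>+x. ennreal (pi / 2) * (PA x + PB x) + ennreal (2 * pi / k) * PA x \<partial>lborel)
    \<le> (\<integral>\<^sup>+x. f x + ennreal pi * PA x + ennreal (pi / k\<^sup>2) * (PA x + PB x) \<partial>lborel)"
    by (intro nn_integral_mono lower)
  then have "ennreal (pi / 2) * (ennreal (pi * k) + ennreal (pi * (k * (k - 1)))) + ennreal (2 * pi / k) * ennreal (pi * k)
    \<le> (\<integral>\<^sup>+x. f x \<partial>lborel) + ennreal pi * ennreal (pi * k) + ennreal (pi / k\<^sup>2) * (ennreal (pi * k) + ennreal (pi * (k * (k - 1))))"
    by (simp add: nn_integral_cmult nn_integral_add IA IB k_def[symmetric])
  also have "ennreal (pi / 2) * (ennreal (pi * k) + ennreal (pi * (k * (k - 1)))) + ennreal (2 * pi / k) * ennreal (pi * k)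
    = ennreal (pi / 2 * (pi * k + pi * (k * (k - 1))) + 2 * pi / k * (pi * k))"
    by (rule em2(1)[symmetric]) (use k in simp_all)
  also have "(\<integral>\<^sup>+x. f x \<partial>lborel) + ennreal pi * ennreal (pi * k) + ennreal (pi / k\<^sup>2) * (ennreal (pi * k) + ennreal (pi * (k * (k - 1))))
    = (\<integral>\<^sup>+x. f x \<partial>lborel) + ennreal (pi * (pi * k) + pi / k\<^sup>2 * (pi * k + pi * (k * (k - 1))))"
    unfolding add.assoc by (subst em2(2)) (use k in \<open>simp_all add: add.assoc\<close>)
  finally have "ennreal (pi / 2 * (pi * k + pi * (k * (k - 1))) + 2 * pi / k * (pi * k)) -
    ennreal (pi * (pi * k) + pi / k\<^sup>2 * (pi * k + pi * (k * (k - 1)))) \<le> (\<integral>\<^sup>+x. f x \<partial>lborel)"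
    by (simp add: ennreal_minus_le_iff add.commute)
  also have "ennreal (pi / 2 * (pi * k + pi * (k * (k - 1))) + 2 * pi / k * (pi * k)) -
    ennreal (pi * (pi * k) + pi / k\<^sup>2 * (pi * k + pi * (k * (k - 1)))) =
    ennreal (pi / 2 * (pi * k + pi * (k * (k - 1))) + 2 * pi / k * (pi * k) - (pi * (pi * k) + pi / k\<^sup>2 * (pi * k + pi * (k * (k - 1)))))"
    using k by (intro ennreal_minus) simp
  also have "pi / 2 * (pi * k + pi * (k * (k - 1))) + 2 * pi / k * (pi * k) - (pi * (pi * k) + pi / k\<^sup>2 * (pi * k + pi * (k * (k - 1))))
    = pi\<^sup>2 / 2 * (k\<^sup>2 - 2 * k + 2)"
    using k by (simp add: field_simps power2_eq_square)
  finally show "ennreal (pi\<^sup>2 / 2 * ((real d)\<^sup>2 - 2 * real d + 2)) \<le> (\<integral>\<^sup>+Q. curvature_density curve Q \<partial>\<mu>)"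
    by (simp add: If k_def)
qed

end

theorem proposition6p8:
  fixes d :: nat and M :: "3 cproj set"
  assumes "smooth_plane_curve d M"
  shows "ennreal (2 * (real d)^2 - 4 * real d + 4) \<le> total_absolute_curvature M \<and>
    total_absolute_curvature M \<le> ennreal (2 * (real d)^2)"
proof -
  obtain a where d: "d \<ge> 1" and a: "\<And>z. z \<noteq> 0 \<Longrightarrow> ternary_form d a z = 0 \<Longrightarrow> \<exists>k. partial_deriv k (ternary_form d a) z \<noteq> 0"
    and M: "M = {proj z | z. z \<noteq> 0 \<and> ternary_form d a z = 0}"
    using assms unfolding smooth_plane_curve_def by blast
  interpret smooth_form d a
    by unfold_locales (use a in \<open>fastforce simp: partial_deriv_ternary_form\<close>)
  obtain e0 e1 e2 where "branched_cover d a e0 e1 e2" using branched_cover_exists[OF d] by blast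
  then interpret branched_cover d a e0 e1 e2 .
  define I where "I = (\<integral>\<^sup>+Q. curvature_density curve Q \<partial>\<mu>)"
  have "2 / ennreal (pi\<^sup>2 / 2) = ennreal (4 / pi\<^sup>2)"
    using divide_ennreal[of 2 "pi\<^sup>2 / 2"] by simp
  then have T: "total_absolute_curvature M = ennreal (4 / pi\<^sup>2) * I"
    by (simp add: total_absolute_curvature_def volume_cp2 I_def \<mu>_def M curve_def[symmetric])
  have q: "0 \<le> (real d)\<^sup>2 - 2 * real d + 2"
    using zero_le_power2[of "real d - 1"] by (simp add: power2_diff)
  have "ennreal (2 * (real d)\<^sup>2 - 4 * real d + 4) = ennreal (4 / pi\<^sup>2) * ennreal (pi\<^sup>2 / 2 * ((real d)\<^sup>2 - 2 * real d + 2))"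
    by (subst ennreal_mult'[symmetric]) (simp_all add: algebra_simps)
  also have "\<dots> \<le> total_absolute_curvature M"
    unfolding T by (intro mult_left_mono) (use curvature_integral_bounds(1)[OF d] in \<open>simp_all add: I_def\<close>)
  finally have 1: "ennreal (2 * (real d)\<^sup>2 - 4 * real d + 4) \<le> total_absolute_curvature M" .
  have "total_absolute_curvature M \<le> ennreal (4 / pi\<^sup>2) * ennreal (pi\<^sup>2 / 2 * (real d)\<^sup>2)"
    unfolding T by (intro mult_left_mono) (use curvature_integral_bounds(2)[OF d] in \<open>simp_all add: I_def\<close>)
  also have "\<dots> = ennreal (2 * (real d)\<^sup>2)"
    by (subst ennreal_mult'[symmetric]) simp_all
  finally show ?thesis using 1 by blast
qed

end
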